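(* Let $X=\mathbb R^n$, let $E$ be a finite dimensional complex Hilbert space, $\mathscr H=L^2(X;E)$, let $\alpha_0\equiv\beta,\alpha_1,\dots,\alpha_n$ be symmetric operators on $E$ such that $\alpha_j\alpha_k+\alpha_k\alpha_j=\delta_{jk}$, and let $D=\sum_{k=1}^n\alpha_kP_k+m\beta$ be the free Dirac operator, where $m$ is a real number. Let $V,W$ be measurable functions on $X$ with values symmetric operators on $E$ and such that the operators of multiplication by $V$ and $W$ define continuous maps $\mathscr H^{1/2}\to\mathscr H^{-1/2}$ and $V-W\in\mathcal B_0(\mathscr H^{1/2},\mathscr H^{-1/2})$. Assume that $D+V+i$ and $D+W+i$ are bijective maps $\mathscr H^{1/2}\to\mathscr H^{-1/2}$. Then $D+V$ and $D+W$ induce self-adjoint operators $A$ and $B$ in $\mathscr H$, $B$ is a compact perturbation of $A$, and $\sigma_{\rm ess}(B)=\sigma_{\rm ess}(A)$.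
   Context: $P_k=-i\partial_k$. $\mathscr H^s$ is the Sobolev space of order $s$ of $E$-valued distributions on $\mathbb R^n$, with $\mathscr H^{1/2}\subset\mathscr H\subset\mathscr H^{-1/2}=(\mathscr H^{1/2})^*$. The operator induced in $\mathscr H$ by $S:\mathscr H^{1/2}\to\mathscr H^{-1/2}$ is the restriction of $S$ to the domain $\{u\in\mathscr H^{1/2}:Su\in\mathscr H\}$. Each $\mathscr H^s$ is a Banach module whose multiplier algebra $\mathcal M^s$ is the norm closure in $\mathcal B(\mathscr H^s)$ of the set of operators of multiplication by (scalar) Schwartz functions. $\mathcal B_0(\mathscr H^{1/2},\mathscr H^{-1/2})$ is the set of operators which belong both to the norm-closed linear span of the operators $MT$ with $M\in\mathcal M^{-1/2}$, $T\in\mathcal B(\mathscr H^{1/2},\mathscr H^{-1/2})$, and to the norm-closed linear span of the operators $TM$ with $T\in\mathcal B(\mathscr H^{1/2},\mathscr H^{-1/2})$, $M\in\mathcal M^{1/2}$. $B$ is a compact perturbation of $A$ if there is $z\in\rho(A)\cap\rho(B)$ such that $(A-z)^{-1}-(B-z)^{-1}$ is compact. $\sigma_{\rm ess}(A)$ is the set of $\lambda\in\mathbb C$ such that $A-\lambda$ is not Fredholm. *)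

theory Defs
  imports "HOL-Analysis.Analysis" "HOL-Library.Function_Algebras"
begin

class complex_vector = ab_group_add +
  fixes scaleC :: "complex \<Rightarrow> 'a \<Rightarrow> 'a" (infixr "*\<^sub>C" 75)
  assumes scaleC_add_right: "a *\<^sub>C (x + y) = a *\<^sub>C x + a *\<^sub>C y"
    and scaleC_add_left: "(a + b) *\<^sub>C x = a *\<^sub>C x + b *\<^sub>C x"
    and scaleC_scaleC: "a *\<^sub>C b *\<^sub>C x = (a * b) *\<^sub>C x"
    and scaleC_one: "1 *\<^sub>C x = x"

global_interpretation complex_vector:
  vector_space "scaleC :: complex \<Rightarrow> 'a \<Rightarrow> 'a::complex_vector"
  by unfold_locales (rule scaleC_add_right scaleC_add_left scaleC_scaleC scaleC_one)+

text \<open>Both distributions and operators between spaces of distributions are functions, so that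
  sums, scalar multiples and linear spans of them are formed pointwise.\<close>

instantiation "fun" :: (type, complex_vector) complex_vector
begin

definition scaleC_fun_def: "c *\<^sub>C f = (\<lambda>x. c *\<^sub>C f x)"

instance
  by standard (simp_all add: scaleC_fun_def fun_eq_iff complex_vector.scale_right_distrib
      complex_vector.scale_left_distrib)

end

text \<open>A (nonzero) finite-dimensional complex Hilbert space; the inner product is linear in the
  second argument, and the real inner product inherited from \<open>euclidean_space\<close> is its real
  part, so that the inherited norm is the Hilbert space norm.\<close>

class complex_euclidean_space = complex_vector + euclidean_space +
  fixes cinner :: "'a \<Rightarrow> 'a \<Rightarrow> complex"
  assumes scaleC_of_real: "complex_of_real r *\<^sub>C x = r *\<^sub>R x"
    and cinner_commute: "cinner x y = cnj (cinner y x)"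
    and cinner_add_right: "cinner x (y + z) = cinner x y + cinner x z"
    and cinner_scaleC_right: "cinner x (c *\<^sub>C y) = c * cinner x y"
    and inner_eq_Re_cinner: "inner x y = Re (cinner x y)"

definition clinear_on :: "'a::complex_vector set \<Rightarrow> ('a \<Rightarrow> 'b::complex_vector) \<Rightarrow> bool" where
  "clinear_on X T \<longleftrightarrow>
     (\<forall>x\<in>X. \<forall>y\<in>X. T (x + y) = T x + T y) \<and> (\<forall>c. \<forall>x\<in>X. T (c *\<^sub>C x) = c *\<^sub>C T x)"

definition symmetric_operator :: "('e::complex_euclidean_space \<Rightarrow> 'e) \<Rightarrow> bool" where
  "symmetric_operator T \<longleftrightarrow> clinear_on UNIV T \<and> (\<forall>x y. cinner (T x) y = cinner x (T y))"

text \<open>A normed space is given by a subspace of an ambient complex vector space and a norm, which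
  is only relevant on that subspace. Likewise, operators are only relevant on their domain.\<close>

record 'a nspace =
  vecs :: "'a set"
  nrm :: "'a \<Rightarrow> real"

definition bounded_ops ::
    "'a::complex_vector nspace \<Rightarrow> 'b::complex_vector nspace \<Rightarrow> ('a \<Rightarrow> 'b) set" where
  "bounded_ops X Y = {T. T ` vecs X \<subseteq> vecs Y \<and> clinear_on (vecs X) T \<and>
     (\<exists>K. \<forall>x\<in>vecs X. nrm Y (T x) \<le> K * nrm X x)}"

text \<open>Closure in \<open>bounded_ops X Y\<close> with respect to the operator norm.\<close>

definition op_closure ::
    "'a::complex_vector nspace \<Rightarrow> 'b::complex_vector nspace \<Rightarrow> ('a \<Rightarrow> 'b) set \<Rightarrow> ('a \<Rightarrow> 'b) set" where
  "op_closure X Y \<S> = {T \<in> bounded_ops X Y.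
     \<forall>\<epsilon>>0. \<exists>S\<in>\<S>. \<forall>x\<in>vecs X. nrm Y (T x - S x) \<le> \<epsilon> * nrm X x}"

definition converges_in :: "'a::complex_vector nspace \<Rightarrow> (nat \<Rightarrow> 'a) \<Rightarrow> 'a \<Rightarrow> bool" where
  "converges_in X x l \<longleftrightarrow> l \<in> vecs X \<and> (\<lambda>n. nrm X (x n - l)) \<longlonglongrightarrow> 0"

definition compact_op ::
    "'a::complex_vector nspace \<Rightarrow> 'b::complex_vector nspace \<Rightarrow> ('a \<Rightarrow> 'b) \<Rightarrow> bool" where
  "compact_op X Y T \<longleftrightarrow> T \<in> bounded_ops X Y \<and>
     (\<forall>x::nat \<Rightarrow> 'a. (\<forall>n. x n \<in> vecs X \<and> nrm X (x n) \<le> 1) \<longrightarrow>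
        (\<exists>r y. strict_mono r \<and> converges_in Y (\<lambda>n. T (x (r n))) y))"

text \<open>An unbounded operator in a normed space, given by its domain and its action.\<close>

record 'a unbounded_op =
  dom_op :: "'a set"
  app_op :: "'a \<Rightarrow> 'a"

definition shift_op :: "'a::complex_vector unbounded_op \<Rightarrow> complex \<Rightarrow> 'a unbounded_op" where
  "shift_op A z = \<lparr>dom_op = dom_op A, app_op = (\<lambda>u. app_op A u - z *\<^sub>C u)\<rparr>"

definition inv_op :: "'a unbounded_op \<Rightarrow> 'a \<Rightarrow> 'a" where
  "inv_op A = inv_into (dom_op A) (app_op A)"

definition resolvent_set ::
    "'a::complex_vector nspace \<Rightarrow> 'a unbounded_op \<Rightarrow> complex set" where
  "resolvent_set H A = {z. bij_betw (app_op (shift_op A z)) (dom_op A) (vecs H) \<and>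
     inv_op (shift_op A z) \<in> bounded_ops H H}"

definition compact_perturbation ::
    "'a::complex_vector nspace \<Rightarrow> 'a unbounded_op \<Rightarrow> 'a unbounded_op \<Rightarrow> bool" where
  "compact_perturbation H B A \<longleftrightarrow> (\<exists>z \<in> resolvent_set H A \<inter> resolvent_set H B.
     compact_op H H (inv_op (shift_op A z) - inv_op (shift_op B z)))"

definition fredholm :: "'a::complex_vector nspace \<Rightarrow> 'a unbounded_op \<Rightarrow> bool" where
  "fredholm H A \<longleftrightarrow>
     (\<exists>F. finite F \<and> {u \<in> dom_op A. app_op A u = 0} \<subseteq> complex_vector.span F) \<and>
     (\<forall>y l. (\<forall>n. y n \<in> app_op A ` dom_op A) \<and> converges_in H y l \<longrightarrow> l \<in> app_op A ` dom_op A) \<and>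
     (\<exists>F. finite F \<and> F \<subseteq> vecs H \<and>
        (\<forall>v\<in>vecs H. \<exists>u\<in>dom_op A. v - app_op A u \<in> complex_vector.span F))"

definition ess_spectrum ::
    "'a::complex_vector nspace \<Rightarrow> 'a unbounded_op \<Rightarrow> complex set" where
  "ess_spectrum H A = {z. \<not> fredholm H (shift_op A z)}"

definition partial_deriv :: "'n::finite \<Rightarrow> (real^'n \<Rightarrow> complex) \<Rightarrow> real^'n \<Rightarrow> complex" where
  "partial_deriv k f x = frechet_derivative f (at x) (axis k 1)"

definition partial_derivs :: "'n::finite list \<Rightarrow> (real^'n \<Rightarrow> complex) \<Rightarrow> real^'n \<Rightarrow> complex" where
  "partial_derivs ks f = foldr partial_deriv ks f"

definition schwartz :: "(real^'n::finite \<Rightarrow> complex) \<Rightarrow> bool" where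
  "schwartz f \<longleftrightarrow> (\<forall>ks x. partial_derivs ks f differentiable (at x)) \<and>
     (\<forall>ks N. \<exists>C. \<forall>x. (1 + norm x) ^ N * norm (partial_derivs ks f x) \<le> C)"

definition test_function :: "(real^'n::finite \<Rightarrow> complex) \<Rightarrow> bool" where
  "test_function f \<longleftrightarrow> schwartz f \<and> (\<exists>K. compact K \<and> (\<forall>x. x \<notin> K \<longrightarrow> f x = 0))"

text \<open>An \<open>'e\<close>-valued distribution is a linear map from scalar test functions to \<open>'e\<close>. As HOL
  functions are total, tempered distributions take the value \<open>0\<close> at functions that are not
  Schwartz, so that equality of distributions is equality of functions.\<close>

type_synonym ('n, 'e) distr = "(real^'n \<Rightarrow> complex) \<Rightarrow> 'e"

definition tempered :: "('n::finite, 'e::complex_euclidean_space) distr \<Rightarrow> bool" where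
  "tempered u \<longleftrightarrow>
     (\<forall>\<phi>. \<not> schwartz \<phi> \<longrightarrow> u \<phi> = 0) \<and>
     (\<forall>\<phi> \<psi>. schwartz \<phi> \<longrightarrow> schwartz \<psi> \<longrightarrow> u (\<lambda>x. \<phi> x + \<psi> x) = u \<phi> + u \<psi>) \<and>
     (\<forall>c \<phi>. schwartz \<phi> \<longrightarrow> u (\<lambda>x. c * \<phi> x) = c *\<^sub>C u \<phi>) \<and>
     (\<exists>N C. \<forall>\<phi> b. schwartz \<phi> \<longrightarrow>
        (\<forall>ks x. length ks \<le> N \<longrightarrow> (1 + norm x) ^ N * norm (partial_derivs ks \<phi> x) \<le> b) \<longrightarrow>
        norm (u \<phi>) \<le> C * b)"

definition distr_of :: "(real^'n::finite \<Rightarrow> 'e::complex_euclidean_space) \<Rightarrow> ('n, 'e) distr" where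
  "distr_of f = (\<lambda>\<phi>. if schwartz \<phi> then LINT x|lebesgue. \<phi> x *\<^sub>C f x else 0)"

definition schwartz_mult ::
    "(real^'n::finite \<Rightarrow> complex) \<Rightarrow> ('n, 'e::complex_euclidean_space) distr \<Rightarrow> ('n, 'e) distr" where
  "schwartz_mult \<theta> u = (\<lambda>\<phi>. if schwartz \<phi> then u (\<lambda>x. \<theta> x * \<phi> x) else 0)"

text \<open>\<open>P\<^sub>k = -\<i>\<partial>\<^sub>k\<close>, with \<open>(\<partial>\<^sub>k u) \<phi> = - u (\<partial>\<^sub>k \<phi>)\<close>.\<close>

definition momentum ::
    "'n::finite \<Rightarrow> ('n, 'e::complex_euclidean_space) distr \<Rightarrow> ('n, 'e) distr" where
  "momentum k u = (\<lambda>\<phi>. if schwartz \<phi> then (- \<i>) *\<^sub>C (- u (partial_deriv k \<phi>)) else 0)"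

definition fourier :: "(real^'n::finite \<Rightarrow> complex) \<Rightarrow> real^'n \<Rightarrow> complex" where
  "fourier \<phi> \<xi> = complex_of_real ((2 * pi) powr (- real CARD('n) / 2)) *
     (LINT x|lebesgue. exp (- \<i> * complex_of_real (x \<bullet> \<xi>)) * \<phi> x)"

definition square_integrable :: "(real^'n::finite \<Rightarrow> 'e::complex_euclidean_space) \<Rightarrow> bool" where
  "square_integrable f \<longleftrightarrow>
     f \<in> borel_measurable lebesgue \<and> integrable lebesgue (\<lambda>x. (norm (f x))\<^sup>2)"

text \<open>Elements of $L^2$ are regarded as distributions, which identifies functions that coincide
  almost everywhere. \<open>L2_rep\<close> picks a representative.\<close>

definition L2_rep ::
    "('n::finite, 'e::complex_euclidean_space) distr \<Rightarrow> real^'n \<Rightarrow> 'e" where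
  "L2_rep u = (SOME f. square_integrable f \<and> u = distr_of f)"

definition L2 :: "('n::finite, 'e::complex_euclidean_space) distr nspace" where
  "L2 = \<lparr>vecs = distr_of ` {f. square_integrable f},
         nrm = (\<lambda>u. sqrt (LINT x|lebesgue. (norm (L2_rep u x))\<^sup>2))\<rparr>"

definition L2_inner :: "('n::finite, 'e::complex_euclidean_space) distr \<Rightarrow> ('n, 'e) distr \<Rightarrow> complex"
  where "L2_inner u v = (LINT x|lebesgue. cinner (L2_rep u x) (L2_rep v x))"

text \<open>\<open>g\<close> is the Fourier transform \<open>\<phi> \<mapsto> u (fourier \<phi>)\<close> of the distribution \<open>u\<close>, and is square
  integrable with weight $(1 + |\xi|^2)^s$.\<close>

definition sobolev_transform :: "real \<Rightarrow> ('n::finite, 'e::complex_euclidean_space) distr \<Rightarrow>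
    (real^'n \<Rightarrow> 'e) \<Rightarrow> bool" where
  "sobolev_transform s u g \<longleftrightarrow>
     g \<in> borel_measurable lebesgue \<and>
     integrable lebesgue (\<lambda>\<xi>. (1 + (norm \<xi>)\<^sup>2) powr s * (norm (g \<xi>))\<^sup>2) \<and>
     (\<forall>\<phi>. schwartz \<phi> \<longrightarrow> u (fourier \<phi>) = (LINT \<xi>|lebesgue. \<phi> \<xi> *\<^sub>C g \<xi>))"

definition sobolev :: "real \<Rightarrow> ('n::finite, 'e::complex_euclidean_space) distr nspace" where
  "sobolev s =
     \<lparr>vecs = {u. tempered u \<and> (\<exists>g. sobolev_transform s u g)},
      nrm = (\<lambda>u. sqrt (LINT \<xi>|lebesgue.
               (1 + (norm \<xi>)\<^sup>2) powr s * (norm ((SOME g. sobolev_transform s u g) \<xi>))\<^sup>2))\<rparr>"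

definition multiplier_algebra :: "real \<Rightarrow>
    (('n::finite, 'e::complex_euclidean_space) distr \<Rightarrow> ('n, 'e) distr) set" where
  "multiplier_algebra s = op_closure (sobolev s) (sobolev s) {schwartz_mult \<theta> | \<theta>. schwartz \<theta>}"

definition B0 :: "(('n::finite, 'e::complex_euclidean_space) distr \<Rightarrow> ('n, 'e) distr) set" where
  "B0 = (let X = sobolev (1/2); Y = sobolev (-1/2) in
     op_closure X Y (complex_vector.span
       {M \<circ> T | M T. M \<in> multiplier_algebra (-1/2) \<and> T \<in> bounded_ops X Y}) \<inter>
     op_closure X Y (complex_vector.span
       {T \<circ> M | T M. T \<in> bounded_ops X Y \<and> M \<in> multiplier_algebra (1/2)}))"

text \<open>The last conjunct says that the adjoint of \<open>A\<close> has the same domain and action as \<open>A\<close>.\<close>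

definition self_adjoint :: "('n::finite, 'e::complex_euclidean_space) distr unbounded_op \<Rightarrow> bool" where
  "self_adjoint A \<longleftrightarrow>
     dom_op A \<subseteq> vecs L2 \<and> complex_vector.subspace (dom_op A) \<and>
     app_op A ` dom_op A \<subseteq> vecs L2 \<and> clinear_on (dom_op A) (app_op A) \<and>
     (\<forall>v\<in>vecs L2. \<forall>\<epsilon>>0. \<exists>u\<in>dom_op A. nrm L2 (v - u) < \<epsilon>) \<and>
     (\<forall>v\<in>vecs L2. \<forall>w\<in>vecs L2.
        (\<forall>u\<in>dom_op A. L2_inner v (app_op A u) = L2_inner w u) \<longleftrightarrow> v \<in> dom_op A \<and> app_op A v = w)"

definition induced_op :: "(('n::finite, 'e::complex_euclidean_space) distr \<Rightarrow> ('n, 'e) distr) \<Rightarrow>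
    ('n, 'e) distr unbounded_op" where
  "induced_op S = \<lparr>dom_op = {u \<in> vecs (sobolev (1/2)). S u \<in> vecs L2}, app_op = S\<rparr>"

text \<open>The matrices $\alpha_0 = \beta, \alpha_1, \dots, \alpha_n$ are indexed by \<open>'n option\<close>,
  where \<open>None\<close> plays the role of the index $0$.\<close>

definition free_dirac :: "('n::finite option \<Rightarrow> 'e::complex_euclidean_space \<Rightarrow> 'e) \<Rightarrow> real \<Rightarrow>
    ('n, 'e) distr \<Rightarrow> ('n, 'e) distr" where
  "free_dirac \<alpha> m u = (\<lambda>\<phi>. (\<Sum>k\<in>UNIV. \<alpha> (Some k) (momentum k u \<phi>)) + m *\<^sub>R \<alpha> None (u \<phi>))"

definition locally_integrable :: "(real^'n::finite \<Rightarrow> 'e::complex_euclidean_space) \<Rightarrow> bool" where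
  "locally_integrable f \<longleftrightarrow> (\<forall>K. compact K \<longrightarrow> set_integrable lebesgue K f)"

text \<open>The distribution \<open>w\<close> is the pointwise product of \<open>V\<close> with the $L^2$ function \<open>u\<close>. This
  product need not have temperate growth, hence \<open>w\<close> is compared with it on functions with
  compact support.\<close>

definition is_product :: "(real^'n::finite \<Rightarrow> 'e::complex_euclidean_space \<Rightarrow> 'e) \<Rightarrow>
    ('n, 'e) distr \<Rightarrow> ('n, 'e) distr \<Rightarrow> bool" where
  "is_product V u w \<longleftrightarrow> (\<exists>f. square_integrable f \<and> u = distr_of f \<and>
     locally_integrable (\<lambda>x. V x (f x)) \<and>
     (\<forall>\<phi>. test_function \<phi> \<longrightarrow> w \<phi> = (LINT x|lebesgue. \<phi> x *\<^sub>C V x (f x))))"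

definition mult_op :: "(real^'n::finite \<Rightarrow> 'e::complex_euclidean_space \<Rightarrow> 'e) \<Rightarrow>
    ('n, 'e) distr \<Rightarrow> ('n, 'e) distr" where
  "mult_op V u = (THE w. w \<in> vecs (sobolev (-1/2)) \<and> is_product V u w)"

definition mult_continuous ::
    "(real^'n::finite \<Rightarrow> 'e::complex_euclidean_space \<Rightarrow> 'e) \<Rightarrow> bool" where
  "mult_continuous V \<longleftrightarrow>
     (\<forall>u\<in>vecs (sobolev (1/2)). \<exists>w\<in>vecs (sobolev (-1/2)). is_product V u w) \<and>
     mult_op V \<in> bounded_ops (sobolev (1/2)) (sobolev (-1/2))"

text \<open>As \<open>'e\<close> is finite-dimensional, measurability of an operator-valued function may be
  tested on vectors.\<close>

definition symmetric_potential ::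
    "(real^'n::finite \<Rightarrow> 'e::complex_euclidean_space \<Rightarrow> 'e) \<Rightarrow> bool" where
  "symmetric_potential V \<longleftrightarrow>
     (\<forall>x. symmetric_operator (V x)) \<and> (\<forall>e. (\<lambda>x. V x e) \<in> borel_measurable lebesgue)"

end

theory Submission
  imports Defs "HOL-Probability.Probability" "HOL-Library.Diagonal_Subsequence"
begin

text \<open>The Fourier transformation identifies $H^{1/2}$, $H$ and $H^{-1/2}$ with $L^2$. Both embeddings
  become the symmetric injective operator \<open>J\<close> of multiplication by $(1+|\xi|^2)^{-1/4}$, and $D+V$ becomes a
  bounded symmetric operator \<open>S\<close> such that $S+iJ^2$ is bijective. Its adjoint $S-iJ^2$ is then bijective,
  too, whence the relation $\{(Jx,h) \mid Sx = Jh\}$ is self-adjoint.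

  If $(D+V+i)\xi = (D+W+i)\eta = h$ with \<open>h\<close> bounded in $H$, then $(D+V+i)(\xi-\eta) = -(V-W)\eta$. As $V-W$ is a norm
  limit of sums of operators $TM$, it suffices that $\theta\eta$ is precompact in $H^{1/2}$ for Schwartz functions
  $\theta$. This follows from $(D+W+i)(\theta\eta) = \theta h + [D,\theta]\eta$ and Rellich's theorem, because $[D,\theta]$ is
  multiplication by a matrix of Schwartz functions.

  For real $\lambda$ the operator $A-\lambda$ is Fredholm iff every bounded sequence \<open>u\<close> with convergent $(A-\lambda)u$ has
  a convergent subsequence. This property is stable under compact perturbations.\<close>

section \<open>Hilbert spaces\<close>

text \<open>One sequence has to serve all Schwartz functions at once. Therefore \<open>h\<close> and
  \<eta> are made weakly convergent before any multiplier is chosen: compactness then gives norm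
  convergence without further extraction, and the Cauchy property survives sums, bounded operators
  and norm limits, so that it reaches the whole closed span. Multiplication by \<open>V\<close> is
  known only through integrals against compactly supported functions. Uniqueness of the product, its
  commutation with \<theta> and the symmetry of the form rest on a description of the Sobolev spaces
  of order s \<ge> -1: their elements are f0 + sum of P_k f_k with square integrable f0 and f_k.
  Such sums are tempered, and test functions determine them. Baire's theorem enters as uniform
  boundedness. It yields, from pairings alone, the boundedness of the inverse of D+V+\<i> and of the
  inverse of A-\<lambda> off its kernel.\<close>

class complex_hilbert = complex_vector + real_inner + complete_space +
  assumes scaleC_complex_of_real: "complex_of_real r *\<^sub>C x = r *\<^sub>R x"
    \<comment> \<open>Together with the real inner product, the adjoint \<open>cnj c\<close> of
      multiplication by \<open>c\<close> determines the complex inner product. Real Hilbert space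
      theory thus applies directly.\<close>
    and inner_scaleC_left: "inner (c *\<^sub>C x) y = inner x (cnj c *\<^sub>C y)"

instance complex_euclidean_space \<subseteq> complex_hilbert
proof
  fix r :: real and c and x y :: 'a
  show "complex_of_real r *\<^sub>C x = r *\<^sub>R x" by (rule scaleC_of_real)
  have "cinner (c *\<^sub>C x) y = cnj c * cinner x y" by (metis cinner_commute cinner_scaleC_right complex_cnj_mult)
  then show "inner (c *\<^sub>C x) y = inner x (cnj c *\<^sub>C y)" by (simp add: inner_eq_Re_cinner cinner_scaleC_right)
qed

lemma norm_scaleC: "norm (c *\<^sub>C x) = cmod c * norm (x::'a::complex_hilbert)"
proof -
  have "(norm (c *\<^sub>C x))\<^sup>2 = inner x ((cnj c * c) *\<^sub>C x)" by (simp add: power2_norm_eq_inner inner_scaleC_left scaleC_scaleC)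
  also have "cnj c * c = complex_of_real ((cmod c)\<^sup>2)" using complex_norm_square[of c] by (simp add: mult.commute)
  also have "inner x (complex_of_real ((cmod c)\<^sup>2) *\<^sub>C x) = (cmod c * norm x)\<^sup>2"
    by (simp only: scaleC_complex_of_real inner_scaleR_right power_mult_distrib power2_norm_eq_inner)
  finally show ?thesis by (simp add: power2_eq_iff_nonneg)
qed

lemma scaleC_scaleR: "c *\<^sub>C r *\<^sub>R x = r *\<^sub>R c *\<^sub>C (x::'a::complex_hilbert)"
  by (metis mult.commute scaleC_complex_of_real scaleC_scaleC)

lemma bounded_linear_scaleC_right: "bounded_linear (\<lambda>x::'a::complex_hilbert. c *\<^sub>C x)"
  by (rule bounded_linear_intro[of _ "cmod c"]) (simp_all add: scaleC_add_right scaleC_scaleR norm_scaleC)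

lemma bounded_bilinear_scaleC: "bounded_bilinear (\<lambda>c (x::'a::complex_hilbert). c *\<^sub>C x)"
proof
  fix r :: real and c c' :: complex and x x' :: 'a
  show "(r *\<^sub>R c) *\<^sub>C x = r *\<^sub>R c *\<^sub>C x" by (metis of_real_def scaleC_complex_of_real scaleC_scaleC scaleR_conv_of_real)
  show "\<exists>K. \<forall>a (b::'a). norm (a *\<^sub>C b) \<le> norm a * norm b * K" by (rule exI[of _ 1]) (simp add: norm_scaleC)
qed (simp_all add: scaleC_add_right scaleC_add_left scaleC_scaleR)

lemmas tendsto_scaleC = bounded_bilinear.tendsto[OF bounded_bilinear_scaleC]
lemmas scaleC_minus_right = complex_vector.scale_minus_right
lemmas scaleC_minus_left = complex_vector.scale_minus_left
lemmas scaleC_diff_right = complex_vector.scale_right_diff_distrib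
lemmas scaleC_zero_left = complex_vector.scale_zero_left
lemmas scaleC_zero_right = complex_vector.scale_zero_right

lemma scaleC_eq_Re_Im: "c *\<^sub>C x = Re c *\<^sub>R x + Im c *\<^sub>R \<i> *\<^sub>C (x::'a::complex_hilbert)"
proof -
  have "c *\<^sub>C x = (complex_of_real (Re c) + complex_of_real (Im c) * \<i>) *\<^sub>C x" using complex_eq[of c] by (simp add: mult.commute)
  then show ?thesis by (simp only: scaleC_add_left scaleC_scaleC[symmetric] scaleC_complex_of_real)
qed

lemma inner_imaginary_self: "inner (\<i> *\<^sub>C x) (x::'a::complex_hilbert) = 0"
  using inner_scaleC_left[of \<i> x x] by (simp add: scaleC_minus_left inner_commute)

section \<open>Projections, weak convergence and compactness in a real Hilbert space\<close>

lemma closed_subspace_projection: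
  fixes x :: "'a::{real_inner,complete_space}"
  assumes "closed M" "subspace M"
  obtains p where "p \<in> M" "\<And>m. m \<in> M \<Longrightarrow> inner (x - p) m = 0"
proof -
  define d where "d = infdist x M"
  have ne: "M \<noteq> {}" using \<open>subspace M\<close> subspace_0 by auto
  have d0: "d \<ge> 0" by (simp add: d_def infdist_nonneg)
  have dle: "d \<le> norm (x - m)" if "m \<in> M" for m using infdist_le[OF that, of x] by (simp add: d_def dist_norm)
  have "\<exists>y\<in>M. norm (x - y) < d + 1 / Suc n" for n
  proof -
    have "(INF a\<in>M. dist x a) < d + 1 / Suc n" unfolding d_def infdist_notempty[OF ne] by simp
    then obtain a where "a \<in> M" "dist x a < d + 1 / Suc n" using cInf_lessD[of "dist x ` M"] ne by auto
    then show ?thesis by (auto simp: dist_norm)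
  qed
  then obtain y where y: "y n \<in> M" "norm (x - y n) < d + 1 / Suc n" for n by metis
  \<comment> \<open>The parallelogram law applies to \<open>x - y m\<close> and
    \<open>x - y n\<close>; the midpoint of \<open>y m\<close> and \<open>y n\<close> stays in
    \<open>M\<close> and so has distance at least \<open>d\<close> from \<open>x\<close>. The
    numerator \<open>2 * d + 1\<close> bounds \<open>2 * d + e\<close> for
    \<open>e = 1 / Suc N\<close>, which is at most 1.\<close>
  have para: "(norm (y m - y n))\<^sup>2 \<le> 4 * (2 * d + 1) / Suc N" if "m \<ge> N" "n \<ge> N" for m n N
  proof -
    have mid: "(1/2) *\<^sub>R (y m + y n) \<in> M" using y \<open>subspace M\<close> by (intro subspace_scale subspace_add) auto
    have "(norm (y m - y n))\<^sup>2 + 4 * (norm (x - (1/2) *\<^sub>R (y m + y n)))\<^sup>2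
        = 2 * (norm (x - y m))\<^sup>2 + 2 * (norm (x - y n))\<^sup>2" unfolding power2_norm_eq_inner
      by (simp add: inner_diff_left inner_diff_right inner_add_left inner_add_right inner_commute algebra_simps)
    moreover have "d\<^sup>2 \<le> (norm (x - (1/2) *\<^sub>R (y m + y n)))\<^sup>2" using dle[OF mid] d0 by (intro power_mono)
    moreover have "(norm (x - y k))\<^sup>2 \<le> d\<^sup>2 + (2 * d + 1) / Suc N" if "k \<ge> N" for k
    proof -
      let ?e = "1 / real (Suc N)"
      have "1 / real (Suc k) \<le> ?e" using that by (simp add: field_simps)
      then have "norm (x - y k) \<le> d + ?e" using y(2)[of k] by linarith
      then have "(norm (x - y k))\<^sup>2 \<le> (d + ?e)\<^sup>2" by (intro power_mono) auto
      also have "\<dots> = d\<^sup>2 + 2 * d * ?e + ?e * ?e" by (simp add: power2_eq_square algebra_simps)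
      also have "?e * ?e \<le> 1 * ?e" by (intro mult_right_mono) auto
      finally show ?thesis by (simp add: algebra_simps add_divide_distrib)
    qed
    from this[OF \<open>m \<ge> N\<close>] this[OF \<open>n \<ge> N\<close>]
    have "2 * (norm (x - y m))\<^sup>2 + 2 * (norm (x - y n))\<^sup>2 \<le> 4 * d\<^sup>2 + 4 * ((2 * d + 1) / Suc N)" by linarith
    ultimately have "(norm (y m - y n))\<^sup>2 \<le> 4 * ((2 * d + 1) / Suc N)" by linarith
    then show ?thesis by simp
  qed
  have "Cauchy y"
  proof (rule metric_CauchyI)
    fix e :: real assume "e > 0"
    obtain N :: nat where "4 * (2 * d + 1) / e\<^sup>2 < N" using reals_Archimedean2 by blast
    then have N: "4 * (2 * d + 1) / e\<^sup>2 < Suc N" by simp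
    then have "4 * (2 * d + 1) / Suc N < e\<^sup>2" using \<open>e > 0\<close> by (simp add: field_simps)
    then have "norm (y m - y n) < e" if "m \<ge> N" "n \<ge> N" for m n
      using para[OF that] \<open>e > 0\<close> by (meson le_less_trans less_le power_less_imp_less_base)
    then show "\<exists>M. \<forall>m\<ge>M. \<forall>n\<ge>M. dist (y m) (y n) < e" by (auto simp: dist_norm)
  qed
  then obtain p where p: "y \<longlonglongrightarrow> p" using Cauchy_convergent convergent_def by blast
  have pM: "p \<in> M" using closed_sequentially[OF \<open>closed M\<close>] y p by blast
  have "(\<lambda>n. norm (x - y n)) \<longlonglongrightarrow> norm (x - p)" by (intro tendsto_intros p)
  moreover have "(\<lambda>n. d + 1 / Suc n) \<longlonglongrightarrow> d + 0" by (intro tendsto_intros LIMSEQ_Suc[OF lim_1_over_n])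
  ultimately have pd: "norm (x - p) \<le> d"
    using y(2) by (intro LIMSEQ_le[where X = "\<lambda>n. norm (x - y n)" and Y = "\<lambda>n. d + 1 / Suc n"]) (auto intro: less_imp_le)
  have "inner (x - p) m = 0" if "m \<in> M" for m
  proof (cases "m = 0")
    case False
    \<comment> \<open>This \<open>t\<close> minimizes the distance from \<open>x - p\<close> to the
      line spanned by \<open>m\<close>.\<close>
    define t where "t = inner (x - p) m / inner m m"
    have mm: "inner m m > 0" using False by simp
    have "p + t *\<^sub>R m \<in> M" using pM that \<open>subspace M\<close> by (intro subspace_add subspace_scale)
    from dle[OF this] pd have "norm (x - p) \<le> norm (x - p - t *\<^sub>R m)" by (simp add: algebra_simps)
    then have "(norm (x - p))\<^sup>2 \<le> (norm (x - p - t *\<^sub>R m))\<^sup>2" by (intro power_mono) auto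
    also have "\<dots> = (norm (x - p))\<^sup>2 - 2 * t * inner (x - p) m + t * t * inner m m" unfolding power2_norm_eq_inner
      by (simp add: inner_diff_left inner_diff_right inner_commute algebra_simps)
    also have "\<dots> = (norm (x - p))\<^sup>2 - (inner (x - p) m)\<^sup>2 / inner m m" using mm by (simp add: t_def power2_eq_square)
    finally have "(inner (x - p) m)\<^sup>2 / inner m m \<le> 0" by simp
    then show ?thesis using mm by (simp add: divide_le_0_iff)
  qed simp
  with pM that show ?thesis by blast
qed

lemma subspace_closure:
  fixes S :: "'a::real_normed_vector set"
  assumes "subspace S"
  shows "subspace (closure S)" unfolding subspace_def
proof (intro conjI ballI allI)
  show "0 \<in> closure S" using assms closure_subset subspace_0 by blast
next
  fix x y assume "x \<in> closure S" "y \<in> closure S"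
  then obtain f g where "\<forall>n. f n \<in> S" "f \<longlonglongrightarrow> x" "\<forall>n. g n \<in> S" "g \<longlonglongrightarrow> y"
    unfolding closure_sequential by blast
  then show "x + y \<in> closure S" unfolding closure_sequential using assms
    by (intro exI[of _ "\<lambda>n. f n + g n"]) (auto intro: subspace_add tendsto_add)
next
  fix c x assume "x \<in> closure S"
  then obtain f where "\<forall>n. f n \<in> S" "f \<longlonglongrightarrow> x" unfolding closure_sequential by blast
  then show "c *\<^sub>R x \<in> closure S" unfolding closure_sequential using assms
    by (intro exI[of _ "\<lambda>n. c *\<^sub>R f n"]) (auto intro: subspace_scale tendsto_scaleR)
qed

text \<open>For a closed range, surjectivity is reduced to the triviality of the orthogonal
  complement, which is a kernel of an adjoint in the applications to operators.\<close>

lemma closed_subspace_eq_UNIV: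
  fixes M :: "'a::{real_inner,complete_space} set"
  assumes "closed M" "subspace M" "\<And>y. (\<And>m. m \<in> M \<Longrightarrow> inner y m = 0) \<Longrightarrow> y = 0"
  shows "M = UNIV"
proof -
  have "x \<in> M" for x using closed_subspace_projection[OF assms(1,2), of x] assms(3) by (metis eq_iff_diff_eq_0)
  then show ?thesis by blast
qed

text \<open>Uniform boundedness by Baire's theorem. Some \<open>S n\<close> contains a ball; moving
  from its centre by half its radius in the direction of \<open>y\<close> bounds
  \<open>norm y\<close>.\<close>

lemma weakly_bounded_imp_bounded:
  fixes B :: "'a::{real_inner,complete_space} set"
  assumes "\<And>x. \<exists>C. \<forall>y\<in>B. \<bar>inner y x\<bar> \<le> C"
  shows "\<exists>C. \<forall>y\<in>B. norm y \<le> C"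
proof -
  define S where "S n = {x. \<forall>y\<in>B. \<bar>inner y x\<bar> \<le> real n}" for n :: nat
  have cl: "closed (S n)" for n
  proof -
    have "S n = (\<Inter>y\<in>B. {x. \<bar>inner y x\<bar> \<le> real n})" by (auto simp: S_def)
    then show ?thesis by (auto intro!: closed_INT closed_Collect_le continuous_intros)
  qed
  have U: "(\<Union>n. S n) = UNIV"
  proof -
    have "\<exists>n. x \<in> S n" for x
    proof -
      obtain C where "\<forall>y\<in>B. \<bar>inner y x\<bar> \<le> C" using assms by blast
      moreover obtain n where "C \<le> real n" using real_arch_simple by blast
      ultimately have "\<forall>y\<in>B. \<bar>inner y x\<bar> \<le> real n" by force
      then show ?thesis unfolding S_def by blast
    qed
    then show ?thesis by blast
  qed
  have "\<exists>n. interior (S n) \<noteq> {}"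
  proof (rule ccontr)
    assume "\<not> ?thesis"
    then have "(euclidean :: 'a topology) interior_of \<Union>(range S) = {}" by (intro Baire_category_alt)
        (auto simp: completely_metrizable_space_euclidean cl)
    then show False using U by simp
  qed
  then obtain n a e where e: "e > 0" "ball a e \<subseteq> S n" by (metis all_not_in_conv mem_interior)
  have "norm y \<le> 4 * real n / e" if "y \<in> B" for y
  proof (cases "y = 0")
    case False
    define u where "u = (e / (2 * norm y)) *\<^sub>R y"
    have "a \<in> S n" "a + u \<in> S n" using e by (auto simp: u_def subset_iff dist_norm False)
    then have "\<bar>inner y a\<bar> \<le> n" "\<bar>inner y (a + u)\<bar> \<le> n" using that by (auto simp: S_def)
    then have "\<bar>inner y u\<bar> \<le> 2 * n" by (simp add: inner_add_right)
    moreover have "inner y u = e * norm y / 2" using False by (simp add: u_def dot_square_norm power2_eq_square)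
    ultimately show ?thesis using e by (simp add: field_simps)
  qed (use e in simp)
  then show ?thesis by blast
qed

text \<open>Boundedness of the sequence makes the functionals equicontinuous, so that convergence
  passes to limits of the argument.\<close>

lemma closed_convergent_inner:
  fixes x :: "nat \<Rightarrow> 'a::{real_inner,complete_space}"
  assumes "bounded (range x)"
  shows "closed {y. convergent (\<lambda>n. inner (x n) y)}" (is "closed ?M")
proof -
  obtain K where K: "K > 0" "\<And>n. norm (x n) \<le> K" using assms unfolding bounded_pos by auto
  have "l \<in> ?M" if y: "\<And>k. y k \<in> ?M" "y \<longlonglongrightarrow> l" for y l
  proof -
    have "Cauchy (\<lambda>n. inner (x n) l)"
    proof (rule CauchyI)
      fix e :: real assume "e > 0"
      obtain k where k: "norm (y k - l) < e / (4 * K)" using LIMSEQ_D[OF y(2), of "e / (4 * K)"] K \<open>e > 0\<close> by auto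
      have "Cauchy (\<lambda>n. inner (x n) (y k))" using y(1)[of k] by (simp add: Cauchy_convergent_iff)
      then obtain N where N: "\<And>m n. m \<ge> N \<Longrightarrow> n \<ge> N \<Longrightarrow> norm (inner (x m) (y k) - inner (x n) (y k)) < e/2"
        using CauchyD[of _ "e/2"] \<open>e > 0\<close> by (metis half_gt_zero)
      have small: "\<bar>inner (x n) (y k - l)\<bar> \<le> e / 4" for n
      proof -
        have "\<bar>inner (x n) (y k - l)\<bar> \<le> norm (x n) * norm (y k - l)" by (rule Cauchy_Schwarz_ineq2)
        also have "\<dots> \<le> K * (e / (4 * K))" using K k by (intro mult_mono) (auto simp: less_imp_le)
        finally show ?thesis using K by simp
      qed
      have "norm (inner (x m) l - inner (x n) l) < e" if "m \<ge> N" "n \<ge> N" for m n using N[OF that] small[of m] small[of n]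
        unfolding real_norm_def inner_diff_right by arith
      then show "\<exists>M. \<forall>m\<ge>M. \<forall>n\<ge>M. norm (inner (x m) l - inner (x n) l) < e" by blast
    qed
    then show ?thesis by (simp add: Cauchy_convergent_iff)
  qed
  then show ?thesis by (metis closed_sequential_limits)
qed

text \<open>The space may fail to be separable. A diagonal sequence makes the pairings with the
  members \<open>x n\<close> themselves converge. The vectors whose pairings converge form a closed
  subspace containing all \<open>x n\<close>, and vectors orthogonal to it pair to 0 with the
  sequence.\<close>

lemma bounded_weakly_convergent_subseq:
  fixes x :: "nat \<Rightarrow> 'a::{real_inner,complete_space}"
  assumes "bounded (range x)"
  obtains r where "strict_mono r" "\<And>y. convergent (\<lambda>n. inner (x (r n)) y)"
proof -
  obtain K where K: "K > 0" "\<And>n. norm (x n) \<le> K" using assms unfolding bounded_pos by auto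
  interpret subseqs "\<lambda>n s. convergent (\<lambda>k. inner (x (s k)) (x n))"
  proof
    fix n and s :: "nat \<Rightarrow> nat" assume "strict_mono s"
    have "bounded (range (\<lambda>k. inner (x (s k)) (x n)))"
    proof (rule boundedI)
      fix v assume "v \<in> range (\<lambda>k. inner (x (s k)) (x n))"
      then obtain k where "v = inner (x (s k)) (x n)" by blast
      then have "norm v \<le> norm (x (s k)) * norm (x n)" using Cauchy_Schwarz_ineq2 by auto
      also have "\<dots> \<le> K * K" using K by (intro mult_mono) (auto simp: less_imp_le)
      finally show "norm v \<le> K * K" .
    qed
    then obtain l r where "strict_mono r" "((\<lambda>k. inner (x (s k)) (x n)) \<circ> r) \<longlonglongrightarrow> l"
      using bounded_imp_convergent_subsequence by blast
    then show "\<exists>r'. strict_mono r' \<and> convergent (\<lambda>k. inner (x ((s \<circ> r') k)) (x n))"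
      by (auto simp: o_def convergent_def)
  qed
  let ?r = diagseq
  have conv: "convergent (\<lambda>k. inner (x (?r k)) (x n))" for n
  proof -
    \<comment> \<open>Only from index \<open>Suc n\<close> on is the diagonal sequence a subsequence
      of the one chosen at stage \<open>n\<close>.\<close>
    have "convergent (\<lambda>k. inner (x ((diagseq \<circ> ((+) (Suc n))) k)) (x n))"
    proof (rule diagseq_holds)
      fix r s :: "nat \<Rightarrow> nat" and m
      assume "strict_mono r" "convergent (\<lambda>k. inner (x (s k)) (x m))"
      then show "convergent (\<lambda>k. inner (x ((s \<circ> r) k)) (x m))"
        using convergent_subseq_convergent[of "\<lambda>k. inner (x (s k)) (x m)" r] by (simp add: o_def)
    qed
    then have "convergent (\<lambda>k. inner (x (diagseq (k + Suc n))) (x n))" by (simp add: add.commute)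
    then show ?thesis by (rule convergent_ignore_initial_segment[THEN iffD1])
  qed
  let ?M = "{y. convergent (\<lambda>n. inner (x (?r n)) y)}"
  have "?M = UNIV"
  proof -
    have cl: "closed ?M" by (rule closed_convergent_inner) (use assms in \<open>auto intro: bounded_subset\<close>)
    have sub: "subspace ?M" unfolding subspace_def
      by (auto simp: inner_add_right convergent_const intro: convergent_add convergent_mult[OF convergent_const])
    have "y \<in> ?M" for y
    proof -
      obtain p where p: "p \<in> ?M" "\<And>m. m \<in> ?M \<Longrightarrow> inner (y - p) m = 0"
        using closed_subspace_projection[OF cl sub] by blast
      have "inner (x (?r n)) (y - p) = 0" for n using p(2)[of "x (?r n)"] conv by (subst inner_commute) blast
      then have "inner (x (?r n)) y = inner (x (?r n)) p" for n by (simp add: inner_diff_right)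
      then show ?thesis using p(1) by simp
    qed
    then show ?thesis by blast
  qed
  then show ?thesis using that[OF subseq_diagseq] by blast
qed

text \<open>An orthogonal basis expresses a vector by finitely many pairings, so that weak
  convergence is convergence in norm.\<close>

lemma bounded_finite_dim_convergent_subseq:
  fixes x :: "nat \<Rightarrow> 'a::{real_inner,complete_space}"
  assumes "finite F" "\<And>n. x n \<in> span F" "bounded (range x)"
  obtains r l where "strict_mono r" "(\<lambda>n. x (r n)) \<longlonglongrightarrow> l"
proof -
  obtain C where C: "finite C" "span C = span F" "pairwise orthogonal C" using basis_orthogonal[OF assms(1)] by blast
  obtain r where r: "strict_mono r" "\<And>y. convergent (\<lambda>n. inner (x (r n)) y)"
    using bounded_weakly_convergent_subseq[OF assms(3)] by blast
  \<comment> \<open>\<open>C\<close> may contain 0. This is harmless: the quotient is then a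
    division by 0, hence 0, and it multiplies the zero vector.\<close>
  have expand: "y = (\<Sum>c\<in>C. (inner y c / inner c c) *\<^sub>R c)" if "y \<in> span F" for y
  proof -
    have "y \<in> span C" using that C by simp
    then show ?thesis
    proof (induction rule: span_induct_alt)
      case (step a b y)
      have "inner b c * inner b b = inner b b * inner c c \<or> inner b c = 0" if "c \<in> C" for c
        using C(3) step(1) that by (auto simp: pairwise_def orthogonal_def)
      then have *: "(inner b c / inner c c) *\<^sub>R c = (if c = b then b else 0)" if "c \<in> C" for c
        using C(3) step(1) that by (auto simp: pairwise_def orthogonal_def)
      have "(\<Sum>c\<in>C. (inner (a *\<^sub>R b + y) c / inner c c) *\<^sub>R c)
        = a *\<^sub>R (\<Sum>c\<in>C. (inner b c / inner c c) *\<^sub>R c) + (\<Sum>c\<in>C. (inner y c / inner c c) *\<^sub>R c)"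
        by (simp add: inner_add_left add_divide_distrib scaleR_add_left sum.distrib scaleR_sum_right)
      also have "(\<Sum>c\<in>C. (inner b c / inner c c) *\<^sub>R c) = b" using step(1) C(1) by (simp add: *)
      finally show ?case using step by simp
    qed simp
  qed
  define l where "l = (\<Sum>c\<in>C. (lim (\<lambda>n. inner (x (r n)) c) / inner c c) *\<^sub>R c)"
  have "(\<lambda>n. \<Sum>c\<in>C. (inner (x (r n)) c / inner c c) *\<^sub>R c) \<longlonglongrightarrow> l" unfolding l_def
  proof (intro tendsto_sum tendsto_scaleR tendsto_const)
    fix c
    have "(\<lambda>n. inner (x (r n)) c * inverse (inner c c)) \<longlonglongrightarrow>
        lim (\<lambda>n. inner (x (r n)) c) * inverse (inner c c)"
      using r(2)[of c] by (intro tendsto_mult tendsto_const) (simp add: convergent_LIMSEQ_iff)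
    then show "(\<lambda>n. inner (x (r n)) c / inner c c) \<longlonglongrightarrow> lim (\<lambda>n. inner (x (r n)) c) / inner c c"
      by (simp add: divide_inverse)
  qed
  then have "(\<lambda>n. x (r n)) \<longlonglongrightarrow> l" using expand[OF assms(2)] by simp
  with r(1) that show ?thesis by blast
qed

text \<open>In infinite dimension the Gram-Schmidt procedure yields an orthonormal sequence in
  \<open>K\<close>. Its members have mutual distance sqrt 2, so that no subsequence
  converges.\<close>

lemma finite_dim_if_convergent_subseqs:
  fixes K :: "'a::{real_inner,complete_space} set"
  assumes K: "subspace K"
    and cv: "\<And>x :: nat \<Rightarrow> 'a. (\<And>n. x n \<in> K) \<Longrightarrow> bounded (range x) \<Longrightarrow> \<exists>r::nat \<Rightarrow> nat. strict_mono r \<and> convergent (\<lambda>n. x (r n))"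
  shows "\<exists>F. finite F \<and> K \<subseteq> span F"
proof (rule ccontr)
  assume no: "\<not> ?thesis"
  have ex: "\<exists>e\<in>K. norm e = 1 \<and> (\<forall>f\<in>F. inner e f = 0)" if F: "finite F" "F \<subseteq> K" for F
  proof -
    obtain C where C: "finite C" "span C = span F" "pairwise orthogonal C" using basis_orthogonal[OF F(1)] by blast
    obtain x where x: "x \<in> K" "x \<notin> span F" using no F by blast
    have CK: "span C \<subseteq> K" using C(2) F K by (metis span_minimal)
    define p where "p = (\<Sum>c\<in>C. (inner x c / inner c c) *\<^sub>R c)"
    have pC: "p \<in> span C" unfolding p_def by (intro span_sum span_scale span_base)
    have ne: "x - p \<noteq> 0" using x pC C by auto
    have orth: "inner (x - p) d = 0" if "d \<in> C" for d
    proof -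
      have "inner p d = (\<Sum>c\<in>C. if c = d then inner x d else 0)" unfolding p_def inner_sum_left
        using C(3) that by (intro sum.cong) (auto simp: pairwise_def orthogonal_def)
      then show ?thesis using C(1) that by (simp add: inner_diff_left)
    qed
    have "inner (x - p) f = 0" if "f \<in> span C" for f using that by (induction rule: span_induct_alt) (auto simp: inner_add_right orth)
    then have "inner (x - p) f = 0" if "f \<in> F" for f using that C(2) span_base by blast
    moreover have "x - p \<in> K" using x pC CK K by (meson subsetD subspace_diff)
    ultimately show ?thesis using ne K by (intro bexI[of _ "(1 / norm (x - p)) *\<^sub>R (x - p)"]) (auto simp: subspace_scale)
  qed
  have "\<exists>e. \<forall>n::nat. e n \<in> K \<and> norm (e n) = 1 \<and> (\<forall>m<n. inner (e n) (e m) = 0)"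
  proof (rule dependent_wellorder_choice)
    fix n :: nat and e assume "\<And>m. m < n \<Longrightarrow> e m \<in> K \<and> norm (e m) = 1 \<and> (\<forall>k<m. inner (e m) (e k) = 0)"
    then show "\<exists>f. f \<in> K \<and> norm f = 1 \<and> (\<forall>m<n. inner f (e m) = 0)"
      using ex[of "e ` {..<n}"] by (auto simp: image_subset_iff)
  qed simp
  then obtain e where e: "\<And>n::nat. e n \<in> K" "\<And>n. norm (e n) = 1" "\<And>m n. m < n \<Longrightarrow> inner (e n) (e m) = 0"
    by metis
  have "bounded (range e)" using e(2) by (intro boundedI[of _ 1]) auto
  then obtain r where r: "strict_mono r" "convergent (\<lambda>n. e (r n))" using cv[of e, OF e(1)] by blast
  have "Cauchy (\<lambda>n. e (r n))" using r(2) by (rule convergent_Cauchy)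
  then obtain M where M: "\<And>m n. m \<ge> M \<Longrightarrow> n \<ge> M \<Longrightarrow> norm (e (r m) - e (r n)) < 1"
    using CauchyD[of _ 1] by (metis zero_less_one)
  have "r M < r (Suc M)" using r(1) by (simp add: strict_mono_Suc_iff)
  then have "inner (e (r (Suc M))) (e (r M)) = 0" by (rule e(3))
  then have "(norm (e (r (Suc M)) - e (r M)))\<^sup>2 = (norm (e (r (Suc M))))\<^sup>2 + (norm (e (r M)))\<^sup>2" unfolding power2_norm_eq_inner
    by (simp add: inner_diff_left inner_diff_right inner_commute)
  then have "(norm (e (r (Suc M)) - e (r M)))\<^sup>2 = 2" using e(2) by simp
  moreover have "norm (e (r (Suc M)) - e (r M)) < 1" using M[of "Suc M" M] by simp
  then have "(norm (e (r (Suc M)) - e (r M)))\<^sup>2 < 1" by (simp add: power_less_one_iff abs_square_less_1)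
  ultimately show False by simp
qed

lemma span_subset_complex_span: "span F \<subseteq> complex_vector.span (F :: 'a::complex_hilbert set)"
proof (rule span_minimal)
  show "subspace (complex_vector.span F)" unfolding subspace_def
    by (metis complex_vector.span_add complex_vector.span_scale complex_vector.span_zero scaleC_complex_of_real)
qed (rule complex_vector.span_superset)

text \<open>Finite dimension is complex in \<open>fredholm_rel\<close> but real in the compactness
  lemmas above; adjoining the multiples by \<i> passes from one to the other.\<close>

lemma complex_span_subset_span:
  "complex_vector.span (F :: 'a::complex_hilbert set) \<subseteq> span (F \<union> (*\<^sub>C) \<i> ` F)" (is "_ \<subseteq> span ?G")
proof (rule complex_vector.span_minimal)
  have i: "\<i> *\<^sub>C x \<in> span ?G" if "x \<in> span ?G" for x using that
  proof (induction rule: span_induct_alt)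
    case (step a g x)
    have "\<i> *\<^sub>C g \<in> span ?G"
    proof (cases "g \<in> F")
      case False
      then obtain f where "f \<in> F" "g = \<i> *\<^sub>C f" using step(1) by blast
      then have "\<i> *\<^sub>C g = - f" by (simp add: scaleC_scaleC scaleC_minus_left scaleC_one)
      then show ?thesis using \<open>f \<in> F\<close> by (simp add: span_base span_neg)
    qed (simp add: span_base)
    then show ?case using step(2) by (simp add: scaleC_add_right scaleC_scaleR span_add span_scale)
  qed (simp add: scaleC_zero_right span_zero)
  have "c *\<^sub>C x \<in> span ?G" if "x \<in> span ?G" for c x
    using i[OF that] that by (simp add: scaleC_eq_Re_Im[of c x] span_add span_scale)
  then show "complex_vector.subspace (span ?G)" by (auto simp: complex_vector.subspace_def span_zero span_add)
qed (auto simp: span_base)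

section \<open>Self-adjoint relations\<close>

text \<open>Unbounded operators are represented by their graphs. Since the graph is a complex subspace,
  the adjoint may be computed with the real inner product.\<close>

definition self_adjoint_rel :: "('a::complex_hilbert \<times> 'a) set \<Rightarrow> bool" where
  "self_adjoint_rel G \<longleftrightarrow> (\<forall>c u h. (u, h) \<in> G \<longrightarrow> (c *\<^sub>C u, c *\<^sub>C h) \<in> G) \<and>
     (\<forall>v w. (v, w) \<in> G \<longleftrightarrow> (\<forall>u h. (u, h) \<in> G \<longrightarrow> inner v h = inner w u))"

text \<open>For the graph \<open>G\<close> of an operator A,
  \<open>(u, f + z *\<^sub>C u) \<in> G\<close> means (A - z) u = f.\<close>

definition fredholm_rel :: "('a::complex_hilbert \<times> 'a) set \<Rightarrow> complex \<Rightarrow> bool" where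
  "fredholm_rel G z \<longleftrightarrow>
     (\<exists>F. finite F \<and> {u. (u, z *\<^sub>C u) \<in> G} \<subseteq> complex_vector.span F) \<and>
     closed {f. \<exists>u. (u, f + z *\<^sub>C u) \<in> G} \<and>
     (\<exists>F. finite F \<and> (\<forall>v. \<exists>u f. (u, f + z *\<^sub>C u) \<in> G \<and> v - f \<in> complex_vector.span F))"

context
  fixes G :: "('a::complex_hilbert \<times> 'a) set"
  assumes G: "self_adjoint_rel G"
begin

lemma self_adjoint_relI: "(\<And>u h. (u, h) \<in> G \<Longrightarrow> inner v h = inner w u) \<Longrightarrow> (v, w) \<in> G"
  using G unfolding self_adjoint_rel_def by blast

lemma self_adjoint_relD: "(v, w) \<in> G \<Longrightarrow> (u, h) \<in> G \<Longrightarrow> inner v h = inner w u"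
  using G unfolding self_adjoint_rel_def by blast

lemma self_adjoint_rel_scaleC: "(u, h) \<in> G \<Longrightarrow> (c *\<^sub>C u, c *\<^sub>C h) \<in> G"
  using G unfolding self_adjoint_rel_def by blast

lemma self_adjoint_rel_scaleR: "(u, h) \<in> G \<Longrightarrow> (r *\<^sub>R u, r *\<^sub>R h) \<in> G"
  by (metis scaleC_complex_of_real self_adjoint_rel_scaleC)

lemma self_adjoint_rel_zero: "(0, 0) \<in> G" by (rule self_adjoint_relI) simp

lemma self_adjoint_rel_add: "(u, h) \<in> G \<Longrightarrow> (v, k) \<in> G \<Longrightarrow> (u + v, h + k) \<in> G"
  by (rule self_adjoint_relI) (simp add: inner_add_left self_adjoint_relD)

lemma self_adjoint_rel_diff: "(u, h) \<in> G \<Longrightarrow> (v, k) \<in> G \<Longrightarrow> (u - v, h - k) \<in> G"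
  by (rule self_adjoint_relI) (simp add: inner_diff_left self_adjoint_relD)

text \<open>A self-adjoint relation is the solution set of a family of continuous equations, hence
  closed.\<close>

lemma self_adjoint_rel_limit:
  assumes "\<And>n. (u n, h n) \<in> G" "u \<longlonglongrightarrow> u'" "h \<longlonglongrightarrow> h'"
  shows "(u', h') \<in> G"
proof (rule self_adjoint_relI)
  fix v k assume v: "(v, k) \<in> G"
  have "(\<lambda>n. inner (u n) k) \<longlonglongrightarrow> inner u' k" "(\<lambda>n. inner (h n) v) \<longlonglongrightarrow> inner h' v"
    by (intro tendsto_intros assms)+
  moreover have "inner (u n) k = inner (h n) v" for n using self_adjoint_relD[OF assms(1) v] by simp
  ultimately show "inner u' k = inner h' v" by (simp add: LIMSEQ_unique)
qed

lemma self_adjoint_rel_kernel: "subspace {u. (u, z *\<^sub>C u) \<in> G}" "closed {u. (u, z *\<^sub>C u) \<in> G}"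
proof -
  show "subspace {u. (u, z *\<^sub>C u) \<in> G}" unfolding subspace_def using self_adjoint_rel_zero self_adjoint_rel_add self_adjoint_rel_scaleR
    by (auto simp: scaleC_zero_right scaleC_add_right scaleC_scaleR)
  show "closed {u. (u, z *\<^sub>C u) \<in> G}" unfolding closed_sequential_limits
  proof (intro allI impI; elim conjE)
    fix u l assume u: "\<forall>n. u n \<in> {u. (u, z *\<^sub>C u) \<in> G}" "u \<longlonglongrightarrow> l"
    have "(\<lambda>n. z *\<^sub>C u n) \<longlonglongrightarrow> z *\<^sub>C l" by (intro tendsto_scaleC tendsto_const u)
    then show "l \<in> {u. (u, z *\<^sub>C u) \<in> G}" using self_adjoint_rel_limit[of u "\<lambda>n. z *\<^sub>C u n"] u by blast
  qed
qed

lemma self_adjoint_rel_range_subspace: "subspace {f. \<exists>u. (u, f + z *\<^sub>C u) \<in> G}" unfolding subspace_def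
proof (intro conjI ballI allI; clarsimp)
  show "\<exists>u. (u, z *\<^sub>C u) \<in> G" using self_adjoint_rel_zero by (intro exI[of _ 0]) (simp add: scaleC_zero_right)
next
  fix x y u v assume "(u, x + z *\<^sub>C u) \<in> G" "(v, y + z *\<^sub>C v) \<in> G"
  from self_adjoint_rel_add[OF this] show "\<exists>u. (u, x + y + z *\<^sub>C u) \<in> G"
    by (intro exI[of _ "u + v"]) (simp add: scaleC_add_right algebra_simps)
next
  fix c x u assume "(u, x + z *\<^sub>C u) \<in> G"
  from self_adjoint_rel_scaleR[OF this, of c] show "\<exists>u. (u, c *\<^sub>R x + z *\<^sub>C u) \<in> G"
    by (intro exI[of _ "c *\<^sub>R u"]) (simp add: scaleR_add_right scaleC_scaleR)
qed

lemma self_adjoint_rel_range_orthogonal: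
  assumes "\<And>u f. (u, f + z *\<^sub>C u) \<in> G \<Longrightarrow> inner y f = 0"
  shows "(y, cnj z *\<^sub>C y) \<in> G"
proof (rule self_adjoint_relI)
  fix u h assume "(u, h) \<in> G"
  then have "inner y (h - z *\<^sub>C u) = 0" using assms[of u "h - z *\<^sub>C u"] by simp
  then show "inner y h = inner (cnj z *\<^sub>C y) u" by (simp add: inner_diff_right inner_scaleC_left)
qed

text \<open>By symmetry \<i> u is orthogonal, in the real inner product, to the image of
  \<open>u\<close>; it is also orthogonal to \<open>u\<close>. Hence (A - Re z) u and Im z times
  \<i> u are the legs of a right triangle with hypotenuse \<open>f\<close>.\<close>

lemma self_adjoint_rel_lower_bound:
  assumes "(u, f + z *\<^sub>C u) \<in> G"
  shows "\<bar>Im z\<bar> * norm u \<le> norm f"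
proof -
  have pythagoras: "inner a b = 0 \<Longrightarrow> (norm (a - b))\<^sup>2 = (norm a)\<^sup>2 + (norm b)\<^sup>2" for a b :: 'a
    unfolding power2_norm_eq_inner by (simp add: inner_diff_left inner_diff_right inner_commute)
  let ?h = "f + z *\<^sub>C u"
  have "inner (\<i> *\<^sub>C u) ?h = inner (\<i> *\<^sub>C ?h) u" using self_adjoint_relD[OF self_adjoint_rel_scaleC[OF assms] assms] .
  also have "\<dots> = - inner (\<i> *\<^sub>C u) ?h" by (subst inner_scaleC_left) (simp add: scaleC_minus_left inner_commute)
  finally have 0: "inner (\<i> *\<^sub>C u) ?h = 0" by simp
  have f: "f = (?h - Re z *\<^sub>R u) - Im z *\<^sub>R \<i> *\<^sub>C u" by (simp add: scaleC_eq_Re_Im[of z u])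
  have "inner (?h - Re z *\<^sub>R u) (Im z *\<^sub>R \<i> *\<^sub>C u) = 0"
    using 0 inner_imaginary_self[of u] by (simp add: inner_diff_right inner_commute[of _ "\<i> *\<^sub>C u"])
  then have "(norm f)\<^sup>2 = (norm (?h - Re z *\<^sub>R u))\<^sup>2 + (norm (Im z *\<^sub>R \<i> *\<^sub>C u))\<^sup>2"
    by (subst f) (rule pythagoras)
  then have "(\<bar>Im z\<bar> * norm u)\<^sup>2 \<le> (norm f)\<^sup>2" by (simp add: norm_scaleC power_mult_distrib)
  then show ?thesis by (rule power2_le_imp_le) simp
qed

text \<open>The lower bound makes the range of A - z closed. Its orthogonal complement lies in the
  kernel of A - \<open>cnj z\<close>, which is trivial by the same bound for
  \<open>cnj z\<close>.\<close>

lemma self_adjoint_rel_nonreal_surj: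
  assumes z: "Im z \<noteq> 0"
  shows "\<exists>u. (u, f + z *\<^sub>C u) \<in> G"
proof -
  let ?R = "{f. \<exists>u. (u, f + z *\<^sub>C u) \<in> G}"
  have "closed ?R" unfolding closed_sequential_limits
  proof (intro allI impI; elim conjE)
    fix f l assume "\<forall>n. f n \<in> ?R" and l: "f \<longlonglongrightarrow> l"
    then obtain u where u: "\<And>n. (u n, f n + z *\<^sub>C u n) \<in> G" by simp metis
    have "norm (u m - u n) \<le> norm (f m - f n) / \<bar>Im z\<bar>" for m n
    proof -
      have "(u m - u n, (f m - f n) + z *\<^sub>C (u m - u n)) \<in> G"
        using self_adjoint_rel_diff[OF u[of m] u[of n]] by (simp add: scaleC_diff_right algebra_simps)
      from self_adjoint_rel_lower_bound[OF this] show ?thesis using z by (simp add: field_simps)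
    qed
    moreover have "Cauchy f" using l by (rule LIMSEQ_imp_Cauchy)
    ultimately have "Cauchy u" using z unfolding Cauchy_iff by (meson le_less_trans mult_pos_pos pos_divide_less_eq zero_less_abs_iff)
    then obtain u' where u': "u \<longlonglongrightarrow> u'" using Cauchy_convergent convergent_def by blast
    have "(\<lambda>n. f n + z *\<^sub>C u n) \<longlonglongrightarrow> l + z *\<^sub>C u'"
      by (intro tendsto_add l tendsto_scaleC tendsto_const u')
    then show "l \<in> ?R" using self_adjoint_rel_limit[OF u u'] by blast
  qed
  moreover have "y = 0" if "\<And>m. m \<in> ?R \<Longrightarrow> inner y m = 0" for y
  proof -
    have "(y, 0 + cnj z *\<^sub>C y) \<in> G" using self_adjoint_rel_range_orthogonal[of z y] that by auto
    from self_adjoint_rel_lower_bound[OF this] show ?thesis using z by (simp add: mult_le_0_iff)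
  qed
  ultimately have "?R = UNIV" using closed_subspace_eq_UNIV self_adjoint_rel_range_subspace by blast
  then show ?thesis by blast
qed

section \<open>The Fredholm property of self-adjoint relations and its stability\<close>

lemma fredholm_rel_nonreal:
  assumes z: "Im z \<noteq> 0"
  shows "fredholm_rel G z"
proof -
  have "u = 0" if "(u, z *\<^sub>C u) \<in> G" for u using self_adjoint_rel_lower_bound[of u 0 z] that z by (simp add: mult_le_0_iff)
  moreover have "{f. \<exists>u. (u, f + z *\<^sub>C u) \<in> G} = UNIV" using self_adjoint_rel_nonreal_surj[OF z] by blast
  ultimately show ?thesis unfolding fredholm_rel_def
    by (auto intro!: exI[of _ "{} :: 'a set"]) (metis diff_self self_adjoint_rel_nonreal_surj[OF z])
qed

text \<open>With \<open>f = 0\<close> the hypothesis makes the kernel finite-dimensional. For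
  solutions orthogonal to the kernel it shows that the range is closed. As \<open>r\<close> is real,
  the orthogonal complement of the range lies in the kernel again.\<close>

lemma weyl_imp_fredholm_rel:
  assumes weyl: "\<And>u f. (\<And>n. (u n, f n + complex_of_real r *\<^sub>C u n) \<in> G) \<Longrightarrow> bounded (range u) \<Longrightarrow>
    convergent f \<Longrightarrow> \<exists>s. strict_mono s \<and> convergent (\<lambda>n. u (s n))"
  shows "fredholm_rel G (complex_of_real r)"
proof -
  let ?z = "complex_of_real r"
  let ?K = "{u. (u, ?z *\<^sub>C u) \<in> G}"
  let ?R = "{f. \<exists>u. (u, f + ?z *\<^sub>C u) \<in> G}"
  obtain F where F: "finite F" "?K \<subseteq> span F"
  proof -
    have "\<exists>F. finite F \<and> ?K \<subseteq> span F"
    proof (rule finite_dim_if_convergent_subseqs[OF self_adjoint_rel_kernel(1)])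
      fix x :: "nat \<Rightarrow> 'a" assume "\<And>n. x n \<in> ?K" "bounded (range x)"
      then show "\<exists>r. strict_mono r \<and> convergent (\<lambda>n. x (r n))"
        using weyl[of x "\<lambda>n. 0"] by (simp add: convergent_const)
    qed
    then show ?thesis using that by blast
  qed
  have cl: "closed ?R" unfolding closed_sequential_limits
  proof (intro allI impI; elim conjE)
    fix f l assume f: "\<forall>n. f n \<in> ?R" "f \<longlonglongrightarrow> l"
    have "\<exists>u. (u, f n + ?z *\<^sub>C u) \<in> G \<and> (\<forall>k\<in>?K. inner u k = 0)" for n
    proof -
      obtain u where u: "(u, f n + ?z *\<^sub>C u) \<in> G" using f by blast
      obtain p where p: "p \<in> ?K" "\<And>k. k \<in> ?K \<Longrightarrow> inner (u - p) k = 0"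
        using closed_subspace_projection[OF self_adjoint_rel_kernel(2,1)] by metis
      have "(u - p, f n + ?z *\<^sub>C (u - p)) \<in> G"
        using self_adjoint_rel_diff[OF u, of p "?z *\<^sub>C p"] p(1) by (simp add: scaleC_diff_right algebra_simps)
      with p(2) show ?thesis by blast
    qed
    then obtain u where u: "\<And>n. (u n, f n + ?z *\<^sub>C u n) \<in> G" "\<And>n k. k \<in> ?K \<Longrightarrow> inner (u n) k = 0" by metis
    \<comment> \<open>Otherwise normalized solutions would have right-hand sides tending to 0, and a
      subsequence would converge to a unit vector of the kernel that is orthogonal to the
      kernel.\<close>
    have "bounded (range u)"
    proof (rule ccontr)
      assume "\<not> ?thesis"
      then have "\<exists>k. norm (u k) > Suc n" for n :: nat unfolding bounded_iff by (metis not_le rangeE)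
      then obtain k where k: "\<And>n::nat. norm (u (k n)) > Suc n" by metis
      define v where "v n = (1 / norm (u (k n))) *\<^sub>R u (k n)" for n
      define g where "g n = (1 / norm (u (k n))) *\<^sub>R f (k n)" for n
      have nz: "norm (u (k n)) > 0" for n using k[of n] by (meson le_less_trans of_nat_0_le_iff)
      have v1: "norm (v n) = 1" for n using nz[of n] by (simp add: v_def)
      have vG: "(v n, g n + ?z *\<^sub>C v n) \<in> G" for n using self_adjoint_rel_scaleR[OF u(1)[of "k n"], of "1 / norm (u (k n))"]
        by (simp add: v_def g_def scaleR_add_right scaleC_scaleR)
      obtain C where C: "C > 0" "\<And>n. norm (f n) \<le> C" using convergent_imp_bounded[OF f(2)] unfolding bounded_pos by auto
      have g0: "g \<longlonglongrightarrow> 0"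
      proof (rule Lim_null_comparison)
        have "norm (g n) \<le> C * (1 / Suc n)" for n
        proof -
          have "norm (g n) = norm (f (k n)) * (1 / norm (u (k n)))" by (simp add: g_def)
          also have "\<dots> \<le> C * (1 / Suc n)" using C nz[of n] k[of n] by (intro mult_mono divide_left_mono) (auto simp: less_imp_le)
          finally show ?thesis .
        qed
        then show "\<forall>\<^sub>F n in sequentially. norm (g n) \<le> C * (1 / Suc n)" by simp
        show "(\<lambda>n. C * (1 / Suc n)) \<longlonglongrightarrow> 0"
          using tendsto_mult[OF tendsto_const[of C] LIMSEQ_Suc[OF lim_1_over_n]] by simp
      qed
      moreover have "bounded (range v)" using v1 by (intro boundedI[of _ 1]) auto
      ultimately obtain s where s: "strict_mono s" "convergent (\<lambda>n. v (s n))" using weyl[of v g, OF vG _ convergentI[OF g0]] by blast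
      then obtain w where w: "(\<lambda>n. v (s n)) \<longlonglongrightarrow> w" unfolding convergent_def by blast
      have "(\<lambda>n. g (s n)) \<longlonglongrightarrow> 0" using LIMSEQ_subseq_LIMSEQ[OF g0 s(1)] by (simp add: o_def)
      then have "(\<lambda>n. g (s n) + ?z *\<^sub>C v (s n)) \<longlonglongrightarrow> 0 + ?z *\<^sub>C w"
        by (intro tendsto_add tendsto_scaleC tendsto_const w)
      from self_adjoint_rel_limit[OF vG w this] have "w \<in> ?K" by simp
      have "(\<lambda>n. inner (v (s n)) w) \<longlonglongrightarrow> inner w w" by (intro tendsto_intros w)
      moreover have "inner (v (s n)) w = 0" for n using u(2)[OF \<open>w \<in> ?K\<close>] by (simp add: v_def)
      ultimately have "w = 0" by (simp add: LIMSEQ_const_iff)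
      moreover have "(\<lambda>n. norm (v (s n))) \<longlonglongrightarrow> norm w" by (intro tendsto_intros w)
      ultimately show False using v1 by (simp add: LIMSEQ_const_iff)
    qed
    then obtain s where s: "strict_mono s" "convergent (\<lambda>n. u (s n))" using weyl[of u f, OF u(1) _ convergentI[OF f(2)]] by blast
    then obtain w where w: "(\<lambda>n. u (s n)) \<longlonglongrightarrow> w" unfolding convergent_def by blast
    have "(\<lambda>n. f (s n)) \<longlonglongrightarrow> l" using LIMSEQ_subseq_LIMSEQ[OF f(2) s(1)] by (simp add: o_def)
    then have "(\<lambda>n. f (s n) + ?z *\<^sub>C u (s n)) \<longlonglongrightarrow> l + ?z *\<^sub>C w"
      by (intro tendsto_add tendsto_scaleC tendsto_const w)
    from self_adjoint_rel_limit[OF u(1) w this] show "l \<in> ?R" by blast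
  qed
  \<comment> \<open>The set \<open>F\<close> that spans the kernel serves for the cokernel as well,
    because \<open>cnj ?z = ?z\<close>.\<close>
  have "\<exists>u f. (u, f + ?z *\<^sub>C u) \<in> G \<and> v - f \<in> complex_vector.span F" for v
  proof -
    obtain f where f: "f \<in> ?R" "\<And>g. g \<in> ?R \<Longrightarrow> inner (v - f) g = 0"
      using closed_subspace_projection[OF cl self_adjoint_rel_range_subspace, of v] by blast
    then have "(v - f, cnj ?z *\<^sub>C (v - f)) \<in> G" by (intro self_adjoint_rel_range_orthogonal) blast
    then have "v - f \<in> complex_vector.span F" using F(2) span_subset_complex_span by auto
    with f(1) show ?thesis by blast
  qed
  moreover have "?K \<subseteq> complex_vector.span F" using F(2) span_subset_complex_span by blast
  ultimately show ?thesis unfolding fredholm_rel_def using cl F(1) by blast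
qed

text \<open>On the orthogonal complement of the kernel, A - r has a bounded inverse. Thus
  \<open>u n - u0\<close> splits into a null sequence \<open>q n\<close> and a bounded sequence
  \<open>p n\<close> in the kernel, which has a convergent subsequence by finite dimension.\<close>

lemma fredholm_rel_imp_weyl:
  assumes fr: "fredholm_rel G (complex_of_real r)"
    and u: "\<And>n. (u n, f n + complex_of_real r *\<^sub>C u n) \<in> G" "bounded (range u)" "convergent f"
  shows "\<exists>s. strict_mono s \<and> convergent (\<lambda>n. u (s n))"
proof -
  let ?z = "complex_of_real r"
  let ?K = "{u. (u, ?z *\<^sub>C u) \<in> G}"
  let ?R = "{f. \<exists>u. (u, f + ?z *\<^sub>C u) \<in> G}"
  obtain F where F: "finite F" "?K \<subseteq> complex_vector.span F" and cl: "closed ?R" using fr unfolding fredholm_rel_def by blast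
  \<comment> \<open>This replaces the open mapping theorem. Split \<open>x\<close> into a part
    \<open>g'\<close> in the range, the image of some \<open>v\<close>, and a part in the kernel.
    Symmetry gives \<open>inner q x = inner g v\<close>, which is at most \<open>norm v\<close> for
    \<open>norm g \<le> 1\<close>.\<close>
  have "\<exists>C. \<forall>y\<in>{q. (\<forall>k\<in>?K. inner q k = 0) \<and> (\<exists>g. (q, g + ?z *\<^sub>C q) \<in> G \<and> norm g \<le> 1)}. norm y \<le> C"
  proof (rule weakly_bounded_imp_bounded)
    fix x
    obtain g' where g': "g' \<in> ?R" "\<And>g. g \<in> ?R \<Longrightarrow> inner (x - g') g = 0"
      using closed_subspace_projection[OF cl self_adjoint_rel_range_subspace, of x] by blast
    then have "(x - g', cnj ?z *\<^sub>C (x - g')) \<in> G" by (intro self_adjoint_rel_range_orthogonal) blast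
    then have xK: "x - g' \<in> ?K" by simp
    obtain v where v: "(v, g' + ?z *\<^sub>C v) \<in> G" using g'(1) by blast
    have "\<bar>inner q x\<bar> \<le> norm v"
      if q: "\<forall>k\<in>?K. inner q k = 0" and g: "(q, g + ?z *\<^sub>C q) \<in> G" "norm g \<le> 1" for q g
    proof -
      have "inner q (g' + ?z *\<^sub>C v) = inner (g + ?z *\<^sub>C q) v" by (rule self_adjoint_relD[OF g(1) v])
      then have "inner q g' = inner g v" by (simp add: inner_add_right inner_add_left scaleC_complex_of_real)
      moreover have "inner q x = inner q g'" using q xK by (metis inner_diff_right eq_iff_diff_eq_0)
      moreover have "\<bar>inner g v\<bar> \<le> norm g * norm v" by (rule Cauchy_Schwarz_ineq2)
      moreover have "norm g * norm v \<le> 1 * norm v" using g by (intro mult_right_mono) auto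
      ultimately show ?thesis by simp
    qed
    then show "\<exists>C. \<forall>y\<in>{q. (\<forall>k\<in>?K. inner q k = 0) \<and> (\<exists>g. (q, g + ?z *\<^sub>C q) \<in> G \<and> norm g \<le> 1)}. \<bar>inner y x\<bar> \<le> C"
      by blast
  qed
  then obtain C where C: "\<And>q g. (\<forall>k\<in>?K. inner q k = 0) \<Longrightarrow> (q, g + ?z *\<^sub>C q) \<in> G \<Longrightarrow> norm g \<le> 1 \<Longrightarrow> norm q \<le> C"
    by blast
  have bd: "norm q \<le> C * norm g" if q: "\<forall>k\<in>?K. inner q k = 0" and g: "(q, g + ?z *\<^sub>C q) \<in> G" for q g
  proof (cases "g = 0")
    case True
    then have "q \<in> ?K" using g by simp
    then have "inner q q = 0" using q by blast
    then show ?thesis using True by simp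
  next
    case False
    have "((1 / norm g) *\<^sub>R q, (1 / norm g) *\<^sub>R g + ?z *\<^sub>C (1 / norm g) *\<^sub>R q) \<in> G"
      using self_adjoint_rel_scaleR[OF g, of "1 / norm g"] by (simp add: scaleR_add_right scaleC_scaleR)
    from C[OF _ this] q have "norm ((1 / norm g) *\<^sub>R q) \<le> C" by simp
    then show ?thesis using False by (simp add: field_simps)
  qed
  obtain l where l: "f \<longlonglongrightarrow> l" using u(3) convergent_def by blast
  have "l \<in> ?R" using closed_sequentially[OF cl _ l] u(1) by blast
  then obtain u0 where u0: "(u0, l + ?z *\<^sub>C u0) \<in> G" by blast
  have "\<exists>p. p \<in> ?K \<and> (\<forall>k\<in>?K. inner (u n - u0 - p) k = 0)" for n
    using closed_subspace_projection[OF self_adjoint_rel_kernel(2,1)] by metis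
  then obtain p where p: "\<And>n. p n \<in> ?K" "\<And>n. \<forall>k\<in>?K. inner (u n - u0 - p n) k = 0" by metis
  define q where "q n = u n - u0 - p n" for n
  have qG: "(q n, (f n - l) + ?z *\<^sub>C q n) \<in> G" for n
    using self_adjoint_rel_diff[OF self_adjoint_rel_diff[OF u(1)[of n] u0], of "p n" "?z *\<^sub>C p n"] p(1)[of n]
    by (simp add: q_def scaleC_diff_right algebra_simps)
  have "q \<longlonglongrightarrow> 0"
  proof (rule Lim_null_comparison)
    show "\<forall>\<^sub>F n in sequentially. norm (q n) \<le> C * norm (f n - l)" using bd[OF _ qG] p(2) by (auto simp: q_def)
    have "(\<lambda>n. C * norm (f n - l)) \<longlonglongrightarrow> C * norm (l - l)" by (intro tendsto_intros l)
    then show "(\<lambda>n. C * norm (f n - l)) \<longlonglongrightarrow> 0" by simp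
  qed
  have "p = (\<lambda>n. u n - u0 - q n)" by (auto simp: q_def)
  moreover have "bounded (range q)" using \<open>q \<longlonglongrightarrow> 0\<close> by (rule convergent_imp_bounded)
  ultimately have "bounded (range p)" using u(2) by (auto intro!: bounded_minus_comp)
  moreover have "p n \<in> span (F \<union> (*\<^sub>C) \<i> ` F)" for n using p(1) F(2) complex_span_subset_span by blast
  ultimately obtain s m where s: "strict_mono s" "(\<lambda>n. p (s n)) \<longlonglongrightarrow> m"
    using bounded_finite_dim_convergent_subseq[of "F \<union> (*\<^sub>C) \<i> ` F" p] F(1) by blast
  have "(\<lambda>n. q (s n)) \<longlonglongrightarrow> 0" using LIMSEQ_subseq_LIMSEQ[OF \<open>q \<longlonglongrightarrow> 0\<close> s(1)] by (simp add: o_def)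
  then have "(\<lambda>n. u0 + p (s n) + q (s n)) \<longlonglongrightarrow> u0 + m + 0" by (intro tendsto_add tendsto_const s)
  then have "convergent (\<lambda>n. u (s n))" by (simp add: q_def convergentI)
  with s(1) show ?thesis by blast
qed

end

text \<open>Compactness of the difference of the resolvents at -\<i>, in terms of sequences:
  \<open>u n\<close> and \<open>v n\<close> are the two solutions for the same right-hand side
  \<open>h n\<close>.\<close>

definition compact_resolvent_difference ::
    "('a::complex_hilbert \<times> 'a) set \<Rightarrow> ('a \<times> 'a) set \<Rightarrow> bool" where
  "compact_resolvent_difference G G' \<longleftrightarrow>
     (\<forall>h u v. bounded (range h) \<longrightarrow> (\<forall>n::nat. (u n, h n - \<i> *\<^sub>C u n) \<in> G \<and> (v n, h n - \<i> *\<^sub>C v n) \<in> G') \<longrightarrow>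
       (\<exists>r. strict_mono r \<and> convergent (\<lambda>n. u (r n) - v (r n))))"

lemma compact_resolvent_difference_sym:
  assumes "compact_resolvent_difference G G'"
  shows "compact_resolvent_difference G' G" unfolding compact_resolvent_difference_def
proof (intro allI impI)
  fix h u v :: "nat \<Rightarrow> 'a"
  assume h: "bounded (range h)" "\<forall>n. (u n, h n - \<i> *\<^sub>C u n) \<in> G' \<and> (v n, h n - \<i> *\<^sub>C v n) \<in> G"
  then obtain r where r: "strict_mono r" "convergent (\<lambda>n. v (r n) - u (r n))"
    using assms unfolding compact_resolvent_difference_def by blast
  then have "convergent (\<lambda>n. - (v (r n) - u (r n)))" by (simp only: convergent_minus_iff[symmetric])
  then show "\<exists>r. strict_mono r \<and> convergent (\<lambda>n. u (r n) - v (r n))" using r(1) by auto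
qed

text \<open>Write A and B for \<open>G\<close> and \<open>G'\<close>, and let (B - r) v = f with
  real r, bounded \<open>v\<close> and convergent \<open>f\<close>. Put h = (B + \<i>) v and solve
  (A + \<i>) u = h. Then u - v converges along a subsequence, and so does (A - r) u = f + (r + \<i>)
  (v - u). The criterion for A yields a convergent subsequence of \<open>u\<close>, hence one of
  \<open>v\<close>.\<close>

lemma fredholm_rel_compact_perturbation:
  assumes G: "self_adjoint_rel G" and G': "self_adjoint_rel G'"
    and comp: "compact_resolvent_difference G G'" and fr: "fredholm_rel G z"
  shows "fredholm_rel G' z"
proof (cases "Im z = 0")
  case False
  then show ?thesis by (rule fredholm_rel_nonreal[OF G'])
next
  case True
  then obtain r where z: "z = complex_of_real r" by (metis complex_is_Real_iff Reals_cases)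
  show ?thesis unfolding z
  proof (rule weyl_imp_fredholm_rel[OF G'])
    fix v f :: "nat \<Rightarrow> 'a"
    assume v: "\<And>n. (v n, f n + complex_of_real r *\<^sub>C v n) \<in> G'" "bounded (range v)" "convergent f"
    define h where "h n = f n + (complex_of_real r + \<i>) *\<^sub>C v n" for n
    obtain K where K: "\<And>n. norm (v n) \<le> K" using v(2) unfolding bounded_iff by auto
    have "bounded (range (\<lambda>n. (complex_of_real r + \<i>) *\<^sub>C v n))"
      using K by (intro boundedI[of _ "cmod (complex_of_real r + \<i>) * K"]) (auto simp: norm_scaleC mult_left_mono)
    moreover have "bounded (range f)" using v(3) convergent_imp_bounded convergent_def by blast
    ultimately have hb: "bounded (range h)" unfolding h_def by (rule bounded_plus_comp[rotated])
    have "\<exists>u. (u, h n - \<i> *\<^sub>C u) \<in> G" for n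
      using self_adjoint_rel_nonreal_surj[OF G, of "-\<i>" "h n"] by (simp add: scaleC_minus_left)
    then obtain u where u: "\<And>n. (u n, h n - \<i> *\<^sub>C u n) \<in> G" by metis
    obtain B where B: "\<And>n. norm (h n) \<le> B" using hb unfolding bounded_iff by auto
    have "norm (u n) \<le> B" for n
      using self_adjoint_rel_lower_bound[OF G, of "u n" "h n" "-\<i>"] u[of n] B[of n] by (simp add: scaleC_minus_left)
    then have ub: "bounded (range u)" by (intro boundedI) auto
    have vG: "(v n, h n - \<i> *\<^sub>C v n) \<in> G'" for n using v(1)[of n] by (simp add: h_def scaleC_add_left)
    obtain s where s: "strict_mono s" "convergent (\<lambda>n. u (s n) - v (s n))"
      using comp hb u vG unfolding compact_resolvent_difference_def by blast
    define g where "g n = f n + (complex_of_real r + \<i>) *\<^sub>C (v n - u n)" for n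
    have gu: "(u n, g n + complex_of_real r *\<^sub>C u n) \<in> G" for n
      using u[of n] by (simp add: h_def g_def scaleC_add_left scaleC_diff_right algebra_simps)
    obtain l where l: "(\<lambda>n. u (s n) - v (s n)) \<longlonglongrightarrow> l" using s(2) convergent_def by blast
    have "(\<lambda>n. - (u (s n) - v (s n))) \<longlonglongrightarrow> - l" by (intro tendsto_minus l)
    then have l': "(\<lambda>n. v (s n) - u (s n)) \<longlonglongrightarrow> - l" by simp
    obtain k where k: "f \<longlonglongrightarrow> k" using v(3) convergent_def by blast
    have "(\<lambda>n. f (s n)) \<longlonglongrightarrow> k" using LIMSEQ_subseq_LIMSEQ[OF k s(1)] by (simp add: o_def)
    then have "(\<lambda>n. g (s n)) \<longlonglongrightarrow> k + (complex_of_real r + \<i>) *\<^sub>C (- l)"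
      unfolding g_def by (intro tendsto_add tendsto_scaleC tendsto_const l')
    then have "convergent (\<lambda>n. g (s n))" by (rule convergentI)
    moreover have "bounded (range (\<lambda>n. u (s n)))" using ub by (rule bounded_subset) auto
    ultimately obtain t where t: "strict_mono t" "convergent (\<lambda>n. u (s (t n)))"
      using fredholm_rel_imp_weyl[OF G fr[unfolded z], of "\<lambda>n. u (s n)" "\<lambda>n. g (s n)"] gu by blast
    have "(\<lambda>n. v (s (t n)) - u (s (t n))) \<longlonglongrightarrow> - l" using LIMSEQ_subseq_LIMSEQ[OF l' t(1)] by (simp add: o_def)
    from convergent_add[OF convergentI[OF this] t(2)] have "convergent (\<lambda>n. v (s (t n)))" by simp
    moreover have "strict_mono (\<lambda>n. s (t n))" using s(1) t(1) by (simp add: strict_mono_def)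
    ultimately show "\<exists>s. strict_mono s \<and> convergent (\<lambda>n. v (s n))" by blast
  qed
qed

section \<open>Operators induced by symmetric forms\<close>

text \<open>Surjectivity of \<open>T\<close> makes the set of all \<open>y\<close> with
  \<open>norm (T' y) \<le> 1\<close> weakly bounded, hence bounded; this is the lower bound. It
  makes the range of \<open>T'\<close> closed, and injectivity of \<open>T\<close> makes that range
  dense.\<close>

lemma bijective_adjoint:
  fixes T T' :: "'a::{real_inner,complete_space} \<Rightarrow> 'a"
  assumes "bounded_linear T" "bounded_linear T'" and adj: "\<And>x y. inner (T x) y = inner x (T' y)"
    and "bij T"
  shows "bij T' \<and> (\<exists>C. \<forall>y. norm y \<le> C * norm (T' y))"
proof -
  interpret T: bounded_linear T by fact
  interpret T': bounded_linear T' by fact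
  have "\<exists>C. \<forall>y\<in>{y. norm (T' y) \<le> 1}. norm y \<le> C"
  proof (rule weakly_bounded_imp_bounded)
    fix x
    obtain x' where x': "x = T x'" using \<open>bij T\<close> by (metis bij_pointE)
    have "\<bar>inner y x\<bar> \<le> norm x'" if "norm (T' y) \<le> 1" for y
    proof -
      have "inner y x = inner x' (T' y)" using adj by (simp add: x' inner_commute)
      moreover have "\<bar>inner x' (T' y)\<bar> \<le> norm x' * norm (T' y)" by (rule Cauchy_Schwarz_ineq2)
      moreover have "norm x' * norm (T' y) \<le> norm x' * 1" using that by (intro mult_left_mono) auto
      ultimately show ?thesis by simp
    qed
    then show "\<exists>C. \<forall>y\<in>{y. norm (T' y) \<le> 1}. \<bar>inner y x\<bar> \<le> C" by blast
  qed
  then obtain C where C: "\<And>y. norm (T' y) \<le> 1 \<Longrightarrow> norm y \<le> C" by blast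
  have inj0: "y = 0" if "T' y = 0" for y
  proof -
    obtain x where "T x = y" using \<open>bij T\<close> by (metis bij_pointE)
    then have "inner y y = 0" using adj[of x y] that by simp
    then show ?thesis by simp
  qed
  have bd: "norm y \<le> C * norm (T' y)" for y
  proof (cases "T' y = 0")
    case False
    have "norm ((1 / norm (T' y)) *\<^sub>R y) \<le> C" using False by (intro C) (simp add: T'.scaleR)
    then show ?thesis using False by (simp add: field_simps)
  qed (simp add: inj0)
  have "inj T'" using inj0 linear_injective_0[OF T'.linear_axioms] by blast
  moreover have "range T' = UNIV"
  proof (rule closed_subspace_eq_UNIV)
    show "subspace (range T')" by (metis T'.linear_axioms linear_subspace_image subspace_UNIV)
    have "1 / (\<bar>C\<bar> + 1) * norm y \<le> norm (T' y)" for y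
    proof -
      have "norm y \<le> (\<bar>C\<bar> + 1) * norm (T' y)" by (rule order_trans[OF bd]) (intro mult_right_mono, auto)
      then show ?thesis by (simp add: field_simps)
    qed
    then show "closed (range T')"
      by (intro complete_imp_closed complete_isometric_image[of "1 / (\<bar>C\<bar> + 1)"] assms(2) complete_UNIV subspace_UNIV) auto
    fix y assume y: "\<And>m. m \<in> range T' \<Longrightarrow> inner y m = 0"
    then have "inner (T y) (T y) = 0" using adj[of y "T y"] by simp
    then have "T y = T 0" by (simp add: T.zero)
    then show "y = 0" using \<open>bij T\<close> by (meson bij_is_inj injD)
  qed
  ultimately show ?thesis using bd by (auto simp: bij_def)
qed

text \<open>Here \<open>J\<close> plays the role of the embeddings $X\subset H\subset X^*$, all three spaces being
  identified with one Hilbert space, and \<open>S\<close> that of a symmetric operator from $X$ to $X^*$.\<close>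

locale symmetric_form =
  fixes S J :: "'a::complex_hilbert \<Rightarrow> 'a"
  assumes S: "bounded_linear S" "\<And>c x. S (c *\<^sub>C x) = c *\<^sub>C S x" "\<And>x y. inner (S x) y = inner x (S y)"
    and J: "bounded_linear J" "\<And>c x. J (c *\<^sub>C x) = c *\<^sub>C J x" "\<And>x y. inner (J x) y = inner x (J y)"
      "inj J"
    and bij: "bij (\<lambda>x. S x + \<i> *\<^sub>C J (J x))"
begin

sublocale S: bounded_linear S by (rule S)
sublocale J: bounded_linear J by (rule J)

definition graph :: "('a \<times> 'a) set" where "graph = {(J x, h) | x h. S x = J h}"

definition T where "T x = S x + \<i> *\<^sub>C J (J x)"
definition T' where "T' x = S x - \<i> *\<^sub>C J (J x)"

lemma bounded_linear_T: "bounded_linear T" "bounded_linear T'"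
proof -
  have "bounded_linear (\<lambda>x. \<i> *\<^sub>C J (J x))"
    by (intro bounded_linear_compose[OF bounded_linear_scaleC_right] bounded_linear_compose[OF J(1)] J(1))
  then show "bounded_linear T" "bounded_linear T'" unfolding T_def T'_def by (auto intro: bounded_linear_add bounded_linear_sub S(1))
qed

lemma T_adjoint: "inner (T x) y = inner x (T' y)" by (simp add: T_def T'_def inner_add_left inner_diff_right S(3) J(3) inner_scaleC_left J(2)
      scaleC_minus_left J.neg)

text \<open>The lower bound for \<open>T\<close> is obtained from the fact that \<open>T\<close> is
  the adjoint of the bijection \<open>T'\<close>.\<close>

lemma bij_T: "bij T" "bij T'" "\<exists>C. \<forall>x. norm x \<le> C * norm (T x)"
proof -
  show T: "bij T" using bij by (simp add: T_def[abs_def])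
  then show T': "bij T'" using bijective_adjoint[OF bounded_linear_T T_adjoint] by blast
  show "\<exists>C. \<forall>x. norm x \<le> C * norm (T x)"
    using bijective_adjoint[OF bounded_linear_T(2,1) _ T'] by (metis T_adjoint inner_commute)
qed

lemma graph_symmetric:
  assumes "(v, w) \<in> graph" "(u, h) \<in> graph"
  shows "inner v h = inner w u" using assms unfolding graph_def by clarsimp (metis S(3) J(3))

text \<open>Let A be the operator with this graph and let \<open>(v, w)\<close> satisfy the adjoint
  relation. Since A - \<i> is onto, some J x in its domain is mapped to w - \<i> v by A - \<i>. Then
  d = v - J x satisfies the adjoint relation together with \<i> d, and testing this against the
  solution of (A + \<i>) J y = d leaves |d|^2 = 0.\<close>

lemma self_adjoint_graph: "self_adjoint_rel graph" unfolding self_adjoint_rel_def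
proof (intro conjI allI impI iffI)
  fix c u h assume "(u, h) \<in> graph"
  then show "(c *\<^sub>C u, c *\<^sub>C h) \<in> graph" unfolding graph_def by clarsimp (metis S(2) J(2))
next
  fix v w u h assume "(v, w) \<in> graph" "(u, h) \<in> graph"
  then show "inner v h = inner w u" by (rule graph_symmetric)
next
  fix v w assume vw: "\<forall>u h. (u, h) \<in> graph \<longrightarrow> inner v h = inner w u"
  obtain x where x: "T' x = J (w - \<i> *\<^sub>C v)" using bij_T(2) by (metis bij_pointE)
  define w' where "w' = w - \<i> *\<^sub>C v + \<i> *\<^sub>C J x"
  have g: "(J x, w') \<in> graph"
  proof -
    have "S x = J w'" using x by (simp add: T'_def w'_def J.add J.diff J(2) algebra_simps)
    then show ?thesis unfolding graph_def by blast
  qed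
  define d where "d = v - J x"
  have wd: "w - w' = \<i> *\<^sub>C d" by (simp add: w'_def d_def scaleC_diff_right)
  obtain y where y: "T y = J d" using bij_T(1) by (metis bij_pointE)
  define h where "h = d - \<i> *\<^sub>C J y"
  have gy: "(J y, h) \<in> graph"
  proof -
    have "S y = J h" using y by (simp add: T_def h_def J.diff J(2) algebra_simps)
    then show ?thesis unfolding graph_def by blast
  qed
  have "inner v h = inner w (J y)" using vw gy by blast
  then have "inner d h = inner (w - w') (J y)" using graph_symmetric[OF g gy] by (simp add: d_def inner_diff_left)
  then have "inner d h = inner (\<i> *\<^sub>C d) (J y)" by (simp only: wd)
  moreover have "inner d h = inner d d - inner d (\<i> *\<^sub>C J y)" by (simp add: h_def inner_diff_right)
  moreover have "inner (\<i> *\<^sub>C d) (J y) = - inner d (\<i> *\<^sub>C J y)" by (simp add: inner_scaleC_left scaleC_minus_left)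
  ultimately have "d = 0" by simp
  then have "v = J x" "w = w'" using wd by (auto simp: d_def scaleC_zero_right)
  then show "(v, w) \<in> graph" using g by simp
qed

text \<open>A vector \<open>v\<close> orthogonal to the domain equals (A + \<i>) J x for some
  \<open>x\<close>. Pairing with \<i> J x annihilates both \<open>v\<close> and A J x, so that J x =
  0; injectivity of \<open>J\<close> gives x = 0 and then v = 0.\<close>

lemma graph_dense:
  shows "closure (fst ` graph) = UNIV"
proof (rule closed_subspace_eq_UNIV)
  have "subspace (fst ` graph)" unfolding subspace_def
  proof (intro conjI ballI allI)
    show "0 \<in> fst ` graph" using self_adjoint_rel_zero[OF self_adjoint_graph] by force
    fix x y assume "x \<in> fst ` graph" "y \<in> fst ` graph"
    then obtain h k where "(x, h) \<in> graph" "(y, k) \<in> graph" by auto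
    from self_adjoint_rel_add[OF self_adjoint_graph this] show "x + y \<in> fst ` graph" by (metis fst_conv image_eqI)
  next
    fix x c assume "x \<in> fst ` graph"
    then obtain h where "(x, h) \<in> graph" by auto
    from self_adjoint_rel_scaleR[OF self_adjoint_graph this, of c] show "c *\<^sub>R x \<in> fst ` graph" by (metis fst_conv image_eqI)
  qed
  then show "subspace (closure (fst ` graph))" by (rule subspace_closure)
  fix v assume "\<And>m. m \<in> closure (fst ` graph) \<Longrightarrow> inner v m = 0"
  then have v: "inner v u = 0" if "(u, h) \<in> graph" for u h using that closure_subset[of "fst ` graph"] by (metis fst_conv image_eqI subsetD)
  obtain x where x: "T x = J v" using bij_T(1) by (metis bij_pointE)
  define h where "h = v - \<i> *\<^sub>C J x"
  have g: "(J x, h) \<in> graph"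
  proof -
    have "S x = J h" using x by (simp add: T_def h_def J.diff J(2) algebra_simps)
    then show ?thesis unfolding graph_def by blast
  qed
  have "inner (\<i> *\<^sub>C J x) h = inner (\<i> *\<^sub>C h) (J x)"
    by (rule graph_symmetric[OF self_adjoint_rel_scaleC[OF self_adjoint_graph g] g])
  also have "\<dots> = - inner (\<i> *\<^sub>C J x) h" by (subst inner_scaleC_left) (simp add: scaleC_minus_left inner_commute)
  finally have "inner (\<i> *\<^sub>C J x) h = 0" by simp
  moreover have "inner (\<i> *\<^sub>C J x) v = 0"
    using v[OF self_adjoint_rel_scaleC[OF self_adjoint_graph g, of \<i>]] by (simp add: inner_commute)
  ultimately have "inner (\<i> *\<^sub>C J x) (\<i> *\<^sub>C J x) = 0" by (simp add: h_def inner_diff_right)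
  then have "norm (\<i> *\<^sub>C J x) = 0" by simp
  then have "J x = 0" by (simp only: norm_scaleC) simp
  then have "x = 0" using J(4) by (metis J.zero injD)
  then have "J v = 0" using x by (simp add: T_def S.zero J.zero scaleC_zero_right)
  then show "v = 0" using J(4) by (metis J.zero injD)
qed simp

end

section \<open>Smooth functions with growth conditions\<close>

lemma partial_derivs_Nil: "partial_derivs [] f = f"
  and partial_derivs_Cons: "partial_derivs (k # ks) f = partial_deriv k (partial_derivs ks f)"
  and partial_derivs_snoc: "partial_derivs (ks @ [k]) f = partial_derivs ks (partial_deriv k f)" by (simp_all add: partial_derivs_def)

lemma partial_deriv_eq: "(f has_derivative f') (at x) \<Longrightarrow> partial_deriv k f x = f' (axis k 1)"
  unfolding partial_deriv_def by (metis frechet_derivative_at)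

text \<open>With \<open>rapid\<close> or \<open>moderate\<close> for \<open>Q\<close> this covers
  Schwartz functions and their smooth multipliers, so that the closure properties are proved once
  for both.\<close>

definition smooth_with :: "((real^'n::finite \<Rightarrow> complex) \<Rightarrow> bool) \<Rightarrow> (real^'n \<Rightarrow> complex) \<Rightarrow> bool" where
  "smooth_with Q f \<longleftrightarrow>
     (\<forall>ks. (\<forall>x. partial_derivs ks f differentiable (at x)) \<and> Q (partial_derivs ks f))"

lemma smooth_withD:
  assumes "smooth_with Q f"
  shows "f differentiable (at x)" "Q f" "smooth_with Q (partial_deriv k f)" using assms unfolding smooth_with_def
  by (metis partial_derivs_Nil partial_derivs_snoc)+

lemma smooth_with_mono: "smooth_with Q f \<Longrightarrow> (\<And>f. Q f \<Longrightarrow> Q' f) \<Longrightarrow> smooth_with Q' f"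
  unfolding smooth_with_def by blast

lemma smooth_with_coinduct:
  assumes "f \<in> B"
    and "\<And>f x. f \<in> B \<Longrightarrow> f differentiable (at x)" "\<And>f. f \<in> B \<Longrightarrow> Q f"
    and "\<And>f k. f \<in> B \<Longrightarrow> partial_deriv k f \<in> B"
  shows "smooth_with Q f"
proof -
  have "partial_derivs ks f \<in> B" for ks by (induction ks) (simp_all add: partial_derivs_Nil partial_derivs_Cons assms)
  then show ?thesis unfolding smooth_with_def using assms by blast
qed

text \<open>The Leibniz rule turns a product into a sum of products. Closing a set of generators
  under linear combinations yields a class that partial derivatives preserve.\<close>

inductive lincomb :: "(real^'n::finite \<Rightarrow> complex) set \<Rightarrow> (real^'n \<Rightarrow> complex) \<Rightarrow> bool" for B where
  base: "f \<in> B \<Longrightarrow> lincomb B f"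
| add: "lincomb B f \<Longrightarrow> lincomb B g \<Longrightarrow> lincomb B (\<lambda>x. f x + g x)"
| scale: "lincomb B f \<Longrightarrow> lincomb B (\<lambda>x. c * f x)"

lemma partial_deriv_add:
  assumes "\<And>x. f differentiable (at x)" "\<And>x. g differentiable (at x)"
  shows "partial_deriv k (\<lambda>x. f x + g x) = (\<lambda>x. partial_deriv k f x + partial_deriv k g x)"
proof
  fix x
  have "(f has_derivative frechet_derivative f (at x)) (at x)" "(g has_derivative frechet_derivative g (at x)) (at x)"
    using assms frechet_derivative_works by blast+
  from has_derivative_add[OF this] show "partial_deriv k (\<lambda>x. f x + g x) x = partial_deriv k f x + partial_deriv k g x"
    by (subst partial_deriv_eq) (auto simp: partial_deriv_def)
qed

lemma partial_deriv_mult: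
  assumes "\<And>x. f differentiable (at x)" "\<And>x. g differentiable (at x)"
  shows "partial_deriv k (\<lambda>x. f x * g x) = (\<lambda>x. partial_deriv k f x * g x + f x * partial_deriv k g x)"
proof
  fix x
  have "(f has_derivative frechet_derivative f (at x)) (at x)" "(g has_derivative frechet_derivative g (at x)) (at x)"
    using assms frechet_derivative_works by blast+
  from has_derivative_mult[OF this]
  have "((\<lambda>x. f x * g x) has_derivative (\<lambda>h. f x * frechet_derivative g (at x) h +
           frechet_derivative f (at x) h * g x)) (at x)" .
  then show "partial_deriv k (\<lambda>x. f x * g x) x = partial_deriv k f x * g x + f x * partial_deriv k g x"
    by (subst partial_deriv_eq, assumption) (simp add: partial_deriv_def)
qed

lemma partial_deriv_const: "partial_deriv k (\<lambda>x. c) = (\<lambda>x. 0)"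
  by (rule ext) (subst partial_deriv_eq[OF has_derivative_const], rule refl)

lemma partial_deriv_cmult:
  assumes "\<And>x. f differentiable (at x)"
  shows "partial_deriv k (\<lambda>x. c * f x) = (\<lambda>x. c * partial_deriv k f x)"
  using partial_deriv_mult[OF _ assms, of "\<lambda>_. c" k] by (simp add: partial_deriv_const)

lemma partial_deriv_cnj:
  assumes "\<And>x. f differentiable (at x)"
  shows "partial_deriv k (\<lambda>x. cnj (f x)) = (\<lambda>x. cnj (partial_deriv k f x))"
proof
  fix x
  have "(f has_derivative frechet_derivative f (at x)) (at x)" using assms frechet_derivative_works by blast
  from bounded_linear.has_derivative[OF bounded_linear_cnj this]
  show "partial_deriv k (\<lambda>x. cnj (f x)) x = cnj (partial_deriv k f x)" by (subst partial_deriv_eq) (auto simp: partial_deriv_def)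
qed

lemma smooth_with_lincomb:
  fixes B :: "(real^'n::finite \<Rightarrow> complex) set"
  assumes f: "lincomb B f"
    and B: "\<And>f x. f \<in> B \<Longrightarrow> f differentiable (at x)" "\<And>f. f \<in> B \<Longrightarrow> Q f"
      "\<And>f k. f \<in> B \<Longrightarrow> lincomb B (partial_deriv k f)"
    and Q: "\<And>f g. Q f \<Longrightarrow> Q g \<Longrightarrow> Q (\<lambda>x. f x + g x)" "\<And>f c. Q f \<Longrightarrow> Q (\<lambda>x. c * f x)"
  shows "smooth_with Q f"
proof (rule smooth_with_coinduct[of f "Collect (lincomb B)"])
  have *: "(\<forall>x. f differentiable (at x)) \<and> Q f \<and> (\<forall>k. lincomb B (partial_deriv k f))"
    if "lincomb B f" for f using that
  proof (induction rule: lincomb.induct)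
    case (base f)
    then show ?case using B by blast
  next
    case (add f g)
    then show ?case using Q(1)[of f g] by (auto simp: partial_deriv_add intro: lincomb.add)
  next
    case (scale f c)
    then show ?case using Q(2)[of f c] by (auto simp: partial_deriv_cmult intro: lincomb.scale)
  qed
  fix f assume "f \<in> Collect (lincomb B)"
  with * show "f differentiable (at x)" "Q f" "partial_deriv k f \<in> Collect (lincomb B)" for x k by blast+
qed (use f in simp)

section \<open>Rapid decrease and polynomial growth\<close>

definition rapid :: "(real^'n::finite \<Rightarrow> complex) \<Rightarrow> bool" where
  "rapid f \<longleftrightarrow> (\<forall>N. \<exists>C. \<forall>x. (1 + norm x) ^ N * norm (f x) \<le> C)"

definition moderate :: "(real^'n::finite \<Rightarrow> complex) \<Rightarrow> bool" where
  "moderate f \<longleftrightarrow> (\<exists>N C. \<forall>x. norm (f x) \<le> C * (1 + norm x) ^ N)"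

lemma schwartz_iff: "schwartz f \<longleftrightarrow> smooth_with rapid f" unfolding schwartz_def smooth_with_def rapid_def by auto

lemma rapidI_nonneg:
  assumes "rapid f" obtains C where "C \<ge> 0" "\<And>x. (1 + norm x) ^ N * norm (f x) \<le> C"
proof -
  obtain C where C: "\<And>x. (1 + norm x) ^ N * norm (f x) \<le> C" using assms unfolding rapid_def by blast
  have "0 \<le> (1 + norm (0::real^'a)) ^ N * norm (f 0)" by simp
  then have "C \<ge> 0" using C order_trans by blast
  with C that show ?thesis by blast
qed

lemma moderateE:
  assumes "moderate f" shows "\<exists>C N. C \<ge> 0 \<and> (\<forall>x. norm (f x) \<le> C * (1 + norm x) ^ N)"
proof -
  obtain N C where C: "\<And>x. norm (f x) \<le> C * (1 + norm x) ^ N" using assms unfolding moderate_def by blast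
  have "0 \<le> norm (f 0)" by simp
  also have "\<dots> \<le> C" using C[of 0] by simp
  finally show ?thesis using C by blast
qed

lemma rapid_add: "rapid f \<Longrightarrow> rapid g \<Longrightarrow> rapid (\<lambda>x. f x + g x)" unfolding rapid_def
proof
  fix N
  assume "\<forall>N. \<exists>C. \<forall>x. (1 + norm x) ^ N * cmod (f x) \<le> C" "\<forall>N. \<exists>C. \<forall>x. (1 + norm x) ^ N * cmod (g x) \<le> C"
  then obtain C D where CD: "\<And>x. (1 + norm x) ^ N * cmod (f x) \<le> C" "\<And>x. (1 + norm x) ^ N * cmod (g x) \<le> D" by metis
  have "(1 + norm x) ^ N * cmod (f x + g x) \<le> C + D" for x
  proof -
    have "(1 + norm x) ^ N * cmod (f x + g x) \<le> (1 + norm x) ^ N * (cmod (f x) + cmod (g x))"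
      by (intro mult_left_mono norm_triangle_ineq) simp
    also have "\<dots> \<le> C + D" using CD[of x] by (simp add: distrib_left)
    finally show ?thesis .
  qed
  then show "\<exists>C. \<forall>x. (1 + norm x) ^ N * cmod (f x + g x) \<le> C" by blast
qed

lemma moderate_mono:
  assumes "C \<ge> 0" "norm (f x) \<le> C * (1 + norm x) ^ N" "N \<le> M"
  shows "norm (f x) \<le> C * (1 + norm (x::real^'n::finite)) ^ M"
proof -
  have "C * (1 + norm x) ^ N \<le> C * (1 + norm x) ^ M" using assms by (intro mult_left_mono power_increasing) auto
  with assms(2) show ?thesis by linarith
qed

lemma moderate_add:
  assumes "moderate f" "moderate g" shows "moderate (\<lambda>x. f x + g x)"
proof -
  obtain C N where C: "C \<ge> 0" "\<And>x. norm (f x) \<le> C * (1 + norm x) ^ N" using moderateE[OF assms(1)] by blast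
  obtain D M where D: "D \<ge> 0" "\<And>x. norm (g x) \<le> D * (1 + norm x) ^ M" using moderateE[OF assms(2)] by blast
  have "norm (f x + g x) \<le> (C + D) * (1 + norm x) ^ (max N M)" for x using moderate_mono[of C f x N, OF C(1) C(2)[of x], of "max N M"]
      moderate_mono[of D g x M, OF D(1) D(2)[of x], of "max N M"]
      norm_triangle_ineq[of "f x" "g x"] by (simp add: distrib_right)
  then show ?thesis unfolding moderate_def by blast
qed

lemma moderate_mult:
  assumes "moderate f" "moderate g" shows "moderate (\<lambda>x. f x * g x)"
proof -
  obtain C N where C: "C \<ge> 0" "\<And>x. norm (f x) \<le> C * (1 + norm x) ^ N" using moderateE[OF assms(1)] by blast
  obtain D M where D: "D \<ge> 0" "\<And>x. norm (g x) \<le> D * (1 + norm x) ^ M" using moderateE[OF assms(2)] by blast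
  have "norm (f x * g x) \<le> (C * D) * (1 + norm x) ^ (N + M)" for x
  proof -
    have "norm (f x) * norm (g x) \<le> (C * (1 + norm x) ^ N) * (D * (1 + norm x) ^ M)" using C D by (intro mult_mono) auto
    then show ?thesis by (simp add: norm_mult power_add mult_ac)
  qed
  then show ?thesis unfolding moderate_def by blast
qed

lemma bounded_imp_moderate: "(\<And>x. norm (f x) \<le> C) \<Longrightarrow> moderate f"
  unfolding moderate_def by (intro exI[of _ 0] exI[of _ C]) simp

lemma rapid_imp_moderate: "rapid f \<Longrightarrow> moderate f" unfolding rapid_def by (drule spec[of _ 0]) (auto intro: bounded_imp_moderate)

lemma moderate_const: "moderate (\<lambda>x. c)" by (rule bounded_imp_moderate[of _ "cmod c"]) simp

lemma rapid_moderate_mult: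
  assumes "moderate g" "rapid f" shows "rapid (\<lambda>x. g x * f x)" unfolding rapid_def
proof
  fix N
  obtain C M where C: "C \<ge> 0" "\<And>x. norm (g x) \<le> C * (1 + norm x) ^ M" using moderateE[OF assms(1)] by blast
  obtain D where D: "D \<ge> 0" "\<And>x. (1 + norm x) ^ (N + M) * norm (f x) \<le> D" using rapidI_nonneg[OF assms(2), of "N + M"] by blast
  have "(1 + norm x) ^ N * norm (g x * f x) \<le> C * D" for x
  proof -
    have "(1 + norm x) ^ N * norm (g x * f x) \<le> (1 + norm x) ^ N * ((C * (1 + norm x) ^ M) * norm (f x))"
      unfolding norm_mult using C by (intro mult_left_mono mult_right_mono) auto
    also have "\<dots> = C * ((1 + norm x) ^ (N + M) * norm (f x))" by (simp add: power_add)
    also have "\<dots> \<le> C * D" using C D by (intro mult_left_mono)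
    finally show ?thesis .
  qed
  then show "\<exists>C. \<forall>x. (1 + norm x) ^ N * norm (g x * f x) \<le> C" by blast
qed

lemma rapid_cmult: "rapid f \<Longrightarrow> rapid (\<lambda>x. c * f x)" by (rule rapid_moderate_mult[OF moderate_const])

lemma moderate_cmult: "moderate f \<Longrightarrow> moderate (\<lambda>x. c * f x)" by (rule moderate_mult[OF moderate_const])

abbreviation smooth_moderate :: "(real^'n::finite \<Rightarrow> complex) \<Rightarrow> bool" where
  "smooth_moderate \<equiv> smooth_with moderate"

lemma schwartz_imp_smooth_moderate: "schwartz f \<Longrightarrow> smooth_moderate f"
  unfolding schwartz_iff by (erule smooth_with_mono) (rule rapid_imp_moderate)

lemma smooth_with_product:
  assumes g: "smooth_with Q1 g" and f: "smooth_with Q2 f"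
    and Q12: "\<And>g f. Q1 g \<Longrightarrow> Q2 f \<Longrightarrow> Q (\<lambda>x. g x * f x)"
    and Q: "\<And>f g. Q f \<Longrightarrow> Q g \<Longrightarrow> Q (\<lambda>x. f x + g x)" "\<And>f c. Q f \<Longrightarrow> Q (\<lambda>x. c * f x)"
  shows "smooth_with Q (\<lambda>x. g x * f x)"
proof (rule smooth_with_lincomb[of "{\<lambda>x. g x * f x | g f. smooth_with Q1 g \<and> smooth_with Q2 f}"])
  show "lincomb {\<lambda>x. g x * f x | g f. smooth_with Q1 g \<and> smooth_with Q2 f} (\<lambda>x. g x * f x)"
    using f g by (intro lincomb.base) blast
next
  fix h assume "h \<in> {\<lambda>x. g x * f x | g f. smooth_with Q1 g \<and> smooth_with Q2 f}"
  then obtain g f where h: "h = (\<lambda>x. g x * f x)" "smooth_with Q1 g" "smooth_with Q2 f" by blast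
  note g = smooth_withD[OF h(2)] and f = smooth_withD[OF h(3)]
  show "h differentiable (at x)" for x unfolding h using f g by (intro differentiable_mult)
  show "Q h" unfolding h using f g by (intro Q12)
  show "lincomb {\<lambda>x. g x * f x | g f. smooth_with Q1 g \<and> smooth_with Q2 f} (partial_deriv k h)" for k
    unfolding h partial_deriv_mult[OF g(1) f(1)] using g(3)[of k] f(3)[of k] h(2,3) by (intro lincomb.add lincomb.base) blast+
qed (use Q in blast)+

lemma schwartz_smooth_mult: "smooth_moderate g \<Longrightarrow> schwartz f \<Longrightarrow> schwartz (\<lambda>x. g x * f x)"
  unfolding schwartz_iff by (erule (1) smooth_with_product) (auto intro: rapid_moderate_mult rapid_add rapid_cmult)

lemma schwartz_mult': "schwartz g \<Longrightarrow> schwartz f \<Longrightarrow> schwartz (\<lambda>x. g x * f x)"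
  by (intro schwartz_smooth_mult schwartz_imp_smooth_moderate)

lemma smooth_moderate_mult: "smooth_moderate g \<Longrightarrow> smooth_moderate f \<Longrightarrow> smooth_moderate (\<lambda>x. g x * f x)"
  by (erule (1) smooth_with_product) (auto intro: moderate_mult moderate_add moderate_cmult)

lemma smooth_with_add:
  assumes "smooth_with Q f" "smooth_with Q g"
    and Q: "\<And>f g. Q f \<Longrightarrow> Q g \<Longrightarrow> Q (\<lambda>x. f x + g x)" "\<And>f c. Q f \<Longrightarrow> Q (\<lambda>x. c * f x)"
  shows "smooth_with Q (\<lambda>x. f x + g x)"
proof (rule smooth_with_lincomb[of "Collect (smooth_with Q)"])
  show "lincomb (Collect (smooth_with Q)) (\<lambda>x. f x + g x)" using assms by (intro lincomb.add lincomb.base) auto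
qed (use Q in \<open>auto intro: lincomb.base smooth_withD\<close>)

lemma schwartz_add: "schwartz f \<Longrightarrow> schwartz g \<Longrightarrow> schwartz (\<lambda>x. f x + g x)"
  unfolding schwartz_iff by (erule (1) smooth_with_add) (auto intro: rapid_add rapid_cmult)

lemma smooth_moderate_add: "smooth_moderate f \<Longrightarrow> smooth_moderate g \<Longrightarrow> smooth_moderate (\<lambda>x. f x + g x)"
  by (erule (1) smooth_with_add) (auto intro: moderate_add moderate_cmult)

lemma smooth_moderate_const: "smooth_moderate (\<lambda>x. c)" by (rule smooth_with_coinduct[of _ "range (\<lambda>c x. c)"])
    (auto simp: partial_deriv_const moderate_const)

lemma schwartz_cmult: "schwartz f \<Longrightarrow> schwartz (\<lambda>x. c * f x)" by (rule schwartz_smooth_mult[OF smooth_moderate_const])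

lemma smooth_moderate_prod:
  "finite I \<Longrightarrow> (\<And>i. i \<in> I \<Longrightarrow> smooth_moderate (f i)) \<Longrightarrow> smooth_moderate (\<lambda>x. \<Prod>i\<in>I. f i x)"
  by (induction I rule: finite_induct) (auto intro: smooth_moderate_const smooth_moderate_mult)

section \<open>Coordinates, characters, bump functions and cutoffs\<close>

lemma has_derivative_coordinate:
  "((\<lambda>x::real^'n::finite. complex_of_real (x $ k)) has_derivative (\<lambda>h. complex_of_real (h $ k))) (at x)"
  by (intro has_derivative_of_real bounded_linear.has_derivative[OF bounded_linear_vec_nth] has_derivative_ident)

lemma partial_deriv_coordinate:
  "partial_deriv j (\<lambda>x::real^'n::finite. complex_of_real (x $ k)) = (\<lambda>x. if j = k then 1 else 0)"
  by (rule ext, subst partial_deriv_eq[OF has_derivative_coordinate]) (auto simp: axis_def)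

lemma smooth_moderate_coordinate: "smooth_moderate (\<lambda>x::real^'n::finite. complex_of_real (x $ k))"
proof (rule smooth_with_coinduct[of _ "insert (\<lambda>x. complex_of_real (x $ k)) (range (\<lambda>c x. c))"])
  fix f assume f: "f \<in> insert (\<lambda>x::real^'n. complex_of_real (x $ k)) (range (\<lambda>c x. c))"
  show "f differentiable (at x)" for x using f has_derivative_coordinate unfolding differentiable_def by (auto intro: has_derivative_const)
  have "norm (complex_of_real (x $ k)) \<le> 1 * (1 + norm x) ^ 1" for x :: "real^'n" using component_le_norm_cart[of x k] by simp
  then have "moderate (\<lambda>x::real^'n. complex_of_real (x $ k))" unfolding moderate_def by blast
  then show "moderate f" using f by (auto simp: moderate_const)
  show "partial_deriv j f \<in> insert (\<lambda>x. complex_of_real (x $ k)) (range (\<lambda>c x. c))" for j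
    using f by (auto simp: partial_deriv_const partial_deriv_coordinate)
qed simp

lemma schwartz_coordinate_mult:
  "schwartz f \<Longrightarrow> schwartz (\<lambda>x::real^'n::finite. complex_of_real (x $ k) * f x)"
  by (rule schwartz_smooth_mult[OF smooth_moderate_coordinate])

lemma schwartz_differentiable: "schwartz f \<Longrightarrow> f differentiable (at x)"
  and schwartz_rapid: "schwartz f \<Longrightarrow> rapid f"
  and schwartz_partial_deriv: "schwartz f \<Longrightarrow> schwartz (partial_deriv k f)" unfolding schwartz_iff by (blast dest: smooth_withD)+

lemma schwartz_continuous: "schwartz f \<Longrightarrow> continuous_on A f"
  by (meson schwartz_differentiable differentiable_imp_continuous_within continuous_at_imp_continuous_on)

lemma schwartz_cnj: "schwartz f \<Longrightarrow> schwartz (\<lambda>x. cnj (f x))" unfolding schwartz_iff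
proof (rule smooth_with_coinduct[of _ "{\<lambda>x. cnj (f x) | f. smooth_with rapid f}"])
  fix g :: "real^'a \<Rightarrow> complex" assume "g \<in> {\<lambda>x. cnj (f x) | f. smooth_with rapid f}"
  then obtain f where g: "g = (\<lambda>x. cnj (f x))" and f: "smooth_with rapid f" by blast
  note f' = smooth_withD[OF f]
  show "g differentiable (at x)" for x unfolding g using f'(1)[of x] bounded_linear.has_derivative[OF bounded_linear_cnj]
    by (metis differentiable_def)
  show "rapid g" using f'(2) unfolding g rapid_def by simp
  show "partial_deriv k g \<in> {\<lambda>x. cnj (f x) | f. smooth_with rapid f}" for k
    unfolding g partial_deriv_cnj[OF f'(1)] using f'(3) by blast
qed blast

lemma has_derivative_character:
  "((\<lambda>x::real^'n::finite. exp (- \<i> * complex_of_real (x \<bullet> \<xi>))) has_derivative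
    (\<lambda>h. - \<i> * complex_of_real (h \<bullet> \<xi>) * exp (- \<i> * complex_of_real (x \<bullet> \<xi>)))) (at x)"
proof -
  have "((\<lambda>x. - \<i> * complex_of_real (x \<bullet> \<xi>)) has_derivative (\<lambda>h. - \<i> * complex_of_real (h \<bullet> \<xi>))) (at x)"
    by (intro has_derivative_mult_right has_derivative_of_real has_derivative_inner_left has_derivative_ident)
  then have "((exp \<circ> (\<lambda>x. - \<i> * complex_of_real (x \<bullet> \<xi>))) has_derivative
      ((\<lambda>y. exp (- \<i> * complex_of_real (x \<bullet> \<xi>)) * y) \<circ> (\<lambda>h. - \<i> * complex_of_real (h \<bullet> \<xi>)))) (at x)"
    using DERIV_exp[of "- \<i> * complex_of_real (x \<bullet> \<xi>)"] by (intro diff_chain_at) (auto simp: has_field_derivative_def)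
  then show ?thesis by (simp add: o_def mult.commute)
qed

lemma partial_deriv_character:
  "partial_deriv k (\<lambda>x::real^'n::finite. exp (- \<i> * complex_of_real (x \<bullet> \<xi>))) =
    (\<lambda>x. - \<i> * complex_of_real (\<xi> $ k) * exp (- \<i> * complex_of_real (x \<bullet> \<xi>)))"
  by (rule ext, subst partial_deriv_eq[OF has_derivative_character]) (simp add: inner_axis' )

lemma norm_character: "cmod (exp (- \<i> * complex_of_real r)) = 1" by (metis mult_minus_left mult_minus_right norm_exp_i_times of_real_minus)

lemma smooth_moderate_character:
  "smooth_moderate (\<lambda>x::real^'n::finite. exp (- \<i> * complex_of_real (x \<bullet> \<xi>)))"
proof (rule smooth_with_lincomb[of "{\<lambda>x. exp (- \<i> * complex_of_real (x \<bullet> \<xi>))}"])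
  show "lincomb {\<lambda>x. exp (- \<i> * complex_of_real (x \<bullet> \<xi>))} (\<lambda>x. exp (- \<i> * complex_of_real (x \<bullet> \<xi>)))"
    by (rule lincomb.base) simp
  fix f assume "f \<in> {\<lambda>x::real^'n. exp (- \<i> * complex_of_real (x \<bullet> \<xi>))}"
  then have f: "f = (\<lambda>x. exp (- \<i> * complex_of_real (x \<bullet> \<xi>)))" by simp
  show "f differentiable (at x)" for x unfolding f differentiable_def using has_derivative_character by blast
  show "moderate f" unfolding f by (rule bounded_imp_moderate[of _ 1]) (simp only: norm_character order_refl)
  show "lincomb {\<lambda>x. exp (- \<i> * complex_of_real (x \<bullet> \<xi>))} (partial_deriv k f)" for k
    unfolding f partial_deriv_character by (intro lincomb.scale lincomb.base) simp
qed (auto intro: moderate_add moderate_cmult)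

lemma schwartz_character_mult:
  "schwartz f \<Longrightarrow> schwartz (\<lambda>x::real^'n::finite. exp (- \<i> * complex_of_real (x \<bullet> \<xi>)) * f x)"
  by (rule schwartz_smooth_mult[OF smooth_moderate_character])

lemma power_le_fact_exp:
  fixes y :: real
  assumes "y \<ge> 0"
  shows "y ^ n \<le> fact n * exp y"
proof -
  have "sum (\<lambda>n. y ^ n /\<^sub>R fact n) {n} \<le> (\<Sum>n. y ^ n /\<^sub>R fact n)"
    using assms exp_converges[of y] by (intro sum_le_suminf) (auto simp: sums_iff)
  then show ?thesis using exp_converges[of y] by (simp add: sums_iff field_simps)
qed

lemma power_times_exp_neg_le:
  fixes t c :: real
  assumes "t > 0" "c > 0"
  shows "(1 / t) ^ n * exp (- c / t) \<le> fact n / c ^ n" using power_le_fact_exp[of "c / t" n] assms by (simp add: exp_minus field_simps)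

text \<open>The derivatives of exp(-c/t), continued by 0 to t \<le> 0, are linear combinations of
  these functions with larger \<open>j\<close>. The parameter \<open>c\<close> will tend to 0 where
  an indicator function is approximated.\<close>

definition bump :: "real \<Rightarrow> nat \<Rightarrow> real \<Rightarrow> real" where
  "bump c j t = (if t > 0 then (1 / t) ^ j * exp (- c / t) else 0)"

lemma bump_nonneg: "bump c j t \<ge> 0" by (simp add: bump_def)

lemma bump_le: "c > 0 \<Longrightarrow> bump c j t \<le> fact j / c ^ j" using power_times_exp_neg_le[of t c j] by (simp add: bump_def)

lemma bump_le_linear:
  assumes "c > 0"
  shows "bump c j t \<le> fact (Suc j) / c ^ Suc j * \<bar>t\<bar>"
proof (cases "t > 0")
  case True
  have "bump c j t = bump c (Suc j) t * t" using True by (simp add: bump_def)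
  also have "\<dots> \<le> fact (Suc j) / c ^ Suc j * t" using True assms by (intro mult_right_mono bump_le) auto
  finally show ?thesis using True by simp
next
  case False
  have "0 \<le> fact (Suc j) / c ^ Suc j * \<bar>t\<bar>" using assms by (intro mult_nonneg_nonneg divide_nonneg_nonneg) auto
  then show ?thesis using False by (simp only: bump_def if_False)
qed

text \<open>Away from 0 this is calculus. At 0 the difference quotient for h > 0 is
  \<open>bump c (Suc j) h\<close>, which is at most a constant times h.\<close>

lemma bump_has_derivative:
  assumes c: "c > 0"
  shows "(bump c j has_real_derivative c * bump c (j + 2) t - j * bump c (j + 1) t) (at t)"
proof (cases t "0 :: real" rule: linorder_cases)
  case less
  have "((\<lambda>t. 0) has_real_derivative 0) (at t)" by simp
  then have "(bump c j has_real_derivative 0) (at t)"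
    by (rule has_field_derivative_transform_within_open[of _ _ _ "{..<0}"]) (use less in \<open>auto simp: bump_def\<close>)
  then show ?thesis using less by (simp add: bump_def)
next
  case greater
  have e: "((\<lambda>t. exp (- c / t)) has_real_derivative c * (1 / t)\<^sup>2 * exp (- c / t)) (at t)"
    using greater by (auto intro!: derivative_eq_intros simp: field_simps power2_eq_square)
  have p: "((\<lambda>t. (1 / t) ^ j) has_real_derivative - j * (1 / t) ^ Suc j) (at t)"
  proof -
    have "((\<lambda>t. 1 / t) has_real_derivative - (1 / t * (1 / t))) (at t)" using greater by (auto intro!: derivative_eq_intros)
    from DERIV_power[OF this, of j] show ?thesis by (rule DERIV_cong) (cases j; simp add: divide_simps; simp add: algebra_simps)
  qed
  have "((\<lambda>t. (1 / t) ^ j * exp (- c / t)) has_real_derivative c * bump c (j + 2) t - j * bump c (j + 1) t) (at t)"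
    by (rule DERIV_cong[OF DERIV_mult[OF p e]]) (use greater in \<open>simp add: bump_def power2_eq_square algebra_simps\<close>)
  then show ?thesis by (rule has_field_derivative_transform_within_open[of _ _ _ "{0<..}"]) (use greater in \<open>auto simp: bump_def\<close>)
next
  case equal
  have "(\<lambda>h. (bump c j (0 + h) - bump c j 0) / h) \<midarrow>0\<rightarrow> 0"
  proof (rule Lim_null_comparison)
    let ?C = "fact (Suc (Suc j)) / c ^ Suc (Suc j)"
    have "norm ((bump c j (0 + h) - bump c j 0) / h) \<le> ?C * \<bar>h\<bar>" for h
    proof (cases "h > 0")
      case True
      then have "(bump c j (0 + h) - bump c j 0) / h = bump c (Suc j) h" by (simp add: bump_def)
      then show ?thesis using bump_le_linear[OF c, of "Suc j" h] bump_nonneg[of c "Suc j" h] by simp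
    next
      case False
      have "0 \<le> ?C * \<bar>h\<bar>" using c by (intro mult_nonneg_nonneg divide_nonneg_nonneg) auto
      moreover have "(bump c j (0 + h) - bump c j 0) / h = 0" using False by (simp add: bump_def)
      ultimately show ?thesis by (simp only: norm_zero)
    qed
    then show "\<forall>\<^sub>F h in at 0. norm ((bump c j (0 + h) - bump c j 0) / h) \<le> ?C * \<bar>h\<bar>" by simp
    have "(\<lambda>h. ?C * \<bar>h\<bar>) \<midarrow>0\<rightarrow> ?C * \<bar>0\<bar>" by (intro tendsto_intros)
    then show "(\<lambda>h::real. ?C * \<bar>h\<bar>) \<midarrow>0\<rightarrow> 0" by simp
  qed
  then show ?thesis using equal by (simp add: DERIV_def bump_def)
qed

lemma has_derivative_bump_coordinate:
  assumes "c > 0"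
  shows "((\<lambda>x::real^'n::finite. complex_of_real (bump c j (s * (x $ k) + a))) has_derivative
    (\<lambda>h. complex_of_real ((c * bump c (j + 2) (s * (x $ k) + a) - j * bump c (j + 1) (s * (x $ k) + a)) * (s * (h $ k))))) (at x)"
proof -
  have "((\<lambda>x::real^'n. s * (x $ k) + a) has_derivative (\<lambda>h. s * (h $ k))) (at x)"
    by (auto intro!: derivative_eq_intros bounded_linear.has_derivative[OF bounded_linear_vec_nth])
  from diff_chain_at[OF this bump_has_derivative[OF assms, of j "s * (x $ k) + a", unfolded has_field_derivative_def]]
  show ?thesis by (intro has_derivative_of_real) (simp add: o_def)
qed

lemma partial_deriv_bump_coordinate:
  assumes "c > 0"
  shows "partial_deriv l (\<lambda>x::real^'n::finite. complex_of_real (bump c j (s * (x $ k) + a))) =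
    (\<lambda>x. complex_of_real (if l = k then s * c else 0) * complex_of_real (bump c (j + 2) (s * (x $ k) + a))
      + complex_of_real (if l = k then - s * j else 0) * complex_of_real (bump c (j + 1) (s * (x $ k) + a)))"
  by (rule ext, subst partial_deriv_eq[OF has_derivative_bump_coordinate[OF assms]]) (auto simp: axis_def algebra_simps)

lemma smooth_moderate_bump_coordinate:
  assumes c: "c > 0"
  shows "smooth_moderate (\<lambda>x::real^'n::finite. complex_of_real (bump c j (s * (x $ k) + a)))"
proof (rule smooth_with_lincomb[of "range (\<lambda>j (x::real^'n). complex_of_real (bump c j (s * (x $ k) + a)))"])
  fix f assume "f \<in> range (\<lambda>j (x::real^'n). complex_of_real (bump c j (s * (x $ k) + a)))"
  then obtain j where f: "f = (\<lambda>x. complex_of_real (bump c j (s * (x $ k) + a)))" by blast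
  show "f differentiable (at x)" for x unfolding f differentiable_def using has_derivative_bump_coordinate[OF c] by blast
  show "moderate f" unfolding f by (rule bounded_imp_moderate[of _ "fact j / c ^ j"]) (use bump_le[OF c] bump_nonneg in simp)
  show "lincomb (range (\<lambda>j (x::real^'n). complex_of_real (bump c j (s * (x $ k) + a)))) (partial_deriv l f)" for l
    unfolding f partial_deriv_bump_coordinate[OF c] by (intro lincomb.add lincomb.scale lincomb.base rangeI)
qed (auto intro: moderate_add moderate_cmult lincomb.base)

lemma partial_deriv_eq_0:
  assumes "closed K" "\<And>x. x \<notin> K \<Longrightarrow> f x = 0" "x \<notin> K"
  shows "partial_deriv k f x = 0"
proof -
  have "((\<lambda>x. 0) has_derivative (\<lambda>h. 0)) (at x)" by (rule has_derivative_const)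
  then have "(f has_derivative (\<lambda>h. 0)) (at x)" by (rule has_derivative_transform_within_open[of _ _ _ _ "- K"]) (use assms in auto)
  then show ?thesis by (simp add: partial_deriv_eq)
qed

text \<open>All derivatives vanish off \<open>K\<close>, and on the bounded set \<open>K\<close>
  polynomial growth is boundedness.\<close>

lemma smooth_compact_support_imp_schwartz:
  fixes f :: "real^'n::finite \<Rightarrow> complex"
  assumes f: "smooth_moderate f" and K: "compact K" "\<And>x. x \<notin> K \<Longrightarrow> f x = 0"
  shows "schwartz f" unfolding schwartz_iff
proof (rule smooth_with_coinduct[of _ "{f. smooth_moderate f \<and> (\<forall>x. x \<notin> K \<longrightarrow> f x = 0)}"])
  fix f :: "real^'n \<Rightarrow> complex" assume "f \<in> {f. smooth_moderate f \<and> (\<forall>x. x \<notin> K \<longrightarrow> f x = 0)}"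
  then have f: "smooth_moderate f" and f0: "\<And>x. x \<notin> K \<Longrightarrow> f x = 0" by auto
  show "f differentiable (at x)" for x using f by (rule smooth_withD)
  have "partial_deriv k f x = 0" if "x \<notin> K" for k x using partial_deriv_eq_0[OF compact_imp_closed[OF K(1)] f0 that] .
  then show "partial_deriv k f \<in> {f. smooth_moderate f \<and> (\<forall>x. x \<notin> K \<longrightarrow> f x = 0)}" for k
    using smooth_withD(3)[OF f] by blast
  obtain B where B: "B > 0" "\<And>x. x \<in> K \<Longrightarrow> norm x \<le> B"
    using compact_imp_bounded[OF K(1)] unfolding bounded_pos by blast
  obtain C M where C: "C \<ge> 0" "\<And>x. norm (f x) \<le> C * (1 + norm x) ^ M" using moderateE[OF smooth_withD(2)[OF f]] by blast
  show "rapid f" unfolding rapid_def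
  proof
    fix N
    have "(1 + norm x) ^ N * norm (f x) \<le> (1 + B) ^ N * (C * (1 + B) ^ M)" for x
    proof (cases "x \<in> K")
      case True
      have "norm (f x) \<le> C * (1 + B) ^ M"
        using C(2)[of x] mult_left_mono[OF power_mono[of "1 + norm x" "1 + B" M] C(1)] B(2)[OF True] by fastforce
      moreover have "(1 + norm x) ^ N \<le> (1 + B) ^ N" using B(2)[OF True] by (intro power_mono) auto
      ultimately show ?thesis using B(1) by (intro mult_mono) auto
    qed (use f0 B C in simp)
    then show "\<exists>C. \<forall>x. (1 + norm x) ^ N * norm (f x) \<le> C" by blast
  qed
qed (use assms in auto)

text \<open>For \<open>c > 0\<close> a smooth function that is nonzero precisely on the open box; it
  tends to the indicator function of the box as \<open>c\<close> decreases to 0.\<close>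

definition box_bump :: "real \<Rightarrow> real^'n::finite \<Rightarrow> real^'n \<Rightarrow> real^'n \<Rightarrow> complex" where
  "box_bump c a b x =
     (\<Prod>k\<in>UNIV. complex_of_real (bump c 0 (x $ k - a $ k)) * complex_of_real (bump c 0 (b $ k - x $ k)))"

lemma smooth_moderate_box_bump_factor:
  "c > 0 \<Longrightarrow> smooth_moderate (\<lambda>x::real^'n::finite. complex_of_real (bump c 0 (x $ k - a)) * complex_of_real (bump c 0 (b - x $ k)))"
  using smooth_moderate_mult[OF smooth_moderate_bump_coordinate[of c 0 1 k "-a"] smooth_moderate_bump_coordinate[of c 0 "-1" k b]] by simp

lemma box_bump_outside: "x \<notin> box a b \<Longrightarrow> box_bump c a b x = 0"
proof -
  assume "x \<notin> box a b"
  then obtain k where "\<not> (a $ k < x $ k \<and> x $ k < b $ k)" unfolding mem_box_cart by blast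
  then show ?thesis unfolding box_bump_def by (intro prod_zero bexI[of _ k]) (auto simp: bump_def)
qed

lemma test_function_box_bump:
  assumes "c > 0" shows "test_function (box_bump c a (b :: real^'n::finite))"
proof -
  have *: "box_bump c a b x = 0" if "x \<notin> cbox a b" for x using that box_subset_cbox by (intro box_bump_outside) blast
  have "smooth_moderate (box_bump c a b)"
    unfolding box_bump_def[abs_def] by (intro smooth_moderate_prod smooth_moderate_box_bump_factor assms) simp
  then have "schwartz (box_bump c a b)" by (rule smooth_compact_support_imp_schwartz[OF _ compact_cbox *])
  then show ?thesis unfolding test_function_def using * compact_cbox by blast
qed

lemma norm_box_bump_le_1: "c \<ge> 0 \<Longrightarrow> norm (box_bump c a b x) \<le> 1"
  unfolding box_bump_def prod_norm[symmetric] norm_mult norm_of_real by (intro prod_le_1 conjI mult_le_one) (auto simp: bump_def)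

lemma box_bump_tendsto_indicator:
  "(\<lambda>n. box_bump (1 / Suc n) a b x) \<longlonglongrightarrow> indicator (box a b) x"
proof (cases "x \<in> box a b")
  case True
  have "(\<lambda>n. bump (1 / Suc n) 0 t) \<longlonglongrightarrow> 1" if "t > 0" for t
  proof -
    have "(\<lambda>n. exp (- (1 / Suc n) / t)) \<longlonglongrightarrow> exp (- 0 / t)"
      by (intro tendsto_intros LIMSEQ_Suc[OF lim_1_over_n]) (use that in simp)
    then show ?thesis using that by (simp add: bump_def)
  qed
  then have "(\<lambda>n. box_bump (1 / Suc n) a b x) \<longlonglongrightarrow> (\<Prod>k\<in>(UNIV::'a set). complex_of_real 1 * complex_of_real 1)"
    unfolding box_bump_def using True by (intro tendsto_prod tendsto_mult tendsto_of_real) (auto simp: mem_box_cart)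
  then show ?thesis using True by simp
qed (simp add: box_bump_outside)

lemma test_function_schwartz_mult: "schwartz \<theta> \<Longrightarrow> test_function \<phi> \<Longrightarrow> test_function (\<lambda>x. \<theta> x * \<phi> x)"
  unfolding test_function_def using schwartz_mult' by auto

text \<open>It equals 1 nowhere, but it is bounded by 1, tends to 1 and has boundedly vanishing
  derivatives as \<open>R\<close> grows, which is what dominated convergence asks for.\<close>

definition cutoff :: "nat \<Rightarrow> real^'n::finite \<Rightarrow> complex" where
  "cutoff R = box_bump 1 (\<chi> k. - real R) (\<chi> k. real R)"

lemma test_function_cutoff: "test_function (cutoff R)" unfolding cutoff_def by (rule test_function_box_bump) simp

lemma norm_cutoff_le_1: "norm (cutoff R x) \<le> 1" unfolding cutoff_def by (rule norm_box_bump_le_1) simp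

lemma bump_shift_tendsto: "(\<lambda>R. bump 1 j (s + real R)) \<longlonglongrightarrow> (if j = 0 then 1 else 0)"
proof -
  have t: "filterlim (\<lambda>R. s + real R) at_top sequentially"
    by (rule filterlim_tendsto_add_at_top[OF tendsto_const filterlim_real_sequentially])
  have "(\<lambda>R. 1 / (s + real R)) \<longlonglongrightarrow> 0"
    by (rule tendsto_divide_0[OF tendsto_const filterlim_at_top_imp_at_infinity[OF t]])
  then have "(\<lambda>R. (1 / (s + real R)) ^ j * exp (- (1 / (s + real R)))) \<longlonglongrightarrow> 0 ^ j * exp (- 0)"
    by (intro tendsto_intros)
  then have "(\<lambda>R. (1 / (s + real R)) ^ j * exp (- 1 / (s + real R))) \<longlonglongrightarrow> (if j = 0 then 1 else 0)"
    by (simp add: power_0_left split: if_splits)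
  moreover have "\<forall>\<^sub>F R in sequentially. s + real R > 0" using t by (simp add: filterlim_at_top_dense)
  then have "\<forall>\<^sub>F R in sequentially. (1 / (s + real R)) ^ j * exp (- 1 / (s + real R)) = bump 1 j (s + real R)"
    by (auto elim!: eventually_mono simp: bump_def)
  ultimately show ?thesis by (rule Lim_transform_eventually)
qed

lemma cutoff_tendsto: "(\<lambda>R. cutoff R x) \<longlonglongrightarrow> 1"
proof -
  have "(\<lambda>R. cutoff R x) \<longlonglongrightarrow> (\<Prod>k\<in>(UNIV::'a set). complex_of_real 1 * complex_of_real 1)"
    unfolding cutoff_def box_bump_def
  proof (intro tendsto_prod tendsto_mult tendsto_of_real)
    fix k :: 'a
    show "(\<lambda>R. bump 1 0 (x $ k - (\<chi> k. - real R) $ k)) \<longlonglongrightarrow> 1" using bump_shift_tendsto[of 0 "x $ k"] by simp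
    show "(\<lambda>R. bump 1 0 ((\<chi> k. real R) $ k - x $ k)) \<longlonglongrightarrow> 1" using bump_shift_tendsto[of 0 "- x $ k"] by simp
  qed
  then show ?thesis by simp
qed

text \<open>Only the factor with index \<open>k\<close> depends on the coordinate with index
  \<open>k\<close>; the others are at most 1. The derivative of \<open>bump 1 0\<close> is
  \<open>bump 1 2\<close>.\<close>

lemma partial_deriv_cutoff:
  fixes x :: "real^'n::finite"
  shows "norm (partial_deriv k (cutoff R) x) \<le> bump 1 2 (x $ k + real R) + bump 1 2 (- x $ k + real R)"
proof -
  define g where "g j x = complex_of_real (bump 1 0 (x $ j - (- real R))) * complex_of_real (bump 1 0 (real R - x $ j))"
    for j and x :: "real^'n"
  have g: "smooth_moderate (g j)" for j unfolding g_def[abs_def] by (rule smooth_moderate_box_bump_factor) simp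
  note gd = smooth_withD(1)[OF g]
  have eq: "g j = (\<lambda>x. complex_of_real (bump 1 0 (1 * (x $ j) + real R)) * complex_of_real (bump 1 0 ((-1) * (x $ j) + real R)))" for j
    by (rule ext) (simp add: g_def algebra_simps)
  have pd: "partial_deriv k (g j) = (\<lambda>x. (if k = j then 1 else 0) * complex_of_real
      (bump 1 2 (x $ j + real R) * bump 1 0 (- x $ j + real R) - bump 1 0 (x $ j + real R) * bump 1 2 (- x $ j + real R)))" for j unfolding eq
      partial_deriv_mult[OF smooth_withD(1)[OF smooth_moderate_bump_coordinate[OF zero_less_one]]
        smooth_withD(1)[OF smooth_moderate_bump_coordinate[OF zero_less_one]]]
      partial_deriv_bump_coordinate[OF zero_less_one] by (rule ext) (simp add: numeral_2_eq_2)
  define p where "p I x = (\<Prod>j\<in>I. g j x)" for I x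
  have p: "smooth_moderate (p I)" for I unfolding p_def[abs_def] by (intro smooth_moderate_prod g) simp
  have p0: "partial_deriv k (p I) = (\<lambda>x. 0)" if "k \<notin> I" for I using finite[of I] that
  proof (induction I rule: finite_induct)
    case empty
    then show ?case by (simp add: p_def[abs_def] partial_deriv_const)
  next
    case (insert j I)
    have "p (insert j I) = (\<lambda>x. g j x * p I x)" using insert by (auto simp: p_def)
    then show ?case using insert by (simp add: partial_deriv_mult[OF gd smooth_withD(1)[OF p]] pd)
  qed
  have c: "cutoff R = (\<lambda>x. g k x * p (UNIV - {k}) x)" unfolding cutoff_def box_bump_def p_def
    by (rule ext, subst prod.remove[of _ k]) (auto simp: g_def)
  have d: "partial_deriv k (cutoff R) x = partial_deriv k (g k) x * p (UNIV - {k}) x"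
    unfolding c by (simp add: partial_deriv_mult[OF gd smooth_withD(1)[OF p]] p0)
  have b1: "\<bar>bump 1 0 t\<bar> \<le> 1" for t by (simp add: bump_def)
  have "norm (p (UNIV - {k}) x) \<le> 1"
    unfolding p_def g_def prod_norm[symmetric] norm_mult using b1 by (intro prod_le_1) (auto intro!: mult_le_one)
  moreover have "norm (partial_deriv k (g k) x) \<le> bump 1 2 (x $ k + real R) + bump 1 2 (- x $ k + real R)"
  proof -
    have *: "\<bar>u * v' - v * u'\<bar> \<le> u + u'" if "u \<ge> 0" "u' \<ge> 0" "\<bar>v\<bar> \<le> 1" "\<bar>v'\<bar> \<le> 1" for u v u' v' :: real
    proof -
      have "\<bar>u * v'\<bar> \<le> u * 1" "\<bar>v * u'\<bar> \<le> 1 * u'" unfolding abs_mult using that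
        by (metis abs_of_nonneg mult_left_mono, metis abs_of_nonneg mult_right_mono)
      then show ?thesis by linarith
    qed
    show ?thesis unfolding pd using *[OF bump_nonneg bump_nonneg b1 b1] by (simp del: of_real_diff of_real_mult)
  qed
  ultimately have "norm (partial_deriv k (cutoff R) x) \<le> (bump 1 2 (x $ k + real R) + bump 1 2 (- x $ k + real R)) * 1"
    unfolding d norm_mult by (intro mult_mono) (auto simp: bump_nonneg)
  then show ?thesis by simp
qed

lemma partial_deriv_cutoff_bound: "norm (partial_deriv k (cutoff R) x) \<le> 4"
proof -
  have "bump 1 2 t \<le> 2" for t using bump_le[of 1 2 t] by (simp add: fact_2)
  from this[of "x $ k + real R"] this[of "- x $ k + real R"] show ?thesis using partial_deriv_cutoff[of k R x] by linarith
qed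

lemma partial_deriv_cutoff_tendsto: "(\<lambda>R. partial_deriv k (cutoff R) x) \<longlonglongrightarrow> 0"
proof (rule Lim_null_comparison[OF always_eventually])
  show "\<forall>R. norm (partial_deriv k (cutoff R) x) \<le> bump 1 2 (x $ k + real R) + bump 1 2 (- x $ k + real R)"
    using partial_deriv_cutoff by blast
  show "(\<lambda>R. bump 1 2 (x $ k + real R) + bump 1 2 (- x $ k + real R)) \<longlonglongrightarrow> 0"
    using tendsto_add[OF bump_shift_tendsto[of 2 "x $ k"] bump_shift_tendsto[of 2 "- x $ k"]] by simp
qed

section \<open>The Fourier transform of Schwartz functions\<close>

lemma one_plus_norm_power_pos: "0 < (1 + norm (x::'a::real_normed_vector)) ^ n" by (intro zero_less_power add_pos_nonneg) auto

text \<open>The exponent leaves one factor (1 + |x|)^2 for each coordinate, and this factor is at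
  least 1 + (x \<bullet> b)^2. A product of integrable functions of one variable is thus a
  majorant.\<close>

lemma integrable_inverse_power_norm:
  "integrable lborel (\<lambda>x::'a::euclidean_space. 1 / (1 + norm x) ^ (2 * DIM('a)))"
proof (rule integrableI_bounded)
  have le: "1 / (1 + norm x) ^ (2 * DIM('a)) \<le> (\<Prod>b\<in>Basis. 1 / (1 + (x \<bullet> b)\<^sup>2))" for x :: 'a
  proof -
    have "(\<Prod>b\<in>(Basis::'a set). 1 / (1 + norm x)\<^sup>2) \<le> (\<Prod>b\<in>Basis. 1 / (1 + (x \<bullet> b)\<^sup>2))"
    proof (intro prod_mono conjI)
      fix b :: 'a assume "b \<in> Basis"
      then have "\<bar>x \<bullet> b\<bar>\<^sup>2 \<le> (norm x)\<^sup>2" by (intro power_mono Basis_le_norm) auto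
      then have "1 + (x \<bullet> b)\<^sup>2 \<le> (1 + norm x)\<^sup>2" using norm_ge_zero[of x] unfolding power2_sum power2_abs one_power2 by linarith
      moreover have "1 + (x \<bullet> b)\<^sup>2 > 0" by (simp add: add_pos_nonneg)
      ultimately show "1 / (1 + norm x)\<^sup>2 \<le> 1 / (1 + (x \<bullet> b)\<^sup>2)" by (simp add: frac_le)
    qed simp
    then show ?thesis by (simp add: power_mult power_one_over)
  qed
  have "set_integrable lborel UNIV (\<lambda>x::real. inverse (1 + x\<^sup>2))"
    using integrable_inverse_1_plus_square by (simp add: einterval_eq_UNIV)
  then have "integral\<^sup>N lborel (\<lambda>t::real. ennreal (1 / (1 + t\<^sup>2))) < \<infinity>"
    by (simp add: set_integrable_def integrable_iff_bounded inverse_eq_divide)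
  then have fin: "(\<Prod>b\<in>(Basis::'a set). integral\<^sup>N lborel (\<lambda>t::real. ennreal (1 / (1 + t\<^sup>2)))) < \<infinity>"
    by (simp add: power_less_top_ennreal)
  have "(\<integral>\<^sup>+ x. ennreal (norm (1 / (1 + norm x) ^ (2 * DIM('a)))) \<partial>(lborel :: 'a measure))
      \<le> (\<integral>\<^sup>+ x. (\<Prod>b\<in>Basis. ennreal (1 / (1 + (x \<bullet> b)\<^sup>2))) \<partial>(lborel :: 'a measure))"
    using le by (intro nn_integral_mono) (simp add: prod_ennreal ennreal_leI)
  also have "\<dots> = (\<Prod>b\<in>(Basis::'a set). (\<integral>\<^sup>+ t. ennreal (1 / (1 + t\<^sup>2)) \<partial>lborel))"
    by (rule nn_integral_lborel_prod) auto
  finally show "(\<integral>\<^sup>+ x. ennreal (norm (1 / (1 + norm x) ^ (2 * DIM('a)))) \<partial>(lborel :: 'a measure)) < \<infinity>"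
    using fin by (rule order_le_less_trans)
qed measurable

lemma rapid_integrable_norm:
  fixes f :: "real^'n::finite \<Rightarrow> complex"
  assumes f: "rapid f" "f \<in> borel_measurable borel"
  shows "integrable lborel (\<lambda>x. norm x ^ k * norm (f x))"
proof -
  let ?d = "2 * DIM(real^'n)"
  obtain C where C: "C \<ge> 0" "\<And>x. (1 + norm x) ^ (k + ?d) * norm (f x) \<le> C" using rapidI_nonneg[OF f(1), of "k + ?d"] by blast
  have "norm (norm x ^ k * norm (f x)) \<le> norm (C * (1 / (1 + norm x) ^ ?d))" for x
  proof -
    have "norm x ^ k * norm (f x) \<le> (1 + norm x) ^ k * norm (f x)" by (intro mult_right_mono power_mono) auto
    then have "norm x ^ k * norm (f x) * (1 + norm x) ^ ?d \<le> (1 + norm x) ^ k * norm (f x) * (1 + norm x) ^ ?d"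
      by (rule mult_right_mono) simp
    also have "\<dots> \<le> C" using C(2)[of x] by (simp add: power_add mult_ac)
    finally have "norm x ^ k * norm (f x) \<le> C / (1 + norm x) ^ ?d" by (subst pos_le_divide_eq) (auto intro: one_plus_norm_power_pos)
    then show ?thesis using C(1) by simp
  qed
  then show ?thesis
    using f(2) by (intro Bochner_Integration.integrable_bound[OF integrable_mult_right[OF integrable_inverse_power_norm[where 'a="real^'n"]]]) auto
qed

lemma rapid_integrable: "rapid f \<Longrightarrow> f \<in> borel_measurable borel \<Longrightarrow> integrable lborel f"
  using rapid_integrable_norm[of f 0] by (simp add: integrable_norm_iff)

lemma schwartz_measurable: "schwartz f \<Longrightarrow> f \<in> borel_measurable borel"
  by (intro borel_measurable_continuous_onI schwartz_continuous)

lemma schwartz_integrable: "schwartz f \<Longrightarrow> integrable lborel f" by (intro rapid_integrable schwartz_rapid schwartz_measurable)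

abbreviation character :: "real \<Rightarrow> complex" where
  "character r \<equiv> exp (- \<i> * complex_of_real r)"

definition fourier_factor :: "'n::finite itself \<Rightarrow> real" where
  "fourier_factor _ = (2 * pi) powr (- real CARD('n) / 2)"

abbreviation (input) cF :: "'n::finite itself \<Rightarrow> complex" where "cF t \<equiv> complex_of_real (fourier_factor t)"

lemma borel_measurable_character: "(\<lambda>x::real^'n::finite. character (x \<bullet> \<xi>)) \<in> borel_measurable borel"
  by (intro borel_measurable_continuous_onI continuous_intros)

lemma integrable_character_mult:
  assumes "integrable lborel (\<phi> :: real^'n::finite \<Rightarrow> complex)"
  shows "integrable lborel (\<lambda>x. character (x \<bullet> \<xi>) * \<phi> x)" using assms borel_measurable_character[of \<xi>]
  by (intro Bochner_Integration.integrable_bound[OF assms]) (auto simp: norm_mult norm_character simp del: mult_minus_left)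

text \<open>Passes from the completed measure of the definition to \<open>lborel\<close>, to which
  Fubini's theorem and substitutions are applied.\<close>

lemma fourier_eq:
  assumes "\<phi> \<in> borel_measurable borel"
  shows "fourier \<phi> \<xi> = cF TYPE('n) * (LINT x|lborel. character (x \<bullet> \<xi>) * \<phi> (x::real^'n::finite))"
  unfolding fourier_def fourier_factor_def using assms borel_measurable_character by (subst integral_completion) auto

lemma fourier_cmult: "fourier (\<lambda>x. c * \<phi> x) = (\<lambda>\<xi>. c * fourier \<phi> \<xi>)"
  unfolding fourier_def by (simp add: mult.left_commute[of _ c])

lemma norm_fourier_le:
  fixes \<phi> :: "real^'n::finite \<Rightarrow> complex"
  assumes "integrable lborel \<phi>"
  shows "norm (fourier \<phi> \<xi>) \<le> fourier_factor TYPE('n) * (LINT x|lborel. norm (\<phi> x))"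
proof -
  have "norm (LINT x|lborel. character (x \<bullet> \<xi>) * \<phi> x) \<le> (LINT x|lborel. norm (character (x \<bullet> \<xi>) * \<phi> x))"
    by (rule integral_norm_bound)
  also have "\<dots> = (LINT x|lborel. norm (\<phi> x))" by (simp only: norm_mult norm_character mult_1)
  finally show ?thesis using assms by (subst fourier_eq) (auto simp: norm_mult fourier_factor_def intro!: mult_left_mono)
qed

text \<open>Differentiation under the integral with an explicit remainder: |exp(-it) - 1 + it| is at
  most t^2/2, and |x|^2 times a Schwartz function is integrable.\<close>

lemma has_derivative_fourier:
  fixes \<phi> :: "real^'n::finite \<Rightarrow> complex"
  assumes \<phi>: "schwartz \<phi>"
  shows "(fourier \<phi> has_derivative
    (\<lambda>h. \<Sum>k\<in>UNIV. complex_of_real (h $ k) * fourier (\<lambda>x. - \<i> * (complex_of_real (x $ k) * \<phi> x)) \<xi>)) (at \<xi>)"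
    (is "(_ has_derivative ?D) _")
proof (rule has_derivativeI_sandwich[of 1])
  note m = schwartz_measurable[OF \<phi>]
  note m' = schwartz_measurable[OF schwartz_coordinate_mult[OF \<phi>]]
  have i': "integrable lborel (\<lambda>x. character (x \<bullet> \<xi>) * (complex_of_real (x $ k) * \<phi> x))" for k
    by (intro integrable_character_mult schwartz_integrable schwartz_coordinate_mult \<phi>)
  show "bounded_linear ?D"
    by (intro bounded_linear_sum bounded_linear_mult_const[of _ _] bounded_linear_compose[OF bounded_linear_of_real bounded_linear_vec_nth])
  let ?C = "fourier_factor TYPE('n) * (LINT x|lborel. norm x ^ 2 * norm (\<phi> x))"
  have Dh: "?D h = cF TYPE('n) * (LINT x|lborel. character (x \<bullet> \<xi>) * (- \<i> * complex_of_real (x \<bullet> h) * \<phi> x))" for h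
  proof -
    have "(\<Sum>k\<in>UNIV. c k * (LINT x|lborel. character (x \<bullet> \<xi>) * (complex_of_real (x $ k) * \<phi> x))) =
        (LINT x|lborel. (\<Sum>k\<in>UNIV. c k * (character (x \<bullet> \<xi>) * (complex_of_real (x $ k) * \<phi> x))))" for c :: "'n \<Rightarrow> complex"
      using i' by (subst Bochner_Integration.integral_sum) (auto simp del: mult_minus_left)
    note sum = this[of "\<lambda>k. - \<i> * complex_of_real (h $ k)"]
    have "?D h = (\<Sum>k\<in>UNIV. complex_of_real (h $ k) * (- \<i> * (cF TYPE('n) * (LINT x|lborel. character (x \<bullet> \<xi>) * (complex_of_real (x $ k) * \<phi> x)))))"
      unfolding fourier_cmult fourier_eq[OF m'] ..
    also have "\<dots> = cF TYPE('n) * (LINT x|lborel. (\<Sum>k\<in>UNIV. - \<i> * complex_of_real (h $ k) * (character (x \<bullet> \<xi>) * (complex_of_real (x $ k) * \<phi> x))))"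
      unfolding sum[symmetric] sum_distrib_left by (intro sum.cong refl) (simp only: mult_ac)
    finally show ?thesis by (simp add: inner_vec_def sum_distrib_left sum_distrib_right mult_ac sum_negf)
  qed
  show "norm ((fourier \<phi> y - fourier \<phi> \<xi>) - ?D (y - \<xi>)) / norm (y - \<xi>) \<le> ?C * norm (y - \<xi>)" if "y \<noteq> \<xi>" for y
  proof -
    let ?h = "y - \<xi>"
    let ?r = "\<lambda>x. character (x \<bullet> \<xi>) * (character (x \<bullet> ?h) - 1 + \<i> * complex_of_real (x \<bullet> ?h)) * \<phi> x"
    have "character (x \<bullet> y) = character (x \<bullet> \<xi>) * character (x \<bullet> ?h)" for x
      by (subst exp_add[symmetric]) (simp add: inner_diff_right algebra_simps)
    then have eq: "?r x = character (x \<bullet> y) * \<phi> x - character (x \<bullet> \<xi>) * \<phi> x - character (x \<bullet> \<xi>) * (- \<i> * complex_of_real (x \<bullet> ?h) * \<phi> x)" for x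
      by (simp only:) (simp add: algebra_simps)
    have int3: "integrable lborel (\<lambda>x. character (x \<bullet> \<xi>) * (- \<i> * complex_of_real (x \<bullet> ?h) * \<phi> x))"
    proof -
      have "integrable lborel (\<lambda>x. \<Sum>k\<in>UNIV. - \<i> * complex_of_real (?h $ k) * (character (x \<bullet> \<xi>) * (complex_of_real (x $ k) * \<phi> x)))"
        by (intro Bochner_Integration.integrable_sum integrable_mult_right i')
      then show ?thesis by (simp add: inner_vec_def sum_distrib_left sum_distrib_right mult_ac sum_negf)
    qed
    note int = integrable_character_mult[OF schwartz_integrable[OF \<phi>]]
    have "(fourier \<phi> y - fourier \<phi> \<xi>) - ?D ?h = cF TYPE('n) * (LINT x|lborel. ?r x)" unfolding eq Dh fourier_eq[OF m]
      by (subst Bochner_Integration.integral_diff[OF Bochner_Integration.integrable_diff[OF int int] int3],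
          subst Bochner_Integration.integral_diff[OF int int]) (simp only: right_diff_distrib)
    moreover have "norm (LINT x|lborel. ?r x) \<le> (LINT x|lborel. norm x ^ 2 * norm (\<phi> x)) * (norm ?h)\<^sup>2"
    proof (subst integral_mult_left_zero[symmetric], rule order_trans[OF integral_norm_bound integral_mono])
      show "integrable lborel (\<lambda>x. norm (?r x))" unfolding eq by (intro integrable_norm Bochner_Integration.integrable_diff int int3)
      show "integrable lborel (\<lambda>x. (norm x ^ 2 * norm (\<phi> x)) * (norm ?h)\<^sup>2)"
        by (intro integrable_mult_left rapid_integrable_norm schwartz_rapid \<phi> m)
      fix x
      have "norm (character (x \<bullet> ?h) - 1 + \<i> * complex_of_real (x \<bullet> ?h)) \<le> \<bar>x \<bullet> ?h\<bar>\<^sup>2 / 2"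
        using iexp_approx1[of "- (x \<bullet> ?h)" 1] by (simp add: algebra_simps numeral_2_eq_2)
      also have "\<dots> \<le> (norm x * norm ?h)\<^sup>2 / 2" by (intro divide_right_mono power_mono Cauchy_Schwarz_ineq2) auto
      also have "\<dots> \<le> (norm x)\<^sup>2 * (norm ?h)\<^sup>2" by (simp add: power_mult_distrib)
      finally have "norm (character (x \<bullet> ?h) - 1 + \<i> * complex_of_real (x \<bullet> ?h)) * norm (\<phi> x) \<le> (norm x)\<^sup>2 * (norm ?h)\<^sup>2 * norm (\<phi> x)"
        by (intro mult_right_mono) auto
      then show "norm (?r x) \<le> (norm x ^ 2 * norm (\<phi> x)) * (norm ?h)\<^sup>2"
        by (simp only: norm_mult norm_character mult_1) (simp add: mult_ac)
    qed
    ultimately have "norm ((fourier \<phi> y - fourier \<phi> \<xi>) - ?D ?h) \<le> ?C * (norm ?h)\<^sup>2"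
      by (simp only: norm_mult norm_of_real mult.assoc) (auto simp: fourier_factor_def intro!: mult_left_mono)
    then show ?thesis using that by (simp add: divide_simps power2_eq_square mult_ac)
  qed
  have "((\<lambda>y. ?C * norm (y - \<xi>)) \<longlongrightarrow> ?C * norm (\<xi> - \<xi>)) (at \<xi>)" by (intro tendsto_intros)
  then show "((\<lambda>y. ?C * norm (y - \<xi>)) \<longlongrightarrow> 0) (at \<xi>)" by simp
qed auto

lemma partial_deriv_fourier:
  assumes "schwartz \<phi>"
  shows "partial_deriv k (fourier \<phi>) = fourier (\<lambda>x. - \<i> * (complex_of_real (x $ k) * \<phi> x))"
proof
  fix \<xi>
  have "partial_deriv k (fourier \<phi>) \<xi> =
    (\<Sum>l\<in>UNIV. (if l = k then 1 else 0) * fourier (\<lambda>x. - \<i> * (complex_of_real (x $ l) * \<phi> x)) \<xi>)"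
    by (subst partial_deriv_eq[OF has_derivative_fourier[OF assms]]) (auto simp: axis_def intro!: sum.cong)
  also have "\<dots> = (\<Sum>l\<in>UNIV. if l = k then fourier (\<lambda>x. - \<i> * (complex_of_real (x $ l) * \<phi> x)) \<xi> else 0)"
    by (intro sum.cong) auto
  finally show "partial_deriv k (fourier \<phi>) \<xi> = fourier (\<lambda>x. - \<i> * (complex_of_real (x $ k) * \<phi> x)) \<xi>" by simp
qed

section \<open>Transforms of derivatives, duality, the Gaussian and the inversion formula\<close>

lemma lborel_integral_translate:
  fixes f :: "'a::euclidean_space \<Rightarrow> 'b::{banach,second_countable_topology}"
  assumes "f \<in> borel_measurable borel"
  shows "(LINT x|lborel. f (a + x)) = (LINT x|lborel. f x)"
  by (subst (2) lborel_distr_plus[symmetric, of a], subst integral_distr) (use assms in auto)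

lemma lborel_integral_scale:
  fixes f :: "'a::euclidean_space \<Rightarrow> 'b::{banach,second_countable_topology}"
  assumes f: "f \<in> borel_measurable borel" and c: "c > 0"
  shows "(LINT x|lborel. f x) = c ^ DIM('a) *\<^sub>R (LINT x|lborel. f (t + c *\<^sub>R x))"
proof -
  have "(LINT x|lborel. f x) = (LINT x|density (distr lborel borel (\<lambda>x. t + c *\<^sub>R x)) (\<lambda>_. ennreal (c ^ DIM('a))). f x)"
    using lborel_affine[of c t] c by (simp add: ennreal_power)
  also have "\<dots> = (LINT x|distr lborel borel (\<lambda>x. t + c *\<^sub>R x). c ^ DIM('a) *\<^sub>R f x)"
    by (rule integral_density) (use f c in auto)
  also have "\<dots> = (LINT x|lborel. c ^ DIM('a) *\<^sub>R f (t + c *\<^sub>R x))" by (rule integral_distr) (use f in auto)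
  finally show ?thesis by simp
qed

lemma schwartz_directional_has_derivative:
  assumes "schwartz \<phi>"
  shows "((\<lambda>s. \<phi> (x + s *\<^sub>R axis k 1)) has_derivative (\<lambda>h. h *\<^sub>R partial_deriv k \<phi> (x + s *\<^sub>R axis k 1))) (at s within S)"
proof -
  have "((\<lambda>s. x + s *\<^sub>R axis k 1) has_derivative (\<lambda>h. h *\<^sub>R axis k 1)) (at s within S)"
    by (auto intro!: derivative_eq_intros)
  moreover have "(\<phi> has_derivative frechet_derivative \<phi> (at (x + s *\<^sub>R axis k 1))) (at (x + s *\<^sub>R axis k 1))"
    using schwartz_differentiable[OF assms] frechet_derivative_works by blast
  ultimately have "((\<lambda>s. \<phi> (x + s *\<^sub>R axis k 1)) has_derivative
      (\<lambda>h. frechet_derivative \<phi> (at (x + s *\<^sub>R axis k 1)) (h *\<^sub>R axis k 1))) (at s within S)"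
    by (rule has_derivative_compose)
  moreover have "linear (frechet_derivative \<phi> (at (x + s *\<^sub>R axis k 1)))"
    using schwartz_differentiable[OF assms] linear_frechet_derivative by blast
  ultimately show ?thesis by (simp add: linear_scale partial_deriv_def)
qed

text \<open>Difference quotients have integral 0 by translation invariance. They converge to the
  derivative, and the mean value theorem supplies a dominating function.\<close>

lemma integral_partial_deriv:
  fixes \<phi> :: "real^'n::finite \<Rightarrow> complex"
  assumes \<phi>: "schwartz \<phi>"
  shows "(LINT x|lborel. partial_deriv k \<phi> x) = 0"
proof -
  let ?e = "axis k 1 :: real^'n" and ?d = "2 * DIM(real^'n)"
  let ?t = "\<lambda>n. (1 / real (Suc n)) *\<^sub>R ?e"
  have aux: "a \<le> b + 1 \<Longrightarrow> 0 \<le> b \<Longrightarrow> 1 + a \<le> 2 * (1 + b)" for a b :: real by simp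
  note d\<phi> = schwartz_partial_deriv[OF \<phi>, of k]
  note m = schwartz_measurable[OF \<phi>]
  define q where "q n x = Suc n *\<^sub>R (\<phi> (x + ?t n) - \<phi> x)" for n x
  obtain C where C: "C \<ge> 0" "\<And>x. (1 + norm x) ^ ?d * norm (partial_deriv k \<phi> x) \<le> C"
    using rapidI_nonneg[OF schwartz_rapid[OF d\<phi>], of ?d] by blast
  \<comment> \<open>The factor \<open>2 ^ ?d\<close> absorbs a shift of the argument by at most 1,
    under which 1 + |x| at most doubles.\<close>
  define w where "w x = 2 ^ ?d * C * (1 / (1 + norm x) ^ ?d)" for x :: "real^'n"
  have "(\<lambda>n. LINT x|lborel. q n x) \<longlonglongrightarrow> (LINT x|lborel. partial_deriv k \<phi> x)"
  proof (rule integral_dominated_convergence)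
    show "partial_deriv k \<phi> \<in> borel_measurable lborel" using schwartz_measurable[OF d\<phi>] by simp
    show "q n \<in> borel_measurable lborel" for n unfolding q_def[abs_def] using m by measurable
    show "integrable lborel w" unfolding w_def[abs_def] by (intro integrable_mult_right integrable_inverse_power_norm)
    show "AE x in lborel. (\<lambda>n. q n x) \<longlonglongrightarrow> partial_deriv k \<phi> x"
    proof (intro AE_I2)
      fix x
      have "((\<lambda>s. \<phi> (x + s *\<^sub>R ?e)) has_vector_derivative partial_deriv k \<phi> x) (at 0)"
        using schwartz_directional_has_derivative[OF \<phi>, of x k 0 UNIV] by (simp add: has_vector_derivative_def)
      then have "((\<lambda>s. norm (\<phi> (x + s *\<^sub>R ?e) - \<phi> x - s *\<^sub>R partial_deriv k \<phi> x) / norm s) \<longlongrightarrow> 0) (at 0)"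
        by (simp add: has_vector_derivative_def has_derivative_at)
      moreover have "filterlim (\<lambda>n. 1 / real (Suc n)) (at 0) sequentially" by (rule filterlim_atI[OF LIMSEQ_Suc[OF lim_1_over_n]]) auto
      ultimately have "(\<lambda>n. norm (\<phi> (x + ?t n) - \<phi> x - (1 / Suc n) *\<^sub>R partial_deriv k \<phi> x) / norm (1 / real (Suc n))) \<longlonglongrightarrow> 0"
        by (rule filterlim_compose)
      moreover have "norm (\<phi> (x + ?t n) - \<phi> x - (1 / Suc n) *\<^sub>R partial_deriv k \<phi> x) / norm (1 / real (Suc n))
          = norm (q n x - partial_deriv k \<phi> x)" for n
      proof -
        have "q n x - partial_deriv k \<phi> x = Suc n *\<^sub>R (\<phi> (x + ?t n) - \<phi> x - (1 / Suc n) *\<^sub>R partial_deriv k \<phi> x)"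
          by (simp add: q_def scaleR_diff_right)
        then show ?thesis by (simp only: norm_scaleR) (simp add: mult.commute)
      qed
      ultimately show "(\<lambda>n. q n x) \<longlonglongrightarrow> partial_deriv k \<phi> x" by (simp only: tendsto_norm_zero_iff LIM_zero_iff)
    qed
    show "AE x in lborel. norm (q n x) \<le> w x" for n
    proof (intro AE_I2)
      fix x
      have b: "norm (partial_deriv k \<phi> (x + s *\<^sub>R ?e)) \<le> w x" if s: "s \<in> {0..1 / Suc n}" for s
      proof -
        let ?y = "x + s *\<^sub>R ?e"
        have "1 / real (Suc n) \<le> 1" by (simp add: field_simps)
        then have "\<bar>s\<bar> \<le> 1" using s unfolding atLeastAtMost_iff by linarith
        then have "norm x \<le> norm ?y + 1" using norm_triangle_sub[of x ?y] by (simp add: norm_axis_1)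
        then have "1 + norm x \<le> 2 * (1 + norm ?y)" by (rule aux) simp
        then have "(1 + norm x) ^ ?d \<le> (2 * (1 + norm ?y)) ^ ?d" by (rule power_mono) simp
        then have "(1 + norm x) ^ ?d * norm (partial_deriv k \<phi> ?y) \<le> 2 ^ ?d * ((1 + norm ?y) ^ ?d * norm (partial_deriv k \<phi> ?y))"
          by (subst mult.assoc[symmetric], subst power_mult_distrib[symmetric], intro mult_right_mono) auto
        also have "\<dots> \<le> 2 ^ ?d * C" by (intro mult_left_mono C) auto
        finally have "norm (partial_deriv k \<phi> ?y) \<le> 2 ^ ?d * C / (1 + norm x) ^ ?d"
          by (subst pos_le_divide_eq) (auto intro: one_plus_norm_power_pos simp: mult.commute)
        then show ?thesis by (simp add: w_def)
      qed
      have "norm (\<phi> (x + ?t n) - \<phi> (x + 0 *\<^sub>R ?e)) \<le> w x * norm (1 / Suc n - 0)"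
      proof (rule differentiable_bound[of "{0..1 / Suc n}" "\<lambda>s. \<phi> (x + s *\<^sub>R ?e)"
            "\<lambda>s h. h *\<^sub>R partial_deriv k \<phi> (x + s *\<^sub>R ?e)"])
        fix s assume s: "s \<in> {0..1 / real (Suc n)}"
        show "((\<lambda>s. \<phi> (x + s *\<^sub>R ?e)) has_derivative (\<lambda>h. h *\<^sub>R partial_deriv k \<phi> (x + s *\<^sub>R ?e))) (at s within {0..1 / Suc n})"
          by (rule schwartz_directional_has_derivative[OF \<phi>])
        show "onorm (\<lambda>h. h *\<^sub>R partial_deriv k \<phi> (x + s *\<^sub>R ?e)) \<le> w x"
        proof (rule onorm_le)
          fix h :: real
          have "norm (h *\<^sub>R partial_deriv k \<phi> (x + s *\<^sub>R ?e)) \<le> \<bar>h\<bar> * w x"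
            using b[OF s] by (simp add: mult_left_mono)
          then show "norm (h *\<^sub>R partial_deriv k \<phi> (x + s *\<^sub>R ?e)) \<le> w x * norm h" by (simp add: mult.commute)
        qed
      qed auto
      then have "norm (\<phi> (x + ?t n) - \<phi> x) \<le> w x * (1 / Suc n)" by simp
      then have "real (Suc n) * norm (\<phi> (x + ?t n) - \<phi> x) \<le> real (Suc n) * (w x * (1 / Suc n))" by (rule mult_left_mono) simp
      then show "norm (q n x) \<le> w x" unfolding q_def norm_scaleR by simp
    qed
  qed
  moreover have "(LINT x|lborel. q n x) = 0" for n
  proof -
    note i = schwartz_integrable[OF \<phi>]
    have i': "integrable lborel (\<lambda>x. \<phi> (x + ?t n))"
      using i integrable_distr_eq[of "(+) (?t n)" lborel borel \<phi>] m by (simp add: lborel_distr_plus add.commute)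
    have "(LINT x|lborel. q n x) = Suc n *\<^sub>R ((LINT x|lborel. \<phi> (x + ?t n)) - (LINT x|lborel. \<phi> x))"
      unfolding q_def using i i' by simp
    also have "(LINT x|lborel. \<phi> (x + ?t n)) = (LINT x|lborel. \<phi> x)"
      using lborel_integral_translate[OF m, of "?t n"] by (simp add: add.commute)
    finally show ?thesis by simp
  qed
  ultimately show ?thesis by (simp add: LIMSEQ_const_iff)
qed

text \<open>The derivative of the product of \<open>\<phi>\<close> with a character has integral
  0.\<close>

lemma fourier_partial_deriv:
  assumes "schwartz \<phi>"
  shows "fourier (partial_deriv k \<phi>) \<xi> = \<i> * complex_of_real (\<xi> $ k) * fourier \<phi> \<xi>"
proof -
  note i = integrable_character_mult[OF schwartz_integrable]
  have d: "(\<lambda>x. character (x \<bullet> \<xi>)) differentiable (at x)" for x :: "real^'a"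
    unfolding differentiable_def using has_derivative_character by blast
  have "partial_deriv k (\<lambda>x. character (x \<bullet> \<xi>) * \<phi> x) =
      (\<lambda>x. - \<i> * complex_of_real (\<xi> $ k) * (character (x \<bullet> \<xi>) * \<phi> x) + character (x \<bullet> \<xi>) * partial_deriv k \<phi> x)"
    unfolding partial_deriv_mult[OF d schwartz_differentiable[OF assms]] partial_deriv_character by (simp only: mult.assoc)
  with integral_partial_deriv[OF schwartz_character_mult[OF assms], of k \<xi>]
  have "- \<i> * complex_of_real (\<xi> $ k) * (LINT x|lborel. character (x \<bullet> \<xi>) * \<phi> x)
      + (LINT x|lborel. character (x \<bullet> \<xi>) * partial_deriv k \<phi> x) = 0"
    using i[OF assms, of \<xi>] i[OF schwartz_partial_deriv[OF assms], of \<xi> k]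
    by (simp add: Bochner_Integration.integral_add del: mult_minus_left)
  then show ?thesis using assms by (simp add: fourier_eq schwartz_measurable schwartz_partial_deriv algebra_simps add_eq_0_iff)
qed

text \<open>Each factor 1 + |\<xi>| costs one derivative: it is at most 1 plus the sum of the
  absolute values of the coordinates, and a coordinate times the transform is, up to a factor of
  modulus 1, the transform of a partial derivative.\<close>

lemma rapid_fourier:
  fixes \<phi> :: "real^'n::finite \<Rightarrow> complex"
  assumes "schwartz \<phi>" shows "rapid (fourier \<phi>)" unfolding rapid_def
proof
  fix N
  show "\<exists>C. \<forall>\<xi>. (1 + norm \<xi>) ^ N * norm (fourier \<phi> \<xi>) \<le> C" using assms
  proof (induction N arbitrary: \<phi>)
    case 0
    then show ?case using norm_fourier_le[OF schwartz_integrable] by auto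
  next
    case (Suc N)
    obtain C0 where C0: "\<And>\<xi>. (1 + norm \<xi>) ^ N * norm (fourier \<phi> \<xi>) \<le> C0" using Suc by blast
    have "\<forall>k. \<exists>C. \<forall>\<xi>. (1 + norm \<xi>) ^ N * norm (fourier (partial_deriv k \<phi>) \<xi>) \<le> C"
      using Suc schwartz_partial_deriv by blast
    then obtain C where C: "\<And>k \<xi>. (1 + norm \<xi>) ^ N * norm (fourier (partial_deriv k \<phi>) \<xi>) \<le> C k" by metis
    have "(1 + norm \<xi>) ^ Suc N * norm (fourier \<phi> \<xi>) \<le> C0 + (\<Sum>k\<in>UNIV. C k)" for \<xi>
    proof -
      have "(1 + norm \<xi>) * norm (fourier \<phi> \<xi>) \<le> (1 + (\<Sum>k\<in>UNIV. \<bar>\<xi> $ k\<bar>)) * norm (fourier \<phi> \<xi>)"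
        by (intro mult_right_mono add_left_mono norm_le_l1_cart) auto
      also have "\<dots> = norm (fourier \<phi> \<xi>) + (\<Sum>k\<in>UNIV. norm (fourier (partial_deriv k \<phi>) \<xi>))"
        by (simp add: fourier_partial_deriv[OF Suc.prems] norm_mult distrib_right sum_distrib_right)
      finally have "(1 + norm \<xi>) ^ N * ((1 + norm \<xi>) * norm (fourier \<phi> \<xi>)) \<le>
          (1 + norm \<xi>) ^ N * (norm (fourier \<phi> \<xi>) + (\<Sum>k\<in>UNIV. norm (fourier (partial_deriv k \<phi>) \<xi>)))"
        by (intro mult_left_mono) auto
      also have "\<dots> \<le> C0 + (\<Sum>k\<in>UNIV. C k)" unfolding distrib_left sum_distrib_left by (intro add_mono C0 sum_mono C)
      finally show ?thesis by (simp add: mult_ac)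
    qed
    then show ?case by blast
  qed
qed

lemma schwartz_fourier:
  fixes \<phi> :: "real^'n::finite \<Rightarrow> complex"
  assumes "schwartz \<phi>" shows "schwartz (fourier \<phi>)" unfolding schwartz_iff
proof (rule smooth_with_coinduct[of _ "fourier ` Collect schwartz"])
  fix f :: "real^'n \<Rightarrow> complex" assume "f \<in> fourier ` Collect schwartz"
  then obtain \<phi> where f: "f = fourier \<phi>" and \<phi>: "schwartz \<phi>" by blast
  show "f differentiable (at x)" for x unfolding f differentiable_def using has_derivative_fourier[OF \<phi>] by blast
  show "rapid f" unfolding f by (rule rapid_fourier[OF \<phi>])
  show "partial_deriv k f \<in> fourier ` Collect schwartz" for k unfolding f partial_deriv_fourier[OF \<phi>]
    by (intro imageI CollectI schwartz_cmult schwartz_coordinate_mult \<phi>)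
qed (use assms in blast)

text \<open>Fubini's theorem for a kernel that is symmetric in its two arguments.\<close>

lemma fourier_duality:
  fixes \<phi> \<psi> :: "real^'n::finite \<Rightarrow> complex"
  assumes \<phi>: "integrable lborel \<phi>" and \<psi>: "integrable lborel \<psi>"
  shows "(LINT x|lborel. fourier \<phi> x * \<psi> x) = (LINT x|lborel. \<phi> x * fourier \<psi> x)"
proof -
  have m[measurable]: "\<phi> \<in> borel_measurable borel" "\<psi> \<in> borel_measurable borel" using \<phi> \<psi> by auto
  let ?f = "\<lambda>x y. character (y \<bullet> x) * (\<phi> y * \<psi> x)"
  have "continuous_on UNIV (\<lambda>p::(real^'n) \<times> (real^'n). character (snd p \<bullet> fst p))" by (intro continuous_intros)
  then have [measurable]: "(\<lambda>p. character (snd p \<bullet> fst p)) \<in> borel_measurable ((borel :: (real^'n) measure) \<Otimes>\<^sub>M (borel :: (real^'n) measure))"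
    by (simp only: borel_prod) (rule borel_measurable_continuous_onI)
  have mf: "case_prod ?f \<in> borel_measurable (lborel \<Otimes>\<^sub>M lborel)" by (simp add: case_prod_beta' del: mult_minus_left)
  have "integrable (lborel \<Otimes>\<^sub>M lborel) (case_prod ?f)"
  proof (rule lborel_pair.Fubini_integrable[OF mf])
    have "(LINT y|lborel. norm (case_prod ?f (x, y))) = norm (\<psi> x) * (LINT y|lborel. norm (\<phi> y))" for x
      by (simp add: norm_mult norm_character mult.commute del: mult_minus_left)
    then show "integrable lborel (\<lambda>x. LINT y|lborel. norm (case_prod ?f (x, y)))" using \<psi> by (simp add: integrable_norm_iff)
    show "AE x in lborel. integrable lborel (\<lambda>y. case_prod ?f (x, y))"
      using integrable_character_mult[OF integrable_mult_left[OF \<phi>]] by simp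
  qed
  then have "(LINT y|lborel. LINT x|lborel. ?f x y) = (LINT x|lborel. LINT y|lborel. ?f x y)" by (rule lborel_pair.Fubini_integral)
  moreover have "(LINT x|lborel. fourier \<phi> x * \<psi> x) = cF TYPE('n) * (LINT x|lborel. LINT y|lborel. ?f x y)"
  proof -
    have "(LINT y|lborel. ?f x y) = (LINT y|lborel. character (y \<bullet> x) * \<phi> y) * \<psi> x" for x
      by (simp only: mult.assoc[symmetric] integral_mult_left_zero)
    then show ?thesis by (simp only: fourier_eq[OF m(1)] mult.assoc integral_mult_right_zero)
  qed
  moreover have "(LINT y|lborel. \<phi> y * fourier \<psi> y) = cF TYPE('n) * (LINT y|lborel. LINT x|lborel. ?f x y)"
  proof -
    have "(LINT x|lborel. ?f x y) = \<phi> y * (LINT x|lborel. character (x \<bullet> y) * \<psi> x)" for y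
      by (simp only: mult.left_commute[of _ "\<phi> y"] integral_mult_right_zero inner_commute[of y])
    then show ?thesis by (simp only: fourier_eq[OF m(2)] mult.left_commute[of "\<phi> _"] integral_mult_right_zero)
  qed
  ultimately show ?thesis by simp
qed

definition gaussian :: "real^'n::finite \<Rightarrow> complex" where
  "gaussian x = complex_of_real (exp (- (norm x)\<^sup>2 / 2))"

lemma has_derivative_gaussian: "(gaussian has_derivative (\<lambda>h. - complex_of_real (h \<bullet> x) * gaussian x)) (at x)"
proof -
  have "((\<lambda>x. exp (- (x \<bullet> x) / 2)) has_derivative (\<lambda>h. - (h \<bullet> x) * exp (- (x \<bullet> x) / 2))) (at x)"
    by (auto intro!: derivative_eq_intros simp: inner_commute)
  from has_derivative_of_real[OF this, where 'a=complex] show ?thesis by (simp add: gaussian_def[abs_def] power2_norm_eq_inner)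
qed

lemma partial_deriv_gaussian: "partial_deriv k gaussian = (\<lambda>x. - complex_of_real (x $ k) * gaussian x)"
  by (rule ext, subst partial_deriv_eq[OF has_derivative_gaussian]) (simp add: inner_axis')

lemma rapid_gaussian: "rapid gaussian" unfolding rapid_def
proof
  fix N
  have "(1 + norm x) ^ N * norm (gaussian x) \<le> fact N * exp 2" for x :: "real^'a"
  proof -
    have "(1 + norm x) ^ N \<le> fact N * exp (1 + norm x)" by (intro power_le_fact_exp) simp
    then have "(1 + norm x) ^ N * norm (gaussian x) \<le> fact N * exp (1 + norm x) * exp (- (norm x)\<^sup>2 / 2)"
      by (simp add: gaussian_def mult_right_mono)
    also have "\<dots> = fact N * exp (1 + norm x - (norm x)\<^sup>2 / 2)" by (simp add: mult_exp_exp mult.assoc)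
    also have "1 + norm x - (norm x)\<^sup>2 / 2 \<le> 2" using zero_le_power2[of "norm x - 1"] by (simp add: power2_diff)
    finally show ?thesis by simp
  qed
  then show "\<exists>C. \<forall>x. (1 + norm x) ^ N * norm (gaussian (x::real^'a)) \<le> C" by blast
qed

lemma schwartz_gaussian: "schwartz (gaussian :: real^'n::finite \<Rightarrow> complex)" unfolding schwartz_iff
proof (rule smooth_with_coinduct[of _ "{\<lambda>x. g x * gaussian x | g. smooth_moderate g}"])
  show "gaussian \<in> {\<lambda>x. g x * gaussian x | g. smooth_moderate (g :: real^'n \<Rightarrow> complex)}"
    using smooth_moderate_const[of 1] by (intro CollectI exI[of _ "\<lambda>_. 1"]) simp
  fix f :: "real^'n \<Rightarrow> complex" assume "f \<in> {\<lambda>x. g x * gaussian x | g. smooth_moderate g}"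
  then obtain g where f: "f = (\<lambda>x. g x * gaussian x)" and g: "smooth_moderate g" by blast
  have d: "gaussian differentiable (at x)" for x :: "real^'n" unfolding differentiable_def using has_derivative_gaussian by blast
  show "f differentiable (at x)" for x unfolding f using smooth_withD(1)[OF g] d by (intro differentiable_mult)
  show "rapid f" unfolding f using smooth_withD(2)[OF g] rapid_gaussian by (rule rapid_moderate_mult)
  show "partial_deriv k f \<in> {\<lambda>x. g x * gaussian x | g. smooth_moderate g}" for k
  proof (intro CollectI exI conjI)
    show "partial_deriv k f = (\<lambda>x. (partial_deriv k g x + (-1) * complex_of_real (x $ k) * g x) * gaussian x)"
      unfolding f partial_deriv_mult[OF smooth_withD(1)[OF g] d] partial_deriv_gaussian by (simp add: algebra_simps)
    show "smooth_moderate (\<lambda>x. partial_deriv k g x + (-1) * complex_of_real (x $ k) * g x)"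
      by (intro smooth_moderate_add smooth_moderate_mult smooth_moderate_const smooth_moderate_coordinate g smooth_withD(3)[OF g])
  qed
qed

lemma integral_gaussian: "cF TYPE('n::finite) * (LINT x|lborel. gaussian (x::real^'n)) = 1"
proof -
  have s: "integral\<^sup>N lborel (\<lambda>t::real. ennreal (exp (- t\<^sup>2 / 2))) = ennreal (sqrt (2 * pi))"
  proof -
    have "exp (- t\<^sup>2 / 2) = sqrt (2 * pi) * std_normal_density t" for t :: real by (simp add: std_normal_density_def)
    then have "integral\<^sup>N lborel (\<lambda>t::real. ennreal (exp (- t\<^sup>2 / 2))) =
        ennreal (sqrt (2 * pi)) * integral\<^sup>N lborel (\<lambda>t. ennreal (std_normal_density t))"
      by (simp add: ennreal_mult'' nn_integral_cmult del: std_normal_density_def)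
    also have "integral\<^sup>N lborel (\<lambda>t. ennreal (std_normal_density t)) = 1" by (subst nn_integral_eq_integral) auto
    finally show ?thesis by simp
  qed
  have "(norm x)\<^sup>2 = (\<Sum>b\<in>Basis. (x \<bullet> b)\<^sup>2)" for x :: "real^'n"
    by (subst power2_norm_eq_inner, subst euclidean_inner) (simp add: power2_eq_square)
  then have "exp (- (norm x)\<^sup>2 / 2) = (\<Prod>b\<in>Basis. exp (- (x \<bullet> b)\<^sup>2 / 2))" for x :: "real^'n"
    by (simp add: exp_sum[symmetric] sum_negf[symmetric] sum_divide_distrib)
  then have "integral\<^sup>N lborel (\<lambda>x::real^'n. ennreal (exp (- (norm x)\<^sup>2 / 2))) =
      integral\<^sup>N lborel (\<lambda>x::real^'n. \<Prod>b\<in>Basis. ennreal (exp (- (x \<bullet> b)\<^sup>2 / 2)))"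
    by (simp add: prod_ennreal)
  also have "\<dots> = (\<Prod>b\<in>(Basis::(real^'n) set). ennreal (sqrt (2 * pi)))"
    by (subst nn_integral_lborel_prod) (simp_all add: s[simplified])
  also have "\<dots> = ennreal (sqrt (2 * pi) ^ CARD('n))" unfolding prod_constant by (subst ennreal_power) auto
  finally have N: "integral\<^sup>N lborel (\<lambda>x::real^'n. ennreal (exp (- (norm x)\<^sup>2 / 2))) = ennreal (sqrt (2 * pi) ^ CARD('n))" .
  have "(LINT x|lborel. exp (- (norm (x::real^'n))\<^sup>2 / 2)) = sqrt (2 * pi) ^ CARD('n)"
    by (subst integral_eq_nn_integral; (subst N)?) simp_all
  moreover have "fourier_factor TYPE('n) * sqrt (2 * pi) ^ CARD('n) = 1"
  proof -
    have "sqrt (2 * pi) ^ CARD('n) = (2 * pi) powr (real CARD('n) / 2)"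
      by (simp add: powr_half_sqrt[symmetric] powr_realpow[symmetric] powr_powr)
    then show ?thesis by (simp add: fourier_factor_def powr_add[symmetric])
  qed
  ultimately show ?thesis unfolding gaussian_def by (simp only: integral_complex_of_real of_real_mult[symmetric] of_real_1)
qed

text \<open>The Gaussian solves a first order system that the transformation carries into itself.
  Hence its transform times exp(|\<xi>|^2/2) has derivative 0; the constant is read off at
  0.\<close>

lemma fourier_gaussian: "fourier gaussian = (gaussian :: real^'n::finite \<Rightarrow> complex)"
proof
  fix \<xi> :: "real^'n"
  let ?E = "\<lambda>\<xi>::real^'n. complex_of_real (exp ((norm \<xi>)\<^sup>2 / 2))"
  have "fourier (\<lambda>x. - \<i> * (complex_of_real (x $ k) * gaussian x)) \<xi> = - complex_of_real (\<xi> $ k) * fourier gaussian \<xi>"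
    for k and \<xi> :: "real^'n"
  proof -
    have "fourier (\<lambda>x. - \<i> * (complex_of_real (x $ k) * gaussian x)) \<xi> = fourier (\<lambda>x. \<i> * partial_deriv k gaussian x) \<xi>"
      unfolding partial_deriv_gaussian by (simp add: mult.assoc)
    then show ?thesis unfolding fourier_cmult fourier_partial_deriv[OF schwartz_gaussian] by (simp add: mult.assoc)
  qed
  then have F: "(fourier gaussian has_derivative (\<lambda>h. - complex_of_real (h \<bullet> \<xi>) * fourier gaussian \<xi>)) (at \<xi>)" for \<xi> :: "real^'n"
    using has_derivative_fourier[OF schwartz_gaussian, of \<xi>] by (simp add: inner_vec_def sum_distrib_right sum_negf mult.assoc)
  have "((\<lambda>x. exp ((x \<bullet> x) / 2)) has_derivative (\<lambda>h. (h \<bullet> x) * exp ((x \<bullet> x) / 2))) (at x)" for x :: "real^'n"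
    by (auto intro!: derivative_eq_intros simp: inner_commute)
  from has_derivative_of_real[OF this, where 'a=complex]
  have E: "(?E has_derivative (\<lambda>h. complex_of_real (h \<bullet> \<xi>) * ?E \<xi>)) (at \<xi>)" for \<xi>
    by (simp add: power2_norm_eq_inner)
  have "((\<lambda>\<xi>. fourier gaussian \<xi> * ?E \<xi>) has_derivative (\<lambda>h. 0)) (at \<xi>)" for \<xi>
    by (rule has_derivative_eq_rhs[OF has_derivative_mult[OF F E]]) (simp add: algebra_simps)
  then have "fourier gaussian \<xi> * ?E \<xi> = fourier gaussian (0::real^'n) * ?E 0"
    using has_derivative_zero_unique[of UNIV "\<lambda>\<xi>. fourier gaussian \<xi> * ?E \<xi>" \<xi> 0] by simp
  also have "fourier gaussian (0::real^'n) = 1" by (subst fourier_eq[OF schwartz_measurable[OF schwartz_gaussian]]) (simp add: integral_gaussian)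
  finally have "fourier gaussian \<xi> * (?E \<xi> * gaussian \<xi>) = gaussian \<xi>" by (simp add: mult.assoc[symmetric])
  moreover have "?E \<xi> * gaussian \<xi> = 1" unfolding gaussian_def of_real_mult[symmetric] exp_add[symmetric] by simp
  ultimately show "fourier gaussian \<xi> = gaussian \<xi>" by simp
qed

lemma gaussian_bounds: "norm (gaussian x) \<le> 1" by (simp add: gaussian_def)

lemma gaussian_scaled_tendsto: "(\<lambda>n. gaussian ((1 / Suc n) *\<^sub>R x)) \<longlonglongrightarrow> 1"
proof -
  have "(\<lambda>n. complex_of_real (exp (- (norm ((1 / Suc n) *\<^sub>R x))\<^sup>2 / 2))) \<longlonglongrightarrow> complex_of_real (exp (- (norm (0 *\<^sub>R x))\<^sup>2 / 2))"
    by (intro tendsto_intros LIMSEQ_Suc[OF lim_1_over_n]) simp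
  then show ?thesis by (simp add: gaussian_def)
qed

text \<open>Duality is applied to a character damped by a wide Gaussian. The transform of this
  function is a narrow Gaussian centred at \<open>- x\<close>; as the damping disappears, both sides
  converge by dominated convergence.\<close>

theorem fourier_inversion:
  fixes \<phi> :: "real^'n::finite \<Rightarrow> complex"
  assumes \<phi>: "schwartz \<phi>"
  shows "fourier (fourier \<phi>) x = \<phi> (- x)"
proof -
  define e where "e n = 1 / real (Suc n)" for n
  have e0: "e n > 0" for n by (simp add: e_def)
  let ?g = "gaussian :: real^'n \<Rightarrow> complex"
  note g = schwartz_gaussian[where 'n='n]
  note [measurable] = schwartz_measurable[OF \<phi>] schwartz_measurable[OF g] borel_measurable_character
    schwartz_measurable[OF schwartz_fourier[OF \<phi>]]
  have [measurable]: "(\<lambda>\<xi>. character (x \<bullet> \<xi>)) \<in> borel_measurable borel" for x :: "real^'n"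
    using borel_measurable_character[of x] by (simp only: inner_commute)
  define \<psi> where "\<psi> n \<xi> = character (x \<bullet> \<xi>) * ?g (e n *\<^sub>R \<xi>)" for n \<xi>
  have m\<psi>[measurable]: "\<psi> n \<in> borel_measurable borel" for n unfolding \<psi>_def[abs_def] by measurable
  have gi: "integrable lborel (\<lambda>\<xi>. ?g (e n *\<^sub>R \<xi>))" for n
  proof -
    have "integrable (density (distr lborel borel (\<lambda>x. 0 + e n *\<^sub>R x)) (\<lambda>_. ennreal (\<bar>e n\<bar> ^ DIM(real^'n)))) ?g"
      using schwartz_integrable[OF g] lborel_affine[of "e n" "0 :: real^'n"] e0[of n] by (simp add: ennreal_power)
    then have "integrable lborel (\<lambda>x. e n ^ CARD('n) *\<^sub>R ?g (e n *\<^sub>R x))"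
      using e0[of n] by (subst (asm) integrable_density) (auto simp: integrable_distr_eq)
    then have "integrable lborel (\<lambda>x. (1 / e n ^ CARD('n)) *\<^sub>R e n ^ CARD('n) *\<^sub>R ?g (e n *\<^sub>R x))"
      by (rule integrable_scaleR_right)
    then show ?thesis using e0[of n] by simp
  qed
  have \<psi>i: "integrable lborel (\<psi> n)" for n
    using integrable_character_mult[OF gi, of x n] by (simp add: \<psi>_def[abs_def] inner_commute)
  have F\<psi>: "fourier (\<psi> n) y = complex_of_real (1 / e n ^ CARD('n)) * ?g ((1 / e n) *\<^sub>R (x + y))" for n y
  proof -
    let ?f = "\<lambda>\<eta>. character (\<eta> \<bullet> ((1 / e n) *\<^sub>R (x + y))) * ?g \<eta>"
    have "?f (0 + e n *\<^sub>R \<xi>) = character (\<xi> \<bullet> y) * \<psi> n \<xi>" for \<xi>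
    proof -
      have "character (\<xi> \<bullet> y) * character (x \<bullet> \<xi>) = character (\<xi> \<bullet> (x + y))"
        by (subst exp_add[symmetric]) (simp add: inner_add_right inner_commute algebra_simps)
      then show ?thesis using e0[of n] by (simp add: \<psi>_def mult.assoc[symmetric])
    qed
    then have "(LINT \<eta>|lborel. ?f \<eta>) = e n ^ CARD('n) *\<^sub>R (LINT \<xi>|lborel. character (\<xi> \<bullet> y) * \<psi> n \<xi>)"
      by (subst lborel_integral_scale[OF _ e0[of n], of _ 0]) simp_all
    then have "cF TYPE('n) * (LINT \<eta>|lborel. ?f \<eta>) = e n ^ CARD('n) *\<^sub>R fourier (\<psi> n) y"
      by (subst fourier_eq[OF m\<psi>]) simp
    moreover have "cF TYPE('n) * (LINT \<eta>|lborel. ?f \<eta>) = ?g ((1 / e n) *\<^sub>R (x + y))"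
      using fourier_eq[of ?g "(1 / e n) *\<^sub>R (x + y)"] by (simp add: fourier_gaussian)
    ultimately show ?thesis using e0[of n] by (simp add: scaleR_conv_of_real field_simps)
  qed
  have eq: "(LINT \<xi>|lborel. fourier \<phi> \<xi> * \<psi> n \<xi>) = (LINT z|lborel. \<phi> (- x + e n *\<^sub>R z) * ?g z)" for n
  proof -
    let ?F = "\<lambda>y. complex_of_real (1 / e n ^ CARD('n)) * (\<phi> y * ?g ((1 / e n) *\<^sub>R (x + y)))"
    have "(LINT \<xi>|lborel. fourier \<phi> \<xi> * \<psi> n \<xi>) = (LINT y|lborel. \<phi> y * fourier (\<psi> n) y)"
      by (rule fourier_duality[OF schwartz_integrable[OF \<phi>] \<psi>i])
    also have "\<dots> = (LINT y|lborel. ?F y)" by (simp add: F\<psi> mult_ac)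
    also have "\<dots> = e n ^ CARD('n) *\<^sub>R (LINT z|lborel. ?F (- x + e n *\<^sub>R z))"
      by (subst lborel_integral_scale[OF _ e0[of n], of _ "-x"]) simp_all
    also have "\<dots> = (LINT z|lborel. \<phi> (- x + e n *\<^sub>R z) * ?g z)"
      using e0[of n] by (simp add: scaleR_conv_of_real[of "e n ^ CARD('n)"])
    finally show ?thesis .
  qed
  have "(\<lambda>n. LINT \<xi>|lborel. fourier \<phi> \<xi> * \<psi> n \<xi>) \<longlonglongrightarrow> (LINT \<xi>|lborel. character (\<xi> \<bullet> x) * fourier \<phi> \<xi>)"
  proof (rule integral_dominated_convergence[where w="\<lambda>\<xi>. norm (fourier \<phi> \<xi>)"])
    show "AE \<xi> in lborel. (\<lambda>n. fourier \<phi> \<xi> * \<psi> n \<xi>) \<longlonglongrightarrow> character (\<xi> \<bullet> x) * fourier \<phi> \<xi>"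
    proof (intro AE_I2)
      fix \<xi>
      have "(\<lambda>n. fourier \<phi> \<xi> * (character (x \<bullet> \<xi>) * ?g ((1 / Suc n) *\<^sub>R \<xi>))) \<longlonglongrightarrow> fourier \<phi> \<xi> * (character (x \<bullet> \<xi>) * 1)"
        by (intro tendsto_mult tendsto_const gaussian_scaled_tendsto)
      then show "(\<lambda>n. fourier \<phi> \<xi> * \<psi> n \<xi>) \<longlonglongrightarrow> character (\<xi> \<bullet> x) * fourier \<phi> \<xi>"
        by (simp add: \<psi>_def e_def mult_ac inner_commute)
    qed
    have "norm (\<psi> n \<xi>) \<le> 1" for n \<xi> unfolding \<psi>_def norm_mult norm_character using gaussian_bounds by simp
    then show "AE \<xi> in lborel. norm (fourier \<phi> \<xi> * \<psi> n \<xi>) \<le> norm (fourier \<phi> \<xi>)" for n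
      unfolding norm_mult by (intro AE_I2 mult_left_le) auto
  qed (auto intro: integrable_norm schwartz_integrable schwartz_fourier \<phi>)
  moreover have "(\<lambda>n. LINT z|lborel. \<phi> (- x + e n *\<^sub>R z) * ?g z) \<longlonglongrightarrow> (LINT z|lborel. \<phi> (- x) * ?g z)"
  proof -
    obtain C where C: "\<And>z. norm (\<phi> z) \<le> C" using rapidI_nonneg[OF schwartz_rapid[OF \<phi>], of 0] by auto
    show ?thesis
    proof (rule integral_dominated_convergence[where w="\<lambda>z. C * norm (?g z)"])
      show "integrable lborel (\<lambda>z. C * norm (?g z))" by (intro integrable_mult_right integrable_norm schwartz_integrable g)
      show "AE z in lborel. norm (\<phi> (- x + e n *\<^sub>R z) * ?g z) \<le> C * norm (?g z)" for n
        unfolding norm_mult using C by (intro AE_I2 mult_right_mono) auto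
      show "AE z in lborel. (\<lambda>n. \<phi> (- x + e n *\<^sub>R z) * ?g z) \<longlonglongrightarrow> \<phi> (- x) * ?g z"
      proof (intro AE_I2 tendsto_mult tendsto_const)
        fix z
        have "(\<lambda>n. - x + e n *\<^sub>R z) \<longlonglongrightarrow> - x + 0 *\<^sub>R z"
          unfolding e_def by (intro tendsto_intros LIMSEQ_Suc[OF lim_1_over_n])
        then show "(\<lambda>n. \<phi> (- x + e n *\<^sub>R z)) \<longlonglongrightarrow> \<phi> (- x)"
          using continuous_on_tendsto_compose[OF schwartz_continuous[OF \<phi>, of UNIV]] by simp
      qed
    qed simp_all
  qed
  ultimately have "(LINT \<xi>|lborel. character (\<xi> \<bullet> x) * fourier \<phi> \<xi>) = \<phi> (- x) * (LINT z|lborel. ?g z)"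
    unfolding eq by (simp add: LIMSEQ_unique)
  then show ?thesis by (subst fourier_eq) (simp_all add: mult.left_commute[of _ "\<phi> (- x)"] integral_gaussian)
qed

text \<open>The reflected Fourier transform. Two conjugations in place of the reflection make the
  closure properties of Schwartz functions applicable at once.\<close>

definition inv_fourier :: "(real^'n::finite \<Rightarrow> complex) \<Rightarrow> real^'n \<Rightarrow> complex" where
  "inv_fourier \<phi> = (\<lambda>x. cnj (fourier (\<lambda>y. cnj (\<phi> y)) x))"

lemma schwartz_inv_fourier: "schwartz \<phi> \<Longrightarrow> schwartz (inv_fourier \<phi>)"
  unfolding inv_fourier_def by (intro schwartz_cnj schwartz_fourier)

lemma inv_fourier_eq: "inv_fourier \<phi> \<xi> = fourier \<phi> (- \<xi>)"
  unfolding inv_fourier_def fourier_def by (simp add: exp_cnj flip: Bochner_Integration.integral_cnj)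

lemma fourier_inv_fourier: "schwartz \<phi> \<Longrightarrow> fourier (inv_fourier \<phi>) = \<phi>"
proof
  fix x assume \<phi>: "schwartz \<phi>"
  have "cnj (fourier (inv_fourier \<phi>) x) = inv_fourier (fourier (\<lambda>y. cnj (\<phi> y))) x" by (simp add: inv_fourier_def)
  also have "\<dots> = cnj (\<phi> x)" using fourier_inversion[OF schwartz_cnj[OF \<phi>], of "- x"] by (simp add: inv_fourier_eq)
  finally show "fourier (inv_fourier \<phi>) x = \<phi> x" by simp
qed

lemma inv_fourier_fourier: "schwartz \<phi> \<Longrightarrow> inv_fourier (fourier \<phi>) = \<phi>"
  by (rule ext) (simp add: inv_fourier_eq fourier_inversion)

lemma fourier_parseval:
  assumes "schwartz \<phi>" "schwartz \<psi>"
  shows "(LINT x|lborel. cnj (fourier \<phi> x) * fourier \<psi> x) = (LINT x|lborel. cnj (\<phi> x) * \<psi> x)"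
proof -
  have c: "cnj (fourier \<phi> x) = inv_fourier (\<lambda>y. cnj (\<phi> y)) x" for x by (simp add: inv_fourier_def)
  have "(LINT x|lborel. fourier \<psi> x * inv_fourier (\<lambda>y. cnj (\<phi> y)) x) =
      (LINT x|lborel. \<psi> x * fourier (inv_fourier (\<lambda>y. cnj (\<phi> y))) x)"
    by (intro fourier_duality schwartz_integrable schwartz_inv_fourier schwartz_cnj assms)
  then show ?thesis by (simp add: c fourier_inv_fourier[OF schwartz_cnj[OF assms(1)]] mult.commute)
qed

text \<open>The convolution theorem: \<open>\<theta>\<close> and the character are combined into one
  function, whose transform is a translate of that of \<open>\<theta>\<close>, and duality is
  applied to it.\<close>

lemma inv_fourier_mult:
  assumes \<theta>: "schwartz \<theta>" and \<phi>: "schwartz (\<phi> :: real^'n::finite \<Rightarrow> complex)"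
  shows "inv_fourier (\<lambda>x. \<theta> x * fourier \<phi> x) \<xi> = cF TYPE('n) * (LINT \<eta>|lborel. inv_fourier \<theta> (\<xi> - \<eta>) * \<phi> \<eta>)"
proof -
  note [measurable] = schwartz_measurable[OF \<theta>] schwartz_measurable[OF \<phi>] schwartz_measurable[OF schwartz_fourier[OF \<phi>]]
  let ?t = "\<lambda>x. character (x \<bullet> (- \<xi>)) * \<theta> x"
  have t: "schwartz ?t" by (rule schwartz_character_mult[OF \<theta>])
  have F: "fourier ?t \<eta> = inv_fourier \<theta> (\<xi> - \<eta>)" for \<eta>
  proof -
    have "character (x \<bullet> \<eta>) * (character (x \<bullet> (- \<xi>)) * \<theta> x) = character (x \<bullet> (\<eta> - \<xi>)) * \<theta> x" for x
      by (subst mult.assoc[symmetric], subst exp_add[symmetric]) (simp add: inner_diff_right algebra_simps)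
    then show ?thesis
      by (simp only: inv_fourier_eq fourier_eq[OF schwartz_measurable[OF t]] fourier_eq[OF schwartz_measurable[OF \<theta>]] minus_diff_eq)
  qed
  have "inv_fourier (\<lambda>x. \<theta> x * fourier \<phi> x) \<xi> = cF TYPE('n) * (LINT x|lborel. fourier \<phi> x * ?t x)"
    unfolding inv_fourier_eq by (subst fourier_eq) (simp_all add: mult_ac)
  also have "(LINT x|lborel. fourier \<phi> x * ?t x) = (LINT \<eta>|lborel. \<phi> \<eta> * fourier ?t \<eta>)"
    by (intro fourier_duality schwartz_integrable t \<phi>)
  finally show ?thesis by (simp only: F) (simp only: mult.commute)
qed

section \<open>Test functions separate locally integrable functions\<close>

lemma scaleC_measurable [measurable]:
  fixes f :: "'a \<Rightarrow> complex" and g :: "'a \<Rightarrow> 'e::complex_euclidean_space"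
  assumes [measurable]: "f \<in> borel_measurable M" "g \<in> borel_measurable M"
  shows "(\<lambda>x. f x *\<^sub>C g x) \<in> borel_measurable M"
proof -
  have [measurable]: "(\<lambda>x. \<i> *\<^sub>C g x) \<in> borel_measurable M"
    by (rule borel_measurable_continuous_on[OF linear_continuous_on[OF bounded_linear_scaleC_right]]) measurable
  show ?thesis by (subst scaleC_eq_Re_Im) measurable
qed

text \<open>Product measures are formed from \<open>lborel\<close>; a Lebesgue measurable function
  enters there through a Borel version.\<close>

lemma lebesgue_ex_borel:
  fixes f :: "'a::euclidean_space \<Rightarrow> 'b::euclidean_space"
  assumes f: "f \<in> borel_measurable lebesgue"
  obtains g where "g \<in> borel_measurable borel" "AE x in lebesgue. f x = g x"
proof -
  have "\<exists>g\<in>borel_measurable lborel. AE x in lborel. f x \<bullet> b = g x" for b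
    using f by (intro completion_ex_borel_measurable_real borel_measurable_inner borel_measurable_const)
  then have "\<forall>b. \<exists>g. g \<in> borel_measurable borel \<and> (AE x in lborel. f x \<bullet> b = g x)" by auto
  from choice[OF this] obtain g where g: "\<And>b. g b \<in> borel_measurable borel" "\<And>b. AE x in lborel. f x \<bullet> b = g b x" by blast
  have "AE x in lborel. \<forall>b\<in>Basis. f x \<bullet> b = g b x" using g(2) by (intro AE_finite_allI) auto
  then have "AE x in lebesgue. f x = (\<Sum>b\<in>Basis. g b x *\<^sub>R b)"
    by (intro AE_completion) (erule eventually_mono, subst euclidean_representation[symmetric], auto intro!: sum.cong)
  moreover have "(\<lambda>x. \<Sum>b\<in>Basis. g b x *\<^sub>R b) \<in> borel_measurable borel" using g(1) by measurable
  ultimately show ?thesis using that by blast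
qed

text \<open>Boxes generate the Borel sets and are stable under intersection. The sets over which the
  integral vanishes are closed under countable disjoint unions and, by \<open>tot\<close>, under
  complements; hence every Borel set is one of them.\<close>

lemma AE_eq_0_if_integral_boxes:
  fixes f :: "'a::euclidean_space \<Rightarrow> 'b::{banach,second_countable_topology}"
  assumes f: "integrable lborel f" and box: "\<And>a b. (LINT x:box a b|lborel. f x) = 0" and tot: "(LINT x|lborel. f x) = 0"
  shows "AE x in lborel. f x = 0"
proof (rule sigma_finite_measure.density_zero[OF sigma_finite_lborel f])
  fix A :: "'a set" assume "A \<in> sets lborel"
  have si: "set_integrable lborel A f" if "A \<in> sets lborel" for A
    using f that unfolding set_integrable_def by (rule integrable_mult_indicator[rotated])
  let ?G = "range (\<lambda>(a, b). box a b :: 'a set)"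
  have "Int_stable ?G" by (auto simp: Int_stable_def box_Int_box)
  moreover have "?G \<subseteq> Pow UNIV" by auto
  moreover have "A \<in> sets borel" using \<open>A \<in> sets lborel\<close> by simp
  then have "A \<in> sigma_sets UNIV ?G" unfolding borel_eq_box by simp
  ultimately show "(LINT x:A|lborel. f x) = 0"
  proof (induction rule: sigma_sets_induct_disjoint)
    case (basic A)
    then show ?case using box by auto
  next
    case empty
    then show ?case by (simp add: set_lebesgue_integral_def)
  next
    case (compl A)
    then have A: "A \<in> sets lborel" by (simp add: borel_eq_box)
    have "(LINT x:(A \<union> (UNIV - A))|lborel. f x) = (LINT x:A|lborel. f x) + (LINT x:(UNIV - A)|lborel. f x)"
      using A by (intro set_integral_Un si) auto
    then show ?case using compl tot by (simp add: set_lebesgue_integral_def)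
  next
    case (union A)
    have A: "A i \<in> sets lborel" for i using union(2) by (auto simp: borel_eq_box)
    have "(LINT x:(\<Union>i. A i)|lborel. f x) = (\<Sum>i. (LINT x:(A i)|lborel. f x))"
      using A union(1) by (intro lebesgue_integral_countable_add si) (auto simp: disjoint_family_on_def)
    then show ?case using union by simp
  qed
qed

text \<open>Box bumps show that the integrals over boxes vanish. On each box \<open>Q N\<close> of
  an exhausting sequence the function has an integrable Borel version, whose integrals over boxes
  and over the whole space vanish as well.\<close>

theorem test_functions_separate:
  fixes g :: "real^'n::finite \<Rightarrow> 'e::complex_euclidean_space"
  assumes g: "\<And>K. compact K \<Longrightarrow> set_integrable lebesgue K g"
    and 0: "\<And>\<phi>. test_function \<phi> \<Longrightarrow> (LINT x|lebesgue. \<phi> x *\<^sub>C g x) = 0"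
  shows "AE x in lebesgue. g x = 0"
proof -
  have gb: "set_integrable lebesgue (box a b) g" for a b :: "real^'n"
    by (rule set_integrable_subset[OF g[OF compact_cbox[of a b]]]) (auto simp: box_subset_cbox)
  have gm: "(\<lambda>x. indicator (box a b) x *\<^sub>R g x) \<in> borel_measurable lebesgue" for a b :: "real^'n"
    using gb[of a b] unfolding set_integrable_def by auto
  have box: "(LINT x:box a b|lebesgue. g x) = 0" for a b :: "real^'n"
  proof -
    let ?f = "\<lambda>n x. box_bump (1 / Suc n) a b x *\<^sub>C g x"
    have eq: "box_bump c a b x *\<^sub>C g x = box_bump c a b x *\<^sub>C (indicator (box a b) x *\<^sub>R g x)" for c x
      by (cases "x \<in> box a b") (auto simp: box_bump_outside scaleC_zero_left)
    have "(\<lambda>n. LINT x|lebesgue. ?f n x) \<longlonglongrightarrow> (LINT x|lebesgue. indicator (box a b) x *\<^sub>R g x)"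
    proof (rule integral_dominated_convergence)
      have "box_bump (1 / Suc n) a b \<in> borel_measurable borel" for n
        using test_function_box_bump[of "1 / Suc n" a b] by (auto simp: test_function_def intro: schwartz_measurable)
      then have "box_bump (1 / Suc n) a b \<in> borel_measurable lebesgue" for n by (simp add: measurable_completion)
      then show "(\<lambda>x. ?f n x) \<in> borel_measurable lebesgue" for n unfolding eq by (intro scaleC_measurable gm)
      show "integrable lebesgue (\<lambda>x. norm (indicator (box a b) x *\<^sub>R g x))"
        using gb[of a b] unfolding set_integrable_def by (rule integrable_norm)
      show "AE x in lebesgue. norm (?f n x) \<le> norm (indicator (box a b) x *\<^sub>R g x)" for n
      proof (intro AE_I2)
        fix x
        have "norm (box_bump (1 / Suc n) a b x) \<le> 1" by (rule norm_box_bump_le_1) simp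
        then show "norm (?f n x) \<le> norm (indicator (box a b) x *\<^sub>R g x)" unfolding eq norm_scaleC by (intro mult_left_le_one_le) auto
      qed
      show "AE x in lebesgue. (\<lambda>n. ?f n x) \<longlonglongrightarrow> indicator (box a b) x *\<^sub>R g x"
      proof (intro AE_I2)
        fix x
        have "(\<lambda>n. ?f n x) \<longlonglongrightarrow> (indicator (box a b) x :: complex) *\<^sub>C g x"
          by (intro tendsto_scaleC tendsto_const box_bump_tendsto_indicator)
        then show "(\<lambda>n. ?f n x) \<longlonglongrightarrow> indicator (box a b) x *\<^sub>R g x"
          by (cases "x \<in> box a b") (auto simp: scaleC_zero_left scaleC_one)
      qed
    qed (use gm in auto)
    moreover have "(LINT x|lebesgue. ?f n x) = 0" for n by (intro 0 test_function_box_bump) simp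
    ultimately show ?thesis by (simp add: LIMSEQ_const_iff set_lebesgue_integral_def)
  qed
  define Q :: "nat \<Rightarrow> (real^'n) set" where "Q N = box (\<chi> k. - real N) (\<chi> k. real N)" for N
  have "AE x in lebesgue. indicator (Q N) x *\<^sub>R g x = 0" for N
  proof -
    obtain h where h: "h \<in> borel_measurable borel" "AE x in lebesgue. indicator (Q N) x *\<^sub>R g x = h x"
      using lebesgue_ex_borel[OF gm] unfolding Q_def by blast
    have cong: "(LINT x|lborel. indicator A x *\<^sub>R h x) = (LINT x:(A \<inter> Q N)|lebesgue. g x)" if "A \<in> sets borel" for A
    proof -
      have [measurable]: "(\<lambda>x. indicator A x *\<^sub>R h x) \<in> borel_measurable lborel" using that h(1) by simp
      have "(LINT x|lborel. indicator A x *\<^sub>R h x) = (LINT x|lebesgue. indicator A x *\<^sub>R h x)"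
        by (rule integral_completion[symmetric]) simp
      also have "\<dots> = (LINT x|lebesgue. indicator A x *\<^sub>R (indicator (Q N) x *\<^sub>R g x))"
      proof (rule integral_cong_AE)
        show "(\<lambda>x. indicator A x *\<^sub>R (indicator (Q N) x *\<^sub>R g x)) \<in> borel_measurable lebesgue"
          unfolding Q_def by (rule borel_measurable_scaleR[OF borel_measurable_indicator gm]) (use that in auto)
      qed (use h in \<open>auto simp: measurable_completion simp del: scaleR_scaleR elim!: eventually_mono\<close>)
      finally show ?thesis by (simp add: set_lebesgue_integral_def indicator_inter_arith)
    qed
    have "integrable lebesgue h" using gb[of "\<chi> k. - real N" "\<chi> k. real N"] h gm[of "\<chi> k. - real N" "\<chi> k. real N"]
      unfolding set_integrable_def Q_def[symmetric] by (subst integrable_cong_AE[of _ _ "\<lambda>x. indicator (Q N) x *\<^sub>R g x"])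
        (auto simp: measurable_completion Q_def elim!: eventually_mono)
    then have "integrable lborel h" using h(1) by (subst (asm) integrable_completion) auto
    moreover have "(LINT x:box a b|lborel. h x) = 0" for a b
      using cong[of "box a b"] box by (simp add: set_lebesgue_integral_def Q_def box_Int_box)
    moreover have "(LINT x|lborel. h x) = 0" using cong[of UNIV] box by (simp add: Q_def)
    ultimately have "AE x in lborel. h x = 0" by (rule AE_eq_0_if_integral_boxes)
    then have "AE x in lebesgue. h x = 0" by (rule AE_completion)
    with h(2) show ?thesis by eventually_elim simp
  qed
  then have "AE x in lebesgue. \<forall>N. indicator (Q N) x *\<^sub>R g x = 0" unfolding AE_all_countable by blast
  then show ?thesis
  proof eventually_elim
    case (elim x)
    obtain N :: nat where N: "norm x < real N" using reals_Archimedean2 by blast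
    have "\<bar>x $ k\<bar> < real N" for k using component_le_norm_cart[of x k] N by linarith
    then have "x \<in> Q N" unfolding Q_def mem_box_cart by (auto simp: abs_less_iff minus_less_iff)
    then show ?case using elim[rule_format, of N] by simp
  qed
qed

section \<open>The Hilbert space of square integrable functions\<close>

lemma mult_le_sum_squares: "0 \<le> a \<Longrightarrow> 0 \<le> b \<Longrightarrow> a * b \<le> a\<^sup>2 + (b :: real)\<^sup>2"
  using sum_squares_bound[of a b] mult_nonneg_nonneg[of a b] by linarith

lemma square_integrable_mult_norm:
  assumes "square_integrable f" "square_integrable g"
  shows "integrable lebesgue (\<lambda>x. norm (f x) * norm (g x))"
proof (rule Bochner_Integration.integrable_bound)
  show "integrable lebesgue (\<lambda>x. (norm (f x))\<^sup>2 + (norm (g x))\<^sup>2)" using assms unfolding square_integrable_def by auto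
  show "(\<lambda>x. norm (f x) * norm (g x)) \<in> borel_measurable lebesgue" using assms unfolding square_integrable_def by auto
  show "AE x in lebesgue. norm (norm (f x) * norm (g x)) \<le> norm ((norm (f x))\<^sup>2 + (norm (g x))\<^sup>2)"
  proof (intro AE_I2)
    fix x
    have "norm (f x) * norm (g x) \<le> (norm (f x))\<^sup>2 + (norm (g x))\<^sup>2" by (rule mult_le_sum_squares) auto
    then show "norm (norm (f x) * norm (g x)) \<le> norm ((norm (f x))\<^sup>2 + (norm (g x))\<^sup>2)" by simp
  qed
qed

lemma square_integrable_inner:
  assumes "square_integrable f" "square_integrable g"
  shows "integrable lebesgue (\<lambda>x. inner (f x) (g x))"
  by (rule Bochner_Integration.integrable_bound[OF square_integrable_mult_norm[OF assms]])
    (use assms in \<open>auto simp: square_integrable_def Cauchy_Schwarz_ineq2\<close>)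

lemma square_integrable_bound:
  assumes "square_integrable g" "f \<in> borel_measurable lebesgue" "\<And>x. norm (f x) \<le> C * norm (g x)"
  shows "square_integrable f" unfolding square_integrable_def
proof
  show "integrable lebesgue (\<lambda>x. (norm (f x))\<^sup>2)"
  proof (rule Bochner_Integration.integrable_bound[of _ "\<lambda>x. C\<^sup>2 * (norm (g x))\<^sup>2"])
    show "integrable lebesgue (\<lambda>x. C\<^sup>2 * (norm (g x))\<^sup>2)"
      using assms(1) unfolding square_integrable_def by (intro integrable_mult_right) blast
    show "(\<lambda>x. (norm (f x))\<^sup>2) \<in> borel_measurable lebesgue" using assms(2) by measurable
    show "AE x in lebesgue. norm ((norm (f x))\<^sup>2) \<le> norm (C\<^sup>2 * (norm (g x))\<^sup>2)"
    proof (intro AE_I2)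
      fix x
      have "(norm (f x))\<^sup>2 \<le> (C * norm (g x))\<^sup>2" using assms(3)[of x] by (intro power_mono) auto
      then show "norm ((norm (f x))\<^sup>2) \<le> norm (C\<^sup>2 * (norm (g x))\<^sup>2)" by (simp add: power_mult_distrib)
    qed
  qed
qed (rule assms(2))

lemma square_integrable_scaleC: "square_integrable f \<Longrightarrow> square_integrable (\<lambda>x. c *\<^sub>C f x)"
  by (rule square_integrable_bound[of f _ "cmod c"]) (auto simp: norm_scaleC square_integrable_def)

lemma square_integrable_uminus: "square_integrable f \<Longrightarrow> square_integrable (\<lambda>x. - f x)"
  using square_integrable_scaleC[of f "-1"] by (simp add: scaleC_minus_left scaleC_one)

lemma square_integrable_add:
  assumes "square_integrable f" "square_integrable g"
  shows "square_integrable (\<lambda>x. f x + g x)"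
proof -
  have "integrable lebesgue (\<lambda>x. (norm (f x))\<^sup>2 + 2 * inner (f x) (g x) + (norm (g x))\<^sup>2)"
    using assms square_integrable_inner[OF assms] unfolding square_integrable_def
    by (intro Bochner_Integration.integrable_add integrable_mult_right) auto
  moreover have "(norm (f x + g x))\<^sup>2 = (norm (f x))\<^sup>2 + 2 * inner (f x) (g x) + (norm (g x))\<^sup>2" for x
    by (simp add: power2_norm_eq_inner inner_add_left inner_add_right inner_commute)
  ultimately show ?thesis using assms unfolding square_integrable_def by (auto intro: borel_measurable_add)
qed

lemma square_integrable_cong_AE:
  assumes "square_integrable f" "g \<in> borel_measurable lebesgue" "AE x in lebesgue. f x = g x"
  shows "square_integrable g"
proof -
  have "integrable lebesgue (\<lambda>x. (norm (g x))\<^sup>2) \<longleftrightarrow> integrable lebesgue (\<lambda>x. (norm (f x))\<^sup>2)"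
    using assms by (intro integrable_cong_AE) (auto simp: square_integrable_def elim!: eventually_mono)
  then show ?thesis using assms unfolding square_integrable_def by simp
qed

definition L2_eq :: "(real^'n::finite \<Rightarrow> 'e::complex_euclidean_space) \<Rightarrow> (real^'n \<Rightarrow> 'e) \<Rightarrow> bool" where
  "L2_eq f g \<longleftrightarrow> square_integrable f \<and> square_integrable g \<and> (AE x in lebesgue. f x = g x)"

lemma square_integrable_zero: "square_integrable (\<lambda>x. 0)" by (simp add: square_integrable_def)

\<comment> \<open>A type of square integrable functions modulo null sets gives access to the type
  classes of Hilbert spaces. The quotient is partial, because only square integrable functions have
  a class.\<close>
quotient_type (overloaded) ('n, 'e) l2 = "real^'n::finite \<Rightarrow> 'e::complex_euclidean_space" / partial: L2_eq
proof (rule part_equivpI)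
  show "\<exists>f. L2_eq f f" using square_integrable_zero by (auto simp: L2_eq_def)
  show "symp L2_eq" by (rule sympI) (auto simp: L2_eq_def eq_commute elim: eventually_mono)
  show "transp L2_eq"
  proof (rule transpI)
    fix f g h assume *: "L2_eq f g" "L2_eq g h"
    then have "AE x in lebesgue. f x = g x" "AE x in lebesgue. g x = h x" by (auto simp: L2_eq_def)
    then have "AE x in lebesgue. f x = h x" by eventually_elim simp
    then show "L2_eq f h" using * by (simp add: L2_eq_def)
  qed
qed

lemma L2_eq_self: "L2_eq f f \<longleftrightarrow> square_integrable f" by (simp add: L2_eq_def)

instantiation l2 :: (finite, complex_euclidean_space) "{complex_vector, real_inner}"
begin

lift_definition zero_l2 :: "('a, 'b) l2" is "\<lambda>x. 0" by (simp add: L2_eq_def square_integrable_zero)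

lift_definition plus_l2 :: "('a, 'b) l2 \<Rightarrow> ('a, 'b) l2 \<Rightarrow> ('a, 'b) l2" is "\<lambda>f g x. f x + g x"
  by (auto simp: L2_eq_def intro: square_integrable_add)

lift_definition scaleC_l2 :: "complex \<Rightarrow> ('a, 'b) l2 \<Rightarrow> ('a, 'b) l2" is "\<lambda>c f x. c *\<^sub>C f x"
  by (auto simp: L2_eq_def intro: square_integrable_scaleC elim!: eventually_mono)

lift_definition inner_l2 :: "('a, 'b) l2 \<Rightarrow> ('a, 'b) l2 \<Rightarrow> real" is "\<lambda>f g. LINT x|lebesgue. inner (f x) (g x)"
  by (rule integral_cong_AE) (auto simp: L2_eq_def square_integrable_def)

definition "uminus_l2 (a :: ('a, 'b) l2) = (-1) *\<^sub>C a"
definition "minus_l2 (a :: ('a, 'b) l2) b = a + (-1) *\<^sub>C b"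
definition "scaleR_l2 r (a :: ('a, 'b) l2) = complex_of_real r *\<^sub>C a"
definition "norm_l2 (a :: ('a, 'b) l2) = sqrt (inner a a)"
definition "dist_l2 (a :: ('a, 'b) l2) b = norm (a - b)"
definition "sgn_l2 (a :: ('a, 'b) l2) = inverse (norm a) *\<^sub>R a"
definition "uniformity_l2 = (INF e\<in>{0 <..}. principal {(x :: ('a, 'b) l2, y). dist x y < e})"
definition "open_l2 (U :: ('a, 'b) l2 set) \<longleftrightarrow> (\<forall>x\<in>U. eventually (\<lambda>(x', y). x' = x \<longrightarrow> y \<in> U) uniformity)"

lemma l2_cases: obtains f where "square_integrable f" "(a :: ('a, 'b) l2) = abs_l2 f"
  using l2.abs_induct[of "\<lambda>a. \<exists>f. square_integrable f \<and> a = abs_l2 f" a] by (auto simp: L2_eq_def)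

lemma add_abs_l2: "square_integrable f \<Longrightarrow> square_integrable g \<Longrightarrow> abs_l2 f + abs_l2 g = abs_l2 (\<lambda>x. f x + (g x :: 'b))"
  by (simp add: plus_l2.abs_eq L2_eq_self)

lemma scaleC_abs_l2: "square_integrable f \<Longrightarrow> c *\<^sub>C abs_l2 f = abs_l2 (\<lambda>x. c *\<^sub>C (f x :: 'b))"
  by (simp add: scaleC_l2.abs_eq L2_eq_self)

lemma inner_abs_l2: "square_integrable f \<Longrightarrow> square_integrable g \<Longrightarrow>
    inner (abs_l2 f) (abs_l2 g) = (LINT x|lebesgue. inner (f x) (g x :: 'b))" by (simp add: inner_l2.abs_eq L2_eq_self)

lemma abs_l2_eq_iff: "square_integrable f \<Longrightarrow> square_integrable g \<Longrightarrow>
    abs_l2 f = abs_l2 g \<longleftrightarrow> (AE x in lebesgue. f x = (g x :: 'b))"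
  using Quotient3_rel[OF Quotient3_l2, of f g] by (simp add: L2_eq_def)

lemma abs_l2_eqI: "(\<And>x. f x = g x) \<Longrightarrow> abs_l2 f = abs_l2 g" by (rule arg_cong[of f g abs_l2]) auto

lemma diff_abs_l2:
  assumes "square_integrable f" "square_integrable g"
  shows "abs_l2 f - abs_l2 g = abs_l2 (\<lambda>x. f x - (g x :: 'b))"
proof -
  have "abs_l2 f - abs_l2 g = abs_l2 (\<lambda>x. f x + (-1) *\<^sub>C g x)"
    unfolding minus_l2_def by (simp only: assms scaleC_abs_l2 add_abs_l2 square_integrable_scaleC)
  then show ?thesis by (simp add: scaleC_minus_left scaleC_one)
qed

lemmas l2_simps = add_abs_l2 scaleC_abs_l2 inner_abs_l2 square_integrable_add square_integrable_scaleC

instance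
proof
  fix a b c :: "('a, 'b) l2" and r s :: real and y z :: complex
  obtain f g h where f: "square_integrable f" "a = abs_l2 f" and g: "square_integrable g" "b = abs_l2 g"
    and h: "square_integrable h" "c = abs_l2 h" by (metis l2_cases)
  note fgh = f(2) g(2) h(2)
  note si = f(1) g(1) h(1)
  show "a + b + c = a + (b + c)" unfolding fgh by (simp add: l2_simps si add.assoc)
  show "a + b = b + a" unfolding fgh by (simp add: l2_simps si add.commute)
  show "0 + a = a" unfolding fgh zero_l2_def by (simp add: l2_simps si square_integrable_zero)
  show "- a + a = 0" unfolding fgh zero_l2_def uminus_l2_def by (simp add: l2_simps si scaleC_minus_left scaleC_one square_integrable_uminus)
  show "a - b = a + - b" by (simp add: minus_l2_def uminus_l2_def)
  show "y *\<^sub>C (a + b) = y *\<^sub>C a + y *\<^sub>C b" unfolding fgh by (simp add: l2_simps si scaleC_add_right)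
  show "(y + z) *\<^sub>C a = y *\<^sub>C a + z *\<^sub>C a" unfolding fgh by (simp add: l2_simps si scaleC_add_left)
  show "y *\<^sub>C z *\<^sub>C a = (y * z) *\<^sub>C a" unfolding fgh by (simp add: l2_simps si scaleC_scaleC)
  show s1: "1 *\<^sub>C a = a" unfolding fgh by (simp add: l2_simps si scaleC_one)
  show "r *\<^sub>R (a + b) = r *\<^sub>R a + r *\<^sub>R b" unfolding fgh scaleR_l2_def by (simp add: l2_simps si scaleC_add_right)
  show "(r + s) *\<^sub>R a = r *\<^sub>R a + s *\<^sub>R a" unfolding fgh scaleR_l2_def by (simp add: l2_simps si scaleC_add_left)
  show "r *\<^sub>R s *\<^sub>R a = (r * s) *\<^sub>R a" unfolding fgh scaleR_l2_def by (simp add: l2_simps si scaleC_scaleC)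
  show "1 *\<^sub>R a = a" by (simp add: scaleR_l2_def s1)
  show "dist a b = norm (a - b)" by (rule dist_l2_def)
  show "sgn a = inverse (norm a) *\<^sub>R a" by (rule sgn_l2_def)
  show "uniformity = (INF e\<in>{0<..}. principal {(x :: ('a, 'b) l2, y). dist x y < e})" by (rule uniformity_l2_def)
  show "open U \<longleftrightarrow> (\<forall>x\<in>U. eventually (\<lambda>(x', y). x' = x \<longrightarrow> y \<in> U) uniformity)" for U :: "('a, 'b) l2 set"
    by (rule open_l2_def)
  show "inner a b = inner b a" unfolding fgh by (simp add: l2_simps si inner_commute)
  show "inner (a + b) c = inner a c + inner b c" unfolding fgh by (simp add: l2_simps si inner_add_left square_integrable_inner)
  show "inner (r *\<^sub>R a) b = r * inner a b" unfolding fgh scaleR_l2_def by (simp only: l2_simps si) (simp add: scaleC_complex_of_real)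
  show "0 \<le> inner a a" unfolding fgh by (simp add: l2_simps si)
  show "inner a a = 0 \<longleftrightarrow> a = 0" unfolding fgh zero_l2_def using si(1) square_integrable_inner[OF si(1) si(1)]
    by (simp add: l2_simps abs_l2_eq_iff square_integrable_zero integral_nonneg_eq_0_iff_AE)
  show "norm a = sqrt (inner a a)" by (rule norm_l2_def)
qed

end

instance l2 :: (finite, complex_euclidean_space) complex_hilbert
proof
  fix a b :: "('a, 'b) l2" and r :: real and y :: complex
  obtain f g where fg: "square_integrable f" "a = abs_l2 f" "square_integrable g" "b = abs_l2 g" by (metis l2_cases)
  show "complex_of_real r *\<^sub>C a = r *\<^sub>R a" by (simp add: scaleR_l2_def)
  show "inner (y *\<^sub>C a) b = inner a (cnj y *\<^sub>C b)" unfolding fg by (simp add: l2_simps fg inner_scaleC_left)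
next
  fix X :: "nat \<Rightarrow> ('a, 'b) l2" assume "Cauchy X"
  have ex: "\<forall>n. \<exists>N. \<forall>i\<ge>N. \<forall>j\<ge>N. dist (X i) (X j) < (1/2) ^ n"
    using \<open>Cauchy X\<close> unfolding Cauchy_def by (metis half_gt_zero_iff zero_less_one zero_less_power)
  then obtain N where N: "\<And>n i j. i \<ge> N n \<Longrightarrow> j \<ge> N n \<Longrightarrow> dist (X i) (X j) < (1/2) ^ n" by metis
  \<comment> \<open>The partial sum is at least \<open>N i\<close> for every
    \<open>i \<le> n\<close>, whatever the order of the values of \<open>N\<close>.\<close>
  define r where "r n = (\<Sum>i\<le>n. N i)" for n
  have r: "r m \<ge> N n" if "m \<ge> n" for m n unfolding r_def using member_le_sum[of n "{..m}" N] that by simp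
  have rd: "dist (X (r i)) (X (r j)) < (1/2) ^ n" if "i \<ge> n" "j \<ge> n" for i j n using N r that by blast
  have "\<forall>n. \<exists>f. square_integrable f \<and> X (r n) = abs_l2 f" by (metis l2_cases)
  then obtain f where f: "\<And>n. square_integrable (f n)" "\<And>n. X (r n) = abs_l2 (f n)" by metis
  have fm[measurable]: "f n \<in> borel_measurable lebesgue" for n using f(1)[of n] by (simp add: square_integrable_def)
  have sd: "square_integrable (\<lambda>x. f i x - f j x)" for i j
    using square_integrable_add[OF f(1) square_integrable_uminus[OF f(1)], of i j] by simp
  have dd: "(\<integral>\<^sup>+x. ennreal ((norm (f i x - f j x))\<^sup>2) \<partial>lebesgue) = ennreal ((dist (X (r i)) (X (r j)))\<^sup>2)" for i j
  proof -
    have "X (r i) - X (r j) = abs_l2 (\<lambda>x. f i x - f j x)" unfolding f(2) by (rule diff_abs_l2[OF f(1) f(1)])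
    then have "(dist (X (r i)) (X (r j)))\<^sup>2 = (LINT x|lebesgue. (norm (f i x - f j x))\<^sup>2)"
      by (simp add: dist_l2_def norm_l2_def l2_simps sd power2_norm_eq_inner)
    then show ?thesis using sd[of i j] unfolding square_integrable_def by (subst nn_integral_eq_integral) auto
  qed
  let ?g = "\<lambda>n x. norm (f (Suc n) x - f n x)"
  \<comment> \<open>The weight \<open>2 ^ n\<close> is affordable, since the integral of the square
    of \<open>?g n\<close> is at most \<open>(1/4) ^ n\<close>. For almost every \<open>x\<close> it
    makes \<open>?g n x\<close> of order 2^(-n/2), so that the telescoping series converges.\<close>
  have "(\<integral>\<^sup>+x. (\<Sum>n. ennreal (2 ^ n * (?g n x)\<^sup>2)) \<partial>lebesgue) = (\<Sum>n. (\<integral>\<^sup>+x. ennreal (2 ^ n * (?g n x)\<^sup>2) \<partial>lebesgue))"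
    by (rule nn_integral_suminf) measurable
  also have "\<dots> \<le> (\<Sum>n. ennreal ((1/2) ^ n))"
  proof (intro suminf_le allI)
    fix n
    have "(\<integral>\<^sup>+x. ennreal (2 ^ n * (?g n x)\<^sup>2) \<partial>lebesgue) = ennreal (2 ^ n) * (\<integral>\<^sup>+x. ennreal ((?g n x)\<^sup>2) \<partial>lebesgue)"
      by (subst nn_integral_cmult[symmetric]) (auto simp: ennreal_mult')
    also have "\<dots> = ennreal (2 ^ n * (dist (X (r (Suc n))) (X (r n)))\<^sup>2)" by (simp add: dd ennreal_mult')
    also have "\<dots> \<le> ennreal ((1/2) ^ n)"
    proof (rule ennreal_leI)
      have "dist (X (r (Suc n))) (X (r n)) \<le> (1/2) ^ n" using rd[of n "Suc n" n] by simp
      then have "(dist (X (r (Suc n))) (X (r n)))\<^sup>2 \<le> ((1/2) ^ n)\<^sup>2" by (intro power_mono) (auto simp: dist_l2_def norm_l2_def)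
      then have "2 ^ n * (dist (X (r (Suc n))) (X (r n)))\<^sup>2 \<le> 2 ^ n * ((1/2) ^ n)\<^sup>2" by (intro mult_left_mono) auto
      also have "\<dots> = (1/2) ^ n" by (simp add: power2_eq_square power_one_over)
      finally show "2 ^ n * (dist (X (r (Suc n))) (X (r n)))\<^sup>2 \<le> (1/2) ^ n" .
    qed
    finally show "(\<integral>\<^sup>+x. ennreal (2 ^ n * (?g n x)\<^sup>2) \<partial>lebesgue) \<le> ennreal ((1/2) ^ n)" .
  qed auto
  also have "\<dots> < \<infinity>" by (subst suminf_ennreal2) (auto simp: summable_geometric)
  finally have "AE x in lebesgue. (\<Sum>n. ennreal (2 ^ n * (?g n x)\<^sup>2)) \<noteq> \<infinity>" by (intro nn_integral_PInf_AE) auto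
  then have conv: "AE x in lebesgue. convergent (\<lambda>n. f n x)"
  proof eventually_elim
    case (elim x)
    have "summable (\<lambda>n. 2 ^ n * (?g n x)\<^sup>2)" using elim by (intro summable_suminf_not_top) auto
    then have "bounded (range (\<lambda>n. 2 ^ n * (?g n x)\<^sup>2))" using summable_LIMSEQ_zero convergent_imp_bounded by blast
    then obtain C where C: "C > 0" "\<And>n. 2 ^ n * (?g n x)\<^sup>2 \<le> C" unfolding bounded_pos by fastforce
    have "summable (\<lambda>n. f (Suc n) x - f n x)"
    proof (rule summable_comparison_test')
      show "summable (\<lambda>n. sqrt C * (sqrt (1/2)) ^ n)" by (intro summable_mult summable_geometric) (simp add: real_sqrt_divide)
      fix n
      have "(?g n x)\<^sup>2 \<le> C * (1/2) ^ n" using C(2)[of n] by (simp add: field_simps)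
      then have "sqrt ((?g n x)\<^sup>2) \<le> sqrt (C * (1/2) ^ n)" by (rule real_sqrt_le_mono)
      then show "norm (f (Suc n) x - f n x) \<le> sqrt C * (sqrt (1/2)) ^ n" by (simp add: real_sqrt_mult real_sqrt_power)
    qed
    then have "convergent (\<lambda>n. \<Sum>i<n. f (Suc i) x - f i x)" by (simp add: summable_iff_convergent)
    then have "convergent (\<lambda>n. f n x - f 0 x)" using sum_lessThan_telescope[of "\<lambda>n. f n x"] by simp
    then have "convergent (\<lambda>n. (f n x - f 0 x) + f 0 x)" by (intro convergent_add convergent_const)
    then show ?case by simp
  qed
  define g where "g x = lim (\<lambda>n. f n x)" for x
  have gm[measurable]: "g \<in> borel_measurable lebesgue" unfolding g_def[abs_def] by (rule borel_measurable_lim_metric) measurable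
  \<comment> \<open>Fatou's lemma transfers the Cauchy estimate to the pointwise limit.\<close>
  have fat: "(\<integral>\<^sup>+x. ennreal ((norm (g x - f m x))\<^sup>2) \<partial>lebesgue) \<le> ennreal (((1/2) ^ m)\<^sup>2)" for m
  proof -
    have "(\<integral>\<^sup>+x. ennreal ((norm (g x - f m x))\<^sup>2) \<partial>lebesgue) = (\<integral>\<^sup>+x. liminf (\<lambda>n. ennreal ((norm (f n x - f m x))\<^sup>2)) \<partial>lebesgue)"
    proof (rule nn_integral_cong_AE)
      show "AE x in lebesgue. ennreal ((norm (g x - f m x))\<^sup>2) = liminf (\<lambda>n. ennreal ((norm (f n x - f m x))\<^sup>2))" using conv
      proof eventually_elim
        case (elim x)
        then have "(\<lambda>n. f n x) \<longlonglongrightarrow> g x" by (simp add: g_def convergent_LIMSEQ_iff)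
        then have "(\<lambda>n. ennreal ((norm (f n x - f m x))\<^sup>2)) \<longlonglongrightarrow> ennreal ((norm (g x - f m x))\<^sup>2)"
          by (intro tendsto_intros tendsto_ennrealI)
        then show ?case using lim_imp_Liminf[OF sequentially_bot] by metis
      qed
    qed
    also have "\<dots> \<le> liminf (\<lambda>n. (\<integral>\<^sup>+x. ennreal ((norm (f n x - f m x))\<^sup>2) \<partial>lebesgue))"
      by (rule nn_integral_liminf) measurable
    also have "\<dots> \<le> ennreal (((1/2) ^ m)\<^sup>2)"
    proof (rule Liminf_le)
      show "\<forall>\<^sub>F n in sequentially. (\<integral>\<^sup>+x. ennreal ((norm (f n x - f m x))\<^sup>2) \<partial>lebesgue) \<le> ennreal (((1/2) ^ m)\<^sup>2)"
        using eventually_ge_at_top[of m]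
      proof eventually_elim
        case (elim n)
        then have "dist (X (r n)) (X (r m)) \<le> (1/2) ^ m" using rd[of m n m] by simp
        then have "(dist (X (r n)) (X (r m)))\<^sup>2 \<le> ((1/2) ^ m)\<^sup>2" by (intro power_mono) (auto simp: dist_l2_def norm_l2_def)
        then show ?case unfolding dd by (rule ennreal_leI)
      qed
    qed simp
    finally show ?thesis .
  qed
  have gf: "square_integrable (\<lambda>x. g x - f m x)" for m unfolding square_integrable_def integrable_iff_bounded
    using fat[of m] by (auto intro: le_less_trans[OF _ ennreal_less_top])
  have g: "square_integrable g" using square_integrable_add[OF gf f(1), of 0 0] by simp
  have dl: "dist (X (r m)) (abs_l2 g) \<le> (1/2) ^ m" for m
  proof -
    have fg: "square_integrable (\<lambda>x. f m x - g x)" using square_integrable_uminus[OF gf[of m]] by simp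
    have "X (r m) - abs_l2 g = abs_l2 (\<lambda>x. f m x - g x)" unfolding f(2) by (rule diff_abs_l2[OF f(1) g])
    then have d2: "(dist (X (r m)) (abs_l2 g))\<^sup>2 = (LINT x|lebesgue. (norm (f m x - g x))\<^sup>2)"
      by (simp add: dist_l2_def norm_l2_def l2_simps fg power2_norm_eq_inner)
    have "ennreal ((dist (X (r m)) (abs_l2 g))\<^sup>2) = (\<integral>\<^sup>+x. ennreal ((norm (f m x - g x))\<^sup>2) \<partial>lebesgue)"
      unfolding d2 using fg unfolding square_integrable_def by (subst nn_integral_eq_integral) auto
    also have "\<dots> \<le> ennreal (((1/2) ^ m)\<^sup>2)" using fat[of m] by (simp add: norm_minus_commute)
    finally have "(dist (X (r m)) (abs_l2 g))\<^sup>2 \<le> ((1/2) ^ m)\<^sup>2" by (simp add: ennreal_le_iff)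
    then show ?thesis by (rule power2_le_imp_le) simp
  qed
  have "(\<lambda>n. X n) \<longlonglongrightarrow> abs_l2 g"
  proof (rule metric_LIMSEQ_I)
    fix e :: real assume "e > 0"
    obtain m where m: "(1/2) ^ m < e / 2" using real_arch_pow_inv[of "e/2" "1/2"] \<open>e > 0\<close> by auto
    have "dist (X n) (abs_l2 g) < e" if "n \<ge> N m" for n
      using N[OF that r[of m m]] dl[of m] m dist_triangle[of "X n" "abs_l2 g" "X (r m)"] by linarith
    then show "\<exists>no. \<forall>n\<ge>no. dist (X n) (abs_l2 g) < e" by blast
  qed
  then show "convergent X" by (auto simp: convergent_def)
qed

section \<open>Weighted square integrable functions\<close>

definition wt :: "real^'n::finite \<Rightarrow> real" where "wt \<xi> = 1 + (norm \<xi>)\<^sup>2"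

lemma wt_ge_1: "wt \<xi> \<ge> 1" and wt_pos: "wt \<xi> > 0" and wt_nonzero: "wt \<xi> \<noteq> 0"
  by (simp_all add: wt_def add_pos_nonneg) (smt (verit) zero_le_power2)

lemma wt_powr_measurable: "(\<lambda>\<xi>. wt \<xi> powr s) \<in> borel_measurable borel" unfolding wt_def by measurable

lemma wt_powr_measurable' [measurable]: "(\<lambda>\<xi>. wt \<xi> powr s) \<in> borel_measurable lebesgue"
  by (simp add: measurable_completion wt_powr_measurable)

lemma wt_powr_le: "wt \<xi> powr s \<le> (1 + norm \<xi>) ^ (2 * nat \<lceil>\<bar>s\<bar>\<rceil>)"
proof -
  have "s \<le> real (nat \<lceil>\<bar>s\<bar>\<rceil>)" by linarith
  then have "wt \<xi> powr s \<le> wt \<xi> powr real (nat \<lceil>\<bar>s\<bar>\<rceil>)" by (intro powr_mono wt_ge_1)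
  also have "\<dots> = wt \<xi> ^ nat \<lceil>\<bar>s\<bar>\<rceil>" by (rule powr_realpow[OF wt_pos])
  also have "\<dots> \<le> ((1 + norm \<xi>)\<^sup>2) ^ nat \<lceil>\<bar>s\<bar>\<rceil>" by (intro power_mono) (auto simp: wt_def power2_sum)
  finally show ?thesis by (simp add: power_mult)
qed

lemma abs_component_le_wt: "\<bar>\<xi> $ k\<bar> \<le> wt \<xi> powr (1/2)"
proof -
  have "\<bar>\<xi> $ k\<bar> = sqrt (\<bar>\<xi> $ k\<bar>\<^sup>2)" by simp
  also have "\<dots> \<le> sqrt (wt \<xi>)"
    unfolding wt_def using power_mono[OF component_le_norm_cart[of \<xi> k], of 2] by (intro real_sqrt_le_mono) simp
  also have "\<dots> = wt \<xi> powr (1/2)" using wt_pos[of \<xi>] by (simp add: powr_half_sqrt)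
  finally show ?thesis .
qed

definition weighted :: "real \<Rightarrow> (real^'n::finite \<Rightarrow> 'e::complex_euclidean_space) \<Rightarrow> bool" where
  "weighted s g \<longleftrightarrow> g \<in> borel_measurable lebesgue \<and> integrable lebesgue (\<lambda>\<xi>. wt \<xi> powr s * (norm (g \<xi>))\<^sup>2)"

lemma norm_wt_scale: "(norm (wt \<xi> powr (s/2) *\<^sub>R v))\<^sup>2 = wt \<xi> powr s * (norm v)\<^sup>2"
proof -
  have "(wt \<xi> powr (s/2))\<^sup>2 = wt \<xi> powr s" by (simp add: power2_eq_square powr_add[symmetric])
  then show ?thesis by (simp add: power_mult_distrib)
qed

lemma weighted_iff: "weighted s g \<longleftrightarrow> square_integrable (\<lambda>\<xi>. wt \<xi> powr (s/2) *\<^sub>R g \<xi>)"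
proof -
  have "g \<in> borel_measurable lebesgue" if "(\<lambda>\<xi>. wt \<xi> powr (s/2) *\<^sub>R g \<xi>) \<in> borel_measurable lebesgue"
  proof -
    have "(\<lambda>\<xi>. wt \<xi> powr (- s/2) *\<^sub>R wt \<xi> powr (s/2) *\<^sub>R g \<xi>) \<in> borel_measurable lebesgue"
      by (intro borel_measurable_scaleR that) measurable
    then show ?thesis by (simp add: powr_add[symmetric] wt_nonzero)
  qed
  moreover have "(\<lambda>\<xi>. wt \<xi> powr (s/2) *\<^sub>R g \<xi>) \<in> borel_measurable lebesgue" if "g \<in> borel_measurable lebesgue"
    by (rule borel_measurable_scaleR[OF wt_powr_measurable' that])
  ultimately show ?thesis unfolding weighted_def square_integrable_def norm_wt_scale by blast
qed

lemma weighted_zero_iff: "weighted 0 g \<longleftrightarrow> square_integrable g" by (simp add: weighted_iff wt_nonzero)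

lemma weighted_bound:
  assumes "weighted s g" "f \<in> borel_measurable lebesgue" "\<And>\<xi>. norm (f \<xi>) \<le> C * wt \<xi> powr ((s - t)/2) * norm (g \<xi>)"
  shows "weighted t f" unfolding weighted_iff
proof (rule square_integrable_bound)
  show "square_integrable (\<lambda>\<xi>. wt \<xi> powr (s/2) *\<^sub>R g \<xi>)" using assms(1) by (simp add: weighted_iff)
  show "(\<lambda>\<xi>. wt \<xi> powr (t/2) *\<^sub>R f \<xi>) \<in> borel_measurable lebesgue" using assms(2) by measurable
  fix \<xi>
  have "norm (wt \<xi> powr (t/2) *\<^sub>R f \<xi>) \<le> wt \<xi> powr (t/2) * (C * wt \<xi> powr ((s - t)/2) * norm (g \<xi>))"
    using assms(3)[of \<xi>] by (simp add: mult_left_mono)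
  also have "\<dots> = C * (wt \<xi> powr (t/2) * wt \<xi> powr ((s - t)/2)) * norm (g \<xi>)" by (simp only: mult_ac)
  also have "wt \<xi> powr (t/2) * wt \<xi> powr ((s - t)/2) = wt \<xi> powr (s/2)" by (simp add: powr_add[symmetric] diff_divide_distrib)
  finally show "norm (wt \<xi> powr (t/2) *\<^sub>R f \<xi>) \<le> C * norm (wt \<xi> powr (s/2) *\<^sub>R g \<xi>)" by simp
qed

lemma weighted_mono:
  fixes g :: "real^'n::finite \<Rightarrow> 'e::complex_euclidean_space"
  shows "weighted s g \<Longrightarrow> t \<le> s \<Longrightarrow> weighted t g"
proof (rule weighted_bound[of s g g 1 t])
  fix \<xi> :: "real^'n" assume "t \<le> s"
  then have "1 \<le> wt \<xi> powr ((s - t)/2)" using wt_ge_1[of \<xi>] by (intro ge_one_powr_ge_zero) auto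
  then show "norm (g \<xi>) \<le> 1 * wt \<xi> powr ((s - t)/2) * norm (g \<xi>)" using mult_right_mono[OF _ norm_ge_zero[of "g \<xi>"]] by fastforce
qed (simp_all add: weighted_def)

lemma weighted_add: "weighted s f \<Longrightarrow> weighted s g \<Longrightarrow> weighted s (\<lambda>\<xi>. f \<xi> + g \<xi>)"
  unfolding weighted_iff scaleR_add_right by (rule square_integrable_add)

lemma weighted_linear:
  assumes "weighted s g" "linear A" shows "weighted s (\<lambda>\<xi>. A (g \<xi>))"
proof -
  have b: "bounded_linear A" using \<open>linear A\<close> by (simp add: linear_conv_bounded_linear)
  obtain C where "\<And>x. norm (A x) \<le> norm x * C" using bounded_linear.bounded[OF b] by blast
  moreover have "(\<lambda>\<xi>. A (g \<xi>)) \<in> borel_measurable lebesgue"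
    using assms(1) linear_continuous_on[OF b] by (intro borel_measurable_continuous_on[of A]) (auto simp: weighted_def)
  ultimately show ?thesis by (intro weighted_bound[OF assms(1), of _ C]) (auto simp: wt_nonzero mult.commute)
qed

lemma schwartz_lebesgue_measurable: "schwartz \<phi> \<Longrightarrow> \<phi> \<in> borel_measurable lebesgue"
  by (simp add: measurable_completion schwartz_measurable)

lemma integrable_lebesgue_iff: "f \<in> borel_measurable borel \<Longrightarrow> integrable lebesgue f \<longleftrightarrow> integrable lborel f"
  for f :: "'a::euclidean_space \<Rightarrow> 'b::{banach,second_countable_topology}" by (rule integrable_completion) simp

lemma schwartz_weighted_integrable:
  fixes \<phi> :: "real^'n::finite \<Rightarrow> complex"
  assumes \<phi>: "schwartz \<phi>"
  shows "integrable lebesgue (\<lambda>\<xi>. wt \<xi> powr s * (norm (\<phi> \<xi>))\<^sup>2)"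
proof -
  let ?k = "2 * nat \<lceil>\<bar>s\<bar>\<rceil>"
  note [measurable] = schwartz_measurable[OF \<phi>] wt_powr_measurable
  obtain C where C: "C \<ge> 0" "\<And>x. norm (\<phi> x) \<le> C" using rapidI_nonneg[OF schwartz_rapid[OF \<phi>], of 0] by auto
  have "rapid (\<lambda>x::real^'n. complex_of_real ((1 + norm x) ^ ?k) * \<phi> x)"
    by (intro rapid_moderate_mult schwartz_rapid \<phi>) (unfold moderate_def, intro exI[of _ ?k] exI[of _ 1], simp only: norm_of_real, simp)
  then have "integrable lborel (\<lambda>x. complex_of_real ((1 + norm x) ^ ?k) * \<phi> x)" by (rule rapid_integrable) measurable
  then have "integrable lborel (\<lambda>x. C * norm (complex_of_real ((1 + norm x) ^ ?k) * \<phi> x))"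
    by (intro integrable_mult_right integrable_norm)
  then have "integrable lborel (\<lambda>\<xi>. wt \<xi> powr s * (norm (\<phi> \<xi>))\<^sup>2)"
  proof (rule Bochner_Integration.integrable_bound)
    show "AE x in lborel. norm (wt x powr s * (norm (\<phi> x))\<^sup>2) \<le> norm (C * norm (complex_of_real ((1 + norm x) ^ ?k) * \<phi> x))"
    proof (intro AE_I2)
      fix x
      have "wt x powr s * (norm (\<phi> x) * norm (\<phi> x)) \<le> (1 + norm x) ^ ?k * (C * norm (\<phi> x))"
        using C wt_powr_le[of x s] by (intro mult_mono) auto
      moreover have "norm (complex_of_real ((1 + norm x) ^ ?k)) = (1 + norm x) ^ ?k" by (simp only: norm_of_real) simp
      then have "norm (complex_of_real ((1 + norm x) ^ ?k) * \<phi> x) = (1 + norm x) ^ ?k * norm (\<phi> x)" by (simp only: norm_mult)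
      ultimately show "norm (wt x powr s * (norm (\<phi> x))\<^sup>2) \<le> norm (C * norm (complex_of_real ((1 + norm x) ^ ?k) * \<phi> x))"
        using C(1) by (simp add: power2_eq_square mult_ac)
    qed
  qed measurable
  then show ?thesis by (subst integrable_lebesgue_iff) measurable
qed

lemma schwartz_weighted: "schwartz \<phi> \<Longrightarrow> weighted s (\<lambda>\<xi>. \<phi> \<xi> *\<^sub>C e)"
proof -
  assume \<phi>: "schwartz \<phi>"
  have "integrable lebesgue (\<lambda>\<xi>. (norm e)\<^sup>2 * (wt \<xi> powr s * (norm (\<phi> \<xi>))\<^sup>2))"
    by (intro integrable_mult_right schwartz_weighted_integrable \<phi>)
  then show ?thesis using schwartz_lebesgue_measurable[OF \<phi>] unfolding weighted_def
    by (auto simp: norm_scaleC power_mult_distrib mult_ac intro: scaleC_measurable)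
qed

lemma schwartz_square_integrable: "schwartz \<phi> \<Longrightarrow> square_integrable (\<lambda>\<xi>. \<phi> \<xi> *\<^sub>C e)"
  using schwartz_weighted[of \<phi> 0] by (simp add: weighted_zero_iff)

text \<open>The integrand is split into wt^(-s/2) \<phi> and wt^(s/2) g, and a product of
  nonnegative numbers is at most the sum of their squares.\<close>

lemma weighted_pairing_bound:
  assumes g: "weighted s g" and \<phi>: "schwartz \<phi>"
  shows "integrable lebesgue (\<lambda>\<xi>. \<phi> \<xi> *\<^sub>C g \<xi>)"
proof (rule Bochner_Integration.integrable_bound)
  show "integrable lebesgue (\<lambda>\<xi>. wt \<xi> powr (-s) * (norm (\<phi> \<xi>))\<^sup>2 + wt \<xi> powr s * (norm (g \<xi>))\<^sup>2)"
    using g schwartz_weighted_integrable[OF \<phi>, of "-s"] unfolding weighted_def by (intro Bochner_Integration.integrable_add) auto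
  show "(\<lambda>\<xi>. \<phi> \<xi> *\<^sub>C g \<xi>) \<in> borel_measurable lebesgue"
    using g schwartz_lebesgue_measurable[OF \<phi>] unfolding weighted_def by (auto intro: scaleC_measurable)
  show "AE \<xi> in lebesgue. norm (\<phi> \<xi> *\<^sub>C g \<xi>) \<le> norm (wt \<xi> powr (-s) * (norm (\<phi> \<xi>))\<^sup>2 + wt \<xi> powr s * (norm (g \<xi>))\<^sup>2)"
  proof (intro AE_I2)
    fix \<xi>
    let ?a = "wt \<xi> powr (-s/2) * norm (\<phi> \<xi>)" and ?b = "wt \<xi> powr (s/2) * norm (g \<xi>)"
    have "?a * ?b = wt \<xi> powr (-s/2) * wt \<xi> powr (s/2) * (norm (\<phi> \<xi>) * norm (g \<xi>))" by (simp only: mult_ac)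
    also have "wt \<xi> powr (-s/2) * wt \<xi> powr (s/2) = 1" by (simp add: powr_add[symmetric] wt_nonzero)
    finally have ab: "?a * ?b = norm (\<phi> \<xi> *\<^sub>C g \<xi>)" by (simp add: norm_scaleC)
    have "0 \<le> ?a * ?b" by simp
    then have "?a * ?b \<le> ?a\<^sup>2 + ?b\<^sup>2" using sum_squares_bound[of ?a ?b] by linarith
    moreover have "?a\<^sup>2 = wt \<xi> powr (-s) * (norm (\<phi> \<xi>))\<^sup>2" "?b\<^sup>2 = wt \<xi> powr s * (norm (g \<xi>))\<^sup>2"
      using norm_wt_scale[of \<xi> "-s" "\<phi> \<xi>"] norm_wt_scale[of \<xi> s "g \<xi>"] by simp_all
    ultimately show "norm (\<phi> \<xi> *\<^sub>C g \<xi>) \<le> norm (wt \<xi> powr (-s) * (norm (\<phi> \<xi>))\<^sup>2 + wt \<xi> powr s * (norm (g \<xi>))\<^sup>2)"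
      unfolding ab by simp
  qed
qed

lemma weighted_locally_integrable:
  assumes g: "weighted s g" and K: "compact K"
  shows "set_integrable lebesgue K g"
proof -
  obtain B where B: "\<And>x. x \<in> K \<Longrightarrow> norm x \<le> B" using compact_imp_bounded[OF K] unfolding bounded_iff by blast
  have Kl: "K \<in> lmeasurable" using K by (rule lmeasurable_compact)
  let ?C = "(1 + B) ^ (2 * nat \<lceil>\<bar>-s\<bar>\<rceil>)"
  show ?thesis unfolding set_integrable_def
  proof (rule Bochner_Integration.integrable_bound)
  show "integrable lebesgue (\<lambda>x. indicator K x * ?C + wt x powr s * (norm (g x))\<^sup>2)" using g Kl unfolding weighted_def
    by (intro Bochner_Integration.integrable_add integrable_mult_left) (auto simp: lmeasurable_iff_integrable)
  show "(\<lambda>x. indicator K x *\<^sub>R g x) \<in> borel_measurable lebesgue"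
    using g Kl unfolding weighted_def by (auto intro!: borel_measurable_scaleR borel_measurable_indicator)
  show "AE x in lebesgue. norm (indicator K x *\<^sub>R g x) \<le> norm (indicator K x * ?C + wt x powr s * (norm (g x))\<^sup>2)"
  proof (intro AE_I2)
    fix x
    show "norm (indicator K x *\<^sub>R g x) \<le> norm (indicator K x * ?C + wt x powr s * (norm (g x))\<^sup>2)"
    proof (cases "x \<in> K")
      case True
      let ?a = "wt x powr (-s/2)" and ?b = "wt x powr (s/2) * norm (g x)"
      have "?a * ?b = (?a * wt x powr (s/2)) * norm (g x)" by (simp only: mult_ac)
      also have "?a * wt x powr (s/2) = 1" by (simp add: powr_add[symmetric] wt_nonzero)
      finally have ab: "?a * ?b = norm (g x)" by simp
      have "0 \<le> ?a * ?b" by simp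
      then have "?a * ?b \<le> ?a\<^sup>2 + ?b\<^sup>2" using sum_squares_bound[of ?a ?b] by linarith
      moreover have "?b\<^sup>2 = wt x powr s * (norm (g x))\<^sup>2" using norm_wt_scale[of x s "g x"] by simp
      moreover have "?a\<^sup>2 \<le> ?C"
      proof -
        have "?a\<^sup>2 = wt x powr (-s)" by (simp add: power2_eq_square powr_add[symmetric])
        also have "\<dots> \<le> (1 + norm x) ^ (2 * nat \<lceil>\<bar>-s\<bar>\<rceil>)" by (rule wt_powr_le)
        also have "\<dots> \<le> ?C" using B[OF True] by (intro power_mono) auto
        finally show ?thesis .
      qed
      ultimately have "norm (g x) \<le> ?C + wt x powr s * (norm (g x))\<^sup>2" unfolding ab by linarith
      then show ?thesis using True by simp
    qed simp
  qed
  qed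
qed

lemma weighted_separate:
  assumes "weighted s g" "weighted s h"
    and "\<And>\<phi>. test_function \<phi> \<Longrightarrow> (LINT x|lebesgue. \<phi> x *\<^sub>C g x) = (LINT x|lebesgue. \<phi> x *\<^sub>C h x)"
  shows "AE x in lebesgue. g x = h x"
proof -
  have h': "weighted s (\<lambda>x. - h x)"
    using weighted_linear[OF assms(2) bounded_linear.linear[OF bounded_linear_minus[OF bounded_linear_ident]]] .
  have d: "weighted s (\<lambda>x. g x - h x)" using weighted_add[OF assms(1) h'] by simp
  have "AE x in lebesgue. g x - h x = 0"
  proof (rule test_functions_separate)
    show "set_integrable lebesgue K (\<lambda>x. g x - h x)" if "compact K" for K using weighted_locally_integrable[OF d that] .
    fix \<phi> :: "real^'a \<Rightarrow> complex" assume t: "test_function \<phi>"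
    then have "schwartz \<phi>" by (simp add: test_function_def)
    then show "(LINT x|lebesgue. \<phi> x *\<^sub>C (g x - h x)) = 0"
      using assms(3)[OF t] weighted_pairing_bound[OF assms(1)] weighted_pairing_bound[OF assms(2)]
      by (simp add: scaleC_diff_right Bochner_Integration.integral_diff)
  qed
  then show ?thesis by simp
qed

lemma integral_scaleC:
  fixes f :: "'a \<Rightarrow> 'e::complex_euclidean_space"
  assumes "integrable M f"
  shows "(LINT x|M. c *\<^sub>C f x) = c *\<^sub>C (LINT x|M. f x)" by (rule integral_bounded_linear[OF bounded_linear_scaleC_right assms])

lemma integral_linear:
  fixes f :: "'a \<Rightarrow> 'e::complex_euclidean_space" and A :: "'e \<Rightarrow> 'e"
  assumes "integrable M f" "linear A"
  shows "(LINT x|M. A (f x)) = A (LINT x|M. f x)" using assms by (intro integral_bounded_linear) (simp_all add: linear_conv_bounded_linear)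

section \<open>The Fourier transform on square integrable functions\<close>

definition schwartz_vec :: "(real^'n::finite \<Rightarrow> complex) \<Rightarrow> 'e::complex_euclidean_space \<Rightarrow> ('n, 'e) l2" where
  "schwartz_vec \<phi> e = abs_l2 (\<lambda>x. \<phi> x *\<^sub>C e)"

lemma inner_schwartz_vec:
  assumes "schwartz \<phi>" "square_integrable f"
  shows "inner (schwartz_vec \<phi> e) (abs_l2 f) = inner e (LINT x|lebesgue. cnj (\<phi> x) *\<^sub>C f x)"
proof -
  have "integrable lebesgue (\<lambda>x. cnj (\<phi> x) *\<^sub>C f x)"
    using assms weighted_pairing_bound[of 0 f "\<lambda>x. cnj (\<phi> x)"] by (simp add: weighted_zero_iff schwartz_cnj)
  then show ?thesis using assms by (simp add: schwartz_vec_def inner_abs_l2 schwartz_square_integrable inner_scaleC_left)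
qed

lemma inner_schwartz_vec2:
  assumes "schwartz \<phi>" "schwartz \<psi>"
  shows "inner (schwartz_vec \<phi> e) (schwartz_vec \<psi> e') = inner e ((LINT x|lborel. cnj (\<phi> x) * \<psi> x) *\<^sub>C e')"
proof -
  have s: "schwartz (\<lambda>x. cnj (\<phi> x) * \<psi> x)" by (intro schwartz_mult' schwartz_cnj assms)
  have "(LINT x|lebesgue. (cnj (\<phi> x) * \<psi> x) *\<^sub>C e') = (LINT x|lebesgue. cnj (\<phi> x) * \<psi> x) *\<^sub>C e'"
    using schwartz_integrable[OF s] schwartz_measurable[OF s]
    by (intro integral_bounded_linear bounded_bilinear.bounded_linear_left[OF bounded_bilinear_scaleC]) (simp add: integrable_lebesgue_iff)
  also have "(LINT x|lebesgue. cnj (\<phi> x) * \<psi> x) = (LINT x|lborel. cnj (\<phi> x) * \<psi> x)"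
    using schwartz_measurable[OF s] by (intro integral_completion) simp
  finally show ?thesis unfolding schwartz_vec_def[of \<psi>] inner_schwartz_vec[OF assms(1) schwartz_square_integrable[OF assms(2)]]
    by (simp add: scaleC_scaleC)
qed

lemma schwartz_vec_separate:
  assumes "\<And>\<phi> e. schwartz \<phi> \<Longrightarrow> inner a (schwartz_vec \<phi> e) = 0"
  shows "a = 0"
proof -
  obtain f where f: "square_integrable f" "a = abs_l2 f" by (metis l2_cases)
  have "AE x in lebesgue. f x = 0"
  proof (rule weighted_separate[of 0])
    fix \<phi> :: "real^'a \<Rightarrow> complex" assume "test_function \<phi>"
    then have c: "schwartz (\<lambda>x. cnj (\<phi> x))" by (simp add: schwartz_cnj test_function_def)
    have "inner e (LINT x|lebesgue. \<phi> x *\<^sub>C f x) = 0" for e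
      using assms[OF c, of e] inner_schwartz_vec[OF c f(1), of e] by (simp add: f(2) inner_commute)
    then have "(LINT x|lebesgue. \<phi> x *\<^sub>C f x) = 0" by (metis inner_eq_zero_iff)
    then show "(LINT x|lebesgue. \<phi> x *\<^sub>C f x) = (LINT x|lebesgue. \<phi> x *\<^sub>C 0)" by (simp add: scaleC_zero_right)
  qed (simp_all add: weighted_zero_iff f square_integrable_zero)
  then show ?thesis unfolding f(2) zero_l2_def by (simp add: abs_l2_eq_iff f(1) square_integrable_zero)
qed

text \<open>The Plancherel transformation as a closed relation: the closure of its graph on Schwartz
  functions with vector coefficients. Everything about it is proved by checking generators and
  passing to limits.\<close>

definition fourier_graph :: "(('n::finite, 'e::complex_euclidean_space) l2 \<times> ('n, 'e) l2) set" where
  "fourier_graph = closure (span {(schwartz_vec \<phi> e, schwartz_vec (fourier \<phi>) e) | \<phi> e. schwartz \<phi>})"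

lemma fourier_graph_base: "schwartz \<phi> \<Longrightarrow> (schwartz_vec \<phi> e, schwartz_vec (fourier \<phi>) e) \<in> fourier_graph"
  unfolding fourier_graph_def by (rule subsetD[OF closure_subset], rule span_base) blast

text \<open>On generators this is Parseval's identity; both sides are linear and continuous in each
  argument separately.\<close>

lemma fourier_graph_inner:
  assumes "p \<in> fourier_graph" "q \<in> fourier_graph"
  shows "inner (fst p) (fst q) = inner (snd p) (snd (q :: ('n::finite, 'e::complex_euclidean_space) l2 \<times> ('n, 'e) l2))"
proof -
  let ?B = "{(schwartz_vec \<phi> e, schwartz_vec (fourier \<phi>) e) | \<phi> e. schwartz \<phi>} :: (('n, 'e) l2 \<times> ('n, 'e) l2) set"
  let ?P = "\<lambda>p q :: ('n, 'e) l2 \<times> ('n, 'e) l2. inner (fst p) (fst q) = inner (snd p) (snd q)"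
  have sub: "subspace {q. ?P p q}" "closed {q. ?P p q}" for p
    by (auto simp: subspace_def inner_add_right intro!: closed_Collect_eq continuous_intros)
  have ext: "?P p q" if "\<And>b. b \<in> ?B \<Longrightarrow> ?P p b" "q \<in> fourier_graph" for p q
  proof -
    have "span ?B \<subseteq> {q. ?P p q}" using that(1) by (intro span_minimal sub) auto
    then have "closure (span ?B) \<subseteq> {q. ?P p q}" by (intro closure_minimal sub)
    then show ?thesis using that(2) unfolding fourier_graph_def by blast
  qed
  have bb: "?P b c" if "b \<in> ?B" "c \<in> ?B" for b c using that by (auto simp: inner_schwartz_vec2 schwartz_fourier fourier_parseval)
  have "?P b q" if "b \<in> ?B" for b using ext[OF bb[OF that] assms(2)] .
  then have "?P q b" if "b \<in> ?B" for b using that by (simp add: inner_commute)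
  from ext[OF this assms(1)] show ?thesis by (simp add: inner_commute)
qed

lemma fourier_graph_subspace: "subspace fourier_graph" "closed fourier_graph"
  unfolding fourier_graph_def by (auto intro: subspace_closure subspace_span)

lemma fourier_graph_norm:
  assumes "p \<in> fourier_graph" shows "norm (fst p) = norm (snd p)" using fourier_graph_inner[OF assms assms] by (simp add: norm_eq_sqrt_inner)

text \<open>As the relation is isometric and closed, both projections of it are closed. They are
  dense, since they contain all Schwartz functions with vector coefficients.\<close>

lemma fourier_graph_surj:
  fixes a b :: "('a::finite, 'b::complex_euclidean_space) l2"
  shows "\<exists>b. (a, b) \<in> fourier_graph" and "\<exists>a. (a, b) \<in> fourier_graph"
proof -
  let ?G = "fourier_graph :: (('a, 'b) l2 \<times> ('a, 'b) l2) set"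
  note sub = fourier_graph_subspace
  have dist_eq: "dist (fst p) (fst q) = dist (snd p) (snd q)" if "p \<in> fourier_graph" "q \<in> fourier_graph"
    for p q :: "('a, 'b) l2 \<times> ('a, 'b) l2" using fourier_graph_norm[OF subspace_diff[OF sub(1) that]] by (simp add: dist_norm)
  have cl: "closed (fst ` ?G)" "closed (snd ` ?G)" unfolding closed_sequential_limits
  proof (safe)
    fix x l assume x: "\<forall>n. x n \<in> fst ` ?G" and l: "x \<longlonglongrightarrow> l"
    from x have "\<forall>n. \<exists>p. p \<in> fourier_graph \<and> x n = fst p" by blast
    then obtain p where p: "\<And>n. p n \<in> fourier_graph" "\<And>n. x n = fst (p n)" by metis
    have "Cauchy x" using l by (rule LIMSEQ_imp_Cauchy)
    then have "Cauchy (\<lambda>n. snd (p n))" using dist_eq[OF p(1) p(1)] unfolding Cauchy_def p(2) by simp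
    then obtain b where "(\<lambda>n. snd (p n)) \<longlonglongrightarrow> b" using Cauchy_convergent convergent_def by blast
    with l have "p \<longlonglongrightarrow> (l, b)" using tendsto_Pair[of x l sequentially "\<lambda>n. snd (p n)" b] by (simp add: p(2))
    then have "(l, b) \<in> fourier_graph" using closed_sequentially[OF sub(2)] p(1) by blast
    then show "l \<in> fst ` fourier_graph" by force
  next
    fix x l assume x: "\<forall>n. x n \<in> snd ` ?G" and l: "x \<longlonglongrightarrow> l"
    from x have "\<forall>n. \<exists>p. p \<in> fourier_graph \<and> x n = snd p" by blast
    then obtain p where p: "\<And>n. p n \<in> fourier_graph" "\<And>n. x n = snd (p n)" by metis
    have "Cauchy x" using l by (rule LIMSEQ_imp_Cauchy)
    then have "Cauchy (\<lambda>n. fst (p n))" using dist_eq[OF p(1) p(1)] unfolding Cauchy_def p(2) by simp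
    then obtain b where "(\<lambda>n. fst (p n)) \<longlonglongrightarrow> b" using Cauchy_convergent convergent_def by blast
    with l have "p \<longlonglongrightarrow> (b, l)" using tendsto_Pair[of "\<lambda>n. fst (p n)" b sequentially x l] by (simp add: p(2))
    then have "(b, l) \<in> fourier_graph" using closed_sequentially[OF sub(2)] p(1) by blast
    then show "l \<in> snd ` fourier_graph" by force
  qed
  have "fst ` ?G = UNIV"
  proof (rule closed_subspace_eq_UNIV[OF cl(1)])
    show "subspace (fst ` ?G)" by (rule linear_subspace_image[OF bounded_linear.linear[OF bounded_linear_fst] sub(1)])
    fix y assume y: "\<And>m. m \<in> fst ` ?G \<Longrightarrow> inner y m = 0"
    show "y = 0"
    proof (rule schwartz_vec_separate, rule y)
      fix \<phi> :: "real^'a \<Rightarrow> complex" and e :: 'b assume "schwartz \<phi>"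
      from fourier_graph_base[OF this, of e] show "schwartz_vec \<phi> e \<in> fst ` fourier_graph" by (metis fst_conv image_eqI)
    qed
  qed
  then have "a \<in> fst ` ?G" by simp
  then show "\<exists>b. (a, b) \<in> fourier_graph" by force
  have "snd ` ?G = UNIV"
  proof (rule closed_subspace_eq_UNIV[OF cl(2)])
    show "subspace (snd ` ?G)" by (rule linear_subspace_image[OF bounded_linear.linear[OF bounded_linear_snd] sub(1)])
    fix y assume y: "\<And>m. m \<in> snd ` ?G \<Longrightarrow> inner y m = 0"
    show "y = 0"
    proof (rule schwartz_vec_separate, rule y)
      fix \<phi> :: "real^'a \<Rightarrow> complex" and e :: 'b assume "schwartz \<phi>"
      then have "(schwartz_vec (inv_fourier \<phi>) e, schwartz_vec \<phi> e) \<in> fourier_graph"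
        using fourier_graph_base[OF schwartz_inv_fourier, of \<phi> e] by (simp add: fourier_inv_fourier)
      then show "schwartz_vec \<phi> e \<in> snd ` fourier_graph" by (metis snd_conv image_eqI)
    qed
  qed
  then have "b \<in> snd ` ?G" by simp
  then show "\<exists>a. (a, b) \<in> fourier_graph" by force
qed

text \<open>Links the Hilbert space transform, controlled by inner products, with that of
  distributions, defined by a bilinear pairing. The function \<open>?\<chi>\<close> is chosen so
  that its transform is the conjugate of \<open>\<phi>\<close>.\<close>

lemma fourier_graph_pairing:
  assumes fg: "(abs_l2 f, abs_l2 g) \<in> fourier_graph" "square_integrable f" "square_integrable g" and \<phi>: "schwartz \<phi>"
  shows "(LINT x|lebesgue. fourier \<phi> x *\<^sub>C f x) = (LINT x|lebesgue. \<phi> x *\<^sub>C g x)"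
proof -
  let ?\<chi> = "inv_fourier (\<lambda>x. cnj (\<phi> x))"
  have \<chi>: "schwartz ?\<chi>" "fourier ?\<chi> = (\<lambda>x. cnj (\<phi> x))"
    by (simp_all add: schwartz_inv_fourier schwartz_cnj \<phi> fourier_inv_fourier)
  have "inner e (LINT x|lebesgue. fourier \<phi> x *\<^sub>C f x) = inner e (LINT x|lebesgue. \<phi> x *\<^sub>C g x)" for e
    using fourier_graph_inner[OF fourier_graph_base[OF \<chi>(1), of e] fg(1)]
    by (simp add: \<chi>(2) inner_schwartz_vec[OF \<chi>(1) fg(2)] inner_schwartz_vec[OF schwartz_cnj[OF \<phi>] fg(3)])
      (simp add: inv_fourier_def)
  then show ?thesis by (subst vector_eq_ldot[symmetric]) blast
qed

section \<open>Tempered distributions and Sobolev spaces\<close>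

lemma clinear_on_UNIV_linear:
  fixes A :: "'e::complex_euclidean_space \<Rightarrow> 'e"
  assumes "clinear_on UNIV A" shows "linear A" using assms unfolding clinear_on_def by (intro linearI) (auto simp: scaleC_of_real[symmetric])

lemma tempered_schwartz:
  assumes "tempered u"
  shows "\<not> schwartz \<phi> \<Longrightarrow> u \<phi> = 0"
    and "schwartz \<phi> \<Longrightarrow> schwartz \<psi> \<Longrightarrow> u (\<lambda>x. \<phi> x + \<psi> x) = u \<phi> + u \<psi>"
    and "schwartz \<phi> \<Longrightarrow> u (\<lambda>x. c * \<phi> x) = c *\<^sub>C u \<phi>" using assms unfolding tempered_def by blast+

definition distribution_bound :: "nat \<Rightarrow> real \<Rightarrow> ('n::finite, 'e::complex_euclidean_space) distr \<Rightarrow> bool" where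
  "distribution_bound N C u \<longleftrightarrow> (\<forall>\<phi> b. schwartz \<phi> \<longrightarrow>
    (\<forall>ks x. length ks \<le> N \<longrightarrow> (1 + norm x) ^ N * norm (partial_derivs ks \<phi> x) \<le> b) \<longrightarrow> norm (u \<phi>) \<le> C * b)"

lemma distribution_boundD:
  assumes "distribution_bound N C u" "schwartz \<phi>"
    and "\<And>ks x. length ks \<le> N \<Longrightarrow> (1 + norm x) ^ N * norm (partial_derivs ks \<phi> x) \<le> b"
  shows "norm (u \<phi>) \<le> C * b" using assms unfolding distribution_bound_def by blast

text \<open>The constant may be taken nonnegative, because every admissible \<open>b\<close> bounds
  an absolute value and is therefore nonnegative.\<close>

lemma tempered_bound:
  fixes u :: "('n::finite, 'e::complex_euclidean_space) distr"
  assumes "tempered u"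
  shows "\<exists>N C. C \<ge> 0 \<and> distribution_bound N C u"
proof -
  obtain N C where C: "distribution_bound N C u" using assms unfolding tempered_def distribution_bound_def by blast
  have "distribution_bound N \<bar>C\<bar> u" unfolding distribution_bound_def
  proof (intro allI impI)
    fix \<phi> :: "real^'n \<Rightarrow> complex" and b assume \<phi>: "schwartz \<phi>"
      and b: "\<forall>ks x. length ks \<le> N \<longrightarrow> (1 + norm x) ^ N * norm (partial_derivs ks \<phi> x) \<le> b"
    have "0 \<le> (1 + norm (0::real^'n)) ^ N * norm (partial_derivs [] \<phi> 0)" by simp
    also have "(1 + norm (0::real^'n)) ^ N * norm (partial_derivs [] \<phi> 0) \<le> b" using b[rule_format, of "[]" 0] by simp
    finally have "b \<ge> 0" .
    have "norm (u \<phi>) \<le> C * b" using distribution_boundD[OF C \<phi>] b by blast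
    also have "C * b \<le> \<bar>C\<bar> * b" using \<open>b \<ge> 0\<close> by (intro mult_right_mono) auto
    finally show "norm (u \<phi>) \<le> \<bar>C\<bar> * b" .
  qed
  then show ?thesis by (intro exI[of _ N] exI[of _ "\<bar>C\<bar>"]) simp
qed

lemma temperedI:
  assumes "\<And>\<phi>. \<not> schwartz \<phi> \<Longrightarrow> u \<phi> = 0"
    and "\<And>\<phi> \<psi>. schwartz \<phi> \<Longrightarrow> schwartz \<psi> \<Longrightarrow> u (\<lambda>x. \<phi> x + \<psi> x) = u \<phi> + u \<psi>"
    and "\<And>c \<phi>. schwartz \<phi> \<Longrightarrow> u (\<lambda>x. c * \<phi> x) = c *\<^sub>C u \<phi>"
    and "\<And>\<phi> b. schwartz \<phi> \<Longrightarrow>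
      (\<And>ks x. length ks \<le> N \<Longrightarrow> (1 + norm x) ^ N * norm (partial_derivs ks \<phi> x) \<le> b) \<Longrightarrow> norm (u \<phi>) \<le> C * b"
  shows "tempered u" unfolding tempered_def using assms by blast

lemma tempered_linear:
  fixes A :: "'e::complex_euclidean_space \<Rightarrow> 'e" and u :: "('n::finite, 'e) distr"
  assumes u: "tempered u" and A: "clinear_on UNIV A"
  shows "tempered (\<lambda>\<phi>. A (u \<phi>))"
proof -
  obtain N C where C: "C \<ge> 0" "distribution_bound N C u" using tempered_bound[OF u] by blast
  have l: "linear A" by (rule clinear_on_UNIV_linear[OF A])
  obtain B where B: "B > 0" "\<And>x. norm (A x) \<le> B * norm x" using linear_bounded_pos[OF l] by blast
  show ?thesis
  proof (rule temperedI[where N = N and C = "B * C"])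
    fix \<phi> :: "real^'n \<Rightarrow> complex" and b assume "schwartz \<phi>" "\<And>ks x. length ks \<le> N \<Longrightarrow> (1 + norm x) ^ N * norm (partial_derivs ks \<phi> x) \<le> b"
    then have "norm (u \<phi>) \<le> C * b" by (rule distribution_boundD[OF C(2)])
    then have "B * norm (u \<phi>) \<le> B * (C * b)" using B(1) by (intro mult_left_mono) auto
    then show "norm (A (u \<phi>)) \<le> B * C * b" using B(2)[of "u \<phi>"] by simp
  qed (use A in \<open>auto simp: tempered_schwartz[OF u] linear_0[OF l] clinear_on_def\<close>)
qed

lemma tempered_scaleC: "tempered u \<Longrightarrow> tempered (\<lambda>\<phi>. c *\<^sub>C u \<phi>)"
  by (erule tempered_linear) (auto simp: clinear_on_def scaleC_add_right scaleC_scaleC mult.commute)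

lemma tempered_zero: "tempered (\<lambda>\<phi>. 0)" by (rule temperedI[where C = 0]) (auto simp: scaleC_zero_right)

lemma tempered_add:
  fixes u v :: "('n::finite, 'e::complex_euclidean_space) distr"
  assumes u: "tempered u" and v: "tempered v"
  shows "tempered (\<lambda>\<phi>. u \<phi> + v \<phi>)"
proof -
  obtain N C where C: "C \<ge> 0" "distribution_bound N C u" using tempered_bound[OF u] by blast
  obtain M D where D: "D \<ge> 0" "distribution_bound M D v" using tempered_bound[OF v] by blast
  show ?thesis
  proof (rule temperedI[where N = "max N M" and C = "C + D"])
    fix \<phi> :: "real^'n \<Rightarrow> complex" and b assume \<phi>: "schwartz \<phi>" and b: "\<And>ks x. length ks \<le> max N M \<Longrightarrow> (1 + norm x) ^ max N M * norm (partial_derivs ks \<phi> x) \<le> b"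
    have b': "(1 + norm x) ^ K * norm (partial_derivs ks \<phi> x) \<le> b" if "length ks \<le> K" "K \<le> max N M" for K ks x
    proof -
      have "(1 + norm x) ^ K * norm (partial_derivs ks \<phi> x) \<le> (1 + norm x) ^ max N M * norm (partial_derivs ks \<phi> x)"
        using that by (intro mult_right_mono power_increasing) auto
      also have "\<dots> \<le> b" using that by (intro b) auto
      finally show ?thesis .
    qed
    have "norm (u \<phi>) \<le> C * b" by (intro distribution_boundD[OF C(2)] \<phi> b') auto
    moreover have "norm (v \<phi>) \<le> D * b" by (intro distribution_boundD[OF D(2)] \<phi> b') auto
    ultimately show "norm (u \<phi> + v \<phi>) \<le> (C + D) * b"
      using norm_triangle_ineq[of "u \<phi>" "v \<phi>"] by (simp add: distrib_right)
  qed (auto simp: tempered_schwartz[OF u] tempered_schwartz[OF v] scaleC_add_right)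
qed

lemma tempered_sum: "finite I \<Longrightarrow> (\<And>i. i \<in> I \<Longrightarrow> tempered (u i)) \<Longrightarrow> tempered (\<lambda>\<phi>. \<Sum>i\<in>I. u i \<phi>)"
  by (induction I rule: finite_induct) (auto intro: tempered_zero tempered_add)

lemma tempered_momentum:
  assumes u: "tempered u" shows "tempered (momentum k u)"
proof -
  obtain N C where C: "C \<ge> 0" "distribution_bound N C u" using tempered_bound[OF u] by blast
  show ?thesis
  proof (rule temperedI[where N = "Suc N" and C = C])
    fix \<phi> \<psi> :: "real^'a \<Rightarrow> complex" and c b assume \<phi>: "schwartz \<phi>"
    note t = tempered_schwartz[OF u]
    show "momentum k u (\<lambda>x. c * \<phi> x) = c *\<^sub>C momentum k u \<phi>"
      using \<phi> by (simp add: momentum_def schwartz_cmult partial_deriv_cmult schwartz_differentiable t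
          schwartz_partial_deriv scaleC_minus_right scaleC_scaleC mult.commute)
    show "momentum k u (\<lambda>x. \<phi> x + \<psi> x) = momentum k u \<phi> + momentum k u \<psi>" if "schwartz \<psi>"
      using \<phi> that by (simp add: momentum_def schwartz_add partial_deriv_add schwartz_differentiable t
          schwartz_partial_deriv scaleC_diff_right scaleC_minus_right scaleC_add_right)
    assume b: "\<And>ks x. length ks \<le> Suc N \<Longrightarrow> (1 + norm x) ^ Suc N * norm (partial_derivs ks \<phi> x) \<le> b"
    have "norm (u (partial_deriv k \<phi>)) \<le> C * b"
    proof (intro distribution_boundD[OF C(2)] schwartz_partial_deriv \<phi>)
      fix ks :: "'a list" and x assume ks: "length ks \<le> N"
      have "(1 + norm x) ^ N * norm (partial_derivs ks (partial_deriv k \<phi>) x) \<le>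
          (1 + norm x) ^ Suc N * norm (partial_derivs (ks @ [k]) \<phi> x)"
        unfolding partial_derivs_snoc by (intro mult_right_mono power_increasing) auto
      also have "\<dots> \<le> b" using ks by (intro b) simp
      finally show "(1 + norm x) ^ N * norm (partial_derivs ks (partial_deriv k \<phi>) x) \<le> b" .
    qed
    then show "norm (momentum k u \<phi>) \<le> C * b" using \<phi> by (simp add: momentum_def norm_scaleC)
  qed (simp add: momentum_def)
qed

lemma tempered_distr_of:
  fixes f :: "real^'n::finite \<Rightarrow> 'e::complex_euclidean_space"
  assumes f: "square_integrable f" shows "tempered (distr_of f)"
proof -
  have int: "integrable lebesgue (\<lambda>x. \<phi> x *\<^sub>C f x)" if "schwartz \<phi>" for \<phi>
    using weighted_pairing_bound[OF _ that, of 0 f] f by (simp add: weighted_zero_iff)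
  let ?d = "DIM(real^'n)"
  \<comment> \<open>If |\<phi>| is at most b (1 + |x|)^(-d), then the product with \<open>f\<close>
    is at most \<open>b * ?h\<close>, again by splitting a product into two squares.\<close>
  let ?h = "\<lambda>x::real^'n. 1 / (1 + norm x) ^ (2 * ?d) + (norm (f x))\<^sup>2"
  have hi: "integrable lebesgue ?h"
  proof (intro Bochner_Integration.integrable_add)
    show "integrable lebesgue (\<lambda>x::real^'n. 1 / (1 + norm x) ^ (2 * ?d))"
      using integrable_inverse_power_norm[where 'a="real^'n"] by (subst integrable_lebesgue_iff) measurable
    show "integrable lebesgue (\<lambda>x. (norm (f x))\<^sup>2)" using f by (simp add: square_integrable_def)
  qed
  show ?thesis
  proof (rule temperedI[where N = ?d and C = "LINT x|lebesgue. ?h x"])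
    fix \<phi> :: "real^'n \<Rightarrow> complex" and b assume \<phi>: "schwartz \<phi>"
      and b: "\<And>ks x. length ks \<le> ?d \<Longrightarrow> (1 + norm x) ^ ?d * norm (partial_derivs ks \<phi> x) \<le> b"
    have b0: "(1 + norm x) ^ ?d * norm (\<phi> x) \<le> b" for x using b[of "[]" x] by (simp add: partial_derivs_Nil)
    have "0 \<le> (1 + norm (0::real^'n)) ^ ?d * norm (\<phi> 0)" by simp
    also note b0
    finally have "b \<ge> 0" .
    have "norm (LINT x|lebesgue. \<phi> x *\<^sub>C f x) \<le> (LINT x|lebesgue. b * ?h x)"
    proof (rule order_trans[OF integral_norm_bound integral_mono])
      show "integrable lebesgue (\<lambda>x. norm (\<phi> x *\<^sub>C f x))" using int[OF \<phi>] by (rule integrable_norm)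
      show "integrable lebesgue (\<lambda>x. b * ?h x)" using hi by (rule integrable_mult_right)
      fix x :: "real^'n"
      let ?q = "1 / (1 + norm x) ^ ?d"
      have "norm (\<phi> x) \<le> b * ?q" using b0[of x] by (simp add: pos_le_divide_eq one_plus_norm_power_pos mult.commute)
      then have "norm (\<phi> x) * norm (f x) \<le> b * ?q * norm (f x)" by (intro mult_right_mono) auto
      also have "\<dots> = b * (?q * norm (f x))" by simp
      also have "?q * norm (f x) \<le> ?q\<^sup>2 + (norm (f x))\<^sup>2" by (rule mult_le_sum_squares) auto
      also have "?q\<^sup>2 = 1 / (1 + norm x) ^ (2 * ?d)" by (simp add: power_one_over power_mult[symmetric] mult.commute)
      finally show "norm (\<phi> x *\<^sub>C f x) \<le> b * ?h x" using \<open>b \<ge> 0\<close> by (simp add: norm_scaleC mult_left_mono)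
    qed
    then show "norm (distr_of f \<phi>) \<le> (LINT x|lebesgue. ?h x) * b" using \<phi> by (simp add: distr_of_def mult.commute)
  next
    fix \<phi> \<psi> :: "real^'n \<Rightarrow> complex" and c assume \<phi>: "schwartz \<phi>"
    show "distr_of f (\<lambda>x. c * \<phi> x) = c *\<^sub>C distr_of f \<phi>"
      using \<phi> schwartz_cmult[OF \<phi>] integral_scaleC[OF int[OF \<phi>], of c] by (simp add: distr_of_def scaleC_scaleC)
    show "distr_of f (\<lambda>x. \<phi> x + \<psi> x) = distr_of f \<phi> + distr_of f \<psi>" if "schwartz \<psi>"
      using \<phi> that schwartz_add[OF \<phi> that] int[OF \<phi>] int[OF that]
      by (simp add: distr_of_def scaleC_add_left Bochner_Integration.integral_add)
  qed (simp add: distr_of_def)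
qed

lemma sobolev_transform_iff:
  "sobolev_transform s u g \<longleftrightarrow>
    weighted s g \<and> (\<forall>\<phi>. schwartz \<phi> \<longrightarrow> u (fourier \<phi>) = (LINT \<xi>|lebesgue. \<phi> \<xi> *\<^sub>C g \<xi>))"
  unfolding sobolev_transform_def weighted_def wt_def by auto

lemma sobolev_transformD:
  assumes "sobolev_transform s u g"
  shows "weighted s g" "schwartz \<phi> \<Longrightarrow> u (fourier \<phi>) = (LINT \<xi>|lebesgue. \<phi> \<xi> *\<^sub>C g \<xi>)"
  using assms unfolding sobolev_transform_iff by blast+

lemma sobolev_transform_add:
  assumes "sobolev_transform s u g" "sobolev_transform s v h"
  shows "sobolev_transform s (\<lambda>\<phi>. u \<phi> + v \<phi>) (\<lambda>\<xi>. g \<xi> + h \<xi>)" unfolding sobolev_transform_iff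
proof (intro conjI allI impI)
  show "weighted s (\<lambda>\<xi>. g \<xi> + h \<xi>)" using assms by (simp add: sobolev_transform_iff weighted_add)
  fix \<phi> :: "real^'a \<Rightarrow> complex" assume \<phi>: "schwartz \<phi>"
  note w = weighted_pairing_bound[OF sobolev_transformD(1)[OF assms(1)] \<phi>]
    weighted_pairing_bound[OF sobolev_transformD(1)[OF assms(2)] \<phi>]
  show "u (fourier \<phi>) + v (fourier \<phi>) = (LINT \<xi>|lebesgue. \<phi> \<xi> *\<^sub>C (g \<xi> + h \<xi>))"
    using sobolev_transformD(2)[OF assms(1) \<phi>] sobolev_transformD(2)[OF assms(2) \<phi>] w
    by (simp add: scaleC_add_right Bochner_Integration.integral_add)
qed

lemma sobolev_transform_linear:
  fixes A :: "'e::complex_euclidean_space \<Rightarrow> 'e"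
  assumes "sobolev_transform s u g" and A: "clinear_on UNIV A"
  shows "sobolev_transform s (\<lambda>\<phi>. A (u \<phi>)) (\<lambda>\<xi>. A (g \<xi>))" unfolding sobolev_transform_iff
proof (intro conjI allI impI)
  note l = clinear_on_UNIV_linear[OF A] and w = sobolev_transformD[OF assms(1)]
  show "weighted s (\<lambda>\<xi>. A (g \<xi>))" by (rule weighted_linear[OF w(1) l])
  fix \<phi> :: "real^'a \<Rightarrow> complex" assume \<phi>: "schwartz \<phi>"
  have "\<phi> \<xi> *\<^sub>C A (g \<xi>) = A (\<phi> \<xi> *\<^sub>C g \<xi>)" for \<xi> using A by (simp add: clinear_on_def)
  then show "A (u (fourier \<phi>)) = (LINT \<xi>|lebesgue. \<phi> \<xi> *\<^sub>C A (g \<xi>))"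
    using integral_linear[OF weighted_pairing_bound[OF w(1) \<phi>] l] w(2)[OF \<phi>] by simp
qed

lemma sobolev_transform_scaleC:
  "sobolev_transform s u g \<Longrightarrow> sobolev_transform s (\<lambda>\<phi>. c *\<^sub>C u \<phi>) (\<lambda>\<xi>. c *\<^sub>C g \<xi>)"
  by (erule sobolev_transform_linear) (auto simp: clinear_on_def scaleC_add_right scaleC_scaleC mult.commute)

lemma sobolev_transform_sum:
  "finite I \<Longrightarrow> (\<And>i. i \<in> I \<Longrightarrow> sobolev_transform s (u i) (g i)) \<Longrightarrow>
    sobolev_transform s (\<lambda>\<phi>. \<Sum>i\<in>I. u i \<phi>) (\<lambda>\<xi>. \<Sum>i\<in>I. g i \<xi>)"
proof (induction I rule: finite_induct)
  case empty
  then show ?case by (auto simp: sobolev_transform_iff weighted_def scaleC_zero_right)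
qed (auto intro: sobolev_transform_add)

lemma sobolev_transform_mono: "sobolev_transform s u g \<Longrightarrow> t \<le> s \<Longrightarrow> sobolev_transform t u g"
  unfolding sobolev_transform_iff using weighted_mono by blast

lemma sobolev_transform_momentum:
  assumes "sobolev_transform s u g" "weighted t (\<lambda>\<xi>. \<xi> $ k *\<^sub>R g \<xi>)"
  shows "sobolev_transform t (momentum k u) (\<lambda>\<xi>. \<xi> $ k *\<^sub>R g \<xi>)" unfolding sobolev_transform_iff
proof (intro conjI assms(2) allI impI)
  fix \<phi> :: "real^'a \<Rightarrow> complex" assume \<phi>: "schwartz \<phi>"
  let ?\<psi> = "\<lambda>x. - \<i> * (complex_of_real (x $ k) * \<phi> x)"
  have \<psi>: "schwartz ?\<psi>" by (intro schwartz_cmult schwartz_coordinate_mult \<phi>)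
  note i = weighted_pairing_bound[OF sobolev_transformD(1)[OF assms(1)] \<psi>]
  have "momentum k u (fourier \<phi>) = (- \<i>) *\<^sub>C (- (LINT \<xi>|lebesgue. ?\<psi> \<xi> *\<^sub>C g \<xi>))"
    using sobolev_transformD(2)[OF assms(1) \<psi>] schwartz_fourier[OF \<phi>] by (simp add: momentum_def partial_deriv_fourier[OF \<phi>])
  also have "\<dots> = \<i> *\<^sub>C (LINT \<xi>|lebesgue. ?\<psi> \<xi> *\<^sub>C g \<xi>)" by (simp only: scaleC_minus_right scaleC_minus_left minus_minus)
  also have "\<dots> = (LINT \<xi>|lebesgue. \<i> *\<^sub>C ?\<psi> \<xi> *\<^sub>C g \<xi>)" by (rule integral_scaleC[OF i, symmetric])
  also have "\<dots> = (LINT \<xi>|lebesgue. \<phi> \<xi> *\<^sub>C \<xi> $ k *\<^sub>R g \<xi>)"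
    by (simp add: scaleC_scaleC scaleC_of_real[symmetric] mult_ac)
  finally show "momentum k u (fourier \<phi>) = (LINT \<xi>|lebesgue. \<phi> \<xi> *\<^sub>C \<xi> $ k *\<^sub>R g \<xi>)" .
qed

lemma sobolev_transform_unique:
  assumes "sobolev_transform s u g" "sobolev_transform t u h"
  shows "AE \<xi> in lebesgue. g \<xi> = h \<xi>"
proof (rule weighted_separate[of "min s t"])
  show "weighted (min s t) g" "weighted (min s t) h"
    using assms by (auto simp: sobolev_transform_iff intro: weighted_mono[where s=s] weighted_mono[where s=t])
  show "(LINT x|lebesgue. \<phi> x *\<^sub>C g x) = (LINT x|lebesgue. \<phi> x *\<^sub>C h x)" if "test_function \<phi>" for \<phi>
    using assms that unfolding sobolev_transform_iff test_function_def by metis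
qed

lemma distribution_eqI:
  assumes "\<And>\<phi>. schwartz \<phi> \<Longrightarrow> u (fourier \<phi>) = v (fourier \<phi>)"
    and "\<And>\<phi>. \<not> schwartz \<phi> \<Longrightarrow> u \<phi> = 0" "\<And>\<phi>. \<not> schwartz \<phi> \<Longrightarrow> v \<phi> = 0"
  shows "u = v"
proof
  fix \<phi> show "u \<phi> = v \<phi>"
  proof (cases "schwartz \<phi>")
    case True
    then show ?thesis using assms(1)[OF schwartz_inv_fourier[OF True]] by (simp add: fourier_inv_fourier)
  qed (simp add: assms)
qed

lemma sobolev_transform_ext:
  assumes "sobolev_transform s u g" "sobolev_transform t v h" "AE \<xi> in lebesgue. g \<xi> = h \<xi>"
    and "\<And>\<phi>. \<not> schwartz \<phi> \<Longrightarrow> u \<phi> = 0" "\<And>\<phi>. \<not> schwartz \<phi> \<Longrightarrow> v \<phi> = 0"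
  shows "u = v"
proof (rule distribution_eqI[OF _ assms(4,5)])
  fix \<phi> :: "real^'a \<Rightarrow> complex" assume \<phi>: "schwartz \<phi>"
  have "(LINT \<xi>|lebesgue. \<phi> \<xi> *\<^sub>C g \<xi>) = (LINT \<xi>|lebesgue. \<phi> \<xi> *\<^sub>C h \<xi>)"
    using assms(1-3) schwartz_lebesgue_measurable[OF \<phi>] unfolding sobolev_transform_iff weighted_def
    by (intro integral_cong_AE scaleC_measurable) (auto elim!: eventually_mono)
  then show "u (fourier \<phi>) = v (fourier \<phi>)" using assms(1,2) \<phi> by (simp add: sobolev_transform_iff)
qed

lemma sobolev_transform_distr_of:
  assumes "(abs_l2 f, abs_l2 g) \<in> fourier_graph" "square_integrable f" "square_integrable g"
  shows "sobolev_transform 0 (distr_of f) g" using assms fourier_graph_pairing[OF assms] schwartz_fourier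
  by (auto simp: sobolev_transform_iff weighted_zero_iff distr_of_def)

lemma square_integrable_ex_transform:
  assumes "square_integrable f"
  shows "\<exists>g. (abs_l2 f, abs_l2 g) \<in> fourier_graph \<and> square_integrable g \<and> sobolev_transform 0 (distr_of f) g"
  using fourier_graph_surj(1)[of "abs_l2 f"] l2_cases sobolev_transform_distr_of assms by metis

lemma square_integrable_ex_inverse_transform:
  assumes "square_integrable g"
  shows "\<exists>f. (abs_l2 f, abs_l2 g) \<in> fourier_graph \<and> square_integrable f \<and> sobolev_transform 0 (distr_of f) g"
  using fourier_graph_surj(2)[of "abs_l2 g"] l2_cases sobolev_transform_distr_of assms by metis

lemma vecs_sobolev: "vecs (sobolev s) = {u. tempered u \<and> (\<exists>g. sobolev_transform s u g)}" by (simp add: sobolev_def)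

text \<open>Plancherel's theorem. For the inclusion from right to left, a distribution is recovered
  from its transform, which determines the values at Schwartz functions; all other values are
  0.\<close>

lemma vecs_L2: "vecs L2 = vecs (sobolev 0 :: ('n::finite, 'e::complex_euclidean_space) distr nspace)"
proof (intro equalityI subsetI)
  fix u :: "('n, 'e) distr" assume "u \<in> vecs L2"
  then obtain f where "square_integrable f" "u = distr_of f" by (auto simp: L2_def)
  then show "u \<in> vecs (sobolev 0)" using square_integrable_ex_transform tempered_distr_of unfolding vecs_sobolev by blast
next
  fix u :: "('n, 'e) distr" assume "u \<in> vecs (sobolev 0)"
  then obtain g where g: "tempered u" "sobolev_transform 0 u g" unfolding vecs_sobolev by blast
  then have "square_integrable g" by (simp add: sobolev_transform_iff weighted_zero_iff)
  then obtain f where f: "square_integrable f" "sobolev_transform 0 (distr_of f) g" using square_integrable_ex_inverse_transform by blast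
  moreover have "u = distr_of f" by (rule sobolev_transform_ext[OF g(2) f(2)]) (auto simp: tempered_schwartz[OF g(1)] distr_of_def)
  ultimately show "u \<in> vecs L2" by (auto simp: L2_def)
qed

text \<open>Since wt is 1 plus the sum of the squared coordinates, g is the sum of g0 = g/wt and of
  the \<xi>_k gk with gk = \<xi>_k g/wt. The bound \<open>s \<ge> -1\<close> makes every gk square
  integrable. The inverse transforms give f0 + sum of P_k f_k, which yields temperedness here and
  the sufficiency of test functions in \<open>sobolev_eqI_test\<close>.\<close>

lemma weighted_ex_decomposition:
  fixes g :: "real^'n::finite \<Rightarrow> 'e::complex_euclidean_space"
  assumes g: "weighted s g" and s: "s \<ge> -1"
  shows "\<exists>f0 f. square_integrable f0 \<and> (\<forall>k. square_integrable (f k)) \<and>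
    sobolev_transform s (\<lambda>\<phi>. distr_of f0 \<phi> + (\<Sum>k\<in>UNIV. momentum k (distr_of (f k)) \<phi>)) g"
proof -
  have gm: "g \<in> borel_measurable lebesgue" using g by (simp add: weighted_def)
  have m: "(\<lambda>\<xi>::real^'n. \<xi> $ k) \<in> borel_measurable lebesgue" for k
  proof -
    have "(\<lambda>\<xi>::real^'n. \<xi> $ k) \<in> borel_measurable borel" by (intro borel_measurable_continuous_onI continuous_intros)
    then show ?thesis by (simp add: measurable_completion)
  qed
  define g0 where "g0 \<xi> = wt \<xi> powr -1 *\<^sub>R g \<xi>" for \<xi>
  define gk where "gk k \<xi> = (\<xi> $ k) *\<^sub>R wt \<xi> powr -1 *\<^sub>R g \<xi>" for k \<xi>
  have le: "wt \<xi> powr a \<le> 1 * wt \<xi> powr ((s - 0)/2)" if "a \<le> -1/2" for a and \<xi> :: "real^'n"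
    using that s wt_ge_1[of \<xi>] by (simp add: powr_mono)
  have g0: "square_integrable g0" unfolding weighted_zero_iff[symmetric]
  proof (rule weighted_bound[OF g])
    show "g0 \<in> borel_measurable lebesgue" unfolding g0_def[abs_def] by (intro borel_measurable_scaleR wt_powr_measurable' gm)
    show "norm (g0 \<xi>) \<le> 1 * wt \<xi> powr ((s - 0)/2) * norm (g \<xi>)" for \<xi>
      unfolding g0_def norm_scaleR using le[of "-1" \<xi>] by (intro mult_right_mono) auto
  qed
  have gk: "square_integrable (gk k)" for k unfolding weighted_zero_iff[symmetric]
  proof (rule weighted_bound[OF g])
    show "gk k \<in> borel_measurable lebesgue" unfolding gk_def[abs_def] by (intro borel_measurable_scaleR wt_powr_measurable' gm m)
    fix \<xi>
    have "\<bar>\<xi> $ k\<bar> * wt \<xi> powr -1 \<le> wt \<xi> powr (1/2) * wt \<xi> powr -1"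
      by (intro mult_right_mono abs_component_le_wt) auto
    also have "wt \<xi> powr (1/2) * wt \<xi> powr -1 = wt \<xi> powr (-1/2)" by (subst powr_add[symmetric]) simp
    also have "\<dots> \<le> 1 * wt \<xi> powr ((s - 0)/2)" by (rule le) simp
    finally show "norm (gk k \<xi>) \<le> 1 * wt \<xi> powr ((s - 0)/2) * norm (g \<xi>)"
      unfolding gk_def norm_scaleR mult.assoc[symmetric] by (intro mult_right_mono) auto
  qed
  obtain f0 where f0: "square_integrable f0" "sobolev_transform 0 (distr_of f0) g0" using square_integrable_ex_inverse_transform[OF g0] by blast
  have "\<forall>k. \<exists>f. square_integrable f \<and> sobolev_transform 0 (distr_of f) (gk k)"
    using square_integrable_ex_inverse_transform[OF gk] by metis
  then obtain f where f: "\<And>k. square_integrable (f k)" "\<And>k. sobolev_transform 0 (distr_of (f k)) (gk k)" by metis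
  let ?u = "\<lambda>\<phi>. distr_of f0 \<phi> + (\<Sum>k\<in>UNIV. momentum k (distr_of (f k)) \<phi>)"
  have wk: "weighted (-1) (\<lambda>\<xi>. \<xi> $ k *\<^sub>R gk k \<xi>)" for k
  proof (rule weighted_bound[of 0 "gk k" _ 1])
    show "weighted 0 (gk k)" by (simp add: gk weighted_zero_iff)
    then show "(\<lambda>\<xi>. \<xi> $ k *\<^sub>R gk k \<xi>) \<in> borel_measurable lebesgue"
      unfolding weighted_def by (intro borel_measurable_scaleR m) blast
    fix \<xi>
    show "norm (\<xi> $ k *\<^sub>R gk k \<xi>) \<le> 1 * wt \<xi> powr ((0 - - 1) / 2) * norm (gk k \<xi>)"
      using abs_component_le_wt[of \<xi> k] by (simp add: mult_right_mono)
  qed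
  have "sobolev_transform (-1) ?u (\<lambda>\<xi>. g0 \<xi> + (\<Sum>k\<in>UNIV. \<xi> $ k *\<^sub>R gk k \<xi>))"
    by (intro sobolev_transform_add sobolev_transform_sum sobolev_transform_momentum[OF f(2) wk]
        sobolev_transform_mono[OF f0(2)]) auto
  moreover have "g0 \<xi> + (\<Sum>k\<in>UNIV. \<xi> $ k *\<^sub>R gk k \<xi>) = g \<xi>" for \<xi>
  proof -
    have "(norm \<xi>)\<^sup>2 = (\<Sum>k\<in>UNIV. \<xi> $ k * \<xi> $ k)" by (simp add: power2_norm_eq_inner inner_vec_def)
    moreover have "q + (\<Sum>k\<in>UNIV. \<xi> $ k *\<^sub>R \<xi> $ k *\<^sub>R q) = (1 + (\<Sum>k\<in>UNIV. \<xi> $ k * \<xi> $ k)) *\<^sub>R q" for q :: 'e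
      by (simp add: scaleR_add_left scaleR_sum_left)
    ultimately have "g0 \<xi> + (\<Sum>k\<in>UNIV. \<xi> $ k *\<^sub>R gk k \<xi>) = wt \<xi> *\<^sub>R wt \<xi> powr -1 *\<^sub>R g \<xi>"
      unfolding g0_def gk_def by (simp only: wt_def)
    then show ?thesis using wt_pos[of \<xi>] by (simp add: powr_minus)
  qed
  ultimately have "sobolev_transform s ?u g" using g by (simp add: sobolev_transform_iff)
  then show ?thesis using f0 f by blast
qed

lemma tempered_decomposition:
  "square_integrable f0 \<Longrightarrow> (\<And>k. square_integrable (f k)) \<Longrightarrow>
    tempered (\<lambda>\<phi>. distr_of f0 \<phi> + (\<Sum>k\<in>UNIV. momentum k (distr_of (f k)) \<phi>))"
  by (intro tempered_add tempered_sum tempered_momentum tempered_distr_of) auto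

lemma weighted_ex_transform:
  "weighted s g \<Longrightarrow> s \<ge> -1 \<Longrightarrow> \<exists>u. tempered u \<and> sobolev_transform s u g"
  using weighted_ex_decomposition tempered_decomposition by blast

section \<open>Isometries of Sobolev spaces with square integrable functions\<close>

text \<open>For \<open>s \<ge> -1\<close> this is the unitary identification of the Sobolev space of
  order s with \<open>l2\<close>.\<close>

definition Lam :: "real \<Rightarrow> ('n::finite, 'e::complex_euclidean_space) distr \<Rightarrow> ('n, 'e) l2" where
  "Lam s u = abs_l2 (\<lambda>\<xi>. wt \<xi> powr (s/2) *\<^sub>R (SOME g. sobolev_transform s u g) \<xi>)"

lemma square_integrable_wt: "sobolev_transform s u g \<Longrightarrow> square_integrable (\<lambda>\<xi>. wt \<xi> powr (s/2) *\<^sub>R g \<xi>)"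
  by (simp add: sobolev_transform_iff weighted_iff)

lemma sobolev_transform_someI: "sobolev_transform s u g \<Longrightarrow> sobolev_transform s u (SOME g. sobolev_transform s u g)"
  by (rule someI[of "sobolev_transform s u"])

lemma Lam_eq:
  assumes "sobolev_transform s u g"
  shows "Lam s u = abs_l2 (\<lambda>\<xi>. wt \<xi> powr (s/2) *\<^sub>R g \<xi>)"
proof -
  note g' = sobolev_transform_someI[OF assms]
  show ?thesis unfolding Lam_def abs_l2_eq_iff[OF square_integrable_wt[OF g'] square_integrable_wt[OF assms]]
    using sobolev_transform_unique[OF g' assms] by eventually_elim simp
qed

lemma norm_abs_l2: "square_integrable f \<Longrightarrow> norm (abs_l2 f) = sqrt (LINT x|lebesgue. (norm (f x))\<^sup>2)"
  by (simp add: norm_eq_sqrt_inner inner_abs_l2)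

lemma nrm_sobolev:
  assumes "u \<in> vecs (sobolev s)" shows "nrm (sobolev s) u = norm (Lam s u)"
proof -
  obtain g where g: "sobolev_transform s u g" using assms by (auto simp: vecs_sobolev)
  note g' = sobolev_transform_someI[OF g]
  show ?thesis unfolding Lam_def norm_abs_l2[OF square_integrable_wt[OF g']] norm_wt_scale by (simp add: sobolev_def wt_def)
qed

lemma sobolev_add:
  assumes "u \<in> vecs (sobolev s)" "v \<in> vecs (sobolev s)"
  shows "u + v \<in> vecs (sobolev s)" "Lam s (u + v) = Lam s u + Lam s v"
proof -
  obtain g where g: "tempered u" "sobolev_transform s u g" using assms(1) by (auto simp: vecs_sobolev)
  obtain h where h: "tempered v" "sobolev_transform s v h" using assms(2) by (auto simp: vecs_sobolev)
  have eq: "u + v = (\<lambda>\<phi>. u \<phi> + v \<phi>)" by (simp add: plus_fun_def)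
  note gh = sobolev_transform_add[OF g(2) h(2)]
  show "u + v \<in> vecs (sobolev s)" unfolding eq vecs_sobolev using tempered_add[OF g(1) h(1)] gh by blast
  show "Lam s (u + v) = Lam s u + Lam s v" unfolding eq Lam_eq[OF gh] Lam_eq[OF g(2)] Lam_eq[OF h(2)]
    by (simp add: add_abs_l2 square_integrable_wt[OF g(2)] square_integrable_wt[OF h(2)] scaleR_add_right)
qed

lemma sobolev_scaleC:
  assumes "u \<in> vecs (sobolev s)"
  shows "c *\<^sub>C u \<in> vecs (sobolev s)" "Lam s (c *\<^sub>C u) = c *\<^sub>C Lam s u"
proof -
  obtain g where g: "tempered u" "sobolev_transform s u g" using assms(1) by (auto simp: vecs_sobolev)
  have eq: "c *\<^sub>C u = (\<lambda>\<phi>. c *\<^sub>C u \<phi>)" by (simp add: scaleC_fun_def)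
  note cg = sobolev_transform_scaleC[OF g(2)]
  show "c *\<^sub>C u \<in> vecs (sobolev s)" unfolding eq vecs_sobolev using tempered_scaleC[OF g(1)] cg by blast
  show "Lam s (c *\<^sub>C u) = c *\<^sub>C Lam s u" unfolding eq Lam_eq[OF cg] Lam_eq[OF g(2)]
    by (simp add: scaleC_abs_l2 square_integrable_wt[OF g(2)] scaleC_scaleR)
qed

lemma sobolev_subspace: "complex_vector.subspace (vecs (sobolev s))"
proof -
  have "sobolev_transform s (\<lambda>\<phi>. 0) (\<lambda>\<xi>. 0)" by (auto simp: sobolev_transform_iff weighted_def scaleC_zero_right)
  then have "0 \<in> vecs (sobolev s)" unfolding vecs_sobolev zero_fun_def using tempered_zero by blast
  then show ?thesis unfolding complex_vector.subspace_def using sobolev_add(1) sobolev_scaleC(1) by blast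
qed

lemma sobolev_diff:
  assumes "u \<in> vecs (sobolev s)" "v \<in> vecs (sobolev s)"
  shows "u - v \<in> vecs (sobolev s)" "Lam s (u - v) = Lam s u - Lam s v"
  using sobolev_add[OF assms(1) sobolev_scaleC(1)[OF assms(2)], of "-1"] sobolev_scaleC(2)[OF assms(2), of "-1"]
  by (simp_all add: complex_vector.scale_minus_left complex_vector.scale_one)

lemma Lam_inj: "inj_on (Lam s) (vecs (sobolev s))"
proof (rule inj_onI)
  fix u v :: "('a, 'b) distr" assume uv: "u \<in> vecs (sobolev s)" "v \<in> vecs (sobolev s)" "Lam s u = Lam s v"
  obtain g where g: "tempered u" "sobolev_transform s u g" using uv(1) by (auto simp: vecs_sobolev)
  obtain h where h: "tempered v" "sobolev_transform s v h" using uv(2) by (auto simp: vecs_sobolev)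
  have "AE \<xi> in lebesgue. wt \<xi> powr (s/2) *\<^sub>R g \<xi> = wt \<xi> powr (s/2) *\<^sub>R h \<xi>"
    using uv(3) unfolding Lam_eq[OF g(2)] Lam_eq[OF h(2)]
    by (simp add: abs_l2_eq_iff square_integrable_wt[OF g(2)] square_integrable_wt[OF h(2)])
  then have "AE \<xi> in lebesgue. g \<xi> = h \<xi>" by eventually_elim (simp add: wt_nonzero)
  then show "u = v" by (rule sobolev_transform_ext[OF g(2) h(2)]) (auto simp: tempered_schwartz[OF g(1)] tempered_schwartz[OF h(1)])
qed

lemma Lam_bij:
  assumes "s \<ge> -1"
  shows "bij_betw (Lam s) (vecs (sobolev s)) UNIV" unfolding bij_betw_def
proof (intro conjI Lam_inj set_eqI iffI UNIV_I)
  fix a :: "('a, 'b) l2"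
  obtain f where f: "square_integrable f" "a = abs_l2 f" by (metis l2_cases)
  let ?g = "\<lambda>\<xi>. wt \<xi> powr (- s/2) *\<^sub>R f \<xi>"
  have eq: "wt \<xi> powr (s/2) *\<^sub>R ?g \<xi> = f \<xi>" for \<xi> by (simp add: powr_add[symmetric] wt_nonzero)
  then have "weighted s ?g" using f(1) by (simp add: weighted_iff)
  then obtain u where u: "tempered u" "sobolev_transform s u ?g" using weighted_ex_transform assms by blast
  then have "Lam s u = a" unfolding Lam_eq[OF u(2)] eq f(2) by simp
  then show "a \<in> Lam s ` vecs (sobolev s)" using u by (auto simp: vecs_sobolev)
qed

text \<open>With exponent (r - s)/2 this is the inclusion of the Sobolev space of order s in that of
  order r, seen in \<open>l2\<close>. The exponent -1/4 gives the operator J.\<close>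

definition wt_op :: "real \<Rightarrow> ('n::finite, 'e::complex_euclidean_space) l2 \<Rightarrow> ('n, 'e) l2" where
  "wt_op t a = abs_l2 (\<lambda>\<xi>. wt \<xi> powr t *\<^sub>R (SOME f. square_integrable f \<and> a = abs_l2 f) \<xi>)"

context
  fixes t :: real assumes t: "t \<le> 0"
begin

lemma wt_powr_le_1: "wt \<xi> powr t \<le> 1" using powr_mono[OF t wt_ge_1[of \<xi>]] by (simp add: wt_nonzero)

lemma square_integrable_wt_mult:
  assumes f: "square_integrable f" shows "square_integrable (\<lambda>\<xi>. wt \<xi> powr t *\<^sub>R f \<xi>)"
proof (rule square_integrable_bound[OF f, of _ 1])
  from f show "(\<lambda>\<xi>. wt \<xi> powr t *\<^sub>R f \<xi>) \<in> borel_measurable lebesgue"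
    by (intro borel_measurable_scaleR wt_powr_measurable') (simp add: square_integrable_def)
qed (auto intro: mult_left_le_one_le wt_powr_le_1)

lemma wt_op_abs:
  assumes f: "square_integrable f"
  shows "wt_op t (abs_l2 f) = abs_l2 (\<lambda>\<xi>. wt \<xi> powr t *\<^sub>R f \<xi>)"
proof -
  define g where "g = (SOME g. square_integrable g \<and> abs_l2 f = abs_l2 g)"
  have g: "square_integrable g \<and> abs_l2 f = abs_l2 g" unfolding g_def by (rule someI[of _ f]) (simp add: f)
  then have "AE \<xi> in lebesgue. f \<xi> = g \<xi>" using abs_l2_eq_iff f by blast
  then have "AE \<xi> in lebesgue. wt \<xi> powr t *\<^sub>R g \<xi> = wt \<xi> powr t *\<^sub>R f \<xi>" by eventually_elim simp
  then show ?thesis unfolding wt_op_def g_def[symmetric] by (subst abs_l2_eq_iff) (auto intro: square_integrable_wt_mult simp: f g)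
qed

lemma wt_op_add: "wt_op t (a + b) = wt_op t a + wt_op t b"
  and wt_op_scaleC: "wt_op t (c *\<^sub>C a) = c *\<^sub>C wt_op t a"
  and wt_op_symmetric: "inner (wt_op t a) b = inner a (wt_op t b)"
  and norm_wt_op_le: "norm (wt_op t a) \<le> norm a"
  and wt_op_inj0: "wt_op t a = 0 \<Longrightarrow> a = 0"
proof -
  obtain f g where f: "square_integrable f" "a = abs_l2 f" and g: "square_integrable g" "b = abs_l2 g" by (metis l2_cases)
  note s = f(1) g(1) square_integrable_wt_mult[OF f(1)] square_integrable_wt_mult[OF g(1)]
  show "wt_op t (a + b) = wt_op t a + wt_op t b" unfolding f(2) g(2) by (simp add: l2_simps wt_op_abs s scaleR_add_right)
  show "wt_op t (c *\<^sub>C a) = c *\<^sub>C wt_op t a" unfolding f(2) g(2) by (simp add: l2_simps wt_op_abs s scaleC_scaleR)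
  show "inner (wt_op t a) b = inner a (wt_op t b)" unfolding f(2) g(2) by (simp add: l2_simps wt_op_abs s)
  have "(LINT x|lebesgue. (norm (wt x powr t *\<^sub>R f x))\<^sup>2) \<le> (LINT x|lebesgue. (norm (f x))\<^sup>2)"
    using s wt_powr_le_1 unfolding square_integrable_def by (intro integral_mono) (auto intro!: power_mono mult_left_le_one_le)
  then show "norm (wt_op t a) \<le> norm a" unfolding f(2) by (simp add: wt_op_abs s norm_abs_l2)
  assume "wt_op t a = 0"
  then have "AE x in lebesgue. wt x powr t *\<^sub>R f x = 0"
    unfolding f(2) zero_l2_def by (simp add: wt_op_abs s abs_l2_eq_iff square_integrable_zero)
  then have "AE x in lebesgue. f x = 0" by eventually_elim (simp add: wt_nonzero)
  then show "a = 0" unfolding f(2) zero_l2_def by (simp add: abs_l2_eq_iff s square_integrable_zero)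
qed

lemma bounded_linear_wt_op: "bounded_linear (wt_op t :: ('n::finite, 'e::complex_euclidean_space) l2 \<Rightarrow> _)"
proof (rule bounded_linear_intro[of _ 1])
  show "wt_op t (r *\<^sub>R a) = r *\<^sub>R wt_op t a" for r and a :: "('n, 'e) l2"
    using wt_op_scaleC[of "complex_of_real r" a] by (simp add: scaleC_complex_of_real)
qed (simp_all add: wt_op_add norm_wt_op_le)

lemma inj_wt_op: "inj (wt_op t)" using wt_op_inj0 linear_injective_0[OF bounded_linear.linear[OF bounded_linear_wt_op]] by blast

end

lemma Lam_mono:
  assumes "u \<in> vecs (sobolev s)" "t \<le> s"
  shows "u \<in> vecs (sobolev t)" "Lam t u = wt_op ((t - s)/2) (Lam s u)"
proof -
  obtain g where g: "tempered u" "sobolev_transform s u g" using assms(1) by (auto simp: vecs_sobolev)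
  note tg = sobolev_transform_mono[OF g(2) assms(2)]
  show "u \<in> vecs (sobolev t)" using g(1) tg by (auto simp: vecs_sobolev)
  have eq: "wt \<xi> powr ((t - s)/2) *\<^sub>R wt \<xi> powr (s/2) *\<^sub>R g \<xi> = wt \<xi> powr (t/2) *\<^sub>R g \<xi>" for \<xi>
    by (simp add: powr_add[symmetric] diff_divide_distrib)
  show "Lam t u = wt_op ((t - s)/2) (Lam s u)" unfolding Lam_eq[OF g(2)] Lam_eq[OF tg]
    by (subst wt_op_abs[OF _ square_integrable_wt[OF g(2)]]) (use assms(2) in simp, simp only: eq)
qed

text \<open>The graph is the closure of a real span, so that complex homogeneity has to come from
  the generators: a scalar can be moved into the vector \<open>e\<close>.\<close>

lemma fourier_graph_scaleC:
  fixes a b :: "('n::finite, 'e::complex_euclidean_space) l2"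
  assumes "(a, b) \<in> fourier_graph" shows "(c *\<^sub>C a, c *\<^sub>C b) \<in> fourier_graph"
proof -
  let ?B = "{(schwartz_vec \<phi> e, schwartz_vec (fourier \<phi>) e) | \<phi> e. schwartz \<phi>} :: (('n, 'e) l2 \<times> ('n, 'e) l2) set"
  let ?m = "\<lambda>p :: ('n, 'e) l2 \<times> ('n, 'e) l2. (c *\<^sub>C fst p, c *\<^sub>C snd p)"
  have m: "bounded_linear ?m"
    by (intro bounded_linear_Pair bounded_linear_compose[OF bounded_linear_scaleC_right] bounded_linear_fst bounded_linear_snd)
  have "?m ` closure (span ?B) \<subseteq> closure (?m ` span ?B)" by (rule closure_bounded_linear_image_subset[OF m])
  also have "?m ` span ?B = span (?m ` ?B)" by (rule linear_span_image[OF bounded_linear.linear[OF m], symmetric])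
  also have "?m ` ?B \<subseteq> ?B"
  proof
    fix p assume "p \<in> ?m ` ?B"
    then obtain q where q: "q \<in> ?B" "p = ?m q" by blast
    then obtain \<phi> e where "schwartz \<phi>" "q = (schwartz_vec \<phi> e, schwartz_vec (fourier \<phi>) e)" by blast
    then have p: "schwartz \<phi>" "p = (c *\<^sub>C schwartz_vec \<phi> e, c *\<^sub>C schwartz_vec (fourier \<phi>) e)" using q by auto
    have "c *\<^sub>C schwartz_vec \<psi> e = schwartz_vec \<psi> (c *\<^sub>C e)" if "schwartz \<psi>" for \<psi> :: "real^'n \<Rightarrow> complex"
      using schwartz_square_integrable[OF that, of e] by (simp add: schwartz_vec_def scaleC_abs_l2 scaleC_scaleC mult.commute)
    then show "p \<in> ?B" using p schwartz_fourier by auto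
  qed
  then have "closure (span (?m ` ?B)) \<subseteq> closure (span ?B)" by (intro closure_mono span_mono)
  finally have "?m ` closure (span ?B) \<subseteq> closure (span ?B)" .
  then show ?thesis using assms unfolding fourier_graph_def by force
qed

lemma L2_rep:
  assumes "u \<in> vecs L2"
  shows "square_integrable (L2_rep u)" "distr_of (L2_rep u) = u"
    "(abs_l2 (L2_rep u), Lam 0 u) \<in> fourier_graph"
proof -
  obtain f where "square_integrable f \<and> u = distr_of f" using assms by (auto simp: L2_def)
  then have "square_integrable (L2_rep u) \<and> u = distr_of (L2_rep u)"
    unfolding L2_rep_def by (rule someI[of "\<lambda>f. square_integrable f \<and> u = distr_of f"])
  then show r: "square_integrable (L2_rep u)" "distr_of (L2_rep u) = u" by auto
  obtain g where g: "(abs_l2 (L2_rep u), abs_l2 g) \<in> fourier_graph" "sobolev_transform 0 (distr_of (L2_rep u)) g"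
    using square_integrable_ex_transform[OF r(1)] by blast
  then show "(abs_l2 (L2_rep u), Lam 0 u) \<in> fourier_graph" using Lam_eq[OF g(2)] by (simp add: r(2) wt_nonzero)
qed

lemma nrm_L2:
  assumes "u \<in> vecs L2" shows "nrm L2 u = norm (Lam 0 u)"
proof -
  have "nrm L2 u = sqrt (LINT x|lebesgue. (norm (L2_rep u x))\<^sup>2)" by (simp add: L2_def)
  then show ?thesis using fourier_graph_norm[OF L2_rep(3)[OF assms]] norm_abs_l2[OF L2_rep(1)[OF assms]] by simp
qed

text \<open>Reduces the complex inner product of \<open>L2\<close> to the real one that
  \<open>l2\<close> carries; the imaginary part is obtained by rotating the second argument.\<close>

lemma cinner_eq: "cinner x y = complex_of_real (inner x y) + \<i> * complex_of_real (inner x ((-\<i>) *\<^sub>C y))"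
proof -
  have "inner x ((-\<i>) *\<^sub>C y) = Re (- \<i> * cinner x y)" by (simp only: inner_eq_Re_cinner cinner_scaleC_right)
  then show ?thesis by (intro complex_eqI) (simp_all add: inner_eq_Re_cinner)
qed

lemma L2_inner_eq:
  assumes u: "u \<in> vecs L2" and v: "v \<in> vecs L2"
  shows "L2_inner u v = complex_of_real (inner (Lam 0 u) (Lam 0 v)) + \<i> * complex_of_real (inner (Lam 0 u) ((-\<i>) *\<^sub>C Lam 0 v))"
proof -
  let ?f = "L2_rep u" and ?g = "L2_rep v"
  note fg = L2_rep(1)[OF u] L2_rep(1)[OF v]
  note s = square_integrable_inner[OF fg] square_integrable_inner[OF fg(1) square_integrable_scaleC[OF fg(2)], of "-\<i>"]
  have "L2_inner u v = complex_of_real (LINT x|lebesgue. inner (?f x) (?g x)) + \<i> * complex_of_real (LINT x|lebesgue. inner (?f x) ((-\<i>) *\<^sub>C ?g x))"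
    unfolding L2_inner_def cinner_eq using s by (subst Bochner_Integration.integral_add)
      (auto simp only: integral_mult_right_zero integral_complex_of_real complex_of_real_integrable_eq integrable_mult_right)
  also have "(LINT x|lebesgue. inner (?f x) (?g x)) = inner (Lam 0 u) (Lam 0 v)"
    using fourier_graph_inner[OF L2_rep(3)[OF u] L2_rep(3)[OF v]] by (simp add: inner_abs_l2 fg)
  also have "(LINT x|lebesgue. inner (?f x) ((-\<i>) *\<^sub>C ?g x)) = inner (Lam 0 u) ((-\<i>) *\<^sub>C Lam 0 v)"
  proof -
    have rot: "(abs_l2 (\<lambda>x. (-\<i>) *\<^sub>C ?g x), (-\<i>) *\<^sub>C Lam 0 v) \<in> fourier_graph"
      using fourier_graph_scaleC[OF L2_rep(3)[OF v], of "-\<i>"] by (simp only: scaleC_abs_l2[OF fg(2)])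
    show ?thesis using fourier_graph_inner[OF L2_rep(3)[OF u] rot]
      by (simp only: fst_conv snd_conv inner_abs_l2[OF fg(1) square_integrable_scaleC[OF fg(2)]])
  qed
  finally show ?thesis .
qed

section \<open>Convolution operators\<close>

lemma lborel_nn_integral_reflect:
  fixes f :: "'a::euclidean_space \<Rightarrow> ennreal"
  assumes [measurable]: "f \<in> borel_measurable borel"
  shows "(\<integral>\<^sup>+x. f (y - x) \<partial>lborel) = (\<integral>\<^sup>+x. f x \<partial>lborel)"
proof -
  have "lborel = density (distr lborel borel (\<lambda>x. y - x)) (\<lambda>_. 1)" using lborel_affine[of "-1" y] by simp
  then have "(\<integral>\<^sup>+x. f x \<partial>lborel) = (\<integral>\<^sup>+x. f x \<partial>density (distr lborel borel (\<lambda>x. y - x)) (\<lambda>_. 1))"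
    by (rule arg_cong)
  also have "\<dots> = (\<integral>\<^sup>+x. f (y - x) \<partial>lborel)" by (subst nn_integral_density) (simp_all add: nn_integral_distr)
  finally show ?thesis by simp
qed

lemma lborel_nn_integral_translate:
  fixes f :: "'a::euclidean_space \<Rightarrow> ennreal"
  assumes [measurable]: "f \<in> borel_measurable borel"
  shows "(\<integral>\<^sup>+y. f (y - x) \<partial>lborel) = (\<integral>\<^sup>+y. f y \<partial>lborel)"
  by (subst (2) lborel_distr_plus[symmetric, of "-x"], subst nn_integral_distr) auto

text \<open>Expand the nonnegative integral of h (A u - c)^2. If A = 0, then h vanishes almost
  everywhere and c = 0.\<close>

lemma weighted_Cauchy_Schwarz:
  fixes h u :: "'a \<Rightarrow> real"
  assumes h: "\<And>x. h x \<ge> 0" "integrable M h" and hu: "integrable M (\<lambda>x. h x * u x)" "integrable M (\<lambda>x. h x * (u x)\<^sup>2)"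
  shows "(LINT x|M. h x * u x)\<^sup>2 \<le> (LINT x|M. h x) * (LINT x|M. h x * (u x)\<^sup>2)"
proof -
  define A c B where "A = (LINT x|M. h x)" and "c = (LINT x|M. h x * u x)" and "B = (LINT x|M. h x * (u x)\<^sup>2)"
  have "h x * (A * u x - c)\<^sup>2 = A\<^sup>2 * (h x * (u x)\<^sup>2) - (2 * A * c) * (h x * u x) + c\<^sup>2 * h x" for x
    by (simp add: power2_eq_square algebra_simps)
  moreover have "0 \<le> (LINT x|M. h x * (A * u x - c)\<^sup>2)" using h by (intro integral_nonneg_AE) auto
  moreover have "(LINT x|M. A\<^sup>2 * (h x * (u x)\<^sup>2) - (2 * A * c) * (h x * u x) + c\<^sup>2 * h x) = A\<^sup>2 * B - (2 * A * c) * c + c\<^sup>2 * A"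
    using h hu unfolding A_def B_def c_def by simp
  ultimately have "0 \<le> A * (A * B - c\<^sup>2)" by (simp add: power2_eq_square algebra_simps)
  moreover have "A \<ge> 0" unfolding A_def using h by (intro integral_nonneg_AE) auto
  moreover have "c = 0" if "A = 0"
  proof -
    have "AE x in M. h x = 0" using that h unfolding A_def by (subst (asm) integral_nonneg_eq_0_iff_AE) auto
    then have "AE x in M. h x * u x = 0" by eventually_elim simp
    then show ?thesis unfolding c_def using hu(1) by (subst integral_cong_AE[of _ _ "\<lambda>_. 0"]) auto
  qed
  ultimately have "c\<^sup>2 \<le> A * B" by (cases "A = 0") (auto simp: zero_le_mult_iff)
  then show ?thesis by (simp add: A_def B_def c_def)
qed

text \<open>A convolution conjugated by the weight wt^a. If a = s/2 and \<open>k\<close> is the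
  normalized inverse transform of \<theta>, the operator with this kernel is multiplication by
  \<theta> on the Sobolev space of order s, seen in \<open>l2\<close>.\<close>

definition wkernel :: "real \<Rightarrow> (real^'n::finite \<Rightarrow> complex) \<Rightarrow> real^'n \<Rightarrow> real^'n \<Rightarrow> complex" where
  "wkernel a k x y = complex_of_real (wt x powr a * wt y powr (-a)) * k (y - x)"

definition kernel_op :: "real \<Rightarrow> (real^'n::finite \<Rightarrow> complex) \<Rightarrow> (real^'n \<Rightarrow> 'e::complex_euclidean_space) \<Rightarrow> real^'n \<Rightarrow> 'e" where
  "kernel_op a k f x = (LINT y|lebesgue. wkernel a k x y *\<^sub>C f y)"

definition kernel_majorant :: "real \<Rightarrow> (real^'n::finite \<Rightarrow> complex) \<Rightarrow> real^'n \<Rightarrow> real" where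
  "kernel_majorant a k z = 2 powr \<bar>a\<bar> * (wt z powr \<bar>a\<bar> * norm (k z))"

lemma norm_diff_square_le: "(norm (x - y))\<^sup>2 \<le> 2 * (norm x)\<^sup>2 + 2 * (norm (y :: 'a::real_normed_vector))\<^sup>2"
proof -
  have "(norm (x - y))\<^sup>2 \<le> (norm x + norm y)\<^sup>2" by (intro power_mono norm_triangle_ineq4) auto
  also have "\<dots> \<le> 2 * (norm x)\<^sup>2 + 2 * (norm y)\<^sup>2" using sum_squares_bound[of "norm x" "norm y"] by (simp add: power2_sum)
  finally show ?thesis .
qed

text \<open>Peetre's inequality, from the bound of wt x by 2 wt y wt (y - x). For negative
  \<open>a\<close> the two points exchange their roles.\<close>

lemma wt_peetre: "wt x powr a * wt y powr (-a) \<le> 2 powr \<bar>a\<bar> * wt (y - x) powr \<bar>a\<bar>"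
proof -
  have le: "wt x \<le> 2 * wt y * wt (y - x)" for x y :: "real^'a"
  proof -
    have "(norm x)\<^sup>2 \<le> 2 * (norm y)\<^sup>2 + 2 * (norm (y - x))\<^sup>2" using norm_diff_square_le[of y "y - x"] by simp
    moreover have "0 \<le> (norm y)\<^sup>2 * (norm (y - x))\<^sup>2" by simp
    moreover have "2 * wt y * wt (y - x) = 2 + 2 * (norm y)\<^sup>2 + 2 * (norm (y - x))\<^sup>2 + 2 * ((norm y)\<^sup>2 * (norm (y - x))\<^sup>2)"
      by (simp add: wt_def algebra_simps)
    ultimately show ?thesis unfolding wt_def[of x] by linarith
  qed
  have pos: "wt x powr b * wt y powr (-b) \<le> 2 powr b * wt (y - x) powr b" if b: "b \<ge> 0" for x y :: "real^'a" and b
  proof -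
    note p = wt_pos[of x] wt_pos[of y] wt_pos[of "y - x"]
    have "wt x powr b \<le> (2 * wt y * wt (y - x)) powr b" using le[of x y] b p by (intro powr_mono2) auto
    also have "\<dots> = 2 powr b * wt (y - x) powr b * wt y powr b" using p by (simp add: powr_mult)
    finally have "wt x powr b * wt y powr (-b) \<le> 2 powr b * wt (y - x) powr b * wt y powr b * wt y powr (-b)" by (intro mult_right_mono) auto
    also have "\<dots> = 2 powr b * wt (y - x) powr b * (wt y powr b * wt y powr (-b))" by (simp only: mult.assoc)
    also have "wt y powr b * wt y powr (-b) = 1" by (simp add: powr_add[symmetric] wt_nonzero)
    finally show ?thesis by simp
  qed
  have "wt (x - y) = wt (y - x)" by (simp add: wt_def norm_minus_commute)
  then show ?thesis using pos[of a x y] pos[of "-a" y x] by (cases "a \<ge> 0") (simp_all add: mult.commute)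
qed

lemma wkernel_le: "norm (wkernel a k x y) \<le> kernel_majorant a k (y - x)"
  using mult_right_mono[OF wt_peetre norm_ge_zero[of "k (y - x)"], of x a y] by (simp add: wkernel_def kernel_majorant_def norm_mult mult.assoc)

lemma kernel_majorant_nonneg: "kernel_majorant a k z \<ge> 0" by (simp add: kernel_majorant_def)

context
  fixes k :: "real^'n::finite \<Rightarrow> complex" and a :: real
  assumes k: "schwartz k"
begin

lemma kernel_majorant_measurable [measurable]: "kernel_majorant a k \<in> borel_measurable borel"
  using schwartz_measurable[OF k] wt_powr_measurable unfolding kernel_majorant_def by measurable

lemma wkernel_measurable [measurable]: "(\<lambda>(x, y). wkernel a k x y) \<in> borel_measurable (borel \<Otimes>\<^sub>M borel)"
proof -
  note [measurable] = schwartz_measurable[OF k] wt_powr_measurable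
  show ?thesis unfolding wkernel_def by measurable
qed

lemma wkernel_measurable2 [measurable]: "wkernel a k x \<in> borel_measurable borel"
proof -
  note [measurable] = schwartz_measurable[OF k] wt_powr_measurable
  show ?thesis unfolding wkernel_def[abs_def] by measurable
qed

lemma kernel_majorant_bounds:
  "\<exists>M. \<forall>z. kernel_majorant a k z \<le> M" "integrable lborel (kernel_majorant a k)"
proof -
  let ?m = "2 * nat \<lceil>\<bar>\<bar>a\<bar>\<bar>\<rceil>"
  note [measurable] = schwartz_measurable[OF k]
  have r: "rapid (\<lambda>x::real^'n. complex_of_real ((1 + norm x) ^ ?m) * k x)" by (intro rapid_moderate_mult schwartz_rapid k)
      (unfold moderate_def, intro exI[of _ ?m] exI[of _ 1], simp only: norm_of_real, simp)
  have n: "norm (complex_of_real ((1 + norm x) ^ ?m) * k x) = (1 + norm x) ^ ?m * norm (k x)" for x by (simp only: norm_mult norm_of_real) simp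
  have le: "kernel_majorant a k z \<le> 2 powr \<bar>a\<bar> * ((1 + norm z) ^ ?m * norm (k z))" for z
    unfolding kernel_majorant_def by (intro mult_left_mono mult_right_mono wt_powr_le) auto
  obtain C where C: "\<And>x. (1 + norm x) ^ ?m * norm (k x) \<le> C" using rapidI_nonneg[OF schwartz_rapid[OF k], of ?m] by blast
  have "kernel_majorant a k z \<le> 2 powr \<bar>a\<bar> * C" for z by (rule order_trans[OF le mult_left_mono[OF C]]) simp
  then show "\<exists>M. \<forall>z. kernel_majorant a k z \<le> M" by blast
  have "integrable lborel (\<lambda>x::real^'n. complex_of_real ((1 + norm x) ^ ?m) * k x)" by (rule rapid_integrable[OF r]) measurable
  then have "integrable lborel (\<lambda>x. 2 powr \<bar>a\<bar> * ((1 + norm x) ^ ?m * norm (k x)))"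
    unfolding n[symmetric] by (intro integrable_mult_right integrable_norm)
  then show "integrable lborel (kernel_majorant a k)"
    by (rule Bochner_Integration.integrable_bound) (auto intro!: AE_I2 simp: abs_of_nonneg[OF kernel_majorant_nonneg] le[simplified])
qed

definition kernel_mass where "kernel_mass = (LINT z|lborel. kernel_majorant a k z)"

lemma kernel_mass_nonneg: "kernel_mass \<ge> 0" unfolding kernel_mass_def by (intro integral_nonneg_AE) (simp add: kernel_majorant_nonneg)

lemma nn_integral_kernel_majorant:
  "(\<integral>\<^sup>+y. ennreal (kernel_majorant a k (y - x)) \<partial>lborel) = ennreal kernel_mass"
  "(\<integral>\<^sup>+x. ennreal (kernel_majorant a k (y - x)) \<partial>lborel) = ennreal kernel_mass" unfolding kernel_mass_def
  using lborel_nn_integral_translate[of "\<lambda>z. ennreal (kernel_majorant a k z)" x]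
    lborel_nn_integral_reflect[of "\<lambda>z. ennreal (kernel_majorant a k z)" y]
    nn_integral_eq_integral[OF kernel_majorant_bounds(2)] by (auto simp: kernel_majorant_nonneg)

lemma integrable_kernel_majorant: "integrable lborel (\<lambda>y. kernel_majorant a k (y - x))"
  "(LINT y|lborel. kernel_majorant a k (y - x)) = kernel_mass"
proof -
  show "integrable lborel (\<lambda>y. kernel_majorant a k (y - x))" unfolding integrable_iff_bounded using nn_integral_kernel_majorant(1)[of x]
    by (simp add: kernel_majorant_nonneg)
  then show "(LINT y|lborel. kernel_majorant a k (y - x)) = kernel_mass"
    using nn_integral_kernel_majorant(1)[of x] kernel_mass_nonneg kernel_majorant_nonneg by (subst integral_eq_nn_integral) auto
qed

lemma integrable_kernel_majorant_mult:
  fixes u :: "real^'n \<Rightarrow> real"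
  assumes u[measurable]: "u \<in> borel_measurable borel" and u2: "integrable lborel (\<lambda>y. (u y)\<^sup>2)"
  shows "integrable lborel (\<lambda>y. kernel_majorant a k (y - x) * (u y)\<^sup>2)"
    "integrable lborel (\<lambda>y. kernel_majorant a k (y - x) * u y)"
proof -
  obtain M where M: "\<And>z. kernel_majorant a k z \<le> M" using kernel_majorant_bounds(1) by blast
  have M0: "M \<ge> 0" using M[of 0] kernel_majorant_nonneg[of a k 0] by linarith
  show 1: "integrable lborel (\<lambda>y. kernel_majorant a k (y - x) * (u y)\<^sup>2)"
    by (rule Bochner_Integration.integrable_bound[OF integrable_mult_right[OF u2, of M]])
      (auto intro!: mult_right_mono simp: M abs_mult kernel_majorant_nonneg M0)
  show "integrable lborel (\<lambda>y. kernel_majorant a k (y - x) * u y)"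
  proof (rule Bochner_Integration.integrable_bound[OF Bochner_Integration.integrable_add[OF integrable_kernel_majorant(1)[of x] 1]])
    have "\<bar>t\<bar> \<le> 1 + t\<^sup>2" for t :: real using sum_squares_bound[of "\<bar>t\<bar>" 1] by simp
    then have "kernel_majorant a k (y - x) * \<bar>u y\<bar> \<le> kernel_majorant a k (y - x) * (1 + (u y)\<^sup>2)" for y
      by (intro mult_left_mono kernel_majorant_nonneg)
    then show "AE y in lborel. norm (kernel_majorant a k (y - x) * u y) \<le> norm (kernel_majorant a k (y - x) + kernel_majorant a k (y - x) * (u y)\<^sup>2)"
      by (auto simp: abs_mult kernel_majorant_nonneg distrib_left)
  qed measurable
qed

lemma kernel_op_eq:
  assumes "f \<in> borel_measurable lebesgue" "f' \<in> borel_measurable borel" "AE x in lebesgue. f x = f' x"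
  shows "kernel_op a k f x = (LINT y|lborel. wkernel a k x y *\<^sub>C f' y)"
proof -
  have m: "wkernel a k x \<in> borel_measurable lebesgue" by (simp add: measurable_completion)
  have m': "f' \<in> borel_measurable lebesgue" using assms(2) by (simp add: measurable_completion)
  have "kernel_op a k f x = (LINT y|lebesgue. wkernel a k x y *\<^sub>C f' y)" unfolding kernel_op_def using assms(1,3) m m'
    by (intro integral_cong_AE scaleC_measurable) (auto elim!: eventually_mono)
  also have "\<dots> = (LINT y|lborel. wkernel a k x y *\<^sub>C f' y)"
    using assms(2) by (intro integral_completion) (auto intro!: scaleC_measurable)
  finally show ?thesis .
qed

lemma square_integrable_ex_borel:
  fixes f :: "real^'n \<Rightarrow> 'e::complex_euclidean_space"
  assumes "square_integrable f"
  shows "\<exists>f'. f' \<in> borel_measurable borel \<and> (AE x in lebesgue. f x = f' x) \<and> square_integrable f' \<and>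
    integrable lborel (\<lambda>y. (norm (f' y))\<^sup>2) \<and> (LINT x|lborel. (norm (f' x))\<^sup>2) = (LINT x|lebesgue. (norm (f x))\<^sup>2)"
proof -
  obtain f' where f': "f' \<in> borel_measurable borel" "AE x in lebesgue. f x = f' x"
    using lebesgue_ex_borel assms unfolding square_integrable_def by blast
  have m: "f' \<in> borel_measurable lebesgue" using f'(1) by (simp add: measurable_completion)
  have s: "square_integrable f'" by (rule square_integrable_cong_AE[OF assms m f'(2)])
  note [measurable] = f'(1)
  have "integrable lborel (\<lambda>y. (norm (f' y))\<^sup>2)"
    using s unfolding square_integrable_def by (subst integrable_lebesgue_iff[symmetric]) auto
  moreover have "(LINT x|lborel. (norm (f' x))\<^sup>2) = (LINT x|lebesgue. (norm (f' x))\<^sup>2)"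
    by (rule integral_completion[symmetric]) measurable
  moreover have "(LINT x|lebesgue. (norm (f' x))\<^sup>2) = (LINT x|lebesgue. (norm (f x))\<^sup>2)"
    using f'(2) assms s unfolding square_integrable_def by (intro integral_cong_AE) (auto elim!: eventually_mono)
  ultimately show ?thesis using f' s by (intro exI[of _ f']) auto
qed

lemma kernel_op_pointwise:
  fixes f :: "real^'n \<Rightarrow> 'e::complex_euclidean_space"
  assumes f[measurable]: "f \<in> borel_measurable borel" and f2: "integrable lborel (\<lambda>y. (norm (f y))\<^sup>2)"
  shows "integrable lborel (\<lambda>y. wkernel a k x y *\<^sub>C f y)"
    "(norm (LINT y|lborel. wkernel a k x y *\<^sub>C f y))\<^sup>2 \<le> kernel_mass * (LINT y|lborel. kernel_majorant a k (y - x) * (norm (f y))\<^sup>2)"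
proof -
  note i = integrable_kernel_majorant_mult[of "\<lambda>y. norm (f y)" x, OF _ f2]
  have le: "norm (wkernel a k x y *\<^sub>C f y) \<le> kernel_majorant a k (y - x) * norm (f y)" for y
    unfolding norm_scaleC by (intro mult_right_mono wkernel_le) auto
  show int: "integrable lborel (\<lambda>y. wkernel a k x y *\<^sub>C f y)" by (rule Bochner_Integration.integrable_bound[OF i(2)])
      (use le in \<open>auto intro!: scaleC_measurable simp: abs_mult kernel_majorant_nonneg\<close>)
  have "norm (LINT y|lborel. wkernel a k x y *\<^sub>C f y) \<le> (LINT y|lborel. kernel_majorant a k (y - x) * norm (f y))"
    by (rule order_trans[OF integral_norm_bound integral_mono]) (use int i(2) le in auto)
  then have "(norm (LINT y|lborel. wkernel a k x y *\<^sub>C f y))\<^sup>2 \<le> (LINT y|lborel. kernel_majorant a k (y - x) * norm (f y))\<^sup>2"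
    by (intro power_mono) auto
  also have "\<dots> \<le> (LINT y|lborel. kernel_majorant a k (y - x)) * (LINT y|lborel. kernel_majorant a k (y - x) * (norm (f y))\<^sup>2)"
    by (rule weighted_Cauchy_Schwarz) (use i integrable_kernel_majorant(1) kernel_majorant_nonneg in auto)
  finally show "(norm (LINT y|lborel. wkernel a k x y *\<^sub>C f y))\<^sup>2 \<le> kernel_mass * (LINT y|lborel. kernel_majorant a k (y - x) * (norm (f y))\<^sup>2)"
    by (simp add: integrable_kernel_majorant(2))
qed

text \<open>Schur's test: the Cauchy-Schwarz inequality with the majorant as weight, followed by
  Tonelli's theorem. Integrating \<open>kernel_majorant a k (y - x)\<close> over either variable
  gives \<open>kernel_mass\<close>.\<close>

lemma kernel_op_bound:
  fixes f :: "real^'n \<Rightarrow> 'e::complex_euclidean_space"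
  assumes f: "square_integrable f"
  shows "square_integrable (kernel_op a k f)"
    "norm (abs_l2 (kernel_op a k f)) \<le> kernel_mass * norm (abs_l2 f)"
proof -
  obtain f' where f': "f' \<in> borel_measurable borel" "AE x in lebesgue. f x = f' x"
    "integrable lborel (\<lambda>y. (norm (f' y))\<^sup>2)" "(LINT x|lborel. (norm (f' x))\<^sup>2) = (LINT x|lebesgue. (norm (f x))\<^sup>2)"
    using square_integrable_ex_borel[OF f] by blast
  note [measurable] = f'(1)
  have eq: "kernel_op a k f = (\<lambda>x. LINT y|lborel. wkernel a k x y *\<^sub>C f' y)"
    using kernel_op_eq[OF _ f'(1,2)] f by (auto simp: square_integrable_def)
  have "(\<lambda>p. (\<lambda>(x, y). wkernel a k x y) p *\<^sub>C f' (snd p)) \<in> borel_measurable (borel \<Otimes>\<^sub>M borel)"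
    by (rule scaleC_measurable) measurable
  then have "(\<lambda>(x, y). wkernel a k x y *\<^sub>C f' y) \<in> borel_measurable (borel \<Otimes>\<^sub>M lborel)"
    by (simp add: case_prod_beta' cong: measurable_cong_sets)
  then have m[measurable]: "kernel_op a k f \<in> borel_measurable borel" unfolding eq by (rule lborel.borel_measurable_lebesgue_integral)
  let ?I = "LINT x|lborel. (norm (f' x))\<^sup>2"
  let ?q = "\<lambda>x y. ennreal (kernel_majorant a k (y - x) * (norm (f' y))\<^sup>2)" and ?u = "\<lambda>x. ennreal ((norm (kernel_op a k f x))\<^sup>2)"
  have I0: "?I \<ge> 0" by (intro integral_nonneg_AE) auto
  have "(\<integral>\<^sup>+x. ?u x \<partial>lborel) \<le>
      (\<integral>\<^sup>+x. ennreal kernel_mass * (\<integral>\<^sup>+y. ?q x y \<partial>lborel) \<partial>lborel)"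
  proof (rule nn_integral_mono)
    fix x
    have "?u x \<le> ennreal (kernel_mass * (LINT y|lborel. kernel_majorant a k (y - x) * (norm (f' y))\<^sup>2))"
      unfolding eq by (rule ennreal_leI[OF kernel_op_pointwise(2)[OF f'(1,3)]])
    also have "\<dots> = ennreal kernel_mass * (\<integral>\<^sup>+y. ?q x y \<partial>lborel)"
      using integrable_kernel_majorant_mult(1)[of "\<lambda>y. norm (f' y)" x, OF _ f'(3)] kernel_mass_nonneg
      by (subst nn_integral_eq_integral) (auto simp: ennreal_mult' kernel_majorant_nonneg)
    finally show "?u x \<le> ennreal kernel_mass * (\<integral>\<^sup>+y. ?q x y \<partial>lborel)" .
  qed
  also have "\<dots> = ennreal kernel_mass * (\<integral>\<^sup>+x. \<integral>\<^sup>+y. ?q x y \<partial>lborel \<partial>lborel)"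
    by (rule nn_integral_cmult) measurable
  also have "(\<integral>\<^sup>+x. \<integral>\<^sup>+y. ?q x y \<partial>lborel \<partial>lborel) =
      (\<integral>\<^sup>+y. \<integral>\<^sup>+x. ?q x y \<partial>lborel \<partial>lborel)" by (rule lborel_pair.Fubini') measurable
  also have "\<dots> = (\<integral>\<^sup>+y. ennreal kernel_mass * ennreal ((norm (f' y))\<^sup>2) \<partial>lborel)"
  proof (rule nn_integral_cong)
    fix y
    have "(\<integral>\<^sup>+x. ?q x y \<partial>lborel) =
        (\<integral>\<^sup>+x. ennreal (kernel_majorant a k (y - x)) * ennreal ((norm (f' y))\<^sup>2) \<partial>lborel)"
      by (simp add: ennreal_mult' kernel_majorant_nonneg)
    also have "\<dots> = ennreal kernel_mass * ennreal ((norm (f' y))\<^sup>2)"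
      by (subst nn_integral_multc) (auto simp: nn_integral_kernel_majorant)
    finally show "(\<integral>\<^sup>+x. ?q x y \<partial>lborel) = ennreal kernel_mass * ennreal ((norm (f' y))\<^sup>2)" .
  qed
  also have "\<dots> = ennreal kernel_mass * ennreal ?I" using f'(3) by (subst nn_integral_cmult) (auto simp: nn_integral_eq_integral)
  finally have *: "(\<integral>\<^sup>+x. ?u x \<partial>lborel) \<le> ennreal (kernel_mass * (kernel_mass * ?I))"
    using kernel_mass_nonneg I0 by (simp add: ennreal_mult')
  have int: "integrable lborel (\<lambda>x. (norm (kernel_op a k f x))\<^sup>2)"
    unfolding integrable_iff_bounded using * by (auto intro: le_less_trans)
  have "(\<lambda>x. (norm (kernel_op a k f x))\<^sup>2) \<in> borel_measurable borel" by measurable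
  note le_eq = integrable_lebesgue_iff[OF this] integral_completion[of _ lborel, simplified, OF this]
  show s: "square_integrable (kernel_op a k f)" unfolding square_integrable_def using int le_eq(1) m by (auto simp: measurable_completion)
  have "ennreal (LINT x|lborel. (norm (kernel_op a k f x))\<^sup>2) \<le> ennreal (kernel_mass * (kernel_mass * ?I))"
    using * int by (subst (asm) nn_integral_eq_integral) auto
  then have "(LINT x|lborel. (norm (kernel_op a k f x))\<^sup>2) \<le> kernel_mass * (kernel_mass * ?I)"
    using kernel_mass_nonneg I0 by (simp add: ennreal_le_iff)
  then have "sqrt (LINT x|lborel. (norm (kernel_op a k f x))\<^sup>2) \<le> sqrt (kernel_mass\<^sup>2 * ?I)"
    by (intro real_sqrt_le_mono) (simp add: power2_eq_square mult.assoc)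
  then show "norm (abs_l2 (kernel_op a k f)) \<le> kernel_mass * norm (abs_l2 f)"
    using kernel_mass_nonneg by (simp add: norm_abs_l2 s f le_eq(2) f'(4) real_sqrt_mult)
qed

text \<open>A bound uniform in \<open>x\<close>, by which the exchange of integrals is justified in
  \<open>sobolev_transform_schwartz_mult\<close>.\<close>

lemma kernel_majorant_mult_bounded:
  fixes u :: "real^'n \<Rightarrow> real"
  assumes u[measurable]: "u \<in> borel_measurable borel" and u2: "integrable lborel (\<lambda>y. (u y)\<^sup>2)"
  shows "\<exists>B. \<forall>x. (LINT y|lborel. kernel_majorant a k (y - x) * u y) \<le> B"
proof -
  obtain M where M: "\<And>z. kernel_majorant a k z \<le> M" using kernel_majorant_bounds(1) by blast
  have "(LINT y|lborel. kernel_majorant a k (y - x) * u y) \<le> kernel_mass + M * (LINT y|lborel. (u y)\<^sup>2)" for x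
  proof -
    have "(LINT y|lborel. kernel_majorant a k (y - x) * u y) \<le> (LINT y|lborel. kernel_majorant a k (y - x) + M * (u y)\<^sup>2)"
    proof (rule integral_mono)
      fix y
      have "kernel_majorant a k (y - x) * u y \<le> kernel_majorant a k (y - x) * (1 + (u y)\<^sup>2)"
        using sum_squares_bound[of "\<bar>u y\<bar>" 1] by (intro mult_left_mono kernel_majorant_nonneg) simp
      also have "\<dots> \<le> kernel_majorant a k (y - x) + M * (u y)\<^sup>2" using M[of "y - x"] by (simp add: distrib_left mult_right_mono)
      finally show "kernel_majorant a k (y - x) * u y \<le> kernel_majorant a k (y - x) + M * (u y)\<^sup>2" .
    qed (use integrable_kernel_majorant_mult(2)[OF u u2] integrable_kernel_majorant(1) u2 in auto)
    also have "\<dots> = kernel_mass + M * (LINT y|lborel. (u y)\<^sup>2)" using integrable_kernel_majorant u2 by simp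
    finally show ?thesis .
  qed
  then show ?thesis by blast
qed

text \<open>The majorant is bounded as well as integrable. The resulting bound is the dominating
  constant on balls in the compactness argument.\<close>

lemma kernel_op_uniform_bound:
  "\<exists>B. \<forall>f x. square_integrable f \<longrightarrow>
    (norm (kernel_op a k f x :: 'e::complex_euclidean_space))\<^sup>2 \<le> B * (norm (abs_l2 f))\<^sup>2"
proof -
  obtain M where M: "\<And>z. kernel_majorant a k z \<le> M" using kernel_majorant_bounds(1) by blast
  have "(norm (kernel_op a k f x))\<^sup>2 \<le> (kernel_mass * M) * (norm (abs_l2 f))\<^sup>2" if f: "square_integrable f"
    for f :: "real^'n \<Rightarrow> 'e" and x
  proof -
    obtain f' where f': "f' \<in> borel_measurable borel" "AE x in lebesgue. f x = f' x"
      "integrable lborel (\<lambda>y. (norm (f' y))\<^sup>2)" "(LINT x|lborel. (norm (f' x))\<^sup>2) = (LINT x|lebesgue. (norm (f x))\<^sup>2)"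
      using square_integrable_ex_borel[OF f] by blast
    have "(LINT y|lborel. kernel_majorant a k (y - x) * (norm (f' y))\<^sup>2) \<le> (LINT y|lborel. M * (norm (f' y))\<^sup>2)"
      using f' M integrable_kernel_majorant_mult(1)[of "\<lambda>y. norm (f' y)" x] by (intro integral_mono mult_right_mono) auto
    then have "kernel_mass * (LINT y|lborel. kernel_majorant a k (y - x) * (norm (f' y))\<^sup>2) \<le> kernel_mass * (M * (LINT y|lborel. (norm (f' y))\<^sup>2))"
      using kernel_mass_nonneg by (intro mult_left_mono) auto
    moreover have "(norm (abs_l2 f))\<^sup>2 = (LINT y|lborel. (norm (f' y))\<^sup>2)"
      unfolding norm_abs_l2[OF f] f'(4) by (subst real_sqrt_pow2) (auto intro: integral_nonneg_AE)
    ultimately show ?thesis using kernel_op_pointwise(2)[OF f'(1,3), of x] kernel_op_eq[OF _ f'(1,2), of x] f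
      by (simp add: square_integrable_def mult.assoc)
  qed
  then show ?thesis by blast
qed

text \<open>Evaluation at \<open>x\<close> is a continuous functional of \<open>f\<close>,
  represented by the conjugate of the kernel. Weak convergence of the arguments thus becomes
  pointwise convergence of the images.\<close>

lemma kernel_op_inner:
  fixes f :: "real^'n \<Rightarrow> 'e::complex_euclidean_space"
  assumes f: "square_integrable f"
  shows "\<exists>v. \<forall>f. square_integrable f \<longrightarrow> inner (kernel_op a k f x) e = inner (abs_l2 f) (v :: ('n, 'e) l2)"
proof -
  let ?v = "\<lambda>y. cnj (wkernel a k x y) *\<^sub>C e"
  obtain M where M: "\<And>z. kernel_majorant a k z \<le> M" using kernel_majorant_bounds(1) by blast
  have "(\<lambda>y. cnj (wkernel a k x y)) \<in> borel_measurable borel"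
    by (rule borel_measurable_continuous_on[OF linear_continuous_on[OF bounded_linear_cnj]]) measurable
  then have vb[measurable]: "?v \<in> borel_measurable borel" by (rule scaleC_measurable) simp
  have "integrable lborel (\<lambda>y. M * kernel_majorant a k (y - x) * (norm e)\<^sup>2)"
    using integrable_kernel_majorant by (intro integrable_mult_left integrable_mult_right)
  then have "integrable lborel (\<lambda>y. (norm (?v y))\<^sup>2)"
  proof (rule Bochner_Integration.integrable_bound)
    have "(norm (wkernel a k x y))\<^sup>2 \<le> M * kernel_majorant a k (y - x)" for y
      unfolding power2_eq_square using wkernel_le[of a k x y] M[of "y - x"] by (intro mult_mono) (auto intro: order_trans kernel_majorant_nonneg)
    then have "(norm (?v y))\<^sup>2 \<le> M * kernel_majorant a k (y - x) * (norm e)\<^sup>2" for y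
      by (simp add: norm_scaleC power_mult_distrib mult_right_mono)
    then show "AE y in lborel. norm ((norm (?v y))\<^sup>2) \<le> norm (M * kernel_majorant a k (y - x) * (norm e)\<^sup>2)"
      by (intro AE_I2) (simp only: real_norm_def, smt (verit) zero_le_power2)
  qed measurable
  moreover have "(\<lambda>y. (norm (?v y))\<^sup>2) \<in> borel_measurable borel" by measurable
  ultimately have v: "square_integrable ?v" unfolding square_integrable_def by (simp add: integrable_lebesgue_iff measurable_completion vb)
  have "inner (kernel_op a k f x) e = inner (abs_l2 f) (abs_l2 ?v)" if f: "square_integrable f" for f
  proof -
    obtain f' where f': "f' \<in> borel_measurable borel" "AE x in lebesgue. f x = f' x" "square_integrable f'"
      "integrable lborel (\<lambda>y. (norm (f' y))\<^sup>2)" using square_integrable_ex_borel[OF f] by blast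
    have ff: "abs_l2 f = abs_l2 f'" using f'(2,3) f by (simp add: abs_l2_eq_iff)
    note [measurable] = f'(1)
    have "inner (abs_l2 f) (abs_l2 ?v) = (LINT y|lebesgue. inner (f' y) (?v y))" unfolding ff by (rule inner_abs_l2[OF f'(3) v])
    also have "\<dots> = (LINT y|lborel. inner (f' y) (?v y))" using vb by (intro integral_completion) measurable
    also have "\<dots> = (LINT y|lborel. inner (wkernel a k x y *\<^sub>C f' y) e)" by (simp add: inner_scaleC_left)
    also have "\<dots> = inner (kernel_op a k f x) e" using kernel_op_pointwise(1)[OF f'(1,4), of x] kernel_op_eq[OF _ f'(1,2), of x] f
      by (simp add: square_integrable_def)
    finally show ?thesis by simp
  qed
  then show ?thesis by blast
qed

text \<open>The functions \<open>kernel_op a k (f n)\<close> are uniformly bounded and converge pointwise, hence in the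
  mean on balls, while the weight with the exponent \<open>t < 0\<close> makes the contribution of the complement
  of a large ball small.\<close>

lemma kernel_op_weakly_convergent_imp_Cauchy:
  fixes f :: "nat \<Rightarrow> real^'n \<Rightarrow> 'e::complex_euclidean_space"
  assumes f: "\<And>n. square_integrable (f n)" "\<And>n. norm (abs_l2 (f n)) \<le> C"
    and w: "\<And>y. convergent (\<lambda>n. inner (abs_l2 (f n)) y)" and t: "t < 0"
  shows "Cauchy (\<lambda>n. wt_op t (abs_l2 (kernel_op a k (f n))))"
proof -
  define F where "F n = kernel_op a k (f n)" for n
  have F: "square_integrable (F n)" for n unfolding F_def by (rule kernel_op_bound(1)[OF f(1)])
  have Fm: "F n \<in> borel_measurable lebesgue" for n using F[of n] by (simp add: square_integrable_def)
  have dF: "square_integrable (\<lambda>x. F n x - F m x)" for n m using square_integrable_add[OF F square_integrable_uminus[OF F]] by simp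
  have conv: "convergent (\<lambda>n. F n x)" for x
  proof -
    have "convergent (\<lambda>n. inner (F n x) b)" for b
    proof -
      obtain v where "\<And>n. inner (F n x) b = inner (abs_l2 (f n)) v" using kernel_op_inner[OF f(1), of x b] f(1) unfolding F_def by blast
      then show ?thesis using w[of v] by simp
    qed
    then obtain l where l: "\<And>b. (\<lambda>n. inner (F n x) b) \<longlonglongrightarrow> l b" unfolding convergent_def by metis
    have "(\<lambda>n. \<Sum>b\<in>Basis. inner (F n x) b *\<^sub>R b) \<longlonglongrightarrow> (\<Sum>b\<in>Basis. l b *\<^sub>R b)"
      by (intro tendsto_sum tendsto_scaleR l tendsto_const)
    then show ?thesis by (simp add: euclidean_representation convergent_def) blast
  qed
  define G where "G x = lim (\<lambda>n. F n x)" for x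
  have G: "(\<lambda>n. F n x) \<longlonglongrightarrow> G x" for x using conv[of x] by (simp add: G_def convergent_LIMSEQ_iff)
  have Gm: "G \<in> borel_measurable lebesgue" by (rule borel_measurable_LIMSEQ_metric[OF Fm G])
  obtain B where B: "\<And>n x. (norm (F n x))\<^sup>2 \<le> B * (norm (abs_l2 (f n)))\<^sup>2"
    using kernel_op_uniform_bound f(1) unfolding F_def by metis
  define B' where "B' = \<bar>B\<bar> * C\<^sup>2"
  have B': "(norm (F n x))\<^sup>2 \<le> B'" for n x
  proof -
    have "(norm (F n x))\<^sup>2 \<le> \<bar>B\<bar> * (norm (abs_l2 (f n)))\<^sup>2" by (rule order_trans[OF B]) (intro mult_right_mono, auto)
    also have "\<dots> \<le> B'" unfolding B'_def using f(2)[of n] by (intro mult_left_mono power_mono) auto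
    finally show ?thesis .
  qed
  have BG: "(norm (G x))\<^sup>2 \<le> B'" for x
    by (rule LIMSEQ_le_const2[of "\<lambda>n. (norm (F n x))\<^sup>2"]) (use B' in \<open>auto intro!: tendsto_intros G\<close>)
  let ?A = "2 * kernel_mass * C"
  have dn: "(LINT x|lebesgue. (norm (F n x - F m x))\<^sup>2) \<le> ?A\<^sup>2" for n m
  proof -
    have b: "norm (abs_l2 (F n)) \<le> kernel_mass * C" for n unfolding F_def by (rule order_trans[OF kernel_op_bound(2)[OF f(1)]])
        (intro mult_left_mono f kernel_mass_nonneg)
    have "norm (abs_l2 (F n) - abs_l2 (F m)) \<le> ?A" using norm_triangle_ineq4[of "abs_l2 (F n)" "abs_l2 (F m)"] b[of n] b[of m] by linarith
    then have "(norm (abs_l2 (\<lambda>x. F n x - F m x)))\<^sup>2 \<le> ?A\<^sup>2" unfolding diff_abs_l2[OF F F] by (intro power_mono) auto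
    then show ?thesis unfolding norm_abs_l2[OF dF] by (subst (asm) real_sqrt_pow2) (auto intro: integral_nonneg_AE)
  qed
  have tail: "\<exists>R. (1 + R\<^sup>2) powr (2 * t) * ?A\<^sup>2 < e" if e: "e > 0" for e
  proof -
    have "((\<lambda>R::real. (1 + R\<^sup>2) powr (2 * t)) \<longlongrightarrow> 0) at_top"
    proof (rule tendsto_neg_powr)
      show "filterlim (\<lambda>R::real. 1 + R\<^sup>2) at_top at_top"
        by (intro filterlim_tendsto_add_at_top[OF tendsto_const] filterlim_pow_at_top filterlim_ident) simp
    qed (use t in simp)
    then have "((\<lambda>R::real. (1 + R\<^sup>2) powr (2 * t) * ?A\<^sup>2) \<longlongrightarrow> 0 * ?A\<^sup>2) at_top" by (intro tendsto_intros)
    then have "\<forall>\<^sub>F R::real in at_top. (1 + R\<^sup>2) powr (2 * t) * ?A\<^sup>2 < e" using e by (simp add: order_tendstoD)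
    then show ?thesis by (rule eventually_happens'[rotated]) simp
  qed
  show ?thesis
  proof (rule CauchyI)
    fix e :: real assume e: "e > 0"
    \<comment> \<open>The complement of the ball contributes less than half of
      \<open>e\<^sup>2\<close>. The other half comes from the ball: two integrals below
      \<open>e\<^sup>2 / 8\<close>, each counted with the factor 2.\<close>
    obtain R where R: "(1 + R\<^sup>2) powr (2 * t) * ?A\<^sup>2 < e\<^sup>2 / 2" using tail[of "e\<^sup>2 / 2"] e by auto
    let ?i = "indicator (cball 0 \<bar>R\<bar>) :: real^'n \<Rightarrow> real"
    let ?h = "\<lambda>n x. ?i x * (norm (F n x - G x))\<^sup>2"
    have ii: "integrable lebesgue ?i" using lmeasurable_cball[of "0 :: real^'n" "\<bar>R\<bar>"] by (simp add: lmeasurable_iff_integrable)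
    have im: "?i \<in> borel_measurable lebesgue" using ii by (rule borel_measurable_integrable)
    have bi: "AE x in lebesgue. norm (?h n x) \<le> ?i x * (4 * B')" for n
    proof (intro AE_I2)
      fix x
      have "(norm (F n x - G x))\<^sup>2 \<le> 4 * B'" using norm_diff_square_le[of "F n x" "G x"] B'[of n x] BG[of x] by linarith
      then show "norm (?h n x) \<le> ?i x * (4 * B')" by (auto simp: indicator_def)
    qed
    have iF: "integrable lebesgue (\<lambda>x. ?h n x)" for n
    proof (rule Bochner_Integration.integrable_bound[OF integrable_mult_left[OF ii, of "4 * B'"]])
      show "AE x in lebesgue. norm (?h n x) \<le> norm (?i x * (4 * B'))" using bi[of n] by (auto elim!: eventually_mono)
      show "(\<lambda>x. ?h n x) \<in> borel_measurable lebesgue"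
      proof -
        note [measurable] = Fm Gm im
        show ?thesis by measurable
      qed
    qed
    have "(\<lambda>n. LINT x|lebesgue. ?h n x) \<longlonglongrightarrow> (LINT x|(lebesgue :: (real^'n) measure). 0)"
    proof (rule integral_dominated_convergence[where w = "\<lambda>x. ?i x * (4 * B')"])
      show "integrable lebesgue (\<lambda>x. ?i x * (4 * B'))" by (rule integrable_mult_left[OF ii])
      show "AE x in lebesgue. (\<lambda>n. ?h n x) \<longlonglongrightarrow> 0"
      proof (intro AE_I2)
        fix x
        have "(\<lambda>n. ?h n x) \<longlonglongrightarrow> ?i x * (norm (G x - G x))\<^sup>2" by (intro tendsto_intros G)
        then show "(\<lambda>n. ?h n x) \<longlonglongrightarrow> 0" by simp
      qed
      show "AE x in lebesgue. norm (?h n x) \<le> ?i x * (4 * B')" for n by (rule bi)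
    qed (use iF in auto)
    then have "\<forall>\<^sub>F n in sequentially. (LINT x|lebesgue. ?h n x) < e\<^sup>2 / 8"
      using e by (intro order_tendstoD(2)[where y = 0]) auto
    then obtain N where N: "\<And>n. n \<ge> N \<Longrightarrow> (LINT x|lebesgue. ?h n x) < e\<^sup>2 / 8"
      unfolding eventually_sequentially by blast
    have "norm (wt_op t (abs_l2 (F n)) - wt_op t (abs_l2 (F m))) < e" if nm: "n \<ge> N" "m \<ge> N" for n m
    proof -
      let ?c = "(1 + R\<^sup>2) powr (2 * t)"
      have t0: "t \<le> 0" using t by simp
      have s: "square_integrable (\<lambda>x. wt x powr t *\<^sub>R (F n x - F m x))" by (rule square_integrable_wt_mult[OF t0 dF])
      have "wt_op t (abs_l2 (F n)) - wt_op t (abs_l2 (F m)) = abs_l2 (\<lambda>x. wt x powr t *\<^sub>R (F n x - F m x))"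
        unfolding wt_op_abs[OF t0 F] by (subst diff_abs_l2) (auto intro: square_integrable_wt_mult[OF t0] F simp: scaleR_diff_right)
      then have "(norm (wt_op t (abs_l2 (F n)) - wt_op t (abs_l2 (F m))))\<^sup>2 = (LINT x|lebesgue. (norm (wt x powr t *\<^sub>R (F n x - F m x)))\<^sup>2)"
        unfolding norm_abs_l2[OF s] by (simp add: norm_abs_l2[OF s] integral_nonneg_AE)
      also have "\<dots> \<le> (LINT x|lebesgue. 2 * (?h n x) + 2 * (?h m x) + ?c * (norm (F n x - F m x))\<^sup>2)"
      proof (rule integral_mono)
        show "integrable lebesgue (\<lambda>x. (norm (wt x powr t *\<^sub>R (F n x - F m x)))\<^sup>2)" using s by (simp add: square_integrable_def)
        show "integrable lebesgue (\<lambda>x. 2 * (?h n x) + 2 * (?h m x) + ?c * (norm (F n x - F m x))\<^sup>2)"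
          using dF[of n m] by (intro Bochner_Integration.integrable_add integrable_mult_right iF) (simp add: square_integrable_def)
        fix x
        let ?d = "(norm (F n x - F m x))\<^sup>2"
        have e1: "(norm (wt x powr t *\<^sub>R (F n x - F m x)))\<^sup>2 = wt x powr (2 * t) * ?d" using norm_wt_scale[of x "2 * t"] by simp
        show "(norm (wt x powr t *\<^sub>R (F n x - F m x)))\<^sup>2 \<le> 2 * (?h n x) + 2 * (?h m x) + ?c * ?d"
        proof (cases "norm x \<le> \<bar>R\<bar>")
          case True
          have "wt x powr (2 * t) * ?d \<le> 1 * ?d" using t wt_powr_le_1[of "2 * t" x] by (intro mult_right_mono) auto
          also have "1 * ?d \<le> 2 * (norm (F n x - G x))\<^sup>2 + 2 * (norm (F m x - G x))\<^sup>2"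
            using norm_diff_square_le[of "F n x - G x" "F m x - G x"] by simp
          finally have "wt x powr (2 * t) * ?d \<le> 2 * (norm (F n x - G x))\<^sup>2 + 2 * (norm (F m x - G x))\<^sup>2" .
          moreover have "0 \<le> ?c * ?d" by simp
          moreover have "?i x = 1" using True by simp
          ultimately show ?thesis unfolding e1 by (simp only: mult_1 add_increasing2)
        next
          case False
          then have "R\<^sup>2 \<le> (norm x)\<^sup>2" by (metis abs_le_square_iff abs_norm_cancel linear)
          then have "wt x powr (2 * t) \<le> ?c" using t unfolding wt_def by (intro powr_mono2') (auto simp: add_pos_nonneg)
          then have "wt x powr (2 * t) * ?d \<le> ?c * ?d" by (intro mult_right_mono) auto
          then show ?thesis unfolding e1 using False by (simp add: indicator_def)
        qed
      qed
      also have "\<dots> = 2 * (LINT x|lebesgue. ?h n x) + 2 * (LINT x|lebesgue. ?h m x)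
          + ?c * (LINT x|lebesgue. (norm (F n x - F m x))\<^sup>2)" using iF dF[of n m] by (simp add: square_integrable_def)
      also have "\<dots> < e\<^sup>2"
      proof -
        have "?c * (LINT x|lebesgue. (norm (F n x - F m x))\<^sup>2) \<le> ?c * ?A\<^sup>2" by (intro mult_left_mono dn) simp
        then show ?thesis using N[OF nm(1)] N[OF nm(2)] R by linarith
      qed
      finally show ?thesis using e by (simp add: power_less_imp_less_base)
    qed
    then show "\<exists>M. \<forall>m\<ge>M. \<forall>n\<ge>M. norm (wt_op t (abs_l2 (kernel_op a k (f m))) - wt_op t (abs_l2 (kernel_op a k (f n)))) < e"
      unfolding F_def by blast
  qed
qed

end

text \<open>The product is evaluated at \<open>fourier \<phi>\<close> by pairing \<open>g\<close>
  with the inverse transform of \<theta> times \<open>fourier \<phi>\<close>, a convolution of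
  \<open>\<phi>\<close> with \<open>k\<close>. Exchanging the integrals moves the kernel onto
  \<open>g\<close>; the weights make it act on the square integrable function wt^(s/2) g.\<close>

lemma sobolev_transform_schwartz_mult:
  fixes u :: "('n::finite, 'e::complex_euclidean_space) distr"
  assumes \<theta>: "schwartz \<theta>" and u: "sobolev_transform s u g"
  defines "k \<equiv> \<lambda>z. cF TYPE('n) * inv_fourier \<theta> z"
  shows "sobolev_transform s (schwartz_mult \<theta> u)
    (\<lambda>x. wt x powr (-s/2) *\<^sub>R kernel_op (s/2) k (\<lambda>y. wt y powr (s/2) *\<^sub>R g y) x)"
proof -
  have k: "schwartz k" unfolding k_def by (intro schwartz_cmult schwartz_inv_fourier \<theta>)
  let ?G = "\<lambda>y. wt y powr (s/2) *\<^sub>R g y"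
  have G: "square_integrable ?G" by (rule square_integrable_wt[OF u])
  let ?F = "kernel_op (s/2) k ?G" and ?h = "\<lambda>x. wt x powr (-s/2) *\<^sub>R kernel_op (s/2) k ?G x"
  have F: "square_integrable ?F" by (rule kernel_op_bound(1)[OF k G])
  have wh: "wt x powr (s/2) *\<^sub>R ?h x = ?F x" for x by (simp add: powr_add[symmetric] wt_nonzero)
  have h: "weighted s ?h" unfolding weighted_iff wh by (rule F)
  obtain G' where G': "G' \<in> borel_measurable borel" "AE x in lebesgue. ?G x = G' x" "square_integrable G'"
    "integrable lborel (\<lambda>y. (norm (G' y))\<^sup>2)" using square_integrable_ex_borel[OF k G] by blast
  have Gm: "?G \<in> borel_measurable lebesgue" using G by (simp add: square_integrable_def)
  note Feq = kernel_op_eq[OF k Gm G'(1,2)]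
  have "schwartz_mult \<theta> u (fourier \<phi>) = (LINT x|lebesgue. \<phi> x *\<^sub>C ?h x)" if \<phi>: "schwartz \<phi>" for \<phi>
  proof -
    note [measurable] = schwartz_measurable[OF \<phi>] schwartz_measurable[OF k] G'(1) wt_powr_measurable
      wkernel_measurable[OF k]
    let ?\<psi> = "inv_fourier (\<lambda>x. \<theta> x * fourier \<phi> x)"
    let ?p = "\<lambda>x. complex_of_real (wt x powr (-s/2)) * \<phi> x"
    let ?w = "\<lambda>y. ?\<psi> y *\<^sub>C wt y powr (-s/2) *\<^sub>R G' y"
    let ?N = "\<lambda>x. LINT y|lborel. norm (wkernel (s/2) k x y *\<^sub>C G' y)" and ?I = "\<lambda>x. LINT y|lborel. wkernel (s/2) k x y *\<^sub>C G' y"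
    let ?\<Phi> = "\<lambda>x y. ?p x *\<^sub>C wkernel (s/2) k x y *\<^sub>C G' y"
    have s\<psi>: "schwartz (\<lambda>x. \<theta> x * fourier \<phi> x)" by (intro schwartz_mult' schwartz_fourier \<theta> \<phi>)
    have \<psi>: "schwartz ?\<psi>" by (rule schwartz_inv_fourier[OF s\<psi>])
    have "(\<lambda>q. ?p (fst q) *\<^sub>C (\<lambda>(x, y). wkernel (s/2) k x y) q *\<^sub>C G' (snd q)) \<in> borel_measurable (borel \<Otimes>\<^sub>M borel)"
      by (intro scaleC_measurable) measurable
    then have m: "case_prod ?\<Phi> \<in> borel_measurable (lborel \<Otimes>\<^sub>M lborel)"
      by (simp add: case_prod_beta' cong: measurable_cong_sets)
    have i: "integrable lborel (\<lambda>y. wkernel (s/2) k x y *\<^sub>C G' y)" for x by (rule kernel_op_pointwise(1)[OF k G'(1,4)])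
    have int: "integrable (lborel \<Otimes>\<^sub>M lborel) (case_prod ?\<Phi>)"
    proof (rule lborel_pair.Fubini_integrable[OF m])
      show "AE x in lborel. integrable lborel (\<lambda>y. case_prod ?\<Phi> (x, y))"
        using integrable_bounded_linear[OF bounded_linear_scaleC_right i] by simp
      obtain B where B: "\<And>x. (LINT y|lborel. kernel_majorant (s/2) k (y - x) * norm (G' y)) \<le> B"
        using kernel_majorant_mult_bounded[OF k, of "\<lambda>y. norm (G' y)"] G'(4) by auto
      show "integrable lborel (\<lambda>x. LINT y|lborel. norm (case_prod ?\<Phi> (x, y)))"
      \<comment> \<open>Here \<open>kernel_majorant\<close> is formed with \<open>\<phi>\<close> in
        place of \<open>k\<close>, as an integrable function that dominates wt^(-s/2)
        \<phi>.\<close>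
      proof (rule Bochner_Integration.integrable_bound[OF integrable_mult_right[OF kernel_majorant_bounds(2)[OF \<phi>, of "s/2"], of B]])
        have "(\<lambda>(x, y). norm (case_prod ?\<Phi> (x, y))) \<in> borel_measurable (lborel \<Otimes>\<^sub>M lborel)"
          using measurable_compose[OF m borel_measurable_norm] by (simp add: case_prod_beta')
        then show "(\<lambda>x. LINT y|lborel. norm (case_prod ?\<Phi> (x, y))) \<in> borel_measurable lborel"
          by (rule lborel.borel_measurable_lebesgue_integral)
        show "AE x in lborel. norm (LINT y|lborel. norm (case_prod ?\<Phi> (x, y))) \<le> norm (B * kernel_majorant (s/2) \<phi> x)"
        proof (intro AE_I2)
          fix x
          have "?N x \<le> (LINT y|lborel. kernel_majorant (s/2) k (y - x) * norm (G' y))"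
            using integrable_kernel_majorant_mult(2)[OF k, of "\<lambda>y. norm (G' y)" "s/2" x] G'(4) i[of x]
            by (intro integral_mono integrable_norm) (auto simp: norm_scaleC intro: mult_right_mono wkernel_le)
          then have b: "?N x \<le> B" using B[of x] by linarith
          have b0: "0 \<le> ?N x" by (intro integral_nonneg_AE) auto
          have "norm (?p x) \<le> kernel_majorant (s/2) \<phi> x"
          proof -
            have "1 * wt x powr (-s/2) \<le> 2 powr \<bar>s/2\<bar> * wt x powr \<bar>s/2\<bar>"
              using wt_ge_1[of x] by (intro mult_mono powr_mono ge_one_powr_ge_zero) auto
            from mult_right_mono[OF this norm_ge_zero[of "\<phi> x"]] show ?thesis by (simp add: kernel_majorant_def norm_mult mult.assoc)
          qed
          then have "norm (?p x) * ?N x \<le> kernel_majorant (s/2) \<phi> x * B"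
            using b b0 by (intro mult_mono) (auto simp: kernel_majorant_nonneg)
          moreover have "(LINT y|lborel. norm (case_prod ?\<Phi> (x, y))) = norm (?p x) * ?N x"
            by (simp only: case_prod_conv norm_scaleC[of "?p x"] integral_mult_right_zero)
          moreover have "0 \<le> (LINT y|lborel. norm (case_prod ?\<Phi> (x, y)))" by (intro integral_nonneg_AE) auto
          ultimately show "norm (LINT y|lborel. norm (case_prod ?\<Phi> (x, y))) \<le> norm (B * kernel_majorant (s/2) \<phi> x)"
            by (simp only: real_norm_def mult.commute[of B])
        qed
      qed
    qed
    have "schwartz_mult \<theta> u (fourier \<phi>) = u (\<lambda>x. \<theta> x * fourier \<phi> x)"
      by (simp add: schwartz_mult_def schwartz_fourier \<phi>)
    also have "\<dots> = (LINT y|lebesgue. ?\<psi> y *\<^sub>C g y)"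
      using sobolev_transformD(2)[OF u \<psi>] by (simp add: fourier_inv_fourier[OF s\<psi>])
    also have "\<dots> = (LINT y|lebesgue. ?w y)"
    proof (rule integral_cong_AE)
      show "(\<lambda>y. ?\<psi> y *\<^sub>C g y) \<in> borel_measurable lebesgue"
        using weighted_pairing_bound[OF sobolev_transformD(1)[OF u] \<psi>] by (rule borel_measurable_integrable)
      show "(\<lambda>y. ?w y) \<in> borel_measurable lebesgue"
        using G'(1) by (intro scaleC_measurable schwartz_lebesgue_measurable \<psi> borel_measurable_scaleR wt_powr_measurable')
          (simp add: measurable_completion)
      show "AE y in lebesgue. ?\<psi> y *\<^sub>C g y = ?w y" using G'(2)
      proof eventually_elim
        case (elim y)
        have "wt y powr (-s/2) *\<^sub>R wt y powr (s/2) *\<^sub>R g y = g y" by (simp add: powr_add[symmetric] wt_nonzero)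
        then show ?case by (simp only: elim)
      qed
    qed
    also have "\<dots> = (LINT y|lborel. ?w y)"
    proof (rule integral_completion)
      note [measurable] = schwartz_measurable[OF \<psi>]
      have "(\<lambda>y. ?w y) \<in> borel_measurable borel" by (intro scaleC_measurable borel_measurable_scaleR) measurable
      then show "(\<lambda>y. ?w y) \<in> borel_measurable lborel" by simp
    qed
    also have "\<dots> = (LINT y|lborel. LINT x|lborel. ?\<Phi> x y)"
    proof (rule Bochner_Integration.integral_cong[OF refl])
      fix y
      have ik: "integrable lborel (\<lambda>x. k (y - x) * \<phi> x)"
      proof -
        obtain M where M: "\<And>z. norm (k z) \<le> M" using rapidI_nonneg[OF schwartz_rapid[OF k], of 0] by auto
        have "norm (k (y - x) * \<phi> x) \<le> norm (M * norm (\<phi> x))" for x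
          using mult_right_mono[OF order_trans[OF M[of "y - x"] abs_ge_self[of M]] norm_ge_zero[of "\<phi> x"]] by (simp add: norm_mult abs_mult)
        then show ?thesis
          by (intro Bochner_Integration.integrable_bound[OF integrable_mult_right[OF integrable_norm[OF schwartz_integrable[OF \<phi>]], of M]]) auto
      qed
      have "?\<psi> y = (LINT x|lborel. k (y - x) * \<phi> x)" unfolding inv_fourier_mult[OF \<theta> \<phi>] k_def by (simp add: mult.assoc)
      then have "?w y = (LINT x|lborel. (k (y - x) * \<phi> x) *\<^sub>C wt y powr (-s/2) *\<^sub>R G' y)"
        using integral_bounded_linear[OF bounded_bilinear.bounded_linear_left[OF bounded_bilinear_scaleC] ik, of "wt y powr (-s/2) *\<^sub>R G' y"] by simp
      also have "\<dots> = (LINT x|lborel. ?\<Phi> x y)"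
      proof (rule Bochner_Integration.integral_cong[OF refl])
        fix x :: "real^'n"
        have "complex_of_real (wt x powr (-s/2)) * complex_of_real (wt x powr (s/2)) = 1"
          by (simp add: of_real_mult[symmetric] powr_add[symmetric] wt_nonzero del: of_real_mult)
        then have "?p x * wkernel (s/2) k x y = (k (y - x) * \<phi> x) * complex_of_real (wt y powr (-s/2))"
          by (simp add: wkernel_def algebra_simps)
        then show "(k (y - x) * \<phi> x) *\<^sub>C wt y powr (-s/2) *\<^sub>R G' y = ?\<Phi> x y"
          by (simp only: scaleC_scaleC scaleC_of_real[symmetric])
      qed
      finally show "?w y = (LINT x|lborel. ?\<Phi> x y)" .
    qed
    also have "\<dots> = (LINT x|lborel. LINT y|lborel. ?\<Phi> x y)" by (rule lborel_pair.Fubini_integral[OF int])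
    also have "\<dots> = (LINT x|lborel. \<phi> x *\<^sub>C wt x powr (-s/2) *\<^sub>R (?I x))"
    proof (rule Bochner_Integration.integral_cong[OF refl])
      fix x :: "real^'n"
      have "(LINT y|lborel. ?\<Phi> x y) = ?p x *\<^sub>C (?I x)" by (rule integral_bounded_linear[OF bounded_linear_scaleC_right i])
      then show "(LINT y|lborel. ?\<Phi> x y) = \<phi> x *\<^sub>C wt x powr (-s/2) *\<^sub>R (?I x)"
        by (simp only: scaleC_of_real[symmetric] scaleC_scaleC mult.commute)
    qed
    also have "\<dots> = (LINT x|lborel. \<phi> x *\<^sub>C ?h x)" by (simp only: Feq)
    also have "\<dots> = (LINT x|lebesgue. \<phi> x *\<^sub>C ?h x)"
    proof (rule integral_completion[symmetric])
      have "(\<lambda>p. (\<lambda>(x, y). wkernel (s/2) k x y) p *\<^sub>C G' (snd p)) \<in> borel_measurable (borel \<Otimes>\<^sub>M borel)"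
        by (rule scaleC_measurable) measurable
      then have "(\<lambda>(x, y). wkernel (s/2) k x y *\<^sub>C G' y) \<in> borel_measurable (borel \<Otimes>\<^sub>M lborel)"
        by (simp add: case_prod_beta' cong: measurable_cong_sets)
      then have [measurable]: "?F \<in> borel_measurable borel" unfolding Feq[abs_def] by (rule lborel.borel_measurable_lebesgue_integral)
      have "(\<lambda>x. \<phi> x *\<^sub>C ?h x) \<in> borel_measurable borel" by (intro scaleC_measurable borel_measurable_scaleR) measurable
      then show "(\<lambda>x. \<phi> x *\<^sub>C ?h x) \<in> borel_measurable lborel" by simp
    qed
    finally show ?thesis .
  qed
  then show ?thesis using h by (auto simp: sobolev_transform_iff)
qed

text \<open>Temperedness of the product is not estimated: the product coincides with the tempered
  distribution that has the same transform, which exists because \<open>s \<ge> -1\<close>.\<close>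

lemma schwartz_mult_sobolev:
  fixes u :: "('n::finite, 'e::complex_euclidean_space) distr"
  assumes \<theta>: "schwartz \<theta>" and s: "s \<ge> -1" and u: "u \<in> vecs (sobolev s)"
  shows "schwartz_mult \<theta> u \<in> vecs (sobolev s)"
    and "sobolev_transform s u g \<Longrightarrow> Lam s (schwartz_mult \<theta> u) =
      abs_l2 (kernel_op (s/2) (\<lambda>z. cF TYPE('n) * inv_fourier \<theta> z) (\<lambda>y. wt y powr (s/2) *\<^sub>R g y))"
proof -
  obtain g where g: "sobolev_transform s u g" using u by (auto simp: vecs_sobolev)
  note t = sobolev_transform_schwartz_mult[OF \<theta> g]
  obtain v where v: "tempered v" "sobolev_transform s v
    (\<lambda>x. wt x powr (-s/2) *\<^sub>R kernel_op (s/2) (\<lambda>z. cF TYPE('n) * inv_fourier \<theta> z) (\<lambda>y. wt y powr (s/2) *\<^sub>R g y) x)"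
    using weighted_ex_transform[OF sobolev_transformD(1)[OF t] s] by blast
  have "schwartz_mult \<theta> u = v" by (rule sobolev_transform_ext[OF t v(2)]) (auto simp: schwartz_mult_def tempered_schwartz[OF v(1)])
  then show "schwartz_mult \<theta> u \<in> vecs (sobolev s)" using v t by (auto simp: vecs_sobolev)
next
  assume g: "sobolev_transform s u g"
  show "Lam s (schwartz_mult \<theta> u) =
      abs_l2 (kernel_op (s/2) (\<lambda>z. cF TYPE('n) * inv_fourier \<theta> z) (\<lambda>y. wt y powr (s/2) *\<^sub>R g y))"
    unfolding Lam_eq[OF sobolev_transform_schwartz_mult[OF \<theta> g]] by (rule abs_l2_eqI) (simp add: powr_add[symmetric] wt_nonzero)
qed

text \<open>Rellich's theorem.\<close>

lemma schwartz_mult_compact: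
  fixes u :: "nat \<Rightarrow> ('n::finite, 'e::complex_euclidean_space) distr"
  assumes \<theta>: "schwartz \<theta>" and u: "\<And>n. u n \<in> vecs (sobolev 0)" "\<And>n. norm (Lam 0 (u n)) \<le> C"
    and w: "\<And>y. convergent (\<lambda>n. inner (Lam 0 (u n)) y)"
  shows "Cauchy (\<lambda>n. Lam (-1/2) (schwartz_mult \<theta> (u n)))"
proof -
  let ?k = "\<lambda>z. cF TYPE('n) * inv_fourier \<theta> z"
  have k: "schwartz ?k" by (intro schwartz_cmult schwartz_inv_fourier \<theta>)
  have "\<forall>n. \<exists>g. sobolev_transform 0 (u n) g" using u(1) by (auto simp: vecs_sobolev)
  then obtain g where g: "\<And>n. sobolev_transform 0 (u n) (g n)" by metis
  define f where "f n y = wt y powr (0/2) *\<^sub>R g n y" for n y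
  have f: "square_integrable (f n)" "Lam 0 (u n) = abs_l2 (f n)" for n
    unfolding f_def[abs_def] by (rule square_integrable_wt[OF g], rule Lam_eq[OF g])
  \<comment> \<open>The exponent is (-1/2 - 0)/2, from the inclusion of order 0 in order -1/2. Its
    negativity is the decay at infinity on which compactness depends.\<close>
  have "Lam (-1/2) (schwartz_mult \<theta> (u n)) = wt_op (-1/4) (abs_l2 (kernel_op 0 ?k (f n)))" for n
  proof -
    have "schwartz_mult \<theta> (u n) \<in> vecs (sobolev 0)" by (rule schwartz_mult_sobolev(1)[OF \<theta> _ u(1)]) simp
    then have "Lam (-1/2) (schwartz_mult \<theta> (u n)) = wt_op ((-1/2 - 0)/2) (Lam 0 (schwartz_mult \<theta> (u n)))"
      by (rule Lam_mono(2)) simp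
    also have "Lam 0 (schwartz_mult \<theta> (u n)) = abs_l2 (kernel_op 0 ?k (f n))"
      using schwartz_mult_sobolev(2)[OF \<theta> _ u(1) g, of n] by (simp add: f_def[abs_def])
    finally show ?thesis by simp
  qed
  moreover have "Cauchy (\<lambda>n. wt_op (-1/4) (abs_l2 (kernel_op 0 ?k (f n))))"
    by (rule kernel_op_weakly_convergent_imp_Cauchy[OF k f(1)]) (use u(2) w in \<open>auto simp: f(2)\<close>)
  ultimately show ?thesis by simp
qed

section \<open>Potentials and the free Dirac operator\<close>

lemma distr_of_tendsto:
  fixes f :: "real^'n::finite \<Rightarrow> 'e::complex_euclidean_space"
  assumes f: "square_integrable f" and \<phi>: "\<And>R. schwartz (\<phi> R)" "schwartz \<psi>" "\<And>x. (\<lambda>R. \<phi> R x) \<longlonglongrightarrow> \<psi> x"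
    and b: "\<And>R x. norm (\<phi> R x) \<le> C * norm (\<eta> x) + norm (\<eta>' x)" and \<eta>: "schwartz \<eta>" "schwartz \<eta>'"
  shows "(\<lambda>R. distr_of f (\<phi> R)) \<longlonglongrightarrow> distr_of f \<psi>"
proof -
  have w: "weighted 0 f" using f by (simp add: weighted_zero_iff)
  have fm: "f \<in> borel_measurable lebesgue" using f by (simp add: square_integrable_def)
  have "(\<lambda>R. LINT x|lebesgue. \<phi> R x *\<^sub>C f x) \<longlonglongrightarrow> (LINT x|lebesgue. \<psi> x *\<^sub>C f x)"
  proof (rule integral_dominated_convergence[where w = "\<lambda>x. C * norm (\<eta> x *\<^sub>C f x) + norm (\<eta>' x *\<^sub>C f x)"])
    show "integrable lebesgue (\<lambda>x. C * norm (\<eta> x *\<^sub>C f x) + norm (\<eta>' x *\<^sub>C f x))"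
      by (intro Bochner_Integration.integrable_add integrable_mult_right integrable_norm weighted_pairing_bound[OF w] \<eta>)
    show "AE x in lebesgue. norm (\<phi> R x *\<^sub>C f x) \<le> C * norm (\<eta> x *\<^sub>C f x) + norm (\<eta>' x *\<^sub>C f x)" for R
      using mult_right_mono[OF b norm_ge_zero] by (intro AE_I2) (simp add: norm_scaleC distrib_right mult.assoc)
    show "AE x in lebesgue. (\<lambda>R. \<phi> R x *\<^sub>C f x) \<longlonglongrightarrow> \<psi> x *\<^sub>C f x"
      by (intro AE_I2 tendsto_scaleC tendsto_const \<phi>)
  qed (intro scaleC_measurable schwartz_lebesgue_measurable \<phi> fm)+
  then show ?thesis by (simp add: distr_of_def \<phi>)
qed

text \<open>The difference is f0 + sum of P_k f_k with square integrable functions. Such a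
  distribution is continuous along cutoffs of a Schwartz function, because only first derivatives of
  the cutoffs occur, and they vanish boundedly in the limit.\<close>

lemma sobolev_eqI_test:
  fixes w w' :: "('n::finite, 'e::complex_euclidean_space) distr"
  assumes w: "w \<in> vecs (sobolev s)" "w' \<in> vecs (sobolev s)" and s: "s \<ge> -1"
    and eq: "\<And>\<phi>. test_function \<phi> \<Longrightarrow> w \<phi> = w' \<phi>"
  shows "w = w'"
proof -
  have d: "w - w' \<in> vecs (sobolev s)" by (rule sobolev_diff(1)[OF w])
  then obtain g where g: "tempered (w - w')" "sobolev_transform s (w - w') g" by (auto simp: vecs_sobolev)
  obtain f0 f where f: "square_integrable f0" "\<And>k. square_integrable (f k)"
    "sobolev_transform s (\<lambda>\<phi>. distr_of f0 \<phi> + (\<Sum>k\<in>UNIV. momentum k (distr_of (f k)) \<phi>)) g"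
    using weighted_ex_decomposition[OF sobolev_transformD(1)[OF g(2)] s] by blast
  have dec: "w - w' = (\<lambda>\<phi>. distr_of f0 \<phi> + (\<Sum>k\<in>UNIV. momentum k (distr_of (f k)) \<phi>))"
  proof (rule sobolev_transform_ext[OF g(2) f(3) AE_I2[OF refl]])
    show "(w - w') \<phi> = 0" if "\<not> schwartz \<phi>" for \<phi> using that by (rule tempered_schwartz(1)[OF g(1)])
    show "distr_of f0 \<phi> + (\<Sum>k\<in>UNIV. momentum k (distr_of (f k)) \<phi>) = 0" if "\<not> schwartz \<phi>" for \<phi>
      using that by (simp add: distr_of_def momentum_def)
  qed
  have "(w - w') \<psi> = 0" for \<psi>
  proof (cases "schwartz \<psi>")
    case \<psi>: True
    define \<phi> where "\<phi> R x = cutoff R x * \<psi> x" for R x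
    have c: "schwartz (cutoff R :: real^'n \<Rightarrow> complex)" for R by (rule conjunct1[OF test_function_cutoff[unfolded test_function_def]])
    have test: "test_function (\<phi> R)" for R
      using test_function_schwartz_mult[OF \<psi> test_function_cutoff[of R]] by (simp add: \<phi>_def[abs_def] mult.commute)
    then have s\<phi>: "schwartz (\<phi> R)" for R by (simp add: test_function_def)
    have t0: "(\<lambda>R. \<phi> R x) \<longlonglongrightarrow> \<psi> x" for x
      unfolding \<phi>_def using tendsto_mult[OF cutoff_tendsto tendsto_const] by simp
    have b0: "norm (\<phi> R x) \<le> 1 * norm (\<psi> x) + norm (\<psi> x)" for R x
    proof -
      have "norm (cutoff R x) * norm (\<psi> x) \<le> 1 * norm (\<psi> x)" by (intro mult_right_mono norm_cutoff_le_1) auto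
      then show ?thesis unfolding \<phi>_def norm_mult using norm_ge_zero[of "\<psi> x"] by linarith
    qed
    have pd: "partial_deriv k (\<phi> R) = (\<lambda>x. partial_deriv k (cutoff R) x * \<psi> x + cutoff R x * partial_deriv k \<psi> x)" for k R
      unfolding \<phi>_def[abs_def] by (rule partial_deriv_mult) (intro schwartz_differentiable c \<psi>)+
    have t1: "(\<lambda>R. partial_deriv k (\<phi> R) x) \<longlonglongrightarrow> partial_deriv k \<psi> x" for k x
    proof -
      have "(\<lambda>R. partial_deriv k (cutoff R) x * \<psi> x + cutoff R x * partial_deriv k \<psi> x) \<longlonglongrightarrow> 0 * \<psi> x + 1 * partial_deriv k \<psi> x"
        by (intro tendsto_intros partial_deriv_cutoff_tendsto cutoff_tendsto)
      then show ?thesis by (simp add: pd)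
    qed
    have b1: "norm (partial_deriv k (\<phi> R) x) \<le> 4 * norm (\<psi> x) + norm (partial_deriv k \<psi> x)" for k R x
    proof -
      have "norm (partial_deriv k (cutoff R) x) * norm (\<psi> x) \<le> 4 * norm (\<psi> x)"
        by (intro mult_right_mono partial_deriv_cutoff_bound) auto
      moreover have "norm (cutoff R x) * norm (partial_deriv k \<psi> x) \<le> 1 * norm (partial_deriv k \<psi> x)"
        by (intro mult_right_mono norm_cutoff_le_1) auto
      ultimately show ?thesis
        unfolding pd using norm_triangle_ineq[of "partial_deriv k (cutoff R) x * \<psi> x" "cutoff R x * partial_deriv k \<psi> x"]
        by (simp add: norm_mult)
    qed
    have "(\<lambda>R. distr_of (f k) (partial_deriv k (\<phi> R))) \<longlonglongrightarrow> distr_of (f k) (partial_deriv k \<psi>)" for k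
      by (rule distr_of_tendsto[OF f(2) _ _ t1 b1]) (intro schwartz_partial_deriv s\<phi> \<psi>)+
    then have "(\<lambda>R. momentum k (distr_of (f k)) (\<phi> R)) \<longlonglongrightarrow> momentum k (distr_of (f k)) \<psi>" for k
      by (simp add: momentum_def s\<phi> \<psi>) (intro tendsto_scaleC tendsto_minus tendsto_const)
    moreover have "(\<lambda>R. distr_of f0 (\<phi> R)) \<longlonglongrightarrow> distr_of f0 \<psi>"
      by (rule distr_of_tendsto[OF f(1) s\<phi> \<psi> t0 b0 \<psi> \<psi>])
    ultimately have "(\<lambda>R. (w - w') (\<phi> R)) \<longlonglongrightarrow> (w - w') \<psi>"
      unfolding dec by (intro tendsto_add tendsto_sum)
    moreover have "(w - w') (\<phi> R) = 0" for R using eq[OF test] by simp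
    ultimately show ?thesis by (simp add: LIMSEQ_const_iff)
  qed (rule tempered_schwartz(1)[OF g(1)])
  then show ?thesis by (intro ext) simp
qed

section \<open>Multiplication by a potential\<close>

lemma distr_of_eq_AE:
  assumes "square_integrable f" "square_integrable g" "distr_of f = distr_of g"
  shows "AE x in lebesgue. f x = g x"
proof (rule weighted_separate[of 0])
  fix \<phi> :: "real^'a \<Rightarrow> complex" assume "test_function \<phi>"
  then have "schwartz \<phi>" by (simp add: test_function_def)
  then show "(LINT x|lebesgue. \<phi> x *\<^sub>C f x) = (LINT x|lebesgue. \<phi> x *\<^sub>C g x)"
    using fun_cong[OF assms(3), of \<phi>] by (simp add: distr_of_def)
qed (use assms in \<open>simp_all add: weighted_zero_iff\<close>)

lemma locally_integrable_test:
  assumes h: "locally_integrable h" and \<phi>: "test_function \<phi>"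
  shows "integrable lebesgue (\<lambda>x. \<phi> x *\<^sub>C h x)"
proof -
  obtain K where K: "compact K" "\<And>x. x \<notin> K \<Longrightarrow> \<phi> x = 0" and s: "schwartz \<phi>" using \<phi> by (auto simp: test_function_def)
  have i: "integrable lebesgue (\<lambda>x. indicator K x *\<^sub>R h x)" using h K(1) by (simp add: locally_integrable_def set_integrable_def)
  have eq: "\<phi> x *\<^sub>C h x = \<phi> x *\<^sub>C (indicator K x *\<^sub>R h x)" for x
    by (cases "x \<in> K") (auto simp: K scaleC_zero_left)
  obtain C where C: "\<And>x. norm (\<phi> x) \<le> C" using rapidI_nonneg[OF schwartz_rapid[OF s], of 0] by auto
  show ?thesis unfolding eq
  proof (rule Bochner_Integration.integrable_bound[OF integrable_mult_right[OF integrable_norm[OF i], of C]])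
    show "(\<lambda>x. \<phi> x *\<^sub>C indicator K x *\<^sub>R h x) \<in> borel_measurable lebesgue"
      using i by (intro scaleC_measurable schwartz_lebesgue_measurable s) (rule borel_measurable_integrable)
    have "norm (\<phi> x *\<^sub>C indicator K x *\<^sub>R h x) \<le> C * norm (indicator K x *\<^sub>R h x)" for x
      unfolding norm_scaleC by (intro mult_right_mono C) auto
    then show "AE x in lebesgue. norm (\<phi> x *\<^sub>C indicator K x *\<^sub>R h x) \<le> norm (C * norm (indicator K x *\<^sub>R h x))"
      by (intro AE_I2) (simp only: real_norm_def, meson abs_ge_self order_trans)
  qed
qed

text \<open>\<open>is_product\<close> leaves the choice of the representative to an existential
  quantifier; a change on a null set does not affect the integrals.\<close>

lemma is_product_eq:
  assumes p: "is_product V u w" and u: "u = distr_of f" "square_integrable f" and \<phi>: "test_function \<phi>"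
    and m: "(\<lambda>x. V x (f x)) \<in> borel_measurable lebesgue"
  shows "w \<phi> = (LINT x|lebesgue. \<phi> x *\<^sub>C V x (f x))" "integrable lebesgue (\<lambda>x. \<phi> x *\<^sub>C V x (f x))"
proof -
  obtain g where g: "square_integrable g" "u = distr_of g" "locally_integrable (\<lambda>x. V x (g x))"
    "w \<phi> = (LINT x|lebesgue. \<phi> x *\<^sub>C V x (g x))" using p \<phi> unfolding is_product_def by blast
  have ae: "AE x in lebesgue. \<phi> x *\<^sub>C V x (g x) = \<phi> x *\<^sub>C V x (f x)"
    using distr_of_eq_AE[OF g(1) u(2)] u(1) g(2) by (auto elim!: eventually_mono)
  have s: "schwartz \<phi>" using \<phi> by (simp add: test_function_def)
  note i = locally_integrable_test[OF g(3) \<phi>]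
  have m': "(\<lambda>x. \<phi> x *\<^sub>C V x (f x)) \<in> borel_measurable lebesgue"
    by (intro scaleC_measurable schwartz_lebesgue_measurable s m)
  show "w \<phi> = (LINT x|lebesgue. \<phi> x *\<^sub>C V x (f x))" unfolding g(4) using i m' ae by (intro integral_cong_AE) auto
  show "integrable lebesgue (\<lambda>x. \<phi> x *\<^sub>C V x (f x))" using i m' ae by (subst integrable_cong_AE[symmetric, OF _ _ ae]) auto
qed

lemma symmetric_operator_linear: "symmetric_operator A \<Longrightarrow> linear A" by (simp add: symmetric_operator_def clinear_on_UNIV_linear)

lemma symmetric_operator_inner: "symmetric_operator A \<Longrightarrow> inner (A x) y = inner x (A y)"
  by (simp add: symmetric_operator_def inner_eq_Re_cinner)

text \<open>Expanding \<open>f x\<close> in the basis reduces the claim to the functions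
  \<open>\<lambda>x. V x b\<close>, whose measurability is assumed.\<close>

lemma symmetric_potential_measurable:
  fixes V :: "real^'n::finite \<Rightarrow> 'e::complex_euclidean_space \<Rightarrow> 'e"
  assumes V: "symmetric_potential V" and f: "f \<in> borel_measurable lebesgue"
  shows "(\<lambda>x. V x (f x)) \<in> borel_measurable lebesgue"
proof -
  have "V x (f x) = (\<Sum>b\<in>Basis. inner (f x) b *\<^sub>R V x b)" for x
  proof -
    have "linear (V x)" using V by (simp add: symmetric_potential_def symmetric_operator_linear)
    then have "V x (\<Sum>b\<in>Basis. inner (f x) b *\<^sub>R b) = (\<Sum>b\<in>Basis. inner (f x) b *\<^sub>R V x b)"
      by (simp add: linear_sum linear_scale)
    then show ?thesis by (simp add: euclidean_representation)
  qed
  then show ?thesis using V f unfolding symmetric_potential_def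
    by (simp only:) (intro borel_measurable_sum borel_measurable_scaleR borel_measurable_inner borel_measurable_const; simp)
qed

lemma is_product_unique:
  fixes u w w' :: "('n::finite, 'e::complex_euclidean_space) distr"
  assumes V: "symmetric_potential V" and w: "w \<in> vecs (sobolev (-1/2))" "is_product V u w"
    and w': "w' \<in> vecs (sobolev (-1/2))" "is_product V u w'"
  shows "w = w'"
proof (rule sobolev_eqI_test[OF w(1) w'(1)])
  obtain f where f: "square_integrable f" "u = distr_of f" using w(2) by (auto simp: is_product_def)
  have m: "(\<lambda>x. V x (f x)) \<in> borel_measurable lebesgue"
    using symmetric_potential_measurable[OF V] f(1) by (simp add: square_integrable_def)
  show "w \<phi> = w' \<phi>" if "test_function \<phi>" for \<phi>
    using is_product_eq(1)[OF w(2) f(2,1) that m] is_product_eq(1)[OF w'(2) f(2,1) that m] by simp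
qed simp

lemma mult_op_eqI:
  "symmetric_potential V \<Longrightarrow> w \<in> vecs (sobolev (-1/2)) \<Longrightarrow> is_product V u w \<Longrightarrow> mult_op V u = w"
  unfolding mult_op_def by (rule the_equality) (auto intro: is_product_unique)

lemma mult_op_product:
  assumes "symmetric_potential V" "mult_continuous V" "u \<in> vecs (sobolev (1/2))"
  shows "mult_op V u \<in> vecs (sobolev (-1/2))" "is_product V u (mult_op V u)" using assms mult_op_eqI unfolding mult_continuous_def by metis+

text \<open>By uniqueness it suffices that \<theta> V f is a product of \<open>V\<close> with
  \<theta> f, and this is the complex linearity of \<open>V x\<close> at each point.\<close>

lemma mult_op_schwartz_mult:
  fixes u :: "('n::finite, 'e::complex_euclidean_space) distr"
  assumes V: "symmetric_potential V" "mult_continuous V" and u: "u \<in> vecs (sobolev (1/2))" and \<theta>: "schwartz \<theta>"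
  shows "mult_op V (schwartz_mult \<theta> u) = schwartz_mult \<theta> (mult_op V u)"
proof (rule mult_op_eqI[OF V(1)])
  note p = mult_op_product[OF V u]
  show "schwartz_mult \<theta> (mult_op V u) \<in> vecs (sobolev (-1/2))" by (rule schwartz_mult_sobolev(1)[OF \<theta> _ p(1)]) simp
  obtain f where f: "square_integrable f" "u = distr_of f" "locally_integrable (\<lambda>x. V x (f x))"
    "\<And>\<phi>. test_function \<phi> \<Longrightarrow> mult_op V u \<phi> = (LINT x|lebesgue. \<phi> x *\<^sub>C V x (f x))"
    using p(2) unfolding is_product_def by blast
  obtain C where C: "\<And>x. norm (\<theta> x) \<le> C" using rapidI_nonneg[OF schwartz_rapid[OF \<theta>], of 0] by auto
  have tm: "\<theta> \<in> borel_measurable lebesgue" by (rule schwartz_lebesgue_measurable[OF \<theta>])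
  have Vs: "V x (c *\<^sub>C v) = c *\<^sub>C V x v" for x c v
    using V(1) by (simp add: symmetric_potential_def symmetric_operator_def clinear_on_def)
  show "is_product V (schwartz_mult \<theta> u) (schwartz_mult \<theta> (mult_op V u))" unfolding is_product_def
  proof (intro exI[of _ "\<lambda>x. \<theta> x *\<^sub>C f x"] conjI allI impI)
    show "square_integrable (\<lambda>x. \<theta> x *\<^sub>C f x)" by (rule square_integrable_bound[OF f(1), of _ C])
        (use f(1) tm C in \<open>auto simp: square_integrable_def norm_scaleC intro: scaleC_measurable mult_right_mono\<close>)
    show "schwartz_mult \<theta> u = distr_of (\<lambda>x. \<theta> x *\<^sub>C f x)"
      by (rule ext) (simp add: schwartz_mult_def distr_of_def f(2) schwartz_mult'[OF \<theta>] scaleC_scaleC mult.commute[of "\<phi> x" "\<theta> x" for \<phi> x])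
    show "locally_integrable (\<lambda>x. V x (\<theta> x *\<^sub>C f x))" unfolding locally_integrable_def set_integrable_def
    proof (intro allI impI)
      fix K :: "(real^'n) set" assume K: "compact K"
      have i: "integrable lebesgue (\<lambda>x. indicator K x *\<^sub>R V x (f x))"
        using f(3) K by (simp add: locally_integrable_def set_integrable_def)
      have eq: "indicator K x *\<^sub>R V x (\<theta> x *\<^sub>C f x) = \<theta> x *\<^sub>C (indicator K x *\<^sub>R V x (f x))" for x
        by (simp add: Vs scaleC_scaleR)
      show "integrable lebesgue (\<lambda>x. indicator K x *\<^sub>R V x (\<theta> x *\<^sub>C f x))" unfolding eq
      proof (rule Bochner_Integration.integrable_bound[OF integrable_mult_right[OF integrable_norm[OF i], of C]])
        show "(\<lambda>x. \<theta> x *\<^sub>C indicator K x *\<^sub>R V x (f x)) \<in> borel_measurable lebesgue"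
          using i by (intro scaleC_measurable tm) (rule borel_measurable_integrable)
        have "norm (\<theta> x *\<^sub>C indicator K x *\<^sub>R V x (f x)) \<le> C * norm (indicator K x *\<^sub>R V x (f x))" for x
          unfolding norm_scaleC by (intro mult_right_mono C) auto
        then show "AE x in lebesgue. norm (\<theta> x *\<^sub>C indicator K x *\<^sub>R V x (f x)) \<le> norm (C * norm (indicator K x *\<^sub>R V x (f x)))"
          by (intro AE_I2) (simp only: real_norm_def, meson abs_ge_self order_trans)
      qed
    qed
    fix \<phi> :: "real^'n \<Rightarrow> complex" assume \<phi>: "test_function \<phi>"
    then have "schwartz \<phi>" by (simp add: test_function_def)
    then show "schwartz_mult \<theta> (mult_op V u) \<phi> = (LINT x|lebesgue. \<phi> x *\<^sub>C V x (\<theta> x *\<^sub>C f x))"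
      using f(4)[OF test_function_schwartz_mult[OF \<theta> \<phi>]] by (simp add: schwartz_mult_def Vs scaleC_scaleC mult.commute)
  qed
qed

text \<open>The Leibniz rule; the second term is the commutator of P_k with multiplication by
  \<theta>.\<close>

lemma momentum_schwartz_mult:
  assumes u: "tempered u" and \<theta>: "schwartz \<theta>"
  shows "momentum k (schwartz_mult \<theta> u) \<phi> =
    schwartz_mult \<theta> (momentum k u) \<phi> + schwartz_mult (\<lambda>x. - \<i> * partial_deriv k \<theta> x) u \<phi>"
proof (cases "schwartz \<phi>")
  case \<phi>: True
  note d = schwartz_partial_deriv
  have s: "schwartz (\<lambda>x. \<theta> x * partial_deriv k \<phi> x)" "schwartz (\<lambda>x. partial_deriv k \<theta> x * \<phi> x)"
    by (intro schwartz_mult' d \<theta> \<phi>)+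
  have "u (partial_deriv k (\<lambda>x. \<theta> x * \<phi> x)) = u (\<lambda>x. partial_deriv k \<theta> x * \<phi> x) + u (\<lambda>x. \<theta> x * partial_deriv k \<phi> x)"
    using tempered_schwartz(2)[OF u s(2,1)] by (simp add: partial_deriv_mult schwartz_differentiable \<theta> \<phi>)
  moreover have "u (\<lambda>x. - \<i> * partial_deriv k \<theta> x * \<phi> x) = (- \<i>) *\<^sub>C u (\<lambda>x. partial_deriv k \<theta> x * \<phi> x)"
    using tempered_schwartz(3)[OF u s(2), of "- \<i>"] by (simp add: mult.assoc)
  ultimately show ?thesis using \<phi> d[OF \<phi>] schwartz_mult'[OF \<theta> \<phi>]
    by (simp add: momentum_def schwartz_mult_def scaleC_minus_left scaleC_minus_right scaleC_add_right scaleC_diff_right)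
qed (simp add: momentum_def schwartz_mult_def)

lemma norm_abs_l2_mono:
  assumes "square_integrable f" "square_integrable g" "\<And>x. norm (f x) \<le> C * norm (g x)" "C \<ge> 0"
  shows "norm (abs_l2 f) \<le> C * norm (abs_l2 g)"
proof -
  have "(LINT x|lebesgue. (norm (f x))\<^sup>2) \<le> (LINT x|lebesgue. C\<^sup>2 * (norm (g x))\<^sup>2)"
    using assms power_mono[OF assms(3) norm_ge_zero, of _ 2]
    by (intro integral_mono integrable_mult_right) (auto simp: square_integrable_def power_mult_distrib)
  then have "sqrt (LINT x|lebesgue. (norm (f x))\<^sup>2) \<le> sqrt (C\<^sup>2 * (LINT x|lebesgue. (norm (g x))\<^sup>2))"
    by (intro real_sqrt_le_mono) simp
  then show ?thesis using assms(4) by (simp add: norm_abs_l2 assms real_sqrt_mult)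
qed

section \<open>The free Dirac operator\<close>

definition dirac_symbol :: "('n::finite option \<Rightarrow> 'e::complex_euclidean_space \<Rightarrow> 'e) \<Rightarrow> real \<Rightarrow> real^'n \<Rightarrow> 'e \<Rightarrow> 'e" where
  "dirac_symbol \<alpha> m \<xi> v = (\<Sum>k\<in>UNIV. \<alpha> (Some k) (\<xi> $ k *\<^sub>R v)) + m *\<^sub>R \<alpha> None v"

context
  fixes \<alpha> :: "'n::finite option \<Rightarrow> 'e::complex_euclidean_space \<Rightarrow> 'e" and m :: real
  assumes \<alpha>: "\<And>j. symmetric_operator (\<alpha> j)"
begin

lemma \<alpha>_clinear: "clinear_on UNIV (\<alpha> j)" using \<alpha> by (simp add: symmetric_operator_def)

lemma \<alpha>_simps: "\<alpha> j (x + y) = \<alpha> j x + \<alpha> j y" "\<alpha> j (c *\<^sub>C x) = c *\<^sub>C \<alpha> j x" "\<alpha> j 0 = 0"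
  using \<alpha>_clinear[of j] linear_0[OF clinear_on_UNIV_linear[OF \<alpha>_clinear[of j]]] by (auto simp: clinear_on_def)

lemma dirac_symbol_symmetric: "inner (dirac_symbol \<alpha> m \<xi> v) w = inner v (dirac_symbol \<alpha> m \<xi> w)"
  by (simp add: dirac_symbol_def inner_add_left inner_add_right inner_sum_left inner_sum_right
      symmetric_operator_inner[OF \<alpha>] linear_scale[OF symmetric_operator_linear[OF \<alpha>]])

lemma dirac_symbol_bound: "\<exists>C. \<forall>\<xi> v. norm (dirac_symbol \<alpha> m \<xi> v) \<le> C * (wt \<xi> powr (1/2) * norm v)"
proof -
  have "\<forall>j. \<exists>B>0. \<forall>x. norm (\<alpha> j x) \<le> B * norm x" using linear_bounded_pos symmetric_operator_linear[OF \<alpha>] by blast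
  then obtain B where B: "\<And>j. B j > 0" "\<And>j x. norm (\<alpha> j x) \<le> B j * norm x" by metis
  have "norm (dirac_symbol \<alpha> m \<xi> v) \<le> ((\<Sum>k\<in>UNIV. B (Some k)) + \<bar>m\<bar> * B None) * (wt \<xi> powr (1/2) * norm v)" for \<xi> v
  proof -
    have 1: "norm (\<alpha> (Some k) (\<xi> $ k *\<^sub>R v)) \<le> B (Some k) * (wt \<xi> powr (1/2) * norm v)" for k
      by (rule order_trans[OF B(2)]) (use B(1)[of "Some k"] abs_component_le_wt[of \<xi> k] in \<open>auto intro!: mult_left_mono mult_right_mono\<close>)
    have "1 \<le> wt \<xi> powr (1/2)" using wt_ge_1[of \<xi>] by (intro ge_one_powr_ge_zero) auto
    then have "B None * (1 * norm v) \<le> B None * (wt \<xi> powr (1/2) * norm v)"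
      using B(1)[of None] by (intro mult_left_mono mult_right_mono) auto
    then have "norm (\<alpha> None v) \<le> B None * (wt \<xi> powr (1/2) * norm v)" using B(2)[of None v] by simp
    then have 2: "norm (m *\<^sub>R \<alpha> None v) \<le> \<bar>m\<bar> * (B None * (wt \<xi> powr (1/2) * norm v))"
      unfolding norm_scaleR by (rule mult_left_mono) simp
    have "norm (dirac_symbol \<alpha> m \<xi> v) \<le> (\<Sum>k\<in>UNIV. norm (\<alpha> (Some k) (\<xi> $ k *\<^sub>R v))) + norm (m *\<^sub>R \<alpha> None v)"
      unfolding dirac_symbol_def by (rule norm_triangle_le[OF add_mono[OF norm_sum order_refl]])
    also have "\<dots> \<le> (\<Sum>k\<in>UNIV. B (Some k) * (wt \<xi> powr (1/2) * norm v)) + \<bar>m\<bar> * (B None * (wt \<xi> powr (1/2) * norm v))"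
      by (intro add_mono sum_mono 1 2)
    finally show ?thesis by (simp add: distrib_right sum_distrib_right mult.assoc)
  qed
  then show ?thesis by blast
qed

lemma free_dirac_transform:
  assumes u: "tempered u" "sobolev_transform (1/2) u g"
  shows "tempered (free_dirac \<alpha> m u)"
    "sobolev_transform (-1/2) (free_dirac \<alpha> m u) (\<lambda>\<xi>. dirac_symbol \<alpha> m \<xi> (g \<xi>))"
proof -
  have eq: "free_dirac \<alpha> m u = (\<lambda>\<phi>. (\<Sum>k\<in>UNIV. \<alpha> (Some k) (momentum k u \<phi>)) + complex_of_real m *\<^sub>C \<alpha> None (u \<phi>))"
    by (rule ext) (simp add: free_dirac_def scaleC_of_real)
  show "tempered (free_dirac \<alpha> m u)"
    unfolding eq by (intro tempered_add tempered_sum tempered_linear[OF _ \<alpha>_clinear] tempered_momentum tempered_scaleC u) simp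
  have "weighted (-1/2) (\<lambda>\<xi>. \<xi> $ k *\<^sub>R g \<xi>)" for k
  proof (rule weighted_bound[OF sobolev_transformD(1)[OF u(2)], of _ 1])
    have "(\<lambda>\<xi>::real^'n. \<xi> $ k) \<in> borel_measurable borel" by (intro borel_measurable_continuous_onI continuous_intros)
    then show "(\<lambda>\<xi>. \<xi> $ k *\<^sub>R g \<xi>) \<in> borel_measurable lebesgue"
      using sobolev_transformD(1)[OF u(2)] by (intro borel_measurable_scaleR) (auto simp: measurable_completion weighted_def)
    show "norm (\<xi> $ k *\<^sub>R g \<xi>) \<le> 1 * wt \<xi> powr ((1/2 - -1/2)/2) * norm (g \<xi>)" for \<xi>
      using abs_component_le_wt[of \<xi> k] by (simp add: mult_right_mono)
  qed
  note st = sobolev_transform_momentum[OF u(2) this]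
  show "sobolev_transform (-1/2) (free_dirac \<alpha> m u) (\<lambda>\<xi>. dirac_symbol \<alpha> m \<xi> (g \<xi>))"
    unfolding eq dirac_symbol_def scaleC_of_real[symmetric]
    by (intro sobolev_transform_add sobolev_transform_sum sobolev_transform_linear[OF _ \<alpha>_clinear] sobolev_transform_scaleC
        sobolev_transform_mono[OF u(2)]) (use st in \<open>simp_all add: scaleC_of_real\<close>)
qed

text \<open>The inner product of \<open>l2\<close> realizes the duality of the orders -1/2 and 1/2:
  the weights wt^(-1/4) and wt^(1/4) cancel, and the symbol is symmetric at every point.\<close>

lemma free_dirac_symmetric:
  assumes "u \<in> vecs (sobolev (1/2))" "v \<in> vecs (sobolev (1/2))"
  shows "inner (Lam (-1/2) (free_dirac \<alpha> m u)) (Lam (1/2) v) = inner (Lam (1/2) u) (Lam (-1/2) (free_dirac \<alpha> m v))"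
proof -
  obtain g h where g: "tempered u" "sobolev_transform (1/2) u g" and h: "tempered v" "sobolev_transform (1/2) v h"
    using assms by (auto simp: vecs_sobolev)
  note dg = free_dirac_transform(2)[OF g] and dh = free_dirac_transform(2)[OF h]
  have "inner (wt \<xi> powr (-1/2/2) *\<^sub>R dirac_symbol \<alpha> m \<xi> (g \<xi>)) (wt \<xi> powr (1/2/2) *\<^sub>R h \<xi>) =
      inner (wt \<xi> powr (1/2/2) *\<^sub>R g \<xi>) (wt \<xi> powr (-1/2/2) *\<^sub>R dirac_symbol \<alpha> m \<xi> (h \<xi>))" for \<xi>
    by (simp add: dirac_symbol_symmetric mult_ac)
  then show ?thesis unfolding Lam_eq[OF dg] Lam_eq[OF dh] Lam_eq[OF g(2)] Lam_eq[OF h(2)]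
    by (simp only: inner_abs_l2 square_integrable_wt[OF dg] square_integrable_wt[OF dh] square_integrable_wt[OF g(2)] square_integrable_wt[OF h(2)])
qed

lemma free_dirac_bounded_ops: "free_dirac \<alpha> m \<in> bounded_ops (sobolev (1/2)) (sobolev (-1/2))"
proof -
  obtain C where C: "\<And>\<xi> v. norm (dirac_symbol \<alpha> m \<xi> v) \<le> C * (wt \<xi> powr (1/2) * norm v)"
    using dirac_symbol_bound by blast
  have "nrm (sobolev (-1/2)) (free_dirac \<alpha> m u) \<le> \<bar>C\<bar> * nrm (sobolev (1/2)) u \<and> free_dirac \<alpha> m u \<in> vecs (sobolev (-1/2))"
    if u: "u \<in> vecs (sobolev (1/2))" for u
  proof -
    obtain g where g: "tempered u" "sobolev_transform (1/2) u g" using u by (auto simp: vecs_sobolev)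
    note dg = free_dirac_transform[OF g]
    have "norm (Lam (-1/2) (free_dirac \<alpha> m u)) \<le> \<bar>C\<bar> * norm (Lam (1/2) u)" unfolding Lam_eq[OF dg(2)] Lam_eq[OF g(2)]
    proof (rule norm_abs_l2_mono[OF square_integrable_wt[OF dg(2)] square_integrable_wt[OF g(2)]])
      fix \<xi>
      have "norm (dirac_symbol \<alpha> m \<xi> (g \<xi>)) \<le> \<bar>C\<bar> * (wt \<xi> powr (1/2) * norm (g \<xi>))"
        by (rule order_trans[OF C]) (intro mult_right_mono, auto)
      then have "wt \<xi> powr (-1/2/2) * norm (dirac_symbol \<alpha> m \<xi> (g \<xi>)) \<le> wt \<xi> powr (-1/2/2) * (\<bar>C\<bar> * (wt \<xi> powr (1/2) * norm (g \<xi>)))"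
        by (rule mult_left_mono) simp
      also have "\<dots> = \<bar>C\<bar> * ((wt \<xi> powr (-1/2/2) * wt \<xi> powr (1/2)) * norm (g \<xi>))" by (simp only: mult_ac)
      also have "wt \<xi> powr (-1/2/2) * wt \<xi> powr (1/2) = wt \<xi> powr (1/2/2)" by (subst powr_add[symmetric]) simp
      finally show "norm (wt \<xi> powr (-1/2/2) *\<^sub>R dirac_symbol \<alpha> m \<xi> (g \<xi>)) \<le> \<bar>C\<bar> * norm (wt \<xi> powr (1/2/2) *\<^sub>R g \<xi>)" by simp
    qed simp
    moreover have "free_dirac \<alpha> m u \<in> vecs (sobolev (-1/2))" using dg by (auto simp: vecs_sobolev)
    ultimately show ?thesis using u by (simp add: nrm_sobolev)
  qed
  moreover have "free_dirac \<alpha> m (u + v) = free_dirac \<alpha> m u + free_dirac \<alpha> m v" for u v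
  proof (rule ext)
    fix \<phi>
    have "momentum k (u + v) \<phi> = momentum k u \<phi> + momentum k v \<phi>" for k
      by (simp add: momentum_def plus_fun_def scaleC_minus_left scaleC_minus_right scaleC_diff_right scaleC_add_right)
    then show "free_dirac \<alpha> m (u + v) \<phi> = (free_dirac \<alpha> m u + free_dirac \<alpha> m v) \<phi>"
      by (simp add: free_dirac_def plus_fun_def \<alpha>_simps sum.distrib scaleR_add_right)
  qed
  moreover have "free_dirac \<alpha> m (c *\<^sub>C u) = c *\<^sub>C free_dirac \<alpha> m u" for c u
  proof (rule ext)
    fix \<phi>
    have "momentum k (c *\<^sub>C u) \<phi> = c *\<^sub>C momentum k u \<phi>" for k
      by (simp add: momentum_def scaleC_fun_def scaleC_zero_right scaleC_scaleC mult.commute flip: scaleC_minus_right)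
    then show "free_dirac \<alpha> m (c *\<^sub>C u) \<phi> = (c *\<^sub>C free_dirac \<alpha> m u) \<phi>"
      by (simp add: free_dirac_def scaleC_fun_def \<alpha>_simps
          scaleC_add_right complex_vector.scale_sum_right scaleC_scaleR)
  qed
  ultimately show ?thesis unfolding bounded_ops_def clinear_on_def by (auto simp: image_subset_iff)
qed

lemma free_dirac_schwartz_mult:
  assumes u: "tempered u" and \<theta>: "schwartz \<theta>"
  shows "free_dirac \<alpha> m (schwartz_mult \<theta> u) \<phi> = schwartz_mult \<theta> (free_dirac \<alpha> m u) \<phi> +
    (\<Sum>k\<in>UNIV. \<alpha> (Some k) (schwartz_mult (\<lambda>x. - \<i> * partial_deriv k \<theta> x) u \<phi>))"
  unfolding free_dirac_def momentum_schwartz_mult[OF u \<theta>]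
  by (simp add: \<alpha>_simps sum.distrib) (simp add: schwartz_mult_def \<alpha>_simps)

end

section \<open>The form associated with a perturbed Dirac operator\<close>

lemma schwartz_distr_sobolev:
  assumes "schwartz \<phi>"
  shows "distr_of (\<lambda>x. \<phi> x *\<^sub>C e) \<in> vecs (sobolev s)"
    and "sobolev_transform s (distr_of (\<lambda>x. \<phi> x *\<^sub>C e)) (\<lambda>\<xi>. fourier \<phi> \<xi> *\<^sub>C e)"
proof -
  have "(abs_l2 (\<lambda>x. \<phi> x *\<^sub>C e), abs_l2 (\<lambda>\<xi>. fourier \<phi> \<xi> *\<^sub>C e)) \<in> fourier_graph"
    using fourier_graph_base[OF assms, of e] by (simp add: schwartz_vec_def)
  from sobolev_transform_distr_of[OF this]
  have "sobolev_transform 0 (distr_of (\<lambda>x. \<phi> x *\<^sub>C e)) (\<lambda>\<xi>. fourier \<phi> \<xi> *\<^sub>C e)"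
    by (simp add: schwartz_square_integrable schwartz_fourier assms)
  then show t: "sobolev_transform s (distr_of (\<lambda>x. \<phi> x *\<^sub>C e)) (\<lambda>\<xi>. fourier \<phi> \<xi> *\<^sub>C e)"
    by (simp add: sobolev_transform_iff schwartz_weighted schwartz_fourier assms)
  then show "distr_of (\<lambda>x. \<phi> x *\<^sub>C e) \<in> vecs (sobolev s)"
    using tempered_distr_of[OF schwartz_square_integrable[OF assms]] by (auto simp: vecs_sobolev)
qed

text \<open>Identifies the inner product of \<open>l2\<close> with the value of a distribution. The
  conjugate enters because distributions are linear in the test function, whereas scalars pass to
  the other side of an inner product as conjugates.\<close>

lemma inner_Lam_schwartz:
  fixes w :: "('n::finite, 'e::complex_euclidean_space) distr"
  assumes w: "w \<in> vecs (sobolev (-1/2))" and \<phi>: "schwartz \<phi>"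
  shows "inner (Lam (-1/2) w) (Lam (1/2) (distr_of (\<lambda>x. \<phi> x *\<^sub>C e))) = inner (w (\<lambda>x. cnj (\<phi> x))) e"
proof -
  obtain g where g: "sobolev_transform (-1/2) w g" using w by (auto simp: vecs_sobolev)
  note h = schwartz_distr_sobolev(2)[OF \<phi>, of "1/2" e]
  let ?\<psi> = "\<lambda>\<xi>. cnj (fourier \<phi> \<xi>)"
  have \<psi>: "schwartz ?\<psi>" by (intro schwartz_cnj schwartz_fourier \<phi>)
  have f\<psi>: "fourier ?\<psi> = (\<lambda>x. cnj (\<phi> x))"
    using fun_cong[OF inv_fourier_fourier[OF \<phi>]] by (intro ext) (metis complex_cnj_cnj inv_fourier_def)
  have "inner (Lam (-1/2) w) (Lam (1/2) (distr_of (\<lambda>x. \<phi> x *\<^sub>C e))) =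
      (LINT \<xi>|lebesgue. inner (wt \<xi> powr (-1/2/2) *\<^sub>R g \<xi>) (wt \<xi> powr (1/2/2) *\<^sub>R fourier \<phi> \<xi> *\<^sub>C e))"
    unfolding Lam_eq[OF g] Lam_eq[OF h] by (rule inner_abs_l2[OF square_integrable_wt[OF g] square_integrable_wt[OF h]])
  also have "\<dots> = (LINT \<xi>|lebesgue. inner (?\<psi> \<xi> *\<^sub>C g \<xi>) e)"
  proof (rule Bochner_Integration.integral_cong[OF refl])
    fix \<xi> :: "real^'n"
    have "wt \<xi> powr (1/2/2) * wt \<xi> powr (-1/2/2) = 1" by (subst powr_add[symmetric]) (simp add: wt_nonzero)
    then show "inner (wt \<xi> powr (-1/2/2) *\<^sub>R g \<xi>) (wt \<xi> powr (1/2/2) *\<^sub>R fourier \<phi> \<xi> *\<^sub>C e) = inner (?\<psi> \<xi> *\<^sub>C g \<xi>) e"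
      by (simp add: inner_scaleC_left mult.assoc[symmetric])
  qed
  also have "\<dots> = inner (LINT \<xi>|lebesgue. ?\<psi> \<xi> *\<^sub>C g \<xi>) e"
    by (rule integral_inner_left) (rule weighted_pairing_bound[OF sobolev_transformD(1)[OF g] \<psi>])
  also have "(LINT \<xi>|lebesgue. ?\<psi> \<xi> *\<^sub>C g \<xi>) = w (\<lambda>x. cnj (\<phi> x))"
    using sobolev_transformD(2)[OF g \<psi>] by (simp add: f\<psi>)
  finally show ?thesis .
qed

lemma test_function_cnj: "test_function \<phi> \<Longrightarrow> test_function (\<lambda>x. cnj (\<phi> x))"
  by (simp add: test_function_def schwartz_cnj)

text \<open>Density of test functions in order 1/2, by duality: \<open>a\<close> represents a
  distribution \<open>w\<close> of order -1/2, and orthogonality says that \<open>w\<close> vanishes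
  at all test functions.\<close>

lemma Lam_test_dense:
  assumes "\<And>\<phi> e. test_function \<phi> \<Longrightarrow> inner a (Lam (1/2) (distr_of (\<lambda>x. \<phi> x *\<^sub>C e))) = 0"
  shows "a = 0"
proof -
  obtain w where w: "w \<in> vecs (sobolev (-1/2))" "a = Lam (-1/2) w" using Lam_bij[of "-1/2"] unfolding bij_betw_def by auto
  have z: "0 \<in> vecs (sobolev (-1/2))" by (rule complex_vector.subspace_0[OF sobolev_subspace])
  have "w = 0"
  proof (rule sobolev_eqI_test[OF w(1) z])
    fix \<phi> :: "real^'a \<Rightarrow> complex" assume "test_function \<phi>"
    then have t: "test_function (\<lambda>x. cnj (\<phi> x))" by (rule test_function_cnj)
    then have "inner (w \<phi>) e = 0" for e
      using assms[OF t, of e] inner_Lam_schwartz[OF w(1), of "\<lambda>x. cnj (\<phi> x)" e] by (simp add: w(2) test_function_def)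
    then have "w \<phi> = 0" by (metis inner_eq_zero_iff)
    then show "w \<phi> = 0 \<phi>" by simp
  qed simp
  then show ?thesis using sobolev_diff(2)[OF w(1) w(1)] w(2) by simp
qed

text \<open>Between test functions the form of \<open>V\<close> is an ordinary integral, to which
  the symmetry of each \<open>V x\<close> applies. General elements are reached by density.\<close>

lemma mult_op_symmetric_test:
  fixes V :: "real^'n::finite \<Rightarrow> 'e::complex_euclidean_space \<Rightarrow> 'e" and d e :: 'e
  assumes V: "symmetric_potential V" "mult_continuous V" and \<phi>: "test_function \<phi>" and \<psi>: "test_function \<psi>"
  defines "u \<equiv> distr_of (\<lambda>x. \<phi> x *\<^sub>C d)" and "v \<equiv> distr_of (\<lambda>x. \<psi> x *\<^sub>C e)"
  shows "inner (Lam (-1/2) (mult_op V u)) (Lam (1/2) v) = inner (Lam (1/2) u) (Lam (-1/2) (mult_op V v))"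
proof -
  have eq: "inner (Lam (-1/2) (mult_op V (distr_of (\<lambda>x. \<phi> x *\<^sub>C d)))) (Lam (1/2) (distr_of (\<lambda>x. \<psi> x *\<^sub>C e)))
      = (LINT x|lebesgue. inner (V x (\<phi> x *\<^sub>C d)) (\<psi> x *\<^sub>C e))"
    if \<phi>: "test_function \<phi>" and \<psi>: "test_function \<psi>" for \<phi> \<psi> :: "real^'n \<Rightarrow> complex" and d e
  proof -
    have s: "schwartz \<phi>" "schwartz \<psi>" using \<phi> \<psi> by (auto simp: test_function_def)
    note p = mult_op_product[OF V schwartz_distr_sobolev(1)[OF s(1)]]
    have m: "(\<lambda>x. V x (\<phi> x *\<^sub>C d)) \<in> borel_measurable lebesgue"
      using schwartz_square_integrable[OF s(1), of d] by (intro symmetric_potential_measurable[OF V(1)]) (simp add: square_integrable_def)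
    note q = is_product_eq[OF p(2) refl schwartz_square_integrable[OF s(1)] test_function_cnj[OF \<psi>] m]
    show ?thesis unfolding inner_Lam_schwartz[OF p(1) s(2)] q(1) by (subst integral_inner_left[symmetric, OF q(2)]) (simp add: inner_scaleC_left)
  qed
  have "inner (Lam (1/2) u) (Lam (-1/2) (mult_op V v)) = (LINT x|lebesgue. inner (V x (\<psi> x *\<^sub>C e)) (\<phi> x *\<^sub>C d))"
    unfolding u_def v_def by (subst inner_commute) (rule eq[OF \<psi> \<phi>])
  also have "\<dots> = (LINT x|lebesgue. inner (V x (\<phi> x *\<^sub>C d)) (\<psi> x *\<^sub>C e))"
  proof (rule Bochner_Integration.integral_cong[OF refl])
    fix x
    have "symmetric_operator (V x)" using V(1) by (simp add: symmetric_potential_def)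
    from symmetric_operator_inner[OF this, of "\<psi> x *\<^sub>C e" "\<phi> x *\<^sub>C d"]
    show "inner (V x (\<psi> x *\<^sub>C e)) (\<phi> x *\<^sub>C d) = inner (V x (\<phi> x *\<^sub>C d)) (\<psi> x *\<^sub>C e)"
      by (simp only: inner_commute[of "V x (\<phi> x *\<^sub>C d)"])
  qed
  finally show ?thesis unfolding u_def v_def eq[OF \<phi> \<psi>] by simp
qed

section \<open>Operators between Sobolev spaces as operators on \<open>l2\<close>\<close>

definition unLam :: "real \<Rightarrow> ('n::finite, 'e::complex_euclidean_space) l2 \<Rightarrow> ('n, 'e) distr" where
  "unLam s = inv_into (vecs (sobolev s)) (Lam s)"

lemma unLam:
  fixes a :: "('n::finite, 'e::complex_euclidean_space) l2"
  assumes "s \<ge> -1"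
  shows "unLam s a \<in> vecs (sobolev s)" "Lam s (unLam s a) = a"
proof -
  have "Lam s ` vecs (sobolev s) = (UNIV :: ('n, 'e) l2 set)" using Lam_bij[OF assms] unfolding bij_betw_def by (rule conjunct2)
  then have "a \<in> Lam s ` vecs (sobolev s)" by simp
  then show "unLam s a \<in> vecs (sobolev s)" "Lam s (unLam s a) = a" unfolding unLam_def by (rule inv_into_into, rule f_inv_into_f)
qed

lemma unLam_Lam: "u \<in> vecs (sobolev s) \<Longrightarrow> unLam s (Lam s u) = u" unfolding unLam_def by (rule inv_into_f_f[OF Lam_inj])

lemma unLam_add: "s \<ge> -1 \<Longrightarrow> unLam s (a + b) = unLam s a + unLam s b"
  using unLam_Lam[OF sobolev_add(1)[OF unLam(1) unLam(1)], of s a b] by (simp add: sobolev_add(2) unLam)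

lemma unLam_scaleC: "s \<ge> -1 \<Longrightarrow> unLam s (c *\<^sub>C a) = c *\<^sub>C unLam s a"
  using unLam_Lam[OF sobolev_scaleC(1)[OF unLam(1)], of s c a] by (simp add: sobolev_scaleC(2) unLam)

definition transport :: "real \<Rightarrow> real \<Rightarrow> (('n::finite, 'e::complex_euclidean_space) distr \<Rightarrow> ('n, 'e) distr) \<Rightarrow>
    ('n, 'e) l2 \<Rightarrow> ('n, 'e) l2" where
  "transport s t T a = Lam t (T (unLam s a))"

lemma transport_Lam: "u \<in> vecs (sobolev s) \<Longrightarrow> transport s t T (Lam s u) = Lam t (T u)" by (simp add: transport_def unLam_Lam)

lemma transport_bounded_linear:
  assumes T: "T \<in> bounded_ops (sobolev s) (sobolev t)" and s: "s \<ge> -1"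
  shows "bounded_linear (transport s t T)" "transport s t T (c *\<^sub>C a) = c *\<^sub>C transport s t T a"
proof -
  obtain K where K: "\<And>u. u \<in> vecs (sobolev s) \<Longrightarrow> nrm (sobolev t) (T u) \<le> K * nrm (sobolev s) u"
    and T': "\<And>u. u \<in> vecs (sobolev s) \<Longrightarrow> T u \<in> vecs (sobolev t)" "clinear_on (vecs (sobolev s)) T"
    using T unfolding bounded_ops_def by blast
  have add: "transport s t T (a + b) = transport s t T a + transport s t T b" for a b
    using T'(2) by (simp add: transport_def unLam_add[OF s] clinear_on_def sobolev_add(2) T'(1) unLam(1)[OF s])
  have scale: "transport s t T (c *\<^sub>C a) = c *\<^sub>C transport s t T a" for c a
    using T'(2) by (simp add: transport_def unLam_scaleC[OF s] clinear_on_def sobolev_scaleC(2) T'(1) unLam(1)[OF s])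
  show "bounded_linear (transport s t T)"
  proof (rule bounded_linear_intro[OF add])
    show "transport s t T (r *\<^sub>R a) = r *\<^sub>R transport s t T a" for r a
      using scale[of "complex_of_real r" a] by (simp add: scaleC_complex_of_real)
    show "norm (transport s t T a) \<le> norm a * K" for a
      using K[OF unLam(1)[OF s]] by (simp add: transport_def nrm_sobolev unLam[OF s] T'(1) mult.commute)
  qed
  show "transport s t T (c *\<^sub>C a) = c *\<^sub>C transport s t T a" by (rule scale)
qed

lemma bounded_ops_lincomb:
  fixes T T' :: "('n::finite, 'e::complex_euclidean_space) distr \<Rightarrow> ('n, 'e) distr"
  assumes T: "T \<in> bounded_ops (sobolev s) (sobolev t)" and T': "T' \<in> bounded_ops (sobolev s) (sobolev t)"
  shows "(\<lambda>u. T u + c *\<^sub>C T' u) \<in> bounded_ops (sobolev s) (sobolev t)"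
proof -
  obtain K where K: "\<And>u. u \<in> vecs (sobolev s) \<Longrightarrow> nrm (sobolev t) (T u) \<le> K * nrm (sobolev s) u"
    and m: "\<And>u. u \<in> vecs (sobolev s) \<Longrightarrow> T u \<in> vecs (sobolev t)" and l: "clinear_on (vecs (sobolev s)) T"
    using T unfolding bounded_ops_def by blast
  obtain K' where K': "\<And>u. u \<in> vecs (sobolev s) \<Longrightarrow> nrm (sobolev t) (T' u) \<le> K' * nrm (sobolev s) u"
    and m': "\<And>u. u \<in> vecs (sobolev s) \<Longrightarrow> T' u \<in> vecs (sobolev t)" and l': "clinear_on (vecs (sobolev s)) T'"
    using T' unfolding bounded_ops_def by blast
  have "nrm (sobolev t) (T u + c *\<^sub>C T' u) \<le> (K + cmod c * K') * nrm (sobolev s) u" if u: "u \<in> vecs (sobolev s)" for u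
    using K[OF u] mult_left_mono[OF K'[OF u], of "cmod c"] norm_triangle_ineq[of "Lam t (T u)" "c *\<^sub>C Lam t (T' u)"]
    by (simp add: nrm_sobolev m[OF u] m'[OF u] u sobolev_add sobolev_scaleC norm_scaleC distrib_right mult.assoc)
  moreover have "clinear_on (vecs (sobolev s)) (\<lambda>u. T u + c *\<^sub>C T' u)"
    using l l' unfolding clinear_on_def by (simp add: complex_vector.scale_right_distrib add_ac mult.commute)
  moreover have "T u + c *\<^sub>C T' u \<in> vecs (sobolev t)" if "u \<in> vecs (sobolev s)" for u
    by (rule sobolev_add(1)[OF m[OF that] sobolev_scaleC(1)[OF m'[OF that]]])
  ultimately show ?thesis unfolding bounded_ops_def by blast
qed

text \<open>With one argument fixed, the solutions of the identity in the other argument form a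
  closed subspace. Density of test functions therefore extends it in two steps, one argument at a
  time.\<close>

lemma bounded_bilinear_dense:
  fixes S :: "('n::finite, 'e::complex_euclidean_space) l2 \<Rightarrow> ('n, 'e) l2"
  assumes S: "bounded_linear S"
    and sym: "\<And>\<phi> \<psi> d e. test_function \<phi> \<Longrightarrow> test_function \<psi> \<Longrightarrow>
      inner (S (Lam (1/2) (distr_of (\<lambda>x. \<phi> x *\<^sub>C d)))) (Lam (1/2) (distr_of (\<lambda>x. \<psi> x *\<^sub>C e))) =
      inner (Lam (1/2) (distr_of (\<lambda>x. \<phi> x *\<^sub>C d))) (S (Lam (1/2) (distr_of (\<lambda>x. \<psi> x *\<^sub>C e))))"
  shows "inner (S x) y = inner x (S y)"
proof -
  interpret S: bounded_linear S by (rule S)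
  let ?p = "\<lambda>\<phi> e. Lam (1/2) (distr_of (\<lambda>x. \<phi> x *\<^sub>C e)) :: ('n, 'e) l2"
  have cont: "continuous_on UNIV S" by (rule S.continuous_on) (rule continuous_on_id)
  have "{y. inner (S (?p \<phi> d)) y = inner (?p \<phi> d) (S y)} = UNIV" if \<phi>: "test_function \<phi>" for \<phi> d
  proof (rule closed_subspace_eq_UNIV)
    show "closed {y. inner (S (?p \<phi> d)) y = inner (?p \<phi> d) (S y)}" by (intro closed_Collect_eq continuous_intros cont)
    show "subspace {y. inner (S (?p \<phi> d)) y = inner (?p \<phi> d) (S y)}" by (simp add: subspace_def S.zero S.add S.scaleR inner_add_right)
    show "y = 0" if y: "\<And>m. m \<in> {y. inner (S (?p \<phi> d)) y = inner (?p \<phi> d) (S y)} \<Longrightarrow> inner y m = 0" for y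
      by (rule Lam_test_dense) (rule y, simp add: sym[OF \<phi>])
  qed
  then have 1: "inner (S (?p \<phi> d)) y = inner (?p \<phi> d) (S y)" if "test_function \<phi>" for \<phi> d y using that by blast
  have "{x. inner (S x) y = inner x (S y)} = UNIV"
  proof (rule closed_subspace_eq_UNIV)
    show "closed {x. inner (S x) y = inner x (S y)}" by (intro closed_Collect_eq continuous_intros cont)
    show "subspace {x. inner (S x) y = inner x (S y)}" by (simp add: subspace_def S.zero S.add S.scaleR inner_add_left)
    show "z = 0" if z: "\<And>m. m \<in> {x. inner (S x) y = inner x (S y)} \<Longrightarrow> inner z m = 0" for z
      by (rule Lam_test_dense) (rule z, simp add: 1)
  qed
  then show ?thesis by blast
qed

lemma Lam_embed:
  assumes "u \<in> vecs (sobolev (1/2))"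
  shows "u \<in> vecs (sobolev 0)" "u \<in> vecs (sobolev (-1/2))" "Lam 0 u = wt_op (-1/4) (Lam (1/2) u)"
  using Lam_mono[OF assms, of 0] Lam_mono(1)[OF assms, of "-1/2"] by simp_all

lemma Lam_embed':
  assumes "u \<in> vecs (sobolev 0)"
  shows "u \<in> vecs (sobolev (-1/2))" "Lam (-1/2) u = wt_op (-1/4) (Lam 0 u)" using Lam_mono[OF assms, of "-1/2"] by simp_all

definition op_graph :: "('n::finite, 'e::complex_euclidean_space) distr unbounded_op \<Rightarrow> (('n, 'e) l2 \<times> ('n, 'e) l2) set" where
  "op_graph A = (\<lambda>u. (Lam 0 u, Lam 0 (app_op A u))) ` dom_op A"

locale dirac_potential =
  fixes \<alpha> :: "'n::finite option \<Rightarrow> 'e::complex_euclidean_space \<Rightarrow> 'e" and m :: real and V :: "real^'n \<Rightarrow> 'e \<Rightarrow> 'e"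
  assumes \<alpha>: "\<And>j. symmetric_operator (\<alpha> j)" and V: "symmetric_potential V" "mult_continuous V"
    and bij: "bij_betw (\<lambda>u. free_dirac \<alpha> m u + mult_op V u + \<i> *\<^sub>C u)
           (vecs (sobolev (1/2))) (vecs (sobolev (-1/2)))"
begin

abbreviation (input) "dirac \<equiv> \<lambda>u. free_dirac \<alpha> m u + mult_op V u"

lemma dirac_bounded_ops: "dirac \<in> bounded_ops (sobolev (1/2)) (sobolev (-1/2))"
  using bounded_ops_lincomb[OF free_dirac_bounded_ops[OF \<alpha>], where T' = "mult_op V" and c = 1] V(2) by (simp add: mult_continuous_def scaleC_one)

lemma dirac_sobolev: "u \<in> vecs (sobolev (1/2)) \<Longrightarrow> dirac u \<in> vecs (sobolev (-1/2))"
  using dirac_bounded_ops by (auto simp: bounded_ops_def)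

lemma dirac_linear:
  assumes "u \<in> vecs (sobolev (1/2))" "v \<in> vecs (sobolev (1/2))"
  shows "dirac (u + v) = dirac u + dirac v" "dirac (c *\<^sub>C u) = c *\<^sub>C dirac u" "dirac (u - v) = dirac u - dirac v"
proof -
  have add: "\<And>u v. u \<in> vecs (sobolev (1/2)) \<Longrightarrow> v \<in> vecs (sobolev (1/2)) \<Longrightarrow> dirac (u + v) = dirac u + dirac v"
    and scale: "\<And>c u. u \<in> vecs (sobolev (1/2)) \<Longrightarrow> dirac (c *\<^sub>C u) = c *\<^sub>C dirac u"
    using dirac_bounded_ops unfolding bounded_ops_def clinear_on_def by blast+
  show "dirac (u + v) = dirac u + dirac v" "dirac (c *\<^sub>C u) = c *\<^sub>C dirac u" by (rule add[OF assms], rule scale[OF assms(1)])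
  have "dirac (u - v) + dirac v = dirac u" using add[OF sobolev_diff(1)[OF assms] assms(2)] by simp
  then show "dirac (u - v) = dirac u - dirac v" by (simp only: eq_diff_eq)
qed

text \<open>The inclusion of order 1/2 in order -1/2 factors through order 0, whence J occurs
  twice.\<close>

lemma dirac_transport_shift:
  assumes u: "u \<in> vecs (sobolev (1/2))"
  shows "transport (1/2) (-1/2) dirac (Lam (1/2) u) + \<i> *\<^sub>C wt_op (-1/4) (wt_op (-1/4) (Lam (1/2) u))
    = Lam (-1/2) (dirac u + \<i> *\<^sub>C u)"
proof -
  note 1 = dirac_sobolev[OF u]
  note 2 = Lam_embed[OF u] and 3 = Lam_embed'[OF Lam_embed(1)[OF u]]
  show ?thesis
    unfolding transport_Lam[OF u] sobolev_add(2)[OF 1 sobolev_scaleC(1)[OF 2(2)]] sobolev_scaleC(2)[OF 2(2)] 2(3)[symmetric] 3(2)[symmetric] ..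
qed

lemma dirac_symmetric_form:
  "symmetric_form (transport (1/2) (-1/2) dirac) (wt_op (-1/4))"
    (is "symmetric_form ?S ?J")
proof (rule symmetric_form.intro)
  show "bounded_linear ?S" by (rule transport_bounded_linear[OF dirac_bounded_ops]) simp
  show "?S (c *\<^sub>C x) = c *\<^sub>C ?S x" for c x by (rule transport_bounded_linear[OF dirac_bounded_ops]) simp
  have Vb: "mult_op V \<in> bounded_ops (sobolev (1/2)) (sobolev (-1/2))" using V(2) by (simp add: mult_continuous_def)
  have Db: "free_dirac \<alpha> m \<in> bounded_ops (sobolev (1/2)) (sobolev (-1/2))" by (rule free_dirac_bounded_ops[OF \<alpha>])
  have sum: "?S x = transport (1/2) (-1/2) (free_dirac \<alpha> m) x + transport (1/2) (-1/2) (mult_op V) x" for x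
  proof -
    have "unLam (1/2) x \<in> vecs (sobolev (1/2))" by (rule unLam) simp
    then have "free_dirac \<alpha> m (unLam (1/2) x) \<in> vecs (sobolev (-1/2))" "mult_op V (unLam (1/2) x) \<in> vecs (sobolev (-1/2))"
      using Vb Db by (auto simp: bounded_ops_def)
    then show ?thesis by (simp add: transport_def sobolev_add(2))
  qed
  show "inner (?S x) y = inner x (?S y)" for x y
  proof -
    have "inner (transport (1/2) (-1/2) (mult_op V) x) y = inner x (transport (1/2) (-1/2) (mult_op V) y)"
    proof (rule bounded_bilinear_dense)
      show "bounded_linear (transport (1/2) (-1/2) (mult_op V))" by (rule transport_bounded_linear[OF Vb]) simp
      fix \<phi> \<psi> :: "real^'n \<Rightarrow> complex" and d e :: 'e assume t: "test_function \<phi>" "test_function \<psi>"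
      then have s: "schwartz \<phi>" "schwartz \<psi>" by (auto simp: test_function_def)
      show "inner (transport (1/2) (-1/2) (mult_op V) (Lam (1/2) (distr_of (\<lambda>x. \<phi> x *\<^sub>C d)))) (Lam (1/2) (distr_of (\<lambda>x. \<psi> x *\<^sub>C e))) =
         inner (Lam (1/2) (distr_of (\<lambda>x. \<phi> x *\<^sub>C d))) (transport (1/2) (-1/2) (mult_op V) (Lam (1/2) (distr_of (\<lambda>x. \<psi> x *\<^sub>C e))))"
        unfolding transport_Lam[OF schwartz_distr_sobolev(1)[OF s(1)]] transport_Lam[OF schwartz_distr_sobolev(1)[OF s(2)]]
        by (rule mult_op_symmetric_test[OF V t])
    qed
    moreover have "inner (transport (1/2) (-1/2) (free_dirac \<alpha> m) x) y = inner x (transport (1/2) (-1/2) (free_dirac \<alpha> m) y)"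
      using free_dirac_symmetric[OF \<alpha>, where m = m and u = "unLam (1/2) x" and v = "unLam (1/2) y"] by (simp add: transport_def unLam)
    ultimately show ?thesis by (simp only: sum inner_add_left inner_add_right)
  qed
  show "bounded_linear ?J" by (rule bounded_linear_wt_op) simp
  show "?J (c *\<^sub>C x) = c *\<^sub>C ?J x" for c x by (rule wt_op_scaleC) simp
  show "inner (?J x) y = inner x (?J y)" for x y by (rule wt_op_symmetric) simp
  show "inj ?J" by (rule inj_wt_op) simp
  have b: "bij_betw (unLam (1/2)) UNIV (vecs (sobolev (1/2)))" unfolding unLam_def by (rule bij_betw_inv_into[OF Lam_bij]) simp
  have "(\<lambda>x. ?S x + \<i> *\<^sub>C ?J (?J x)) = Lam (-1/2) \<circ> (\<lambda>u. dirac u + \<i> *\<^sub>C u) \<circ> unLam (1/2)"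
  proof
    fix x :: "('n, 'e) l2"
    show "?S x + \<i> *\<^sub>C ?J (?J x) = (Lam (-1/2) \<circ> (\<lambda>u. dirac u + \<i> *\<^sub>C u) \<circ> unLam (1/2)) x"
      using dirac_transport_shift[OF unLam(1), of x] by (simp add: unLam(2))
  qed
  then show "bij (\<lambda>x. ?S x + \<i> *\<^sub>C ?J (?J x))"
    using bij_betw_trans[OF b bij_betw_trans[OF bij Lam_bij[of "-1/2"]]] by (simp add: comp_assoc)
qed

text \<open>S x = J h states, as an identity in order -1/2, that D + V maps the distribution of
  \<open>x\<close> to an element of L2. This is the domain condition of the induced
  operator.\<close>

lemma dirac_op_graph:
  "op_graph (induced_op dirac) =
    symmetric_form.graph (transport (1/2) (-1/2) dirac) (wt_op (-1/4))"
    proof -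
  have "(\<exists>u. u \<in> vecs (sobolev (1/2)) \<and> dirac u \<in> vecs L2 \<and> p = Lam 0 u \<and> h = Lam 0 (dirac u)) \<longleftrightarrow>
      (\<exists>x. p = wt_op (-1/4) x \<and> transport (1/2) (-1/2) dirac x = wt_op (-1/4) h)" for p h
  proof
    assume "\<exists>u. u \<in> vecs (sobolev (1/2)) \<and> dirac u \<in> vecs L2 \<and> p = Lam 0 u \<and> h = Lam 0 (dirac u)"
    then obtain u where u: "u \<in> vecs (sobolev (1/2))" "dirac u \<in> vecs (sobolev 0)" "p = Lam 0 u" "h = Lam 0 (dirac u)"
      by (auto simp: vecs_L2)
    show "\<exists>x. p = wt_op (-1/4) x \<and> transport (1/2) (-1/2) dirac x = wt_op (-1/4) h"
      by (rule exI[of _ "Lam (1/2) u"]) (simp only: u(3,4) transport_Lam[OF u(1)] Lam_embed(3)[OF u(1)] Lam_embed'(2)[OF u(2)])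
  next
    assume "\<exists>x. p = wt_op (-1/4) x \<and> transport (1/2) (-1/2) dirac x = wt_op (-1/4) h"
    then obtain x where x: "p = wt_op (-1/4) x" "transport (1/2) (-1/2) dirac x = wt_op (-1/4) h" by blast
    define u where "u = unLam (1/2) x"
    define g where "g = unLam 0 h"
    have u: "u \<in> vecs (sobolev (1/2))" "x = Lam (1/2) u" and g: "g \<in> vecs (sobolev 0)" "h = Lam 0 g" by (simp_all add: u_def g_def unLam)
    have "Lam (-1/2) (dirac u) = Lam (-1/2) g" using x(2) unfolding u(2) g(2) transport_Lam[OF u(1)] Lam_embed'(2)[OF g(1)] .
    then have "dirac u = g" using dirac_sobolev[OF u(1)] Lam_embed'(1)[OF g(1)] by (meson Lam_inj inj_onD)
    then show "\<exists>u. u \<in> vecs (sobolev (1/2)) \<and> dirac u \<in> vecs L2 \<and> p = Lam 0 u \<and> h = Lam 0 (dirac u)"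
      using u g x(1) Lam_embed(3)[OF u(1)] by (auto simp: vecs_L2)
  qed
  then show ?thesis unfolding symmetric_form.graph_def[OF dirac_symmetric_form] op_graph_def induced_op_def by (auto simp: set_eq_iff image_iff)
qed

end

section \<open>Compactness of the difference of the resolvents\<close>

lemma Cauchy_dominated:
  fixes a :: "nat \<Rightarrow> 'a::real_normed_vector" and b :: "nat \<Rightarrow> 'b::real_normed_vector"
  assumes b: "Cauchy b" and le: "\<And>m n. norm (a m - a n) \<le> C * norm (b m - b n)"
  shows "Cauchy a"
proof (rule CauchyI)
  fix e :: real assume e: "e > 0"
  define c where "c = \<bar>C\<bar> + 1"
  have c: "c > 0" by (simp add: c_def)
  obtain M where M: "\<And>m n. m \<ge> M \<Longrightarrow> n \<ge> M \<Longrightarrow> norm (b m - b n) < e / c"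
    using CauchyD[OF b, of "e / c"] e c by auto
  have "norm (a m - a n) < e" if "m \<ge> M" "n \<ge> M" for m n
  proof -
    have "norm (a m - a n) \<le> c * norm (b m - b n)" by (rule order_trans[OF le]) (intro mult_right_mono, auto simp: c_def)
    also have "\<dots> < c * (e / c)" using M[OF that] c by (intro mult_strict_left_mono)
    finally show ?thesis using c by simp
  qed
  then show "\<exists>M. \<forall>m\<ge>M. \<forall>n\<ge>M. norm (a m - a n) < e" by blast
qed

lemma Cauchy_approximation:
  fixes a :: "nat \<Rightarrow> 'a::real_normed_vector"
  assumes "\<And>e. e > 0 \<Longrightarrow> \<exists>b. Cauchy b \<and> (\<forall>n. norm (a n - b n) \<le> e)"
  shows "Cauchy a"
proof (rule CauchyI)
  fix e :: real assume e: "e > 0"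
  then obtain b where b: "Cauchy b" "\<And>n. norm (a n - b n) \<le> e / 4" using assms[of "e / 4"] by auto
  obtain M where M: "\<And>m n. m \<ge> M \<Longrightarrow> n \<ge> M \<Longrightarrow> norm (b m - b n) < e / 2"
    using CauchyD[OF b(1), of "e / 2"] e by auto
  have "norm (a m - a n) < e" if "m \<ge> M" "n \<ge> M" for m n
  proof -
    have "a m - a n = (a m - b m) + (b m - b n) - (a n - b n)" by simp
    then have "norm (a m - a n) \<le> norm (a m - b m) + norm (b m - b n) + norm (a n - b n)"
      by (metis norm_triangle_le_diff add_mono norm_triangle_ineq order_refl)
    then show ?thesis using b(2)[of m] b(2)[of n] M[OF that] e by linarith
  qed
  then show "\<exists>M. \<forall>m\<ge>M. \<forall>n\<ge>M. norm (a m - a n) < e" by blast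
qed

lemma bounded_ops_linear_symbol:
  fixes A :: "'e::complex_euclidean_space \<Rightarrow> 'e"
  assumes A: "clinear_on UNIV A"
  shows "(\<lambda>u. \<lambda>\<phi>. A (u \<phi>)) \<in> bounded_ops (sobolev s :: ('n::finite, 'e) distr nspace) (sobolev s)"
proof -
  have lin: "linear A" by (rule clinear_on_UNIV_linear[OF A])
  obtain B where B: "B > 0" "\<And>x. norm (A x) \<le> B * norm x" using linear_bounded_pos[OF lin] by blast
  have 1: "(\<lambda>\<phi>. A (u \<phi>)) \<in> vecs (sobolev s)" "nrm (sobolev s) (\<lambda>\<phi>. A (u \<phi>)) \<le> B * nrm (sobolev s) u"
    if u: "u \<in> vecs (sobolev s)" for u :: "('n, 'e) distr"
  proof -
    obtain g where g: "tempered u" "sobolev_transform s u g" using u by (auto simp: vecs_sobolev)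
    note t = sobolev_transform_linear[OF g(2) A]
    show v: "(\<lambda>\<phi>. A (u \<phi>)) \<in> vecs (sobolev s)" using tempered_linear[OF g(1) A] t by (auto simp: vecs_sobolev)
    have "norm (Lam s (\<lambda>\<phi>. A (u \<phi>))) \<le> B * norm (Lam s u)" unfolding Lam_eq[OF t] Lam_eq[OF g(2)]
    proof (rule norm_abs_l2_mono[OF square_integrable_wt[OF t] square_integrable_wt[OF g(2)]])
      show "norm (wt \<xi> powr (s/2) *\<^sub>R A (g \<xi>)) \<le> B * norm (wt \<xi> powr (s/2) *\<^sub>R g \<xi>)" for \<xi>
        using B(2)[of "wt \<xi> powr (s/2) *\<^sub>R g \<xi>"] by (simp only: linear_scale[OF lin])
    qed (use B in simp)
    then show "nrm (sobolev s) (\<lambda>\<phi>. A (u \<phi>)) \<le> B * nrm (sobolev s) u" by (simp add: nrm_sobolev u v)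
  qed
  have "clinear_on (vecs (sobolev s)) (\<lambda>u \<phi>. A (u \<phi>))"
    using A unfolding clinear_on_def by (simp add: fun_eq_iff scaleC_fun_def plus_fun_def)
  then show ?thesis unfolding bounded_ops_def using 1 by blast
qed

lemma sobolev_sum:
  assumes "finite I" "\<And>i. i \<in> I \<Longrightarrow> u i \<in> vecs (sobolev s)"
  shows "(\<lambda>\<phi>. \<Sum>i\<in>I. u i \<phi>) \<in> vecs (sobolev s) \<and> Lam s (\<lambda>\<phi>. \<Sum>i\<in>I. u i \<phi>) = (\<Sum>i\<in>I. Lam s (u i))"
  using assms
proof (induction I rule: finite_induct)
  case empty
  have z: "0 \<in> vecs (sobolev s)" by (rule complex_vector.subspace_0[OF sobolev_subspace])
  then show ?case using sobolev_diff(2)[OF z z] by (simp add: zero_fun_def)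
next
  case (insert i I)
  then show ?case using sobolev_add[of "u i" s "\<lambda>\<phi>. \<Sum>i\<in>I. u i \<phi>"] by (simp add: plus_fun_def)
qed

text \<open>Everything concerns one fixed sequence. The Cauchy property is preserved by bounded
  operators, by linear combinations and, as \<open>\<eta>\<close> is bounded in order 1/2, by limits
  in operator norm. The fact \<open>approx\<close> is used twice, for the closure in
  \<open>multiplier_algebra\<close> and for that in \<open>B0\<close>.\<close>

lemma B0_Cauchy:
  fixes \<eta> :: "nat \<Rightarrow> ('n::finite, 'e::complex_euclidean_space) distr"
  assumes \<eta>: "\<And>n. \<eta> n \<in> vecs (sobolev (1/2))" "\<And>n. norm (Lam (1/2) (\<eta> n)) \<le> c"
    and \<theta>: "\<And>\<theta>. schwartz \<theta> \<Longrightarrow> Cauchy (\<lambda>n. Lam (1/2) (schwartz_mult \<theta> (\<eta> n)))"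
    and K: "K \<in> B0"
  shows "Cauchy (\<lambda>n. Lam (-1/2) (K (\<eta> n)))"
proof -
  let ?X = "sobolev (1/2) :: ('n, 'e) distr nspace" and ?Y = "sobolev (-1/2) :: ('n, 'e) distr nspace"
  let ?G = "{T \<circ> M | T M. T \<in> bounded_ops ?X ?Y \<and> M \<in> multiplier_algebra (1/2)}"
  have approx: "Cauchy (\<lambda>n. Lam t (T (\<eta> n)))"
    if T: "T \<in> op_closure ?X (sobolev t) \<S>"
      and S: "\<And>S. S \<in> \<S> \<Longrightarrow> (\<forall>u\<in>vecs ?X. S u \<in> vecs (sobolev t)) \<and> Cauchy (\<lambda>n. Lam t (S (\<eta> n)))" for t T \<S>
  proof (rule Cauchy_approximation)
    fix e :: real assume e: "e > 0"
    have c: "0 \<le> c" by (rule order_trans[OF norm_ge_zero \<eta>(2)])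
    \<comment> \<open>The bound \<open>c\<close> may be 0, hence \<open>c + 1\<close> in the
      denominator.\<close>
    have "e / (c + 1) > 0" using e c by simp
    then obtain S where S': "S \<in> \<S>" "\<And>u. u \<in> vecs ?X \<Longrightarrow> nrm (sobolev t) (T u - S u) \<le> e / (c + 1) * nrm ?X u"
      using T unfolding op_closure_def by blast
    have Tv: "T u \<in> vecs (sobolev t)" if "u \<in> vecs ?X" for u using T that unfolding op_closure_def bounded_ops_def by blast
    have "norm (Lam t (T (\<eta> n)) - Lam t (S (\<eta> n))) \<le> e" for n
    proof -
      note v = Tv[OF \<eta>(1)[of n]] S[OF S'(1), THEN conjunct1, THEN bspec, OF \<eta>(1)[of n]]
      have "norm (Lam t (T (\<eta> n)) - Lam t (S (\<eta> n))) \<le> e / (c + 1) * norm (Lam (1/2) (\<eta> n))"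
        using S'(2)[OF \<eta>(1)[of n]] by (simp add: nrm_sobolev sobolev_diff[OF v] \<eta>(1))
      also have "\<dots> \<le> e / (c + 1) * (c + 1)" using \<eta>(2)[of n] e c by (intro mult_left_mono) auto
      finally show ?thesis using c by simp
    qed
    then show "\<exists>b. Cauchy b \<and> (\<forall>n. norm (Lam t (T (\<eta> n)) - b n) \<le> e)" using S[OF S'(1)] by blast
  qed
  have mult: "Cauchy (\<lambda>n. Lam (1/2) (M (\<eta> n)))" if M: "M \<in> multiplier_algebra (1/2)" for M :: "('n, 'e) distr \<Rightarrow> ('n, 'e) distr"
  proof (rule approx[OF M[unfolded multiplier_algebra_def]])
    fix S :: "('n, 'e) distr \<Rightarrow> ('n, 'e) distr" assume "S \<in> {schwartz_mult \<theta> |\<theta>. schwartz \<theta>}"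
    then show "(\<forall>u\<in>vecs ?X. S u \<in> vecs ?X) \<and> Cauchy (\<lambda>n. Lam (1/2) (S (\<eta> n)))"
      using \<theta> by (auto intro: schwartz_mult_sobolev(1))
  qed
  have "K \<in> op_closure ?X ?Y (complex_vector.span ?G)" using K by (simp add: B0_def Let_def)
  then show ?thesis
  proof (rule approx)
    fix S assume S: "S \<in> complex_vector.span ?G"
    let ?P = "\<lambda>S. (\<forall>u\<in>vecs ?X. S u \<in> vecs ?Y) \<and> Cauchy (\<lambda>n. Lam (-1/2) (S (\<eta> n)))"
    show "?P S"
    proof (rule complex_vector.span_induct[OF S])
      show "complex_vector.subspace (Collect ?P)"
      proof (rule complex_vector.subspaceI)
        have z: "0 \<in> vecs ?Y" by (rule complex_vector.subspace_0[OF sobolev_subspace])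
        then show "0 \<in> Collect ?P" by (simp add: Cauchy_def)
      next
        fix S S' :: "('n, 'e) distr \<Rightarrow> ('n, 'e) distr"
        assume "S \<in> Collect ?P" "S' \<in> Collect ?P"
        then have s: "\<And>u. u \<in> vecs ?X \<Longrightarrow> S u \<in> vecs ?Y" "\<And>u. u \<in> vecs ?X \<Longrightarrow> S' u \<in> vecs ?Y"
          and c: "convergent (\<lambda>n. Lam (-1/2) (S (\<eta> n)))" "convergent (\<lambda>n. Lam (-1/2) (S' (\<eta> n)))"
          by (auto simp: Cauchy_convergent_iff)
        show "S + S' \<in> Collect ?P"
          using convergent_add[OF c] unfolding plus_fun_def[of S] mem_Collect_eq Cauchy_convergent_iff sobolev_add(2)[OF s(1)[OF \<eta>(1)] s(2)[OF \<eta>(1)]]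
          by (blast intro: sobolev_add(1) s)
      next
        fix c :: complex and S :: "('n, 'e) distr \<Rightarrow> ('n, 'e) distr"
        assume "S \<in> Collect ?P"
        then have s: "\<And>u. u \<in> vecs ?X \<Longrightarrow> S u \<in> vecs ?Y"
          and c: "Cauchy (\<lambda>n. Lam (-1/2) (S (\<eta> n)))" by auto
        show "c *\<^sub>C S \<in> Collect ?P" using bounded_linear.Cauchy[OF bounded_linear_scaleC_right c, of c]
          unfolding scaleC_fun_def[of c S] mem_Collect_eq sobolev_scaleC(2)[OF s[OF \<eta>(1)]] by (blast intro: sobolev_scaleC(1) s)
      qed
    next
      fix S assume "S \<in> ?G"
      then obtain T M where T: "T \<in> bounded_ops ?X ?Y" and M: "M \<in> multiplier_algebra (1/2)" and eq: "S = T \<circ> M" by blast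
      have Mv: "M u \<in> vecs ?X" if "u \<in> vecs ?X" for u
        using M that unfolding multiplier_algebra_def op_closure_def bounded_ops_def by blast
      have Tv: "T u \<in> vecs ?Y" if "u \<in> vecs ?X" for u using T that unfolding bounded_ops_def by blast
      have "Cauchy (\<lambda>n. transport (1/2) (-1/2) T (Lam (1/2) (M (\<eta> n))))"
        by (rule bounded_linear.Cauchy[OF transport_bounded_linear(1)[OF T] mult[OF M]]) simp
      then show "?P S" unfolding eq comp_def transport_Lam[OF Mv[OF \<eta>(1)]] by (blast intro: Mv Tv)
    qed
  qed
qed

context dirac_potential
begin

text \<open>Bijectivity of D + V + \<i> yields this bound by way of the adjoint, through
  \<open>bij_T\<close>.\<close>

lemma dirac_lower_bound:
  "\<exists>C. \<forall>u\<in>vecs (sobolev (1/2)). norm (Lam (1/2) u) \<le> C * norm (Lam (-1/2) (dirac u + \<i> *\<^sub>C u))"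
proof -
  note F = dirac_symmetric_form
  obtain C where C: "\<And>x. norm x \<le> C * norm (symmetric_form.T (transport (1/2) (-1/2) dirac) (wt_op (-1/4)) x)"
    using symmetric_form.bij_T(3)[OF F] by blast
  have "norm (Lam (1/2) u) \<le> C * norm (Lam (-1/2) (dirac u + \<i> *\<^sub>C u))" if u: "u \<in> vecs (sobolev (1/2))" for u
    using C[of "Lam (1/2) u"] unfolding symmetric_form.T_def[OF F] dirac_transport_shift[OF u] .
  then show ?thesis by blast
qed

lemma dirac_schwartz_mult:
  assumes u: "u \<in> vecs (sobolev (1/2))" and \<theta>: "schwartz \<theta>"
  shows "Lam (-1/2) (dirac (schwartz_mult \<theta> u) + \<i> *\<^sub>C schwartz_mult \<theta> u) =
    Lam (-1/2) (schwartz_mult \<theta> (dirac u + \<i> *\<^sub>C u)) +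
    (\<Sum>k\<in>UNIV. transport (-1/2) (-1/2) (\<lambda>w \<phi>. \<alpha> (Some k) (w \<phi>)) (Lam (-1/2) (schwartz_mult (\<lambda>x. - \<i> * partial_deriv k \<theta> x) u)))"
proof -
  have t: "tempered u" using u by (auto simp: vecs_sobolev)
  have \<alpha>l: "clinear_on UNIV (\<alpha> j)" for j using \<alpha> by (simp add: symmetric_operator_def)
  let ?\<theta> = "\<lambda>k x. - \<i> * partial_deriv k \<theta> x"
  have s: "schwartz (?\<theta> k)" for k by (intro schwartz_cmult schwartz_partial_deriv \<theta>)
  note ue = Lam_embed[OF u]
  have Du: "dirac u + \<i> *\<^sub>C u \<in> vecs (sobolev (-1/2))" using bij u unfolding bij_betw_def by blast
  have su: "schwartz_mult (?\<theta> k) u \<in> vecs (sobolev (-1/2))" for k by (rule schwartz_mult_sobolev(1)[OF s _ ue(2)]) simp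
  have \<alpha>u: "(\<lambda>\<phi>. \<alpha> (Some k) (schwartz_mult (?\<theta> k) u \<phi>)) \<in> vecs (sobolev (-1/2))" for k
    using bounded_ops_linear_symbol[OF \<alpha>l[of "Some k"], of "-1/2"] su[of k] unfolding bounded_ops_def by auto
  have "dirac (schwartz_mult \<theta> u) + \<i> *\<^sub>C schwartz_mult \<theta> u =
      schwartz_mult \<theta> (dirac u + \<i> *\<^sub>C u) + (\<lambda>\<phi>. \<Sum>k\<in>UNIV. \<alpha> (Some k) (schwartz_mult (?\<theta> k) u \<phi>))"
  proof (rule ext)
    fix \<phi>
    have "schwartz_mult \<theta> (dirac u + \<i> *\<^sub>C u) \<phi> =
        schwartz_mult \<theta> (free_dirac \<alpha> m u) \<phi> + schwartz_mult \<theta> (mult_op V u) \<phi> + \<i> *\<^sub>C schwartz_mult \<theta> u \<phi>"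
      by (simp add: schwartz_mult_def scaleC_fun_def plus_fun_def scaleC_zero_right)
    then show "(dirac (schwartz_mult \<theta> u) + \<i> *\<^sub>C schwartz_mult \<theta> u) \<phi> = (schwartz_mult \<theta> (dirac u + \<i> *\<^sub>C u) +
        (\<lambda>\<phi>. \<Sum>k\<in>UNIV. \<alpha> (Some k) (schwartz_mult (?\<theta> k) u \<phi>))) \<phi>"
      by (simp add: free_dirac_schwartz_mult[OF \<alpha> t \<theta>] mult_op_schwartz_mult[OF V u \<theta>] scaleC_fun_def plus_fun_def)
  qed
  moreover have tr: "transport (-1/2) (-1/2) (\<lambda>w \<phi>. \<alpha> (Some k) (w \<phi>)) (Lam (-1/2) (schwartz_mult (?\<theta> k) u)) =
      Lam (-1/2) (\<lambda>\<phi>. \<alpha> (Some k) (schwartz_mult (?\<theta> k) u \<phi>))" for k by (rule transport_Lam[OF su])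
  ultimately show ?thesis
    unfolding tr using sobolev_sum[of UNIV "\<lambda>k \<phi>. \<alpha> (Some k) (schwartz_mult (?\<theta> k) u \<phi>)" "-1/2"] \<alpha>u
      schwartz_mult_sobolev(1)[OF \<theta> _ Du] by (simp add: sobolev_add(2))
qed

text \<open>Rellich's theorem makes the source term and the commutator terms of
  \<open>dirac_schwartz_mult\<close> Cauchy in order -1/2; the lower bound lifts this to order
  1/2.\<close>

lemma dirac_schwartz_mult_Cauchy:
  assumes \<eta>: "\<And>n. \<eta> n \<in> vecs (sobolev (1/2))" "\<And>n. dirac (\<eta> n) + \<i> *\<^sub>C \<eta> n \<in> vecs (sobolev 0)"
    and b: "\<And>n. norm (Lam 0 (\<eta> n)) \<le> C" "\<And>n. norm (Lam 0 (dirac (\<eta> n) + \<i> *\<^sub>C \<eta> n)) \<le> C'"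
    and w: "\<And>y. convergent (\<lambda>n. inner (Lam 0 (\<eta> n)) y)" "\<And>y. convergent (\<lambda>n. inner (Lam 0 (dirac (\<eta> n) + \<i> *\<^sub>C \<eta> n)) y)"
    and \<theta>: "schwartz \<theta>"
  shows "Cauchy (\<lambda>n. Lam (1/2) (schwartz_mult \<theta> (\<eta> n)))"
proof -
  have \<alpha>l: "clinear_on UNIV (\<alpha> j)" for j using \<alpha> by (simp add: symmetric_operator_def)
  let ?\<theta> = "\<lambda>k x. - \<i> * partial_deriv k \<theta> x"
  have s: "schwartz (?\<theta> k)" for k by (intro schwartz_cmult schwartz_partial_deriv \<theta>)
  let ?g = "\<lambda>n. Lam (-1/2) (dirac (schwartz_mult \<theta> (\<eta> n)) + \<i> *\<^sub>C schwartz_mult \<theta> (\<eta> n))"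
  have "Cauchy (\<lambda>n. transport (-1/2) (-1/2) (\<lambda>w \<phi>. \<alpha> (Some k) (w \<phi>)) (Lam (-1/2) (schwartz_mult (?\<theta> k) (\<eta> n))))" for k
    by (rule bounded_linear.Cauchy[OF transport_bounded_linear(1)[OF bounded_ops_linear_symbol[OF \<alpha>l]]
          schwartz_mult_compact[OF s Lam_embed(1)[OF \<eta>(1)] b(1) w(1)]]) simp
  then have "Cauchy (\<lambda>n. \<Sum>k\<in>UNIV. transport (-1/2) (-1/2) (\<lambda>w \<phi>. \<alpha> (Some k) (w \<phi>)) (Lam (-1/2) (schwartz_mult (?\<theta> k) (\<eta> n))))"
    by (simp only: Cauchy_convergent_iff) (rule convergent_sum)
  moreover have "Cauchy (\<lambda>n. Lam (-1/2) (schwartz_mult \<theta> (dirac (\<eta> n) + \<i> *\<^sub>C \<eta> n)))"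
    by (rule schwartz_mult_compact[OF \<theta> \<eta>(2) b(2) w(2)])
  ultimately have g: "Cauchy ?g" unfolding dirac_schwartz_mult[OF \<eta>(1) \<theta>] by (simp only: Cauchy_convergent_iff) (rule convergent_add)
  obtain K where K: "\<And>u. u \<in> vecs (sobolev (1/2)) \<Longrightarrow> norm (Lam (1/2) u) \<le> K * norm (Lam (-1/2) (dirac u + \<i> *\<^sub>C u))"
    using dirac_lower_bound by blast
  have su: "schwartz_mult \<theta> (\<eta> n) \<in> vecs (sobolev (1/2))" for n by (rule schwartz_mult_sobolev(1)[OF \<theta> _ \<eta>(1)]) simp
  have v: "dirac u + \<i> *\<^sub>C u \<in> vecs (sobolev (-1/2))" if "u \<in> vecs (sobolev (1/2))" for u
    using bij that unfolding bij_betw_def by blast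
  show ?thesis
  proof (rule Cauchy_dominated[OF g])
    fix i j
    let ?u = "schwartz_mult \<theta> (\<eta> i)" and ?v = "schwartz_mult \<theta> (\<eta> j)"
    have "dirac (?u - ?v) + \<i> *\<^sub>C (?u - ?v) = (dirac ?u + \<i> *\<^sub>C ?u) - (dirac ?v + \<i> *\<^sub>C ?v)"
      unfolding dirac_linear(3)[OF su su] by (simp add: complex_vector.scale_right_diff_distrib)
    then have "Lam (-1/2) (dirac (?u - ?v) + \<i> *\<^sub>C (?u - ?v)) = ?g i - ?g j" by (simp only: sobolev_diff(2)[OF v[OF su] v[OF su]])
    then show "norm (Lam (1/2) ?u - Lam (1/2) ?v) \<le> K * norm (?g i - ?g j)"
      using K[OF sobolev_diff(1)[OF su[of i] su[of j]]] by (simp only: sobolev_diff(2)[OF su su])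
  qed
qed

end

lemma dirac_compact_resolvent_difference:
  fixes \<alpha> :: "'n::finite option \<Rightarrow> 'e::complex_euclidean_space \<Rightarrow> 'e" and V W :: "real^'n \<Rightarrow> 'e \<Rightarrow> 'e"
  assumes V: "dirac_potential \<alpha> m V" and W: "dirac_potential \<alpha> m W" and VW: "mult_op V - mult_op W \<in> B0"
  shows "compact_resolvent_difference
    (op_graph (induced_op (\<lambda>u. free_dirac \<alpha> m u + mult_op V u)))
    (op_graph (induced_op (\<lambda>u. free_dirac \<alpha> m u + mult_op W u)))" unfolding compact_resolvent_difference_def
proof (intro allI impI)
  interpret V: dirac_potential \<alpha> m V by (rule V)
  interpret W: dirac_potential \<alpha> m W by (rule W)
  let ?D = "free_dirac \<alpha> m"
  let ?TV = "\<lambda>u. ?D u + mult_op V u" and ?TW = "\<lambda>u. ?D u + mult_op W u"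
  fix h u v :: "nat \<Rightarrow> ('n, 'e) l2"
  assume h: "bounded (range h)"
    and uv: "\<forall>n. (u n, h n - \<i> *\<^sub>C u n) \<in> op_graph (induced_op ?TV) \<and> (v n, h n - \<i> *\<^sub>C v n) \<in> op_graph (induced_op ?TW)"
  \<comment> \<open>Unfolds membership in the graph: some distribution of the form domain solves (T
    + \<i>) \<xi> = h.\<close>
  have ex: "\<exists>\<xi>. \<xi> \<in> vecs (sobolev (1/2)) \<and> u = Lam 0 \<xi> \<and> T \<xi> + \<i> *\<^sub>C \<xi> \<in> vecs (sobolev 0) \<and> h = Lam 0 (T \<xi> + \<i> *\<^sub>C \<xi>)"
    if gr: "(u, h - \<i> *\<^sub>C u) \<in> op_graph (induced_op T)" for T u and h :: "('n, 'e) l2"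
  proof -
    obtain \<xi> where \<xi>: "\<xi> \<in> vecs (sobolev (1/2))" "T \<xi> \<in> vecs (sobolev 0)" "u = Lam 0 \<xi>" "h - \<i> *\<^sub>C u = Lam 0 (T \<xi>)"
      using gr by (auto simp: op_graph_def induced_op_def vecs_L2)
    note i\<xi> = sobolev_scaleC[OF Lam_embed(1)[OF \<xi>(1)], of \<i>]
    have "h = Lam 0 (T \<xi>) + \<i> *\<^sub>C u" using \<xi>(4) by (simp add: algebra_simps)
    then show ?thesis using \<xi> i\<xi> sobolev_add[OF \<xi>(2) i\<xi>(1)] by auto
  qed
  obtain \<xi> where \<xi>: "\<And>n. \<xi> n \<in> vecs (sobolev (1/2))" "\<And>n. u n = Lam 0 (\<xi> n)"
    "\<And>n. ?TV (\<xi> n) + \<i> *\<^sub>C \<xi> n \<in> vecs (sobolev 0)" "\<And>n. h n = Lam 0 (?TV (\<xi> n) + \<i> *\<^sub>C \<xi> n)"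
    using ex[OF conjunct1[OF spec[OF uv]]] by metis
  obtain \<eta> where \<eta>: "\<And>n. \<eta> n \<in> vecs (sobolev (1/2))" "\<And>n. v n = Lam 0 (\<eta> n)"
    "\<And>n. ?TW (\<eta> n) + \<i> *\<^sub>C \<eta> n \<in> vecs (sobolev 0)" "\<And>n. h n = Lam 0 (?TW (\<eta> n) + \<i> *\<^sub>C \<eta> n)"
    using ex[OF conjunct2[OF spec[OF uv]]] by metis
  have eq: "?TV (\<xi> n) + \<i> *\<^sub>C \<xi> n = ?TW (\<eta> n) + \<i> *\<^sub>C \<eta> n" for n
    using \<xi>(4)[of n] \<eta>(4)[of n] \<xi>(3)[of n] \<eta>(3)[of n] Lam_inj unfolding inj_on_def by metis
  obtain H where H: "H \<ge> 0" "\<And>n. norm (h n) \<le> H" using h unfolding bounded_iff by (metis norm_ge_zero order_trans rangeI)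
  obtain C where C: "\<And>u. u \<in> vecs (sobolev (1/2)) \<Longrightarrow> norm (Lam (1/2) u) \<le> C * norm (Lam (-1/2) (?TW u + \<i> *\<^sub>C u))"
    using W.dirac_lower_bound by blast
  have b12: "norm (Lam (1/2) (\<eta> n)) \<le> \<bar>C\<bar> * H" for n
  proof -
    have "norm (Lam (-1/2) (?TW (\<eta> n) + \<i> *\<^sub>C \<eta> n)) \<le> H"
      unfolding Lam_embed'(2)[OF \<eta>(3)] \<eta>(4)[symmetric] by (rule order_trans[OF norm_wt_op_le H(2)]) simp
    then have "\<bar>C\<bar> * norm (Lam (-1/2) (?TW (\<eta> n) + \<i> *\<^sub>C \<eta> n)) \<le> \<bar>C\<bar> * H" by (rule mult_left_mono) simp
    moreover have "C * norm (Lam (-1/2) (?TW (\<eta> n) + \<i> *\<^sub>C \<eta> n)) \<le> \<bar>C\<bar> * norm (Lam (-1/2) (?TW (\<eta> n) + \<i> *\<^sub>C \<eta> n))"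
      by (intro mult_right_mono) auto
    ultimately show ?thesis using C[OF \<eta>(1), of n] by linarith
  qed
  have b0: "norm (v n) \<le> \<bar>C\<bar> * H" for n
    unfolding \<eta>(2) Lam_embed(3)[OF \<eta>(1)] by (rule order_trans[OF norm_wt_op_le b12]) simp
  \<comment> \<open>First \<open>h\<close> and then \<open>v\<close> become weakly convergent; all
    later sequences are Cauchy along the composed subsequence \<open>r\<close>.\<close>
  obtain r1 where r1: "strict_mono r1" "\<And>y. convergent (\<lambda>n. inner (h (r1 n)) y)"
    using bounded_weakly_convergent_subseq[OF h] by blast
  have "bounded (range (v \<circ> r1))" using b0 unfolding bounded_iff by auto
  then obtain r2 where r2: "strict_mono r2" "\<And>y. convergent (\<lambda>n. inner ((v \<circ> r1) (r2 n)) y)"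
    using bounded_weakly_convergent_subseq by blast
  define r where "r = r1 \<circ> r2"
  have r: "strict_mono r" unfolding r_def by (rule strict_mono_o[OF r1(1) r2(1)])
  have wh: "convergent (\<lambda>n. inner (h (r n)) y)" for y using convergent_subseq_convergent[OF r1(2)[of y] r2(1)] by (simp add: r_def o_def)
  have wv: "convergent (\<lambda>n. inner (v (r n)) y)" for y using r2(2)[of y] by (simp add: r_def)
  have "Cauchy (\<lambda>n. Lam (1/2) (schwartz_mult \<theta> (\<eta> (r n))))" if "schwartz \<theta>" for \<theta>
    by (rule W.dirac_schwartz_mult_Cauchy[OF \<eta>(1,3) _ _ _ _ that, where C = "\<bar>C\<bar> * H" and C' = H])
      (simp_all add: \<eta>(2)[symmetric] \<eta>(4)[symmetric] b0 H wh wv)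
  then have g: "Cauchy (\<lambda>n. Lam (-1/2) ((mult_op V - mult_op W) (\<eta> (r n))))" by (rule B0_Cauchy[OF \<eta>(1) b12 _ VW])
  obtain K where K: "\<And>u. u \<in> vecs (sobolev (1/2)) \<Longrightarrow> norm (Lam (1/2) u) \<le> K * norm (Lam (-1/2) (?TV u + \<i> *\<^sub>C u))"
    using V.dirac_lower_bound by blast
  have d: "\<xi> n - \<eta> n \<in> vecs (sobolev (1/2))" for n by (rule sobolev_diff(1)[OF \<xi>(1) \<eta>(1)])
  have img: "?TV (\<xi> n - \<eta> n) + \<i> *\<^sub>C (\<xi> n - \<eta> n) = - (mult_op V - mult_op W) (\<eta> n)" for n
    using eq[of n] unfolding V.dirac_linear(3)[OF \<xi>(1) \<eta>(1)]
    by (simp add: complex_vector.scale_right_diff_distrib fun_diff_def[of "mult_op V"] algebra_simps)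
  have Kv: "(mult_op V - mult_op W) (\<eta> n) \<in> vecs (sobolev (-1/2))" for n
    using mult_op_product(1)[OF V.V \<eta>(1)] mult_op_product(1)[OF W.V \<eta>(1)] by (simp add: fun_diff_def[of "mult_op V"] sobolev_diff(1))
  have "Cauchy (\<lambda>n. Lam (1/2) (\<xi> (r n) - \<eta> (r n)))"
  proof (rule Cauchy_dominated[OF g, of _ K])
    fix i j
    let ?a = "\<xi> (r i) - \<eta> (r i)" and ?b = "\<xi> (r j) - \<eta> (r j)"
    let ?f = "\<lambda>i. (mult_op V - mult_op W) (\<eta> (r i))"
    have "?TV (?a - ?b) + \<i> *\<^sub>C (?a - ?b) = (?TV ?a + \<i> *\<^sub>C ?a) - (?TV ?b + \<i> *\<^sub>C ?b)"
      unfolding V.dirac_linear(3)[OF d d] by (simp add: complex_vector.scale_right_diff_distrib)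
    then have "?TV (?a - ?b) + \<i> *\<^sub>C (?a - ?b) = ?f j - ?f i" unfolding img by simp
    then have "norm (Lam (1/2) (?a - ?b)) \<le> K * norm (Lam (-1/2) (?f j - ?f i))" using K[OF sobolev_diff(1)[OF d d], of "r i" "r j"] by simp
    then show "norm (Lam (1/2) ?a - Lam (1/2) ?b) \<le> K * norm (Lam (-1/2) (?f i) - Lam (-1/2) (?f j))"
      by (simp only: sobolev_diff(2)[OF d d] sobolev_diff(2)[OF Kv Kv] norm_minus_commute)
  qed
  then have "Cauchy (\<lambda>n. wt_op (-1/4) (Lam (1/2) (\<xi> (r n) - \<eta> (r n))))"
    by (rule bounded_linear.Cauchy[OF bounded_linear_wt_op, rotated]) simp
  then have "Cauchy (\<lambda>n. u (r n) - v (r n))"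
    using Lam_embed(3)[OF d] sobolev_diff(2)[OF Lam_embed(1)[OF \<xi>(1)] Lam_embed(1)[OF \<eta>(1)]] by (simp add: \<xi>(2) \<eta>(2))
  then show "\<exists>r. strict_mono r \<and> convergent (\<lambda>n. u (r n) - v (r n))" using r by (auto simp: Cauchy_convergent_iff)
qed

section \<open>Operators in \<open>L2\<close> and their graphs\<close>

lemma complex_span_image:
  fixes f :: "'a::complex_vector \<Rightarrow> 'b::complex_vector"
  assumes W: "complex_vector.subspace W" and f: "clinear_on W f" and B: "B \<subseteq> W" and x: "x \<in> complex_vector.span B"
  shows "x \<in> W \<and> f x \<in> complex_vector.span (f ` B)"
proof (rule complex_vector.span_induct[OF x, of "\<lambda>x. x \<in> W \<and> f x \<in> complex_vector.span (f ` B)"])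
  have "f (0 *\<^sub>C 0) = 0 *\<^sub>C f 0" using f complex_vector.subspace_0[OF W] unfolding clinear_on_def by blast
  then have f0: "f 0 = 0" by simp
  show "complex_vector.subspace {x. x \<in> W \<and> f x \<in> complex_vector.span (f ` B)}" using f W unfolding clinear_on_def
    by (intro complex_vector.subspaceI)
      (auto simp: f0 complex_vector.span_zero complex_vector.subspace_def intro: complex_vector.span_add complex_vector.span_scale)
qed (use B in \<open>auto intro: complex_vector.span_base\<close>)

lemma Lam0_simps:
  shows "u \<in> vecs L2 \<Longrightarrow> v \<in> vecs L2 \<Longrightarrow> Lam 0 (u + v) = Lam 0 u + Lam 0 v"
    and "u \<in> vecs L2 \<Longrightarrow> v \<in> vecs L2 \<Longrightarrow> Lam 0 (u - v) = Lam 0 u - Lam 0 v"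
    and "u \<in> vecs L2 \<Longrightarrow> Lam 0 (c *\<^sub>C u) = c *\<^sub>C Lam 0 u"
  by (simp_all add: vecs_L2 sobolev_add sobolev_diff sobolev_scaleC)

lemma L2_closed:
  shows "u \<in> vecs L2 \<Longrightarrow> v \<in> vecs L2 \<Longrightarrow> u + v \<in> vecs L2"
    and "u \<in> vecs L2 \<Longrightarrow> v \<in> vecs L2 \<Longrightarrow> u - v \<in> vecs L2"
    and "u \<in> vecs L2 \<Longrightarrow> c *\<^sub>C u \<in> vecs L2" by (simp_all add: vecs_L2 sobolev_add sobolev_diff sobolev_scaleC)

lemma L2_subspace: "complex_vector.subspace (vecs L2)" by (simp add: vecs_L2 sobolev_subspace)

lemma Lam0_eq_iff: "u \<in> vecs L2 \<Longrightarrow> v \<in> vecs L2 \<Longrightarrow> Lam 0 u = Lam 0 v \<longleftrightarrow> u = v"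
  using Lam_inj by (auto simp: vecs_L2 inj_on_def)

lemma unLam0: "unLam 0 a \<in> vecs L2" "Lam 0 (unLam 0 a) = a" by (simp_all add: vecs_L2 unLam)

lemma unLam0_Lam: "u \<in> vecs L2 \<Longrightarrow> unLam 0 (Lam 0 u) = u" by (simp add: vecs_L2 unLam_Lam)

lemma L2_bounded_ops:
  "bounded_ops L2 L2 = bounded_ops (sobolev 0 :: ('n, 'e) distr nspace) (sobolev 0 :: ('n::finite, 'e::complex_euclidean_space) distr nspace)"
proof -
  have "nrm L2 u = nrm (sobolev 0) u" if "u \<in> vecs (sobolev 0)" for u :: "('n, 'e) distr"
    using that by (simp add: nrm_sobolev nrm_L2 vecs_L2)
  then show ?thesis by (intro set_eqI) (simp add: bounded_ops_def vecs_L2 image_subset_iff cong: conj_cong)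
qed

lemma Lam0_clinear: "clinear_on (vecs L2) (Lam 0)" by (simp add: clinear_on_def Lam0_simps)

lemma unLam0_clinear: "clinear_on UNIV (unLam 0)" by (simp add: clinear_on_def unLam_add unLam_scaleC)

text \<open>\<open>F\<close> may contain distributions outside \<open>L2\<close>, where
  \<open>Lam 0\<close> has no meaning. A maximal independent subset of \<open>N\<close> takes its
  place; it is finite because \<open>N\<close> lies in the span of \<open>F\<close>.\<close>

lemma finite_span_Lam0:
  fixes N :: "('n::finite, 'e::complex_euclidean_space) distr set"
  assumes N: "complex_vector.subspace N" "N \<subseteq> vecs L2"
  shows "(\<exists>F. finite F \<and> N \<subseteq> complex_vector.span F) \<longleftrightarrow> (\<exists>F. finite F \<and> Lam 0 ` N \<subseteq> complex_vector.span F)"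
proof
  assume "\<exists>F. finite F \<and> N \<subseteq> complex_vector.span F"
  then obtain F where F: "finite F" "N \<subseteq> complex_vector.span F" by blast
  obtain B where B: "B \<subseteq> N" "complex_vector.independent B" "N \<subseteq> complex_vector.span B"
    by (rule complex_vector.maximal_independent_subset)
  have "finite B" using complex_vector.independent_span_bound[OF F(1) B(2)] B(1) F(2) by blast
  moreover have "Lam 0 ` N \<subseteq> complex_vector.span (Lam 0 ` B)"
    using complex_span_image[OF L2_subspace Lam0_clinear, of B] B N(2) by blast
  ultimately show "\<exists>F. finite F \<and> Lam 0 ` N \<subseteq> complex_vector.span F" by blast
next
  assume "\<exists>F. finite F \<and> Lam 0 ` N \<subseteq> complex_vector.span F"
  then obtain F where F: "finite F" "Lam 0 ` N \<subseteq> complex_vector.span F" by blast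
  have "u \<in> complex_vector.span (unLam 0 ` F)" if u: "u \<in> N" for u
  proof -
    have "Lam 0 u \<in> complex_vector.span F" using F(2) u by blast
    from complex_span_image[OF complex_vector.subspace_UNIV unLam0_clinear subset_UNIV this]
    show ?thesis using u N(2) by (auto simp: unLam0_Lam)
  qed
  then show "\<exists>F. finite F \<and> N \<subseteq> complex_vector.span F" using F(1) by blast
qed

lemma sequentially_closed_Lam0:
  fixes R :: "('n::finite, 'e::complex_euclidean_space) distr set"
  assumes R: "R \<subseteq> vecs L2"
  shows "(\<forall>y l. (\<forall>n. y n \<in> R) \<and> converges_in L2 y l \<longrightarrow> l \<in> R) \<longleftrightarrow> closed (Lam 0 ` R)"
proof -
  have conv: "converges_in L2 y l \<longleftrightarrow> (\<lambda>n. Lam 0 (y n)) \<longlonglongrightarrow> Lam 0 l"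
    if y: "\<And>n. y n \<in> R" and l: "l \<in> vecs L2" for y :: "nat \<Rightarrow> ('n, 'e) distr" and l
  proof -
    have "y n \<in> vecs L2" for n using y R by blast
    then have "nrm L2 (y n - l) = norm (Lam 0 (y n) - Lam 0 l)" for n using l by (simp add: nrm_L2 L2_closed Lam0_simps)
    then show ?thesis using l by (simp add: converges_in_def tendsto_norm_zero_iff flip: LIM_zero_iff[of "\<lambda>n. Lam 0 (y n)"])
  qed
  show ?thesis unfolding closed_sequential_limits
  proof (intro iffI allI impI; elim conjE)
    fix a l assume c: "\<forall>y l. (\<forall>n. y n \<in> R) \<and> converges_in L2 y l \<longrightarrow> l \<in> R"
      and a: "\<forall>n. a n \<in> Lam 0 ` R" "a \<longlonglongrightarrow> l"
    have "\<forall>n. \<exists>y. y \<in> R \<and> a n = Lam 0 y" using a(1) by blast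
    then obtain y where y: "\<And>n. y n \<in> R" "\<And>n. a n = Lam 0 (y n)" by metis
    have "converges_in L2 y (unLam 0 l)" unfolding conv[OF y(1) unLam0(1)] using a(2) by (simp add: y(2)[symmetric] unLam0)
    then have "unLam 0 l \<in> R" using c y(1) by blast
    then show "l \<in> Lam 0 ` R" by (metis image_eqI unLam0(2))
  next
    fix y l assume c: "\<forall>x l. (\<forall>n. x n \<in> Lam 0 ` R) \<and> x \<longlonglongrightarrow> l \<longrightarrow> l \<in> Lam 0 ` R"
      and y: "\<forall>n. y n \<in> R" "converges_in L2 y l"
    have l: "l \<in> vecs L2" using y(2) by (simp add: converges_in_def)
    have "(\<lambda>n. Lam 0 (y n)) \<longlonglongrightarrow> Lam 0 l" using y conv[of y l] l by blast
    then have "Lam 0 l \<in> Lam 0 ` R" using c[rule_format, of "\<lambda>n. Lam 0 (y n)" "Lam 0 l"] y(1) by blast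
    then obtain l' where "l' \<in> R" "Lam 0 l = Lam 0 l'" by blast
    then show "l \<in> R" using R l Lam0_eq_iff by blast
  qed
qed

locale L2_operator =
  fixes A :: "('n::finite, 'e::complex_euclidean_space) distr unbounded_op"
  assumes dom: "dom_op A \<subseteq> vecs L2" "complex_vector.subspace (dom_op A)"
    and app: "\<And>u. u \<in> dom_op A \<Longrightarrow> app_op A u \<in> vecs L2" "clinear_on (dom_op A) (app_op A)"
    and graph: "self_adjoint_rel (op_graph A)"
begin

lemma domD: "u \<in> dom_op A \<Longrightarrow> u \<in> vecs L2" using dom(1) by blast

lemma in_op_graph_iff:
  "(p, h) \<in> op_graph A \<longleftrightarrow> (\<exists>u\<in>dom_op A. p = Lam 0 u \<and> h = Lam 0 (app_op A u))"
  unfolding op_graph_def by auto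

lemma shift_in_op_graph_iff:
  "(p, f + z *\<^sub>C p) \<in> op_graph A \<longleftrightarrow> (\<exists>u\<in>dom_op A. p = Lam 0 u \<and> f = Lam 0 (app_op (shift_op A z) u))"
proof -
  have "(f + z *\<^sub>C Lam 0 u = Lam 0 (app_op A u)) \<longleftrightarrow> f = Lam 0 (app_op (shift_op A z) u)" if u: "u \<in> dom_op A" for u
    using app(1)[OF u] domD[OF u] by (auto simp: shift_op_def Lam0_simps L2_closed eq_diff_eq)
  then show ?thesis unfolding in_op_graph_iff by blast
qed

lemma shift_dom: "dom_op (shift_op A z) = dom_op A" by (simp add: shift_op_def)

lemma shift_L2: "u \<in> dom_op A \<Longrightarrow> app_op (shift_op A z) u \<in> vecs L2" by (simp add: shift_op_def L2_closed app(1) domD)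

lemma shift_linear:
  assumes "u \<in> dom_op A" "v \<in> dom_op A"
  shows "app_op (shift_op A z) (u + v) = app_op (shift_op A z) u + app_op (shift_op A z) v"
    "app_op (shift_op A z) (c *\<^sub>C u) = c *\<^sub>C app_op (shift_op A z) u"
  using app(2) assms by (simp_all add: shift_op_def clinear_on_def complex_vector.scale_right_distrib
      complex_vector.scale_right_diff_distrib mult.commute)

text \<open>\<open>self_adjoint\<close> refers to the complex inner product, the relation to the
  real one. Real parts show that an adjoint pair belongs to the graph; conversely, the real identity
  for complex multiples of \<open>u\<close> supplies the imaginary parts.\<close>

lemma self_adjoint:
  assumes dense: "closure (fst ` op_graph A) = UNIV"
  shows "self_adjoint A" unfolding self_adjoint_def
proof (intro conjI ballI allI impI)
  show "app_op A ` dom_op A \<subseteq> vecs L2" using app(1) by blast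
  fix v :: "('n, 'e) distr" and \<epsilon> :: real assume v: "v \<in> vecs L2" and \<epsilon>: "\<epsilon> > 0"
  have "Lam 0 v \<in> closure (fst ` op_graph A)" unfolding dense by simp
  then obtain p where p: "p \<in> fst ` op_graph A" "dist p (Lam 0 v) < \<epsilon>" using \<epsilon> unfolding closure_approachable by blast
  then obtain u where u: "u \<in> dom_op A" "p = Lam 0 u" by (auto simp: op_graph_def)
  have "nrm L2 (v - u) = dist p (Lam 0 v)" using v domD[OF u(1)] by (simp add: u(2) nrm_L2 L2_closed Lam0_simps dist_norm norm_minus_commute)
  then show "\<exists>u\<in>dom_op A. nrm L2 (v - u) < \<epsilon>" using p(2) by (intro bexI[OF _ u(1)]) simp
next
  fix v w :: "('n, 'e) distr" assume v: "v \<in> vecs L2" and w: "w \<in> vecs L2"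
  show "(\<forall>u\<in>dom_op A. L2_inner v (app_op A u) = L2_inner w u) \<longleftrightarrow> v \<in> dom_op A \<and> app_op A v = w"
  proof
    assume eq: "\<forall>u\<in>dom_op A. L2_inner v (app_op A u) = L2_inner w u"
    have "(Lam 0 v, Lam 0 w) \<in> op_graph A"
    proof (rule self_adjoint_relI[OF graph])
      fix p h assume "(p, h) \<in> op_graph A"
      then obtain u where u: "u \<in> dom_op A" "p = Lam 0 u" "h = Lam 0 (app_op A u)" by (auto simp: in_op_graph_iff)
      have "Re (L2_inner v (app_op A u)) = Re (L2_inner w u)" using eq u(1) by simp
      then show "inner (Lam 0 v) h = inner (Lam 0 w) p" by (simp add: L2_inner_eq[OF v app(1)[OF u(1)]] L2_inner_eq[OF w domD[OF u(1)]] u(2,3))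
    qed
    then obtain u where u: "u \<in> dom_op A" "Lam 0 v = Lam 0 u" "Lam 0 w = Lam 0 (app_op A u)" by (auto simp: in_op_graph_iff)
    then have "v = u" "w = app_op A u" using v w domD app(1) by (simp_all add: Lam0_eq_iff)
    then show "v \<in> dom_op A \<and> app_op A v = w" using u(1) by simp
  next
    assume vw: "v \<in> dom_op A \<and> app_op A v = w"
    then have G: "(Lam 0 v, Lam 0 w) \<in> op_graph A" by (auto simp: in_op_graph_iff)
    show "\<forall>u\<in>dom_op A. L2_inner v (app_op A u) = L2_inner w u"
    proof
      fix u assume u: "u \<in> dom_op A"
      have g: "(Lam 0 u, Lam 0 (app_op A u)) \<in> op_graph A" using u by (auto simp: in_op_graph_iff)
      show "L2_inner v (app_op A u) = L2_inner w u" unfolding L2_inner_eq[OF v app(1)[OF u]] L2_inner_eq[OF w domD[OF u]]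
        using self_adjoint_relD[OF graph G g] self_adjoint_relD[OF graph G self_adjoint_rel_scaleC[OF graph g]] by simp
    qed
  qed
qed (use dom app in auto)

text \<open>Kernel and cokernel are transported by complex linear maps, and closedness of the range
  by the isometry \<open>Lam 0\<close>.\<close>

lemma fredholm_iff: "fredholm L2 (shift_op A z) \<longleftrightarrow> fredholm_rel (op_graph A) z"
proof -
  let ?T = "app_op (shift_op A z)" and ?D = "dom_op A"
  let ?N = "{u \<in> ?D. ?T u = 0}"
  let ?C = "\<exists>F. finite F \<and> F \<subseteq> vecs L2 \<and> (\<forall>v\<in>vecs L2. \<exists>u\<in>?D. v - ?T u \<in> complex_vector.span F)"
  let ?C' = "\<exists>F. finite F \<and> (\<forall>a. \<exists>p f. (p, f + z *\<^sub>C p) \<in> op_graph A \<and> a - f \<in> complex_vector.span F)"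
  note D = shift_dom[of z] and T = shift_L2[of _ z] and cl = shift_linear[of _ _ z]
  have z: "0 \<in> vecs L2" by (rule complex_vector.subspace_0[OF L2_subspace])
  have L0: "Lam 0 (0 :: ('n, 'e) distr) = 0" using Lam0_simps(2)[OF z z] by simp
  have T0: "?T 0 = 0" using cl(2)[of 0 0 0] complex_vector.subspace_0[OF dom(2)] by simp
  have "(\<exists>F. finite F \<and> ?N \<subseteq> complex_vector.span F) \<longleftrightarrow>
      (\<exists>F. finite F \<and> Lam 0 ` ?N \<subseteq> complex_vector.span F)"
  proof (rule finite_span_Lam0)
    show "complex_vector.subspace ?N" using dom(2) by (intro complex_vector.subspaceI) (auto simp: cl T0 complex_vector.subspace_def)
  qed (use domD in blast)
  also have "Lam 0 ` ?N = {p. (p, z *\<^sub>C p) \<in> op_graph A}"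
    using shift_in_op_graph_iff[of _ 0 z] Lam0_eq_iff[OF z T] by (auto simp: L0 image_iff)
  finally have 1: "(\<exists>F. finite F \<and> ?N \<subseteq> complex_vector.span F) \<longleftrightarrow>
      (\<exists>F. finite F \<and> {p. (p, z *\<^sub>C p) \<in> op_graph A} \<subseteq> complex_vector.span F)" .
  have "(\<forall>y l. (\<forall>n. y n \<in> ?T ` ?D) \<and> converges_in L2 y l \<longrightarrow> l \<in> ?T ` ?D) \<longleftrightarrow> closed (Lam 0 ` ?T ` ?D)"
    by (rule sequentially_closed_Lam0) (use T in blast)
  also have "Lam 0 ` ?T ` ?D = {f. \<exists>p. (p, f + z *\<^sub>C p) \<in> op_graph A}" unfolding shift_in_op_graph_iff by blast
  finally have 2: "(\<forall>y l. (\<forall>n. y n \<in> ?T ` ?D) \<and> converges_in L2 y l \<longrightarrow> l \<in> ?T ` ?D) \<longleftrightarrow>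
      closed {f. \<exists>p. (p, f + z *\<^sub>C p) \<in> op_graph A}" .
  have 3: "?C \<longleftrightarrow>
      ?C'"
  proof
    assume ?C
    then obtain F where F: "finite F" "F \<subseteq> vecs L2" "\<And>v. v \<in> vecs L2 \<Longrightarrow> \<exists>u\<in>?D. v - ?T u \<in> complex_vector.span F" by blast
    have "\<exists>p f. (p, f + z *\<^sub>C p) \<in> op_graph A \<and> a - f \<in> complex_vector.span (Lam 0 ` F)" for a
    proof -
      obtain u where u: "u \<in> ?D" "unLam 0 a - ?T u \<in> complex_vector.span F" using F(3)[OF unLam0(1)] by blast
      have "Lam 0 (unLam 0 a - ?T u) \<in> complex_vector.span (Lam 0 ` F)"
        using complex_span_image[OF L2_subspace Lam0_clinear F(2) u(2)] by blast
      then have "a - Lam 0 (?T u) \<in> complex_vector.span (Lam 0 ` F)" by (simp add: Lam0_simps unLam0 T[OF u(1)])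
      then show ?thesis using u(1) unfolding shift_in_op_graph_iff by blast
    qed
    then show ?C' using F(1) by blast
  next
    assume ?C'
    then obtain F where F: "finite F" "\<And>a. \<exists>p f. (p, f + z *\<^sub>C p) \<in> op_graph A \<and> a - f \<in> complex_vector.span F" by blast
    have "\<exists>u\<in>?D. v - ?T u \<in> complex_vector.span (unLam 0 ` F)" if v: "v \<in> vecs L2" for v
    proof -
      obtain u where u: "u \<in> ?D" "Lam 0 v - Lam 0 (?T u) \<in> complex_vector.span F"
        using F(2)[of "Lam 0 v"] unfolding shift_in_op_graph_iff by blast
      have "unLam 0 (Lam 0 v - Lam 0 (?T u)) \<in> complex_vector.span (unLam 0 ` F)"
        using complex_span_image[OF complex_vector.subspace_UNIV unLam0_clinear subset_UNIV u(2)] by blast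
      moreover have "unLam 0 (Lam 0 v - Lam 0 (?T u)) = v - ?T u"
        unfolding Lam0_simps(2)[OF v T[OF u(1)], symmetric] by (rule unLam0_Lam[OF L2_closed(2)[OF v T[OF u(1)]]])
      ultimately show ?thesis using u(1) by auto
    qed
    then show ?C using F(1) unLam0(1) by (intro exI[of _ "unLam 0 ` F"]) auto
  qed
  show ?thesis unfolding fredholm_def fredholm_rel_def D 1 2 3 ..
qed

lemma nonreal_resolvent:
  assumes z: "Im z \<noteq> 0"
  shows "z \<in> resolvent_set L2 A"
    and "f \<in> vecs L2 \<Longrightarrow> (Lam 0 (inv_op (shift_op A z) f), Lam 0 f + z *\<^sub>C Lam 0 (inv_op (shift_op A z) f)) \<in> op_graph A"
proof -
  let ?T = "app_op (shift_op A z)" and ?D = "dom_op A"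
  note D = shift_dom[of z] and T = shift_L2[of _ z] and cl = shift_linear[of _ _ z]
  have lower: "\<bar>Im z\<bar> * nrm L2 u \<le> nrm L2 (?T u)" if u: "u \<in> ?D" for u
  proof -
    have "(Lam 0 u, Lam 0 (?T u) + z *\<^sub>C Lam 0 u) \<in> op_graph A" unfolding shift_in_op_graph_iff using u by blast
    from self_adjoint_rel_lower_bound[OF graph this] show ?thesis by (simp add: nrm_L2 T u domD)
  qed
  have inj: "inj_on ?T ?D"
  proof (rule inj_onI)
    fix u v assume uv: "u \<in> ?D" "v \<in> ?D" "?T u = ?T v"
    have "(Lam 0 u, Lam 0 (?T u) + z *\<^sub>C Lam 0 u) \<in> op_graph A" "(Lam 0 v, Lam 0 (?T u) + z *\<^sub>C Lam 0 v) \<in> op_graph A"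
      unfolding shift_in_op_graph_iff using uv by auto
    from self_adjoint_rel_diff[OF graph this] have "(Lam 0 u - Lam 0 v, 0 + z *\<^sub>C (Lam 0 u - Lam 0 v)) \<in> op_graph A"
      by (simp add: scaleC_diff_right)
    from self_adjoint_rel_lower_bound[OF graph this] have "Lam 0 u = Lam 0 v" using z by (simp add: mult_le_0_iff)
    then show "u = v" using uv domD by (simp add: Lam0_eq_iff)
  qed
  have surj: "f \<in> ?T ` ?D" if f: "f \<in> vecs L2" for f
  proof -
    obtain p where "(p, Lam 0 f + z *\<^sub>C p) \<in> op_graph A" using self_adjoint_rel_nonreal_surj[OF graph z] by blast
    then obtain u where "u \<in> ?D" "Lam 0 f = Lam 0 (?T u)" unfolding shift_in_op_graph_iff by blast
    then show ?thesis using f T Lam0_eq_iff by blast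
  qed
  have bij: "bij_betw ?T ?D (vecs L2)" unfolding bij_betw_def using inj surj T by blast
  let ?R = "inv_op (shift_op A z)"
  have R: "?R f \<in> ?D" "?T (?R f) = f" if "f \<in> vecs L2" for f
    unfolding inv_op_def D using surj[OF that] by (rule inv_into_into, rule f_inv_into_f)
  have RT: "?R (?T u) = u" if "u \<in> ?D" for u unfolding inv_op_def D by (rule inv_into_f_f[OF inj that])
  have "?R \<in> bounded_ops L2 L2" unfolding bounded_ops_def
  proof (intro CollectI conjI exI[of _ "1 / \<bar>Im z\<bar>"] ballI image_subsetI)
    show "?R f \<in> vecs L2" if "f \<in> vecs L2" for f by (rule domD[OF R(1)[OF that]])
    show "nrm L2 (?R f) \<le> 1 / \<bar>Im z\<bar> * nrm L2 f" if "f \<in> vecs L2" for f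
      using lower[OF R(1)[OF that]] z by (simp add: R(2)[OF that] field_simps)
    show "clinear_on (vecs L2) ?R" unfolding clinear_on_def
    proof (intro conjI ballI allI)
      fix f g :: "('n, 'e) distr" and c assume f: "f \<in> vecs L2" and g: "g \<in> vecs L2"
      show "?R (f + g) = ?R f + ?R g" using RT[OF complex_vector.subspace_add[OF dom(2) R(1)[OF f] R(1)[OF g]]]
        by (simp add: cl(1)[OF R(1)[OF f] R(1)[OF g]] R(2) f g)
    next
      fix f :: "('n, 'e) distr" and c assume f: "f \<in> vecs L2"
      show "?R (c *\<^sub>C f) = c *\<^sub>C ?R f" using RT[OF complex_vector.subspace_scale[OF dom(2) R(1)[OF f]], of c]
        by (simp add: cl(2)[OF R(1)[OF f] R(1)[OF f]] R(2) f)
    qed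
  qed
  then show "z \<in> resolvent_set L2 A" unfolding resolvent_set_def using bij by simp
  show "(Lam 0 (?R f), Lam 0 f + z *\<^sub>C Lam 0 (?R f)) \<in> op_graph A" if f: "f \<in> vecs L2"
    unfolding shift_in_op_graph_iff using R[OF f] by (intro bexI[of _ "?R f"]) auto
qed

end

text \<open>The witness for \<open>compact_perturbation\<close> is -\<i>, the point at which
  \<open>compact_resolvent_difference\<close> is formulated.\<close>

lemma compact_resolvent_difference_perturbation:
  fixes A B :: "('n::finite, 'e::complex_euclidean_space) distr unbounded_op"
  assumes A: "L2_operator A" and B: "L2_operator B"
    and comp: "compact_resolvent_difference (op_graph A) (op_graph B)"
  shows "compact_perturbation L2 B A" "ess_spectrum L2 B = ess_spectrum L2 A"
proof -
  let ?z = "- \<i>" and ?R = "inv_op (shift_op A (- \<i>))" and ?S = "inv_op (shift_op B (- \<i>))"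
  note RA = L2_operator.nonreal_resolvent[OF A, of ?z, simplified] and RB = L2_operator.nonreal_resolvent[OF B, of ?z, simplified]
  have R: "?R \<in> bounded_ops L2 L2" and S: "?S \<in> bounded_ops L2 L2" using RA(1) RB(1) by (simp_all add: resolvent_set_def)
  have eq: "?R - ?S = (\<lambda>u. ?R u + (-1) *\<^sub>C ?S u)" by (rule ext) (simp add: fun_diff_def complex_vector.scale_minus_left scaleC_one)
  have bounded: "?R - ?S \<in> bounded_ops L2 L2"
    unfolding eq L2_bounded_ops by (intro bounded_ops_lincomb) (use R S in \<open>simp_all only: L2_bounded_ops\<close>)
  have "compact_op L2 L2 (?R - ?S)" unfolding compact_op_def
  proof (intro conjI bounded allI impI)
    fix x :: "nat \<Rightarrow> ('n, 'e) distr" assume x: "\<forall>n. x n \<in> vecs L2 \<and> nrm L2 (x n) \<le> 1"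
    have m: "?R (x n) \<in> vecs L2" "?S (x n) \<in> vecs L2" for n using x R S unfolding bounded_ops_def by blast+
    have "norm (Lam 0 (x n)) \<le> 1" for n using x[rule_format, of n] nrm_L2[of "x n"] by simp
    then have "bounded (range (\<lambda>n. Lam 0 (x n)))" unfolding bounded_iff by blast
    moreover have "(Lam 0 (?R (x n)), Lam 0 (x n) - \<i> *\<^sub>C Lam 0 (?R (x n))) \<in> op_graph A \<and>
        (Lam 0 (?S (x n)), Lam 0 (x n) - \<i> *\<^sub>C Lam 0 (?S (x n))) \<in> op_graph B" for n
      using RA(2)[of "x n"] RB(2)[of "x n"] x by (simp add: scaleC_minus_left)
    ultimately obtain r where r: "strict_mono r" "convergent (\<lambda>n. Lam 0 (?R (x (r n))) - Lam 0 (?S (x (r n))))"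
      using comp[unfolded compact_resolvent_difference_def, THEN spec[of _ "\<lambda>n. Lam 0 (x n)"],
          THEN spec[of _ "\<lambda>n. Lam 0 (?R (x n))"], THEN spec[of _ "\<lambda>n. Lam 0 (?S (x n))"]] by blast
    then obtain l where l: "(\<lambda>n. Lam 0 (?R (x (r n))) - Lam 0 (?S (x (r n)))) \<longlonglongrightarrow> l" by (auto simp: convergent_def)
    have "nrm L2 ((?R - ?S) (x (r n)) - unLam 0 l) = norm (Lam 0 (?R (x (r n))) - Lam 0 (?S (x (r n))) - l)" for n
      by (simp add: fun_diff_def[of ?R] nrm_L2 L2_closed Lam0_simps m unLam0)
    then have "converges_in L2 (\<lambda>n. (?R - ?S) (x (r n))) (unLam 0 l)"
      using tendsto_norm_zero[OF LIM_zero[OF l]] by (simp only: converges_in_def unLam0(1))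
    then show "\<exists>r y. strict_mono r \<and> converges_in L2 (\<lambda>n. (?R - ?S) (x (r n))) y" using r(1) by blast
  qed
  then show "compact_perturbation L2 B A" unfolding compact_perturbation_def using RA(1) RB(1) by blast
  have "fredholm L2 (shift_op B z) \<longleftrightarrow> fredholm L2 (shift_op A z)" for z
    unfolding L2_operator.fredholm_iff[OF A] L2_operator.fredholm_iff[OF B]
    using fredholm_rel_compact_perturbation[OF L2_operator.graph[OF A] L2_operator.graph[OF B] comp]
      fredholm_rel_compact_perturbation[OF L2_operator.graph[OF B] L2_operator.graph[OF A] compact_resolvent_difference_sym[OF comp]] by blast
  then show "ess_spectrum L2 B = ess_spectrum L2 A" by (simp add: ess_spectrum_def)
qed

lemma (in dirac_potential) dirac_L2_operator: "L2_operator (induced_op dirac)" "self_adjoint (induced_op dirac)"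
proof -
  have D: "dom_op (induced_op dirac) = {u \<in> vecs (sobolev (1/2)). dirac u \<in> vecs L2}" by (simp add: induced_op_def)
  show L: "L2_operator (induced_op dirac)"
  proof (rule L2_operator.intro)
    show "dom_op (induced_op dirac) \<subseteq> vecs L2" using Lam_embed(1) by (auto simp: D vecs_L2)
    have z: "0 \<in> vecs (sobolev (1/2))" by (rule complex_vector.subspace_0[OF sobolev_subspace])
    show "complex_vector.subspace (dom_op (induced_op dirac))"
    proof (rule complex_vector.subspaceI; unfold D)
      let ?M = "{u \<in> vecs (sobolev (1/2)). dirac u \<in> vecs L2}"
      show "0 \<in> ?M" using z dirac_linear(3)[OF z z] complex_vector.subspace_0[OF L2_subspace] by simp
      show "u + v \<in> ?M" if "u \<in> ?M" "v \<in> ?M" for u v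
        using that dirac_linear(1)[of u v] sobolev_add(1)[of u _ v] L2_closed(1)[of "dirac u" "dirac v"] by simp
      show "c *\<^sub>C u \<in> ?M" if "u \<in> ?M" for c u
        using that dirac_linear(2)[of u u c] sobolev_scaleC(1)[of u _ c] L2_closed(3)[of "dirac u" c] by simp
    qed
    show "app_op (induced_op dirac) u \<in> vecs L2" if "u \<in> dom_op (induced_op dirac)" for u using that by (simp add: induced_op_def)
    show "clinear_on (dom_op (induced_op dirac)) (app_op (induced_op dirac))"
      unfolding clinear_on_def D using dirac_linear(1) dirac_linear(2)[of u u for u] by (simp add: induced_op_def)
    show "self_adjoint_rel (op_graph (induced_op dirac))"
      unfolding dirac_op_graph by (rule symmetric_form.self_adjoint_graph[OF dirac_symmetric_form])
  qed
  show "self_adjoint (induced_op dirac)"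
    by (rule L2_operator.self_adjoint[OF L]) (simp only: dirac_op_graph symmetric_form.graph_dense[OF dirac_symmetric_form])
qed

theorem proposition4p18:
  fixes \<alpha> :: "'n::finite option \<Rightarrow> 'e::complex_euclidean_space \<Rightarrow> 'e"
    and m :: real
    and V W :: "real^'n \<Rightarrow> 'e \<Rightarrow> 'e"
  assumes "\<And>j. symmetric_operator (\<alpha> j)"
    and "\<And>j k e. \<alpha> j (\<alpha> k e) + \<alpha> k (\<alpha> j e) = (if j = k then e else 0)"
    and "symmetric_potential V" and "symmetric_potential W"
    and "mult_continuous V" and "mult_continuous W"
    and "mult_op V - mult_op W \<in> B0"
    and "bij_betw (\<lambda>u. free_dirac \<alpha> m u + mult_op V u + \<i> *\<^sub>C u)
           (vecs (sobolev (1/2))) (vecs (sobolev (-1/2)))"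
    and "bij_betw (\<lambda>u. free_dirac \<alpha> m u + mult_op W u + \<i> *\<^sub>C u)
           (vecs (sobolev (1/2))) (vecs (sobolev (-1/2)))"
  defines "A \<equiv> induced_op (\<lambda>u. free_dirac \<alpha> m u + mult_op V u)"
    and "B \<equiv> induced_op (\<lambda>u. free_dirac \<alpha> m u + mult_op W u)"
  shows "self_adjoint A \<and> self_adjoint B \<and> compact_perturbation L2 B A \<and>
    ess_spectrum L2 B = ess_spectrum L2 A"
proof -
  note V = dirac_potential.intro[OF assms(1,3,5,8)] and W = dirac_potential.intro[OF assms(1,4,6,9)]
  show ?thesis using dirac_potential.dirac_L2_operator[OF V] dirac_potential.dirac_L2_operator[OF W]
      compact_resolvent_difference_perturbation[OF _ _ dirac_compact_resolvent_difference[OF V W assms(7)]] unfolding A_def B_def by blast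
qed

end
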